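(* Let $X$ be a UMD Banach space with type $2$. Then $X$ satisfies condition $(S_2)$ if and only if $X$ is isomorphic to a Hilbert space.
   Context: All Banach spaces are complex; $\mathbb R_+=(0,\infty)$; Rademacher variables are complex (Steinhaus, i.e. uniformly distributed on the unit circle). A family $\mathscr T$ of bounded operators from $E$ to $F$ is $R$-bounded if there is $C$ with $(\mathbb E\|\sum_{n=1}^N\varepsilon_nT_nx_n\|^2)^{1/2}\le C(\mathbb E\|\sum_{n=1}^N\varepsilon_nx_n\|^2)^{1/2}$ for all $N\ge1$, $T_n\in\mathscr T$, $x_n\in E$, with $(\varepsilon_n)$ an independent sequence of Rademacher variables. Let $W$ be a real Brownian motion with respect to a filtration $\mathscr F=(\mathcal F_t)_{t\ge0}$ on a probability space $(\Omega,\mathcal A,\mathbb P)$, and let $L^2_{\mathscr F}(\Omega\times\mathbb R_+;X)$ be the subspace of strongly progressively measurable processes in $L^2(\Omega\times\mathbb R_+;X)$. Let $X$ be UMD with type $2$. For $k\in L^2(\mathbb R_+)$ the stochastic convolution $(S_kG)(t):=\int_0^tk(t-s)G(s)\,dW(s)$, $t\ge0$, defines a bounded operator $S_k$ from $L^2_{\mathscr F}(\Omega\times\mathbb R_+;X)$ to $L^2(\Omega\times\mathbb R_+;X)$. For $\delta>0$ put $h_\delta(t):=\delta^{-1/2}\mathbf 1_{(0,\delta)}(t)$, $t>0$. $X$ satisfies $(S_2)$ if the family $\{S_{h_\delta}:\delta>0\}$ is $R$-bounded in $\mathscr L(L^2_{\mathscr F}(\Omega\times\mathbb R_+;X),L^2(\Omega\times\mathbb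 R_+;X))$. "Isomorphic" means linearly homeomorphic. *)

theory Defs
  imports "HOL-Probability.Probability"
begin

section \<open>Complex Banach spaces\<close>

class complex_normed_vector = real_normed_vector +
  fixes scaleC :: "complex \<Rightarrow> 'a \<Rightarrow> 'a" (infixr \<open>*\<^sub>C\<close> 75)
  assumes scaleC_add_right: "a *\<^sub>C (x + y) = a *\<^sub>C x + a *\<^sub>C y"
    and scaleC_add_left: "(a + b) *\<^sub>C x = a *\<^sub>C x + b *\<^sub>C x"
    and scaleC_scaleC: "a *\<^sub>C (b *\<^sub>C x) = (a * b) *\<^sub>C x"
    and scaleC_of_real: "complex_of_real r *\<^sub>C x = r *\<^sub>R x"
    and norm_scaleC: "norm (a *\<^sub>C x) = cmod a * norm x"

class complex_banach = complex_normed_vector + banach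

instantiation complex :: complex_banach
begin

definition scaleC_complex :: "complex \<Rightarrow> complex \<Rightarrow> complex" where
  "scaleC_complex a x = a * x"

instance
  by standard (auto simp: scaleC_complex_def algebra_simps norm_mult scaleR_conv_of_real)

end


section \<open>Isomorphism with a Hilbert space\<close>

definition inner_dist ::
  "('h \<Rightarrow> 'h \<Rightarrow> 'h) \<Rightarrow> (complex \<Rightarrow> 'h \<Rightarrow> 'h) \<Rightarrow> ('h \<Rightarrow> 'h \<Rightarrow> complex) \<Rightarrow> 'h \<Rightarrow> 'h \<Rightarrow> real" where
  "inner_dist add cmult ip x y =
     (let z = add x (cmult (-1) y) in sqrt (Re (ip z z)))"

locale complex_hilbert_space =
  fixes add :: "'h \<Rightarrow> 'h \<Rightarrow> 'h"
    and zero :: 'h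
    and cmult :: "complex \<Rightarrow> 'h \<Rightarrow> 'h"
    and ip :: "'h \<Rightarrow> 'h \<Rightarrow> complex"
  assumes add_assoc: "add (add x y) z = add x (add y z)"
    and add_commute: "add x y = add y x"
    and add_zero: "add zero x = x"
    and add_inverse: "add x (cmult (-1) x) = zero"
    and scale_add_right: "cmult a (add x y) = add (cmult a x) (cmult a y)"
    and scale_add_left: "cmult (a + b) x = add (cmult a x) (cmult b x)"
    and scale_scale: "cmult a (cmult b x) = cmult (a * b) x"
    and scale_one: "cmult 1 x = x"
    and ip_add_left: "ip (add x y) z = ip x z + ip y z"
    and ip_scale_left: "ip (cmult a x) y = a * ip x y"
    and ip_cnj: "ip y x = cnj (ip x y)"
    and ip_nonneg: "0 \<le> Re (ip x x)"
    and ip_definite: "ip x x = 0 \<Longrightarrow> x = zero"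
    and complete: "Metric_space.mcomplete UNIV (inner_dist add cmult ip)"

text \<open>HOL cannot quantify over the type carrying the Hilbert space inside a formula. As an
  isomorphism is a bijection, the points of a Hilbert space isomorphic to the space \<open>'x\<close> can be
  labelled by the elements of \<open>'x\<close>. So the existential quantifier ranges over all Hilbert space
  structures on the bare set of elements of \<open>'x\<close>, with operations that are unrelated to those of
  the class, and \<open>T\<close> is an arbitrary linear homeomorphism.\<close>

definition isomorphic_to_hilbert_space :: "'x::complex_banach itself \<Rightarrow> bool" where
  "isomorphic_to_hilbert_space (X :: 'x itself) \<longleftrightarrow>
     (\<exists>(add :: 'x \<Rightarrow> 'x \<Rightarrow> 'x) zero cmult ip (T :: 'x \<Rightarrow> 'x).
        complex_hilbert_space add zero cmult ip \<and>
        (\<forall>x y. T (x + y) = add (T x) (T y)) \<and>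
        (\<forall>a x. T (a *\<^sub>C x) = cmult a (T x)) \<and>
        homeomorphic_map euclidean (Metric_space.mtopology UNIV (inner_dist add cmult ip)) T)"


section \<open>Strong measurability, Bochner integral and $L^2$\<close>

text \<open>The Bochner integral of HOL-Analysis needs a second countable range. The spaces here may be
  nonseparable, so strong measurability (pointwise limits of simple functions) and the Bochner
  integral are stated for arbitrary normed spaces; \<open>bochner_integral_is\<close> has the clauses of
  \<open>has_bochner_integral\<close>, with strong in place of Borel measurability.\<close>

definition strongly_measurable :: "'a measure \<Rightarrow> ('a \<Rightarrow> 'x::real_normed_vector) \<Rightarrow> bool" where
  "strongly_measurable M f \<longleftrightarrow>
     (\<exists>s :: nat \<Rightarrow> 'a \<Rightarrow> 'x. (\<forall>i. simple_function M (s i)) \<and>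
        (\<forall>a\<in>space M. (\<lambda>i. s i a) \<longlonglongrightarrow> f a))"

definition bochner_integral_is ::
  "'a measure \<Rightarrow> ('a \<Rightarrow> 'x::real_normed_vector) \<Rightarrow> 'x \<Rightarrow> bool" where
  "bochner_integral_is M f x \<longleftrightarrow>
     strongly_measurable M f \<and>
     (\<exists>s. (\<forall>i::nat. Bochner_Integration.simple_bochner_integrable M (s i)) \<and>
        (\<lambda>i. \<integral>\<^sup>+a. ennreal (norm (f a - s i a)) \<partial>M) \<longlonglongrightarrow> 0 \<and>
        (\<lambda>i. Bochner_Integration.simple_bochner_integral M (s i)) \<longlonglongrightarrow> x)"

text \<open>Elements of $L^2$ are represented by functions; no quotient by almost everywhere equality is
  formed, so \<open>L2_norm\<close> is a seminorm.\<close>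

definition L2_space :: "'a measure \<Rightarrow> ('a \<Rightarrow> 'x::real_normed_vector) set" where
  "L2_space M = {f. strongly_measurable M f \<and> integrable M (\<lambda>a. (norm (f a))\<^sup>2)}"

definition L2_norm :: "'a measure \<Rightarrow> ('a \<Rightarrow> 'x::real_normed_vector) \<Rightarrow> real" where
  "L2_norm M f = sqrt (\<integral>a. (norm (f a))\<^sup>2 \<partial>M)"


section \<open>UMD spaces\<close>

text \<open>Convention: the first term \<open>d 0\<close> only has to be \<open>F 0\<close>-measurable. The condition
  $E(d_n | F_{n-1}) = 0$ is written as $\int_A d_n = 0$ for all $A \in F_{n-1}$.\<close>

definition martingale_differences ::
  "'a measure \<Rightarrow> (nat \<Rightarrow> 'a measure) \<Rightarrow> real \<Rightarrow> nat \<Rightarrow> (nat \<Rightarrow> 'a \<Rightarrow> 'x::real_normed_vector) \<Rightarrow> bool"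
where
  "martingale_differences M F p N d \<longleftrightarrow>
     (\<forall>n<N. subalgebra M (F n)) \<and>
     (\<forall>n. Suc n < N \<longrightarrow> sets (F n) \<subseteq> sets (F (Suc n))) \<and>
     (\<forall>n<N. strongly_measurable (F n) (d n) \<and> integrable M (\<lambda>\<omega>. norm (d n \<omega>) powr p)) \<and>
     (\<forall>n. Suc n < N \<longrightarrow>
        (\<forall>A\<in>sets (F n). bochner_integral_is M (\<lambda>\<omega>. indicator A \<omega> *\<^sub>R d (Suc n) \<omega>) 0))"

text \<open>The sample space is a probability space on the type \<open>real\<close>, with arbitrary sigma-algebra:
  a formula cannot quantify over all types. Nothing is lost, since the inequality involves only the
  joint law of finitely many strongly measurable functions and is inherited by the filtration they
  generate, and such a law is realised by functions on the unit interval.\<close>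

definition UMD :: "'x::complex_banach itself \<Rightarrow> bool" where
  "UMD (X :: 'x itself) \<longleftrightarrow>
     (\<forall>p::real. 1 < p \<longrightarrow> (\<exists>\<beta>::real. \<forall>(M :: real measure) F N (d :: nat \<Rightarrow> real \<Rightarrow> 'x) \<epsilon>.
        prob_space M \<longrightarrow> martingale_differences M F p N d \<longrightarrow> (\<forall>n<N. cmod (\<epsilon> n) = 1) \<longrightarrow>
        (\<integral>\<omega>. norm (\<Sum>n<N. \<epsilon> n *\<^sub>C d n \<omega>) powr p \<partial>M) powr (1 / p)
          \<le> \<beta> * (\<integral>\<omega>. norm (\<Sum>n<N. d n \<omega>) powr p \<partial>M) powr (1 / p)))"


section \<open>Rademacher sequences, type 2 and R-boundedness\<close>

definition uniform_circle :: "complex measure" where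
  "uniform_circle = distr (uniform_measure lborel {0..<2 * pi}) borel cis"

text \<open>The coordinates \<open>\<lambda>\<epsilon>. \<epsilon> n\<close> on this space are independent complex Rademacher variables; all
  expectations below depend only on their joint law.\<close>

definition rademacher :: "(nat \<Rightarrow> complex) measure" where
  "rademacher = (\<Pi>\<^sub>M n\<in>UNIV. uniform_circle)"

definition type_2 :: "'x::complex_banach itself \<Rightarrow> bool" where
  "type_2 (X :: 'x itself) \<longleftrightarrow>
     (\<exists>\<tau>::real. \<forall>N (x :: nat \<Rightarrow> 'x).
        sqrt (\<integral>\<epsilon>. (norm (\<Sum>n<N. \<epsilon> n *\<^sub>C x n))\<^sup>2 \<partial>rademacher)
          \<le> \<tau> * sqrt (\<Sum>n<N. (norm (x n))\<^sup>2))"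

text \<open>R-boundedness for operators between spaces of vector-valued functions: the domain is the set
  \<open>E\<close>, and \<open>nE\<close>, \<open>nF\<close> are the norms of domain and codomain (seminorms on representatives).\<close>

definition R_bounded ::
  "('s \<Rightarrow> 'x::complex_normed_vector) set \<Rightarrow> (('s \<Rightarrow> 'x) \<Rightarrow> real) \<Rightarrow>
   (('t \<Rightarrow> 'y::complex_normed_vector) \<Rightarrow> real) \<Rightarrow> (('s \<Rightarrow> 'x) \<Rightarrow> 't \<Rightarrow> 'y) set \<Rightarrow> bool" where
  "R_bounded E nE nF \<T> \<longleftrightarrow>
     (\<exists>C::real. \<forall>N\<ge>1. \<forall>T x. (\<forall>n<N. T n \<in> \<T> \<and> x n \<in> E) \<longrightarrow>
        sqrt (\<integral>\<epsilon>. (nF (\<lambda>t. \<Sum>n<N. \<epsilon> n *\<^sub>C T n (x n) t))\<^sup>2 \<partial>rademacher)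
          \<le> C * sqrt (\<integral>\<epsilon>. (nE (\<lambda>s. \<Sum>n<N. \<epsilon> n *\<^sub>C x n s))\<^sup>2 \<partial>rademacher))"


section \<open>Stochastic integration\<close>

text \<open>Only the sigma-algebras \<open>F t\<close> with \<open>t \<ge> 0\<close> and the values \<open>W t\<close> with \<open>t \<ge> 0\<close> matter. The
  usual conditions are not assumed.\<close>

definition brownian_motion ::
  "'w measure \<Rightarrow> (real \<Rightarrow> 'w measure) \<Rightarrow> (real \<Rightarrow> 'w \<Rightarrow> real) \<Rightarrow> bool" where
  "brownian_motion M F W \<longleftrightarrow>
     prob_space M \<and>
     (\<forall>t\<ge>0. subalgebra M (F t)) \<and>
     (\<forall>s t. 0 \<le> s \<longrightarrow> s \<le> t \<longrightarrow> sets (F s) \<subseteq> sets (F t)) \<and>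
     (\<forall>t\<ge>0. W t \<in> borel_measurable (F t)) \<and>
     (AE \<omega> in M. W 0 \<omega> = 0) \<and>
     (AE \<omega> in M. continuous_on {0..} (\<lambda>t. W t \<omega>)) \<and>
     (\<forall>s t. 0 \<le> s \<longrightarrow> s < t \<longrightarrow>
        distributed M lborel (\<lambda>\<omega>. W t \<omega> - W s \<omega>) (normal_density 0 (sqrt (t - s))) \<and>
        prob_space.indep_set M (sets (F s))
          {(\<lambda>\<omega>. W t \<omega> - W s \<omega>) -` A \<inter> space M | A. A \<in> sets borel})"

definition lborel_pos :: "real measure" where
  "lborel_pos = restrict_space lborel {0<..}"

definition progressive ::
  "(real \<Rightarrow> 'w measure) \<Rightarrow> ('w \<times> real \<Rightarrow> 'x::real_normed_vector) \<Rightarrow> bool" where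
  "progressive F G \<longleftrightarrow>
     (\<forall>t>0. strongly_measurable (F t \<Otimes>\<^sub>M restrict_space borel {0<..t}) G)"

definition L2_progressive ::
  "'w measure \<Rightarrow> (real \<Rightarrow> 'w measure) \<Rightarrow> ('w \<times> real \<Rightarrow> 'x::real_normed_vector) set" where
  "L2_progressive M F = {G \<in> L2_space (M \<Otimes>\<^sub>M lborel_pos). progressive F G}"

text \<open>Adapted step processes $\sum_{j<m} 1_{(t_j, t_{j+1}]} \otimes \xi_j$ and their integrals.\<close>

definition adapted_step ::
  "(real \<Rightarrow> 'w measure) \<Rightarrow> nat \<Rightarrow> (nat \<Rightarrow> real) \<Rightarrow> (nat \<Rightarrow> 'w \<Rightarrow> 'x::real_normed_vector) \<Rightarrow> bool" where
  "adapted_step F m t \<xi> \<longleftrightarrow>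
     0 \<le> t 0 \<and> (\<forall>j<m. t j \<le> t (Suc j)) \<and> (\<forall>j<m. simple_function (F (t j)) (\<xi> j))"

definition step_process ::
  "nat \<Rightarrow> (nat \<Rightarrow> real) \<Rightarrow> (nat \<Rightarrow> 'w \<Rightarrow> 'x::real_normed_vector) \<Rightarrow> 'w \<times> real \<Rightarrow> 'x" where
  "step_process m t \<xi> = (\<lambda>(\<omega>, s). \<Sum>j<m. indicator {t j<..t (Suc j)} s *\<^sub>R \<xi> j \<omega>)"

definition step_integral ::
  "(real \<Rightarrow> 'w \<Rightarrow> real) \<Rightarrow> nat \<Rightarrow> (nat \<Rightarrow> real) \<Rightarrow> (nat \<Rightarrow> 'w \<Rightarrow> 'x::real_normed_vector) \<Rightarrow> 'w \<Rightarrow> 'x"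
where
  "step_integral W m t \<xi> = (\<lambda>\<omega>. \<Sum>j<m. (W (t (Suc j)) \<omega> - W (t j) \<omega>) *\<^sub>R \<xi> j \<omega>)"

text \<open>\<open>Y\<close> is a version of the stochastic integral $\int_0^\infty \phi \, dW$: the continuous
  extension of the integral from adapted step processes to $L^2_F$. The extension exists and
  is unique up to null sets in UMD spaces with type 2.\<close>

definition stochastic_integral_is ::
  "'w measure \<Rightarrow> (real \<Rightarrow> 'w measure) \<Rightarrow> (real \<Rightarrow> 'w \<Rightarrow> real) \<Rightarrow>
   ('w \<times> real \<Rightarrow> 'x::real_normed_vector) \<Rightarrow> ('w \<Rightarrow> 'x) \<Rightarrow> bool" where
  "stochastic_integral_is M F W \<phi> Y \<longleftrightarrow>
     \<phi> \<in> L2_progressive M F \<and> Y \<in> L2_space M \<and>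
     (\<exists>m t \<xi>. (\<forall>i::nat. adapted_step F (m i) (t i) (\<xi> i)) \<and>
        (\<lambda>i. \<integral>\<^sup>+z. ennreal ((norm (\<phi> z - step_process (m i) (t i) (\<xi> i) z))\<^sup>2)
               \<partial>(M \<Otimes>\<^sub>M lborel_pos)) \<longlonglongrightarrow> 0 \<and>
        (\<lambda>i. \<integral>\<^sup>+\<omega>. ennreal ((norm (Y \<omega> - step_integral W (m i) (t i) (\<xi> i) \<omega>))\<^sup>2) \<partial>M) \<longlonglongrightarrow> 0)"

text \<open>\<open>S_k G\<close> is an element of $L^2(\Omega \times R_+; X)$ and hence determined by its values at
  almost every time \<open>t\<close>; for general square integrable \<open>k\<close> the integrand
  $1_{(0,t)}(s) k(t-s) G(s)$ lies in $L^2$ only for almost every \<open>t\<close>. The choice operator picks a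
  jointly measurable representative, which is unique up to null sets.\<close>

definition stochastic_convolution ::
  "'w measure \<Rightarrow> (real \<Rightarrow> 'w measure) \<Rightarrow> (real \<Rightarrow> 'w \<Rightarrow> real) \<Rightarrow> (real \<Rightarrow> complex) \<Rightarrow>
   ('w \<times> real \<Rightarrow> 'x::complex_normed_vector) \<Rightarrow> 'w \<times> real \<Rightarrow> 'x" where
  "stochastic_convolution M F W k G =
     (SOME S. S \<in> L2_space (M \<Otimes>\<^sub>M lborel_pos) \<and>
        (AE t in lborel_pos. stochastic_integral_is M F W
           (\<lambda>(\<omega>, s). indicator {0<..<t} s *\<^sub>R (k (t - s) *\<^sub>C G (\<omega>, s))) (\<lambda>\<omega>. S (\<omega>, t))))"

definition h_kernel :: "real \<Rightarrow> real \<Rightarrow> complex" where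
  "h_kernel \<delta> t = complex_of_real (\<delta> powr (-1/2) * indicator {0<..<\<delta>} t)"

definition condition_S2 ::
  "'w measure \<Rightarrow> (real \<Rightarrow> 'w measure) \<Rightarrow> (real \<Rightarrow> 'w \<Rightarrow> real) \<Rightarrow> 'x::complex_banach itself \<Rightarrow> bool"
where
  "condition_S2 M F W (X :: 'x itself) \<longleftrightarrow>
     R_bounded (L2_progressive M F :: ('w \<times> real \<Rightarrow> 'x) set)
       (L2_norm (M \<Otimes>\<^sub>M lborel_pos)) (L2_norm (M \<Otimes>\<^sub>M lborel_pos))
       {stochastic_convolution M F W (h_kernel \<delta>) | \<delta>. 0 < \<delta>}"

end

theory Submission
  imports Defs
begin

text \<open>Condition $(S_2)$, tested on the processes $1_{(0,1]} \otimes x_n$ with $\delta_n = 2^{n+1}$, implies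
  cotype 2: on the time interval $(\delta_n/2, \delta_n)$ the $n$-th convolution is
  $\delta_n^{-1/2} W_1 x_n$, these intervals are disjoint, and on each of them a Rademacher sum
  dominates its $n$-th term. Type 2 and cotype 2 together give a Hilbert norm by Kwapien's theorem: the
  Gaussian square function $E \|\sum_i g_i x_i\|^2$ lies between two multiples of
  $\sum_i \|x_i\|^2$ and is invariant under rotations of two entries; a minimal function $p$ between
  the two multiples that respects all such invariances satisfies the parallelogram law.

  Conversely, let $B$ be a bilinear form with $B(x,x)$ equivalent to $\|x\|^2$. The Ito isometry for $B$
  and $\|h_\delta\|_2 = 1$ give a bound of $S_{h_\delta}$ that does not depend on $\delta$,
  and in such a space square functions with Rademacher variables are equivalent to square sums, so
  uniform boundedness is $R$-boundedness. Since the convolution is a choice of representative, its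
  existence has to be proved first, from the density of adapted step processes.\<close>

section \<open>Minimal functions and norming functionals\<close>

text \<open>Only real symmetric forms are used; a Hermitian product comes from such a form by
  averaging over multiplication by the imaginary unit. A real functional \<open>f\<close> gives the
  form \<open>f y * f z\<close>, so one Ito isometry for forms serves both directions: with an
  equivalent form it bounds the operators from above, and with a norming functional it bounds norms
  from below in an arbitrary Banach space.

  The Gaussian square function is not additive in the vectors, so it is not itself the desired norm.
  It only tells which pairs of vectors must have the same total square. Minimality turns the
  two-sided bounds into these equalities, just as a minimal sublinear function is linear; the
  norming functionals and the Hilbert norm therefore rest on the same application of Zorn's lemma.

  The ranges may be nonseparable. Measurability is that of limits of simple functions, and estimates
  are carried out with nonnegative integrals of norms. A stochastic convolution is known only at
  almost every time, so approximations are taken at a geometric rate, which gives convergence at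
  almost every time without passing to subsequences.\<close>

lemma chain_INF_approx:
  fixes C :: "('a \<Rightarrow> real) set"
  assumes ne: "C \<noteq> {}" and chain: "\<And>p q. p \<in> C \<Longrightarrow> q \<in> C \<Longrightarrow> p \<le> q \<or> q \<le> p"
    and bdd: "\<And>p x. p \<in> C \<Longrightarrow> l x \<le> p x"
    and fin: "finite X" and \<eta>: "0 < \<eta>"
  shows "\<exists>p\<in>C. \<forall>x\<in>X. p x \<le> (INF q\<in>C. q x) + \<eta>"
  using fin
proof (induction X)
  case empty
  then show ?case using ne by auto
next
  case (insert y X)
  then obtain p where p: "p \<in> C" "\<forall>x\<in>X. p x \<le> (INF q\<in>C. q x) + \<eta>" by auto
  have "bdd_below ((\<lambda>q. q y) ` C)" using bdd by (intro bdd_belowI2[of _ "l y"])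
  then have "\<exists>q\<in>C. q y < (INF q\<in>C. q y) + \<eta>"
    using cINF_less_iff[OF ne, of "\<lambda>q. q y" "(INF q\<in>C. q y) + \<eta>"] \<eta> by auto
  then obtain q where q: "q \<in> C" "q y < (INF q\<in>C. q y) + \<eta>" by auto
  \<comment> \<open>The smaller of two members of the chain keeps both approximations.\<close>
  from chain[OF p(1) q(1)] show ?case
  proof
    assume "p \<le> q"
    then have "p y \<le> q y" by (simp add: le_fun_def)
    then show ?thesis using p q by (intro bexI[of _ p]) auto
  next
    assume "q \<le> p"
    then have "q x \<le> p x" for x by (simp add: le_fun_def)
    then show ?thesis using p q by (intro bexI[of _ q]) (auto intro: order_trans)
  qed
qed

text \<open>Zorn's lemma with pointwise infima as lower bounds of chains. The common minorant
  \<open>l\<close> guarantees that these infima exist in the reals.\<close>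

lemma minimal_function_exists:
  fixes Q :: "('a \<Rightarrow> real) set"
  assumes p0: "p0 \<in> Q"
    and bdd: "\<And>p x. p \<in> Q \<Longrightarrow> l x \<le> p x"
    and inf: "\<And>C. C \<noteq> {} \<Longrightarrow> C \<subseteq> Q \<Longrightarrow> (\<And>p q. p \<in> C \<Longrightarrow> q \<in> C \<Longrightarrow> p \<le> q \<or> q \<le> p) \<Longrightarrow>
      (\<lambda>x. INF p\<in>C. p x) \<in> Q"
  shows "\<exists>p\<in>Q. \<forall>q\<in>Q. q \<le> p \<longrightarrow> q = p"
proof -
  \<comment> \<open>\<open>predicate_Zorn\<close> yields maximal elements, hence the reversed
    order.\<close>
  let ?P = "\<lambda>p q. q \<le> (p::'a \<Rightarrow> real)"
  have "\<exists>m\<in>Q. \<forall>a\<in>Q. ?P m a \<longrightarrow> a = m"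
  proof (rule predicate_Zorn)
    show "partial_order_on Q (relation_of ?P Q)"
      by (rule partial_order_on_relation_ofI) auto
    fix C assume C: "C \<in> Chains (relation_of ?P Q)"
    then have sub: "C \<subseteq> Q" by (rule Chains_relation_of)
    have ch: "p \<le> q \<or> q \<le> p" if "p \<in> C" "q \<in> C" for p q
      using C that by (auto simp: Chains_def relation_of_def)
    show "\<exists>u\<in>Q. \<forall>a\<in>C. ?P a u"
    proof (cases "C = {}")
      case True
      then show ?thesis using p0 by auto
    next
      case False
      have "(\<lambda>x. INF p\<in>C. p x) \<le> a" if "a \<in> C" for a
        using that sub bdd by (auto simp: le_fun_def intro!: cINF_lower bdd_belowI2[of _ "l _"])
      then show ?thesis using inf[OF False sub ch] by blast
    qed
  qed
  then show ?thesis by blast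
qed

definition sublinear :: "('a::real_vector \<Rightarrow> real) \<Rightarrow> bool" where
  "sublinear p \<longleftrightarrow> (\<forall>x y. p (x + y) \<le> p x + p y) \<and> (\<forall>r x. 0 \<le> r \<longrightarrow> p (r *\<^sub>R x) = r * p x)"

lemma sublinear_ge: "sublinear p \<Longrightarrow> - p (- x) \<le> p x"
proof -
  assume p: "sublinear p"
  have "p (x + - x) \<le> p x + p (- x)" "p (0 *\<^sub>R x) = 0 * p x"
    using p unfolding sublinear_def by (blast, meson order_refl)
  then show ?thesis by simp
qed

text \<open>Among the sublinear functions below \<open>p\<close>, the tilt \<open>q\<close> is the
  largest one with q(-y) <= -p(y). A minimal \<open>p\<close> has to coincide with it, and this
  makes \<open>p\<close> additive in the direction \<open>y\<close>.\<close>

lemma sublinear_tilt: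
  fixes p :: "'a::real_vector \<Rightarrow> real" and y :: 'a
  assumes p: "sublinear p" and q_def: "q = (\<lambda>x. INF t\<in>{0..}. p (x + t *\<^sub>R y) - t * p y)"
  shows "sublinear q" and "\<And>x t. 0 \<le> t \<Longrightarrow> q x \<le> p (x + t *\<^sub>R y) - t * p y" and "\<And>x. q x \<le> p x"
proof -
  have add: "p (u + v) \<le> p u + p v" for u v using p by (simp add: sublinear_def)
  have hom: "0 \<le> r \<Longrightarrow> p (r *\<^sub>R u) = r * p u" for r u using p by (simp add: sublinear_def)
  have lb: "- p (- x) \<le> p (x + t *\<^sub>R y) - t * p y" if "0 \<le> t" for x t
    using add[of "x + t *\<^sub>R y" "- x"] hom[OF that, of y] by simp
  have bdd: "bdd_below ((\<lambda>t. p (x + t *\<^sub>R y) - t * p y) ` {0..})" for x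
    using lb by (intro bdd_belowI2[of _ "- p (- x)"]) auto
  show le: "q x \<le> p (x + t *\<^sub>R y) - t * p y" if "0 \<le> t" for x t
    unfolding q_def using that by (intro cINF_lower bdd) auto
  show "q x \<le> p x" for x using le[of 0 x] by simp
  have appr: "\<exists>t\<ge>0. p (x + t *\<^sub>R y) - t * p y < q x + \<eta>" if "0 < \<eta>" for x \<eta>
    using cINF_less_iff[OF _ bdd, of x "q x + \<eta>"] that unfolding q_def by auto
  show "sublinear q" unfolding sublinear_def
  proof (intro conjI allI impI)
    fix u v
    show "q (u + v) \<le> q u + q v"
    proof (rule field_le_epsilon)
      fix e :: real assume "0 < e"
      then obtain s t where s: "0 \<le> s" "p (u + s *\<^sub>R y) - s * p y < q u + e / 2"
        and t: "0 \<le> t" "p (v + t *\<^sub>R y) - t * p y < q v + e / 2"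
        using appr[of "e/2"] by (metis half_gt_zero)
      have "q (u + v) \<le> p (u + v + (s + t) *\<^sub>R y) - (s + t) * p y" using s t by (intro le) auto
      also have "u + v + (s + t) *\<^sub>R y = (u + s *\<^sub>R y) + (v + t *\<^sub>R y)" by (simp add: algebra_simps)
      also have "p \<dots> - (s + t) * p y \<le> p (u + s *\<^sub>R y) + p (v + t *\<^sub>R y) - (s + t) * p y"
        using add by simp
      also have "\<dots> \<le> q u + q v + e" using s t by (simp add: algebra_simps)
      finally show "q (u + v) \<le> q u + q v + e" .
    qed
  next
    fix r :: real and u assume r: "0 \<le> r"
    have q0: "q 0 = 0"
    proof -
      have "p (0 + t *\<^sub>R y) - t * p y = 0" if "t \<in> {0..}" for t using hom[of t y] that by simp
      then have "q 0 = (INF t\<in>{0::real..}. 0)" unfolding q_def by (intro INF_cong) auto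
      then show ?thesis by simp
    qed
    \<comment> \<open>One inequality for all positive factors suffices: with the factor
      \<open>inverse r\<close> it yields the reverse one.\<close>
    have le1: "q (r *\<^sub>R u) \<le> r * q u" if r: "0 < r" for r u
    proof (rule field_le_epsilon)
      fix e :: real assume "0 < e"
      then obtain s where s: "0 \<le> s" "p (u + s *\<^sub>R y) - s * p y < q u + e / r"
        using appr[of "e/r" u] r by auto
      have "q (r *\<^sub>R u) \<le> p (r *\<^sub>R u + (r * s) *\<^sub>R y) - (r * s) * p y"
        using s r by (intro le) auto
      also have "r *\<^sub>R u + (r * s) *\<^sub>R y = r *\<^sub>R (u + s *\<^sub>R y)" by (simp add: algebra_simps)
      also have "p \<dots> = r * p (u + s *\<^sub>R y)" using r hom by simp
      also have "r * p (u + s *\<^sub>R y) - (r * s) * p y = r * (p (u + s *\<^sub>R y) - s * p y)"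
        by (simp add: algebra_simps)
      also have "\<dots> \<le> r * (q u + e / r)" using s r by (intro mult_left_mono) auto
      also have "\<dots> = r * q u + e" using r by (simp add: field_simps)
      finally show "q (r *\<^sub>R u) \<le> r * q u + e" .
    qed
    show "q (r *\<^sub>R u) = r * q u"
    proof (cases "r = 0")
      case True
      then show ?thesis using q0 by simp
    next
      case False
      then have r: "0 < r" using r by simp
      have "q (inverse r *\<^sub>R (r *\<^sub>R u)) \<le> inverse r * q (r *\<^sub>R u)" using r by (intro le1) simp
      then have "q u \<le> inverse r * q (r *\<^sub>R u)" using r by simp
      then have "r * q u \<le> q (r *\<^sub>R u)" using r by (simp add: field_simps)
      then show ?thesis using le1[OF r, of u] by simp
    qed
  qed
qed

text \<open>The Hahn-Banach theorem in the form that a minimal sublinear function is linear. The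
  constraint at \<open>- x0\<close> survives passing to smaller functions and to infima of chains,
  and it fixes the value at \<open>x0\<close>.\<close>

lemma norming_functional_exists:
  fixes x0 :: "'a::real_normed_vector"
  obtains f :: "'a \<Rightarrow> real" where "linear f" "\<And>x. \<bar>f x\<bar> \<le> norm x" "f x0 = norm x0"
proof -
  define Q where "Q = {p :: 'a \<Rightarrow> real. sublinear p \<and> (\<forall>x. p x \<le> norm x) \<and> p (- x0) \<le> - norm x0}"
  \<comment> \<open>The norm itself need not satisfy the constraint at \<open>- x0\<close>; its tilt
    in the direction \<open>x0\<close> does, as t = 1 shows.\<close>
  define p0 where "p0 = (\<lambda>x. INF t\<in>{0..}. norm (x + t *\<^sub>R x0) - t * norm x0)"
  have "sublinear (norm :: 'a \<Rightarrow> real)" by (auto simp: sublinear_def norm_triangle_ineq)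
  note tilt = sublinear_tilt[OF this p0_def]
  have "p0 (- x0) \<le> - norm x0" using tilt(2)[of 1 "- x0"] by simp
  then have p0: "p0 \<in> Q" unfolding Q_def using tilt by auto
  have lb: "- norm x \<le> p x" if "p \<in> Q" for p x
  proof -
    have "p (- x) \<le> norm (- x)" using that unfolding Q_def by blast
    then show ?thesis using sublinear_ge[of p x] that unfolding Q_def by auto
  qed
  have "\<exists>p\<in>Q. \<forall>q\<in>Q. q \<le> p \<longrightarrow> q = p"
  proof (rule minimal_function_exists)
    show "p0 \<in> Q" by (rule p0)
    show "\<And>p x. p \<in> Q \<Longrightarrow> - norm x \<le> p x" by (rule lb)
    fix C :: "('a \<Rightarrow> real) set" assume ne: "C \<noteq> {}" and sub: "C \<subseteq> Q"
      and ch: "\<And>p q. p \<in> C \<Longrightarrow> q \<in> C \<Longrightarrow> p \<le> q \<or> q \<le> p"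
    let ?q = "\<lambda>x. INF p\<in>C. p x"
    have le: "?q x \<le> p x" if "p \<in> C" for p x
      using that sub lb by (auto intro!: cINF_lower bdd_belowI2[of _ "- norm x"])
    have appr: "\<exists>p\<in>C. \<forall>x\<in>X. p x \<le> ?q x + e" if "finite X" "0 < e" for X e
      using sub lb that by (intro chain_INF_approx[where l = "\<lambda>x. - norm x"] ne ch) auto
    have "sublinear ?q" unfolding sublinear_def
    proof (intro conjI allI impI)
      fix x y
      show "?q (x + y) \<le> ?q x + ?q y"
      proof (rule field_le_epsilon)
        fix e :: real assume "0 < e"
        then obtain p where p: "p \<in> C" "\<forall>u\<in>{x,y}. p u \<le> ?q u + e/2" using appr[of "{x,y}" "e/2"] by auto
        have "?q (x + y) \<le> p (x + y)" using p le by auto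
        also have "\<dots> \<le> p x + p y" using p sub by (auto simp: Q_def sublinear_def)
        also have "\<dots> \<le> ?q x + ?q y + e" using p by auto
        finally show "?q (x + y) \<le> ?q x + ?q y + e" .
      qed
    next
      fix r :: real and x assume r: "0 \<le> r"
      have hom: "p (r *\<^sub>R x) = r * p x" if "p \<in> C" for p using that sub r by (auto simp: Q_def sublinear_def)
      show "?q (r *\<^sub>R x) = r * ?q x"
      proof (rule antisym)
        show "?q (r *\<^sub>R x) \<le> r * ?q x"
        proof (rule field_le_epsilon)
          fix e :: real assume e: "0 < e"
          \<comment> \<open>The summand 1 in the denominator covers r = 0.\<close>
          obtain p where p: "p \<in> C" "p x \<le> ?q x + e/(r+1)" using appr[of "{x}" "e/(r+1)"] r e by auto
          have "?q (r *\<^sub>R x) \<le> r * p x" using le[OF p(1), of "r *\<^sub>R x"] hom[OF p(1)] by simp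
          also have "\<dots> \<le> r * (?q x + e/(r+1))" using p r by (intro mult_left_mono) auto
          also have "\<dots> \<le> r * ?q x + e" using r e by (simp add: field_simps)
          finally show "?q (r *\<^sub>R x) \<le> r * ?q x + e" .
        qed
        show "r * ?q x \<le> ?q (r *\<^sub>R x)"
        proof (rule cINF_greatest[OF ne])
          fix p assume "p \<in> C"
          then show "r * ?q x \<le> p (r *\<^sub>R x)" using le[of p x] r by (simp only: hom mult_left_mono)
        qed
      qed
    qed
    moreover have "?q x \<le> norm x" for x using ne le[of _ x] sub unfolding Q_def
      by (metis (mono_tags, lifting) ex_in_conv mem_Collect_eq order_trans subsetD)
    moreover have "?q (- x0) \<le> - norm x0" using ne le[of _ "- x0"] sub unfolding Q_def
      by (metis (mono_tags, lifting) ex_in_conv mem_Collect_eq order_trans subsetD)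
    ultimately show "?q \<in> Q" unfolding Q_def by blast
  qed
  then obtain p where p: "p \<in> Q" "\<And>q. q \<in> Q \<Longrightarrow> q \<le> p \<Longrightarrow> q = p" by blast
  have sub: "sublinear p" and le: "p x \<le> norm x" and px0: "p (- x0) \<le> - norm x0" for x
    using p(1) by (auto simp: Q_def)
  have add: "p (x + y) = p x + p y" for x y
  proof -
    \<comment> \<open>By minimality the tilt in the direction \<open>y\<close> equals
      \<open>p\<close>. Taking t = 1 in the infimum then gives the superadditivity that was
      missing.\<close>
    define q where "q = (\<lambda>x. INF t\<in>{0..}. p (x + t *\<^sub>R y) - t * p y)"
    note tilt = sublinear_tilt[OF sub q_def]
    have "q \<in> Q" unfolding Q_def using tilt(1,3) le px0 by (auto intro: order_trans)
    then have "q = p" using p(2) tilt(3) by (auto simp: le_fun_def)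
    then have "p x \<le> p (x + y) - p y" using tilt(2)[of 1 x] by simp
    moreover have "p (x + y) \<le> p x + p y" using sub by (simp add: sublinear_def)
    ultimately show ?thesis by simp
  qed
  have p0: "p 0 = 0" using add[of 0 0] by simp
  have neg: "p (- x) = - p x" for x using add[of x "- x"] p0 by simp
  have scal: "p (r *\<^sub>R x) = r * p x" for r x
  proof (cases "0 \<le> r")
    case True
    then show ?thesis using sub by (simp add: sublinear_def)
  next
    case False
    then have "0 \<le> - r" by simp
    then have "p ((- r) *\<^sub>R x) = (- r) * p x" using sub unfolding sublinear_def by blast
    then show ?thesis using neg[of "r *\<^sub>R x"] by simp
  qed
  show thesis
  proof
    show "linear p" using add scal by (intro linearI) auto
    show "\<bar>p x\<bar> \<le> norm x" for x using le[of x] le[of "- x"] neg[of x] by auto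
    show "p x0 = norm x0" using le[of x0] px0 neg[of x0] by auto
  qed
qed

section \<open>Additive functions on multisets and the parallelogram law\<close>

lemma sum_mset_repeat_mset: "(\<Sum>x\<in>#repeat_mset n R. f x) = of_nat n * (\<Sum>x\<in>#R. f x :: real)"
  by (induction n) (auto simp: algebra_simps)

lemma sum_mset_fun_upd_diff:
  "(\<Sum>x\<in>#R. (p(z := p z - \<eta>)) x) = (\<Sum>x\<in>#R. p x) - real (count R z) * (\<eta>::real)"
  by (induction R) (auto simp: algebra_simps)

text \<open>Call two multisets indistinguishable if \<open>G\<close> agrees on them in every context. Among the functions
  below \<open>U\<close> whose sum over a multiset dominates the sum of \<open>L\<close> over every indistinguishable one,
  a minimal function has equal sums over indistinguishable multisets.\<close>

lemma additive_between:
  fixes G :: "'a multiset \<Rightarrow> real" and L U :: "'a \<Rightarrow> real"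
  assumes LG: "\<And>R. (\<Sum>x\<in>#R. L x) \<le> G R" and GU: "\<And>R. G R \<le> (\<Sum>x\<in>#R. U x)"
  obtains p where "\<And>x. L x \<le> p x" "\<And>x. p x \<le> U x"
    "\<And>z w z' w'. (\<And>T. G ({#z, w#} + T) = G ({#z', w'#} + T)) \<Longrightarrow> p z + p w = p z' + p w'"
proof -
  define sim where "sim R S \<longleftrightarrow> (\<forall>T. G (R + T) = G (S + T))" for R S
  have sim_sym: "sim R S \<Longrightarrow> sim S R" for R S by (simp add: sim_def)
  have sim_trans: "sim R S \<Longrightarrow> sim S T \<Longrightarrow> sim R T" for R S T by (simp add: sim_def)
  \<comment> \<open>Quantifying over all contexts \<open>T\<close> makes \<open>sim\<close> a
    congruence for sums of multisets, although \<open>G\<close> need not be additive.\<close>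
  have sim_add: "sim (R + R') (S + S')" if "sim R S" "sim R' S'" for R S R' S'
    unfolding sim_def using that[unfolded sim_def] by (metis add.assoc add.commute)
  have sim_rep: "sim (repeat_mset n R) (repeat_mset n S)" if "sim R S" for n R S
  proof (induction n)
    case 0
    show ?case by (simp add: sim_def)
  next
    case (Suc n)
    show ?case using sim_add[OF that Suc] by simp
  qed
  define Q where "Q = {p. (\<forall>x. p x \<le> U x) \<and> (\<forall>R S. sim R S \<longrightarrow> (\<Sum>x\<in>#S. L x) \<le> (\<Sum>x\<in>#R. p x))}"
  have QD: "(\<Sum>x\<in>#S. L x) \<le> (\<Sum>x\<in>#R. p x)" if "p \<in> Q" "sim R S" for p R S
    using that by (auto simp: Q_def)
  have lb: "L x \<le> p x" if "p \<in> Q" for p x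
    using QD[OF that, of "{#x#}" "{#x#}"] by (simp add: sim_def)
  have UQ: "U \<in> Q" unfolding Q_def
  proof (intro CollectI conjI allI impI)
    fix R S assume "sim R S"
    then have "G R = G S" unfolding sim_def by (metis add.right_neutral)
    then show "(\<Sum>x\<in>#S. L x) \<le> (\<Sum>x\<in>#R. U x)" using LG[of S] GU[of R] by simp
  qed simp
  have "\<exists>p\<in>Q. \<forall>q\<in>Q. q \<le> p \<longrightarrow> q = p"
  proof (rule minimal_function_exists)
    show "U \<in> Q" by (rule UQ)
    show "\<And>p x. p \<in> Q \<Longrightarrow> L x \<le> p x" by (rule lb)
    fix C :: "('a \<Rightarrow> real) set" assume ne: "C \<noteq> {}" and sub: "C \<subseteq> Q"
      and ch: "\<And>p q. p \<in> C \<Longrightarrow> q \<in> C \<Longrightarrow> p \<le> q \<or> q \<le> p"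
    let ?q = "\<lambda>x. INF p\<in>C. p x"
    have le: "?q x \<le> p x" if "p \<in> C" for p x
      using that sub lb by (auto intro!: cINF_lower bdd_belowI2[of _ "L x"])
    have "?q x \<le> U x" for x using ne le[of _ x] sub unfolding Q_def
      by (metis (mono_tags, lifting) ex_in_conv mem_Collect_eq order_trans subsetD)
    moreover have "(\<Sum>x\<in>#S. L x) \<le> (\<Sum>x\<in>#R. ?q x)" if "sim R S" for R S
    proof (rule field_le_epsilon)
      fix e :: real assume e: "0 < e"
      \<comment> \<open>The error is spread over the entries of \<open>R\<close>; the summand 1
        covers the empty multiset.\<close>
      let ?e = "e / (size R + 1)"
      have "\<exists>p\<in>C. \<forall>x\<in>set_mset R. p x \<le> ?q x + ?e"
        using sub lb e by (intro chain_INF_approx[where l = L] ne ch) auto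
      then obtain p where p: "p \<in> C" "\<And>x. x \<in># R \<Longrightarrow> p x \<le> ?q x + ?e" by auto
      have "(\<Sum>x\<in>#S. L x) \<le> (\<Sum>x\<in>#R. p x)" using QD that p sub by auto
      also have "\<dots> \<le> (\<Sum>x\<in>#R. ?q x + ?e)" using p by (intro sum_mset_mono) auto
      also have "\<dots> = (\<Sum>x\<in>#R. ?q x) + size R * ?e" by (simp add: sum_mset.distrib)
      also have "\<dots> \<le> (\<Sum>x\<in>#R. ?q x) + e" using e by (simp add: field_simps)
      finally show "(\<Sum>x\<in>#S. L x) \<le> (\<Sum>x\<in>#R. ?q x) + e" .
    qed
    ultimately show "?q \<in> Q" unfolding Q_def by blast
  qed
  then obtain p where p: "p \<in> Q" "\<And>q. q \<in> Q \<Longrightarrow> q \<le> p \<Longrightarrow> q = p" by blast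
  \<comment> \<open>Lowering a minimal \<open>p\<close> at the single point \<open>z\<close> leaves
    \<open>Q\<close>, so some constraint breaks. That constraint must contain \<open>z\<close>, and
    for \<open>p\<close> itself it was tight up to \<open>\<eta>\<close> for each occurrence of
    \<open>z\<close>.\<close>
  have low: "\<exists>R S. sim R S \<and> 0 < count R z \<and>
      (\<Sum>x\<in>#R. p x) - real (count R z) * \<eta> < (\<Sum>x\<in>#S. L x)" if \<eta>: "0 < \<eta>" for z \<eta>
  proof -
    let ?q = "p(z := p z - \<eta>)"
    have "?q \<noteq> p" using \<eta> by (metis fun_upd_same diff_eq_eq less_irrefl add_cancel_left_right)
    moreover have "?q \<le> p" using \<eta> by (auto simp: le_fun_def)
    ultimately have "?q \<notin> Q" using p(2) by blast
    moreover have "?q x \<le> U x" for x using p(1) \<eta> unfolding Q_def by (auto intro: order_trans[rotated] )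
    ultimately obtain R S where RS: "sim R S" "(\<Sum>x\<in>#R. ?q x) < (\<Sum>x\<in>#S. L x)"
      unfolding Q_def mem_Collect_eq not_le[symmetric] by blast
    then have *: "(\<Sum>x\<in>#R. p x) - real (count R z) * \<eta> < (\<Sum>x\<in>#S. L x)"
      by (simp only: sum_mset_fun_upd_diff)
    moreover have "0 < count R z" using QD[OF p(1) RS(1)] * by (cases "count R z = 0") auto
    ultimately show ?thesis using RS by blast
  qed
  have main: "p z + p w \<le> p z' + p w'" if zw: "sim {#z, w#} {#z', w'#}" for z w z' w'
  proof (rule field_le_epsilon)
    fix e :: real assume "0 < e"
    then have e2: "0 < e / 2" by simp
    obtain R1 S1 where 1: "sim R1 S1" "0 < count R1 z"
      "(\<Sum>x\<in>#R1. p x) - real (count R1 z) * (e/2) < (\<Sum>x\<in>#S1. L x)" using low[OF e2] by blast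
    obtain R2 S2 where 2: "sim R2 S2" "0 < count R2 w"
      "(\<Sum>x\<in>#R2. p x) - real (count R2 w) * (e/2) < (\<Sum>x\<in>#S2. L x)" using low[OF e2] by blast
    let ?k = "count R1 z" and ?l = "count R2 w"
    \<comment> \<open>Two nearly tight constraints, one for \<open>z\<close> and one for
      \<open>w\<close>, are merged with multiplicities that provide \<open>?k * ?l\<close> copies of
      the pair. These copies are exchanged for \<open>z'\<close> and \<open>w'\<close>, and the
      constraint between the new multiset and \<open>?S\<close> is used.\<close>
    let ?R = "repeat_mset ?l R1 + repeat_mset ?k R2" and ?S = "repeat_mset ?l S1 + repeat_mset ?k S2"
    define T where "T = ?R - repeat_mset (?k * ?l) {#z, w#}"
    have "repeat_mset (?k * ?l) {#z, w#} \<subseteq># ?R"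
      by (auto simp: subseteq_mset_def algebra_simps)
    then have RT: "?R = repeat_mset (?k * ?l) {#z, w#} + T" unfolding T_def by simp
    have "sim (repeat_mset (?k * ?l) {#z', w'#} + T) ?R" unfolding RT
      by (intro sim_add sim_rep sim_sym[OF zw]) (simp add: sim_def)
    moreover have "sim ?R ?S" by (intro sim_add sim_rep 1 2)
    ultimately have "(\<Sum>x\<in>#?S. L x) \<le> (\<Sum>x\<in>#repeat_mset (?k * ?l) {#z', w'#} + T. p x)"
      using QD[OF p(1)] sim_trans by blast
    then have a: "?l * (\<Sum>x\<in>#S1. L x) + ?k * (\<Sum>x\<in>#S2. L x) \<le>
        (real ?k * real ?l) * (p z' + p w') + (\<Sum>x\<in>#T. p x)"
      unfolding image_mset_union sum_mset.union sum_mset_repeat_mset by simp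
    have "(\<Sum>x\<in>#?R. p x) = (\<Sum>x\<in>#repeat_mset (?k * ?l) {#z, w#} + T. p x)" using RT by simp
    then have b: "?l * (\<Sum>x\<in>#R1. p x) + ?k * (\<Sum>x\<in>#R2. p x) =
        (real ?k * real ?l) * (p z + p w) + (\<Sum>x\<in>#T. p x)"
      unfolding image_mset_union sum_mset.union sum_mset_repeat_mset by simp
    \<comment> \<open>Each of the two slacks costs \<open>?k * ?l * (e/2)\<close>. After cancelling
      \<open>T\<close> and dividing by \<open>?k * ?l\<close> the total error is
      \<open>e\<close>.\<close>
    have c: "?l * ((\<Sum>x\<in>#R1. p x) - real ?k * (e/2)) < ?l * (\<Sum>x\<in>#S1. L x)"
      using 1 2 by (intro mult_strict_left_mono) auto
    have d: "?k * ((\<Sum>x\<in>#R2. p x) - real ?l * (e/2)) < ?k * (\<Sum>x\<in>#S2. L x)"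
      using 1 2 by (intro mult_strict_left_mono) auto
    have "(real ?k * real ?l) * (p z + p w) \<le> (real ?k * real ?l) * (p z' + p w' + e)"
      using a b c d by (simp add: algebra_simps)
    then show "p z + p w \<le> p z' + p w' + e" using 1 2 by (subst (asm) mult_le_cancel_left_pos) auto
  qed
  show thesis
  proof
    show "L x \<le> p x" "p x \<le> U x" for x using lb[OF p(1)] p(1) by (auto simp: Q_def)
    fix z w z' w' assume "\<And>T. G ({#z, w#} + T) = G ({#z', w'#} + T)"
    then have "sim {#z, w#} {#z', w'#}" by (simp add: sim_def)
    then show "p z + p w = p z' + p w'" using main sim_sym by (intro antisym) blast+
  qed
qed

text \<open>The defect \<open>h\<close> of homogeneity is additive in the scalar and vanishes on the
  integers, so it has period 1. It is bounded on one period, because the multiples of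
  \<open>x\<close> there stay in the ball where \<open>g\<close> is bounded. A bounded additive
  function is zero.\<close>

lemma additive_bounded_imp_homogeneous:
  fixes g :: "'a::real_normed_vector \<Rightarrow> real"
  assumes add: "\<And>x y. g (x + y) = g x + g y" and bdd: "\<And>x. norm x \<le> M \<Longrightarrow> \<bar>g x\<bar> \<le> K" and x: "norm x \<le> M"
  shows "g (r *\<^sub>R x) = r * g x"
proof -
  define h where "h r = g (r *\<^sub>R x) - r * g x" for r :: real
  have h_add: "h (r + s) = h r + h s" for r s by (simp add: h_def scaleR_add_left add algebra_simps)
  have h1: "h 1 = 0" by (simp add: h_def)
  have h0: "h 0 = 0" using h_add[of 0 0] by simp
  have hn: "h (real n * r) = real n * h r" for n r
    by (induction n) (auto simp: h0 h_add algebra_simps)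
  have hneg: "h (- r) = - h r" for r using h_add[of r "- r"] h0 by simp
  have hint: "h (of_int k) = 0" for k
  proof (cases "0 \<le> k")
    case True then show ?thesis using hn[of "nat k" 1] h1 by simp
  next
    case False then show ?thesis using hn[of "nat (- k)" 1] h1 hneg[of "of_int k"] by simp
  qed
  have hb: "\<bar>h r\<bar> \<le> 2 * K" for r
  proof -
    have "h r = h (frac r) + h (of_int \<lfloor>r\<rfloor>)" by (simp flip: h_add) (simp add: frac_def)
    then have eq: "h r = h (frac r)" using hint by simp
    have f: "0 \<le> frac r" "frac r \<le> 1" using frac_lt_1[of r] by auto
    have "norm (frac r *\<^sub>R x) \<le> 1 * norm x" unfolding norm_scaleR using f by (intro mult_right_mono) auto
    then have "\<bar>g (frac r *\<^sub>R x)\<bar> \<le> K" using x by (intro bdd) auto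
    moreover have "\<bar>frac r * g x\<bar> \<le> 1 * \<bar>g x\<bar>" unfolding abs_mult using f by (intro mult_right_mono) auto
    moreover have "\<bar>g x\<bar> \<le> K" by (rule bdd[OF x])
    ultimately have "\<bar>h (frac r)\<bar> \<le> 2 * K" unfolding h_def by linarith
    then show ?thesis using eq by simp
  qed
  have "h r = 0"
  proof (rule ccontr)
    assume "h r \<noteq> 0"
    then obtain n :: nat where "2 * K < real n * \<bar>h r\<bar>" using reals_Archimedean3[of "\<bar>h r\<bar>"] by auto
    also have "real n * \<bar>h r\<bar> = \<bar>h (real n * r)\<bar>" by (simp add: hn abs_mult)
    finally show False using hb[of "real n * r"] by simp
  qed
  then show ?thesis by (simp add: h_def)
qed

text \<open>The Jordan-von Neumann theorem by polarization. The quadratic bound on \<open>p\<close>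
  takes the place of continuity in the step from additivity to homogeneity.\<close>

lemma parallelogram_imp_bilinear:
  fixes p :: "'a::real_normed_vector \<Rightarrow> real"
  assumes par: "\<And>x y. p (x + y) + p (x - y) = 2 * p x + 2 * p y"
    and p_nonneg: "\<And>x. 0 \<le> p x" and p_le: "\<And>x. p x \<le> K * (norm x)\<^sup>2"
  obtains B where "bounded_bilinear B" "\<And>x y. B x y = B y x" "\<And>x. B x x = p x"
proof -
  have p0: "p 0 = 0" using par[of 0 0] by simp
  have even: "p (- x) = p x" for x using par[of 0 x] p0 by simp
  have p2: "p (2 *\<^sub>R x) = 4 * p x" for x using par[of x x] p0 by (simp add: scaleR_2)
  define B where "B x y = (p (x + y) - p (x - y)) / 4" for x y
  have sym: "B x y = B y x" for x y unfolding B_def using even[of "x - y"] by (simp add: add.commute)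
  have diag: "B x x = p x" for x unfolding B_def using p2[of x] p0 by (simp add: scaleR_2)
  have B0: "B 0 z = 0" for z unfolding B_def using even[of z] by simp
  \<comment> \<open>The difference of the parallelogram laws for \<open>x + z\<close> and
    \<open>x - z\<close>, each with \<open>y\<close>.\<close>
  have B_pm: "B (x + y) z + B (x - y) z = 2 * B x z" for x y z
  proof -
    have eqs: "x + z + y = x + y + z" "x + z - y = x - y + z" "x - z + y = x + y - z" "x - z - y = x - y - z"
      by simp_all
    have lin: "(p1 - p2) / 4 + (p3 - p4) / 4 = 2 * ((a - c) / 4)"
      if "p1 + p3 = 2 * a + 2 * b" "p2 + p4 = 2 * c + 2 * b" for p1 p2 p3 p4 a b c :: real
      using that by (simp add: field_simps)
    show ?thesis unfolding B_def by (rule lin[OF par[of "x + z" y, unfolded eqs] par[of "x - z" y, unfolded eqs]])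
  qed
  have B2: "B (2 *\<^sub>R x) z = 2 * B x z" for x z using B_pm[of x x z] B0 by (simp add: scaleR_2)
  have add: "B (x + y) z = B x z + B y z" for x y z
  proof -
    have e1: "(1/2) *\<^sub>R (x + y) + (1/2) *\<^sub>R (x - y) = x" "(1/2) *\<^sub>R (x + y) - (1/2) *\<^sub>R (x - y) = y"
      by (simp_all add: algebra_simps flip: scaleR_add_left)
    have "B x z + B y z = 2 * B ((1/2) *\<^sub>R (x + y)) z"
      using B_pm[of "(1/2) *\<^sub>R (x + y)" "(1/2) *\<^sub>R (x - y)" z] e1 by simp
    also have "\<dots> = B (x + y) z" using B2[of "(1/2) *\<^sub>R (x + y)" z] by simp
    finally show ?thesis by simp
  qed
  have Bb: "\<bar>B x z\<bar> \<le> \<bar>K\<bar> * (norm x + norm z)\<^sup>2" for x z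
  proof -
    have "p (x + z) \<le> \<bar>K\<bar> * (norm x + norm z)\<^sup>2"
      by (rule order_trans[OF p_le]) (intro mult_mono power_mono norm_triangle_ineq, auto)
    moreover have "p (x - z) \<le> \<bar>K\<bar> * (norm x + norm z)\<^sup>2"
      by (rule order_trans[OF p_le]) (intro mult_mono power_mono norm_triangle_ineq4, auto)
    moreover have "0 \<le> \<bar>K\<bar> * (norm x + norm z)\<^sup>2" by simp
    ultimately have "\<bar>p (x + z) - p (x - z)\<bar> \<le> 4 * (\<bar>K\<bar> * (norm x + norm z)\<^sup>2)"
      using p_nonneg[of "x + z"] p_nonneg[of "x - z"] by linarith
    then show ?thesis by (simp add: B_def abs_divide)
  qed
  have scal: "B (r *\<^sub>R x) z = r * B x z" for r x z
  proof (rule additive_bounded_imp_homogeneous[where M = "norm x" and K = "\<bar>K\<bar> * (norm x + norm z)\<^sup>2"])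
    fix y :: 'a assume "norm y \<le> norm x"
    then show "\<bar>B y z\<bar> \<le> \<bar>K\<bar> * (norm x + norm z)\<^sup>2"
      by (intro order_trans[OF Bb] mult_left_mono power_mono) auto
  qed (auto simp: add)
  have "bounded_bilinear B"
  proof
    show "\<exists>C. \<forall>a b. norm (B a b) \<le> norm a * norm b * C"
    proof (intro exI[of _ "4 * \<bar>K\<bar>"] allI)
      fix a b
      show "norm (B a b) \<le> norm a * norm b * (4 * \<bar>K\<bar>)"
      proof (cases "a = 0 \<or> b = 0")
        case True
        then show ?thesis using B0 sym[of a 0] by auto
      next
        case False
        \<comment> \<open>The bound \<open>Bb\<close> is not homogeneous in each argument
          separately, so it is used on unit vectors only.\<close>
        have "B a b = norm a * norm b * B (sgn a) (sgn b)"
        proof -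
          have ab: "norm a *\<^sub>R sgn a = a" "norm b *\<^sub>R sgn b = b" using False by (simp_all add: sgn_div_norm)
          have "B a b = norm a * B (sgn a) b" using scal[of "norm a" "sgn a" b] unfolding ab .
          also have "B (sgn a) b = B b (sgn a)" by (rule sym)
          also have "\<dots> = norm b * B (sgn b) (sgn a)" using scal[of "norm b" "sgn b" "sgn a"] unfolding ab .
          also have "B (sgn b) (sgn a) = B (sgn a) (sgn b)" by (rule sym)
          finally show ?thesis by simp
        qed
        moreover have "\<bar>B (sgn a) (sgn b)\<bar> \<le> \<bar>K\<bar> * (1 + 1)\<^sup>2"
          using Bb[of "sgn a" "sgn b"] False by (simp add: norm_sgn)
        ultimately show ?thesis by (simp add: abs_mult mult_left_mono)
      qed
    qed
    show "B a (b + b') = B a b + B a b'" for a b b' using add sym by metis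
    show "B a (r *\<^sub>R b) = r *\<^sub>R B a b" for a r b using scal sym by (metis real_scaleR_def)
  qed (auto simp: add scal)
  then show thesis using that sym diag by blast
qed

section \<open>Bilinear forms and Hilbert space structures\<close>

lemma scaleC_minus_left: "(- a) *\<^sub>C x = - (a *\<^sub>C (x::'a::complex_normed_vector))"
  and scaleC_one: "1 *\<^sub>C x = x"
  and scaleC_zero_left: "0 *\<^sub>C x = 0"
  and scaleC_minus_one: "(-1) *\<^sub>C x = - x"
  and scaleC_zero_right: "a *\<^sub>C (0::'a) = 0"
  and scaleC_minus_right: "a *\<^sub>C (- x) = - (a *\<^sub>C x)"
proof -
  show one: "1 *\<^sub>C x = x" for x :: 'a using scaleC_of_real[of 1 x] by simp
  show z: "0 *\<^sub>C x = 0" for x :: 'a using scaleC_of_real[of 0 x] by simp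
  show m: "(- a) *\<^sub>C x = - (a *\<^sub>C x)" for a and x :: 'a
    using scaleC_add_left[of a "- a" x] z[of x] by (simp add: minus_unique)
  show "(-1) *\<^sub>C x = - x" using m[of 1 x] one[of x] by simp
  show z': "a *\<^sub>C (0::'a) = 0" using scaleC_add_right[of a "0::'a" 0] by simp
  show "a *\<^sub>C (- x) = - (a *\<^sub>C x)"
    using scaleC_add_right[of a x "- x"] z' by (simp add: minus_unique)
qed

lemma scaleC_diff_right: "a *\<^sub>C (x - y) = a *\<^sub>C x - a *\<^sub>C (y::'a::complex_normed_vector)"
  using scaleC_add_right[of a x "- y"] by (simp add: scaleC_minus_right)

lemma scaleC_diff_left: "(a - b) *\<^sub>C x = a *\<^sub>C x - b *\<^sub>C (x::'a::complex_normed_vector)"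
  using scaleC_add_left[of a "- b" x] by (simp add: scaleC_minus_left)

lemma bounded_bilinear_scaleC: "bounded_bilinear (scaleC :: complex \<Rightarrow> 'a \<Rightarrow> 'a::complex_normed_vector)"
proof
  show "(r *\<^sub>R a) *\<^sub>C b = r *\<^sub>R a *\<^sub>C b" for r a and b :: 'a
    by (simp add: scaleR_conv_of_real flip: scaleC_scaleC scaleC_of_real)
  show "a *\<^sub>C r *\<^sub>R b = r *\<^sub>R a *\<^sub>C b" for r a and b :: 'a
    by (simp add: scaleC_scaleC mult.commute flip: scaleC_of_real)
  show "\<exists>K. \<forall>a. \<forall>b::'a. norm (a *\<^sub>C b) \<le> norm a * norm b * K"
    by (intro exI[of _ 1]) (simp add: norm_scaleC)
qed (auto simp: scaleC_add_left scaleC_add_right)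

lemma scaleC_Re_Im: "a *\<^sub>C x = Re a *\<^sub>R x + Im a *\<^sub>R (\<i> *\<^sub>C (x::'a::complex_normed_vector))"
proof -
  have "a = complex_of_real (Re a) + complex_of_real (Im a) * \<i>" by (simp add: complex_eq_iff)
  then have "a *\<^sub>C x = (complex_of_real (Re a) + complex_of_real (Im a) * \<i>) *\<^sub>C x" by simp
  then show ?thesis unfolding scaleC_add_left scaleC_scaleC[symmetric] scaleC_of_real .
qed

lemma discriminant_nonneg:
  fixes a b c :: real
  assumes "\<And>t. 0 \<le> a + 2 * t * b + t\<^sup>2 * c"
  shows "b\<^sup>2 \<le> a * c"
proof (cases "c = 0")
  case True
  have "b = 0"
  proof (rule ccontr)
    assume "b \<noteq> 0"
    \<comment> \<open>At this point the affine function takes the value -1.\<close>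
    then show False using assms[of "- (a + 1) / (2 * b)"] True by (simp add: field_simps)
  qed
  then show ?thesis using True by simp
next
  case False
  have "0 \<le> c"
  proof (rule ccontr)
    assume "\<not> 0 \<le> c"
    then have c: "c < 0" by simp
    \<comment> \<open>With this \<open>t\<close> the part \<open>a + 2 * t * b\<close> is at most t
      (t - 1) (-c), so the whole expression is at most t c < 0.\<close>
    define t where "t = 1 + (\<bar>a\<bar> + 2 * \<bar>b\<bar>) / - c"
    have t: "1 \<le> t" unfolding t_def using c by (simp add: divide_le_0_iff)
    have "a + 2 * t * b \<le> t * (\<bar>a\<bar> + 2 * \<bar>b\<bar>)"
    proof -
      have "a \<le> t * \<bar>a\<bar>" using t by (metis abs_ge_self abs_ge_zero mult_right_mono mult_1 order_trans)
      moreover have "t * b \<le> t * \<bar>b\<bar>" using t by (intro mult_left_mono) auto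
      ultimately show ?thesis by (simp add: algebra_simps)
    qed
    moreover have "t * (\<bar>a\<bar> + 2 * \<bar>b\<bar>) = t * ((t - 1) * - c)" unfolding t_def using c by simp
    ultimately have "0 \<le> t * ((t - 1) * - c) + t\<^sup>2 * c" using assms[of t] by linarith
    also have "\<dots> = t * c" by (simp add: algebra_simps power2_eq_square)
    finally show False using t c by (simp add: zero_le_mult_iff)
  qed
  then have "0 < c" using False by simp
  then show ?thesis using assms[of "- b / c"] by (simp add: field_simps power2_eq_square)
qed

lemma sqrt_add_le_of_discriminant:
  fixes a b c :: real
  assumes "0 \<le> a" "0 \<le> c" "b\<^sup>2 \<le> a * c"
  shows "sqrt (a + 2 * b + c) \<le> sqrt a + sqrt c"
proof (rule real_le_lsqrt)
  have "b \<le> sqrt (a * c)" using assms(3) by (rule real_le_rsqrt)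
  then show "a + 2 * b + c \<le> (sqrt a + sqrt c)\<^sup>2"
    using assms by (simp add: power2_sum real_sqrt_mult)
qed (use assms in auto)

text \<open>The algebraic axioms enter as separate hypotheses instead of through
  \<open>complex_hilbert_space\<close>: that locale contains completeness, which can be unfolded and
  proved only after \<open>inner_dist\<close> is known to be a metric.\<close>

lemma inner_dist_Metric_space:
  fixes add :: "'h \<Rightarrow> 'h \<Rightarrow> 'h" and ip :: "'h \<Rightarrow> 'h \<Rightarrow> complex"
  assumes add_assoc: "\<And>x y z. add (add x y) z = add x (add y z)"
    and add_commute: "\<And>x y. add x y = add y x"
    and add_zero: "\<And>x. add zero x = x"
    and add_inverse: "\<And>x. add x (cmult (-1) x) = zero"
    and scale_add_right: "\<And>a x y. cmult a (add x y) = add (cmult a x) (cmult a y)"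
    and scale_scale: "\<And>a b x. cmult a (cmult b x) = cmult (a * b) x"
    and scale_one: "\<And>x. cmult 1 x = x"
    and ip_add_left: "\<And>x y z. ip (add x y) z = ip x z + ip y z"
    and ip_scale_left: "\<And>a x y. ip (cmult a x) y = a * ip x y"
    and ip_cnj: "\<And>x y. ip y x = cnj (ip x y)"
    and ip_nonneg: "\<And>x. 0 \<le> Re (ip x x)"
    and ip_definite: "\<And>x. ip x x = 0 \<Longrightarrow> x = zero"
  shows "Metric_space UNIV (inner_dist add cmult ip)"
    and "(Re (ip x y))\<^sup>2 \<le> Re (ip x x) * Re (ip y y)"
proof -
  let ?r = "\<lambda>x y. Re (ip x y)"
  have r_sym: "?r y x = ?r x y" for x y using ip_cnj[of y x] by simp
  have r_add: "?r (add x y) (add x y) = ?r x x + 2 * ?r x y + ?r y y" for x y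
    using r_sym[of x "add x y"] r_sym[of y "add x y"] r_sym[of x y] by (simp add: ip_add_left)
  have r_scal: "?r (cmult (complex_of_real t) x) y = t * ?r x y" for t x y by (simp add: ip_scale_left)
  have CS: "(?r x y)\<^sup>2 \<le> ?r x x * ?r y y" for x y
  proof (rule discriminant_nonneg)
    fix t
    let ?z = "cmult (complex_of_real t) y"
    have "?r x ?z = t * ?r x y" using r_scal[of t y x] r_sym by metis
    moreover have "?r ?z ?z = t * (t * ?r y y)" using r_scal[of t y ?z] r_scal[of t y y] r_sym by metis
    ultimately show "0 \<le> ?r x x + 2 * t * ?r x y + t\<^sup>2 * ?r y y"
      using ip_nonneg[of "add x ?z"] r_add[of x ?z] by (simp add: power2_eq_square)
  qed
  then show "(Re (ip x y))\<^sup>2 \<le> Re (ip x x) * Re (ip y y)" .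
  have tri: "sqrt (?r (add x y) (add x y)) \<le> sqrt (?r x x) + sqrt (?r y y)" for x y
    unfolding r_add by (intro sqrt_add_le_of_discriminant ip_nonneg CS)
  let ?m = "\<lambda>x y. add x (cmult (-1) y)"
  have d: "inner_dist add cmult ip x y = sqrt (?r (?m x y) (?m x y))" for x y
    by (simp add: inner_dist_def Let_def)
  have ip0: "ip zero zero = 0" using ip_add_left[of zero zero zero] add_zero[of zero] by simp
  show "Metric_space UNIV (inner_dist add cmult ip)"
  proof
    fix x y z
    show "0 \<le> inner_dist add cmult ip x y" by (simp add: d ip_nonneg)
    have "?m y x = cmult (-1) (?m x y)" by (simp add: scale_add_right scale_scale scale_one add_commute)
    then show "inner_dist add cmult ip x y = inner_dist add cmult ip y x"
      using ip_scale_left[of "-1" "?m x y" "?m y x"] ip_scale_left[of "-1" "?m x y" "?m x y"]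
        r_sym[of "?m x y" "?m y x"] by (simp add: d)
    show "inner_dist add cmult ip x y = 0 \<longleftrightarrow> x = y"
    proof
      assume "inner_dist add cmult ip x y = 0"
      then have "?r (?m x y) (?m x y) = 0" by (simp add: d)
      moreover have "Im (ip (?m x y) (?m x y)) = 0" using ip_cnj[of "?m x y" "?m x y"] by (simp add: complex_eq_iff)
      ultimately have "?m x y = zero" by (intro ip_definite) (simp add: complex_eq_iff)
      then have "add (?m x y) y = y" using add_zero by simp
      moreover have "add (?m x y) y = x"
        unfolding add_assoc add_commute[of "cmult (-1) y" y] add_inverse add_commute[of x zero] add_zero ..
      ultimately show "x = y" by simp
    qed (simp add: d add_inverse ip0)
    have "add (?m x y) (?m y z) = add x (add (add y (cmult (-1) y)) (cmult (-1) z))"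
      unfolding add_assoc add_commute[of y "cmult (-1) y"] ..
    also have "\<dots> = ?m x z" by (simp only: add_inverse add_zero)
    finally have "?m x z = add (?m x y) (?m y z)" by simp
    then show "inner_dist add cmult ip x z \<le> inner_dist add cmult ip x y + inner_dist add cmult ip y z"
      unfolding d using tri by simp
  qed
qed

text \<open>Points and operations stay the same and \<open>T\<close> is the identity. Only the norm
  is exchanged for an equivalent one, so topology and completeness carry over.\<close>

lemma isomorphic_to_hilbert_space_if_bilinear:
  fixes B :: "'x::complex_banach \<Rightarrow> 'x \<Rightarrow> real"
  assumes bil: "bounded_bilinear B" and sym: "\<And>x y. B x y = B y x"
    and c: "0 < c" and low: "\<And>x. c * (norm x)\<^sup>2 \<le> B x x"
  shows "isomorphic_to_hilbert_space TYPE('x)"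
proof -
  interpret B: bounded_bilinear B by (rule bil)
  \<comment> \<open>The real part of a Hermitian product is invariant under multiplying both
    arguments by \<open>\<i>\<close>. The average enforces this and keeps the two bounds.\<close>
  define B' where "B' x y = (B x y + B (\<i> *\<^sub>C x) (\<i> *\<^sub>C y)) / 2" for x y
  have ii: "\<i> *\<^sub>C \<i> *\<^sub>C x = - x" for x :: 'x by (simp add: scaleC_scaleC scaleC_minus_one)
  have B'i: "B' (\<i> *\<^sub>C x) y = - B' x (\<i> *\<^sub>C y)" "B' (\<i> *\<^sub>C x) (\<i> *\<^sub>C y) = B' x y" for x y
    unfolding B'_def ii B.minus_left B.minus_right by (simp_all add: field_simps)
  have B'sym: "B' x y = B' y x" for x y unfolding B'_def using sym[of x y] sym[of "\<i> *\<^sub>C x" "\<i> *\<^sub>C y"] by simp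
  have B'add: "B' (x + y) z = B' x z + B' y z" for x y z
    by (simp add: B'_def scaleC_add_right B.add_left add_divide_distrib)
  have iR: "\<i> *\<^sub>C r *\<^sub>R x = r *\<^sub>R \<i> *\<^sub>C x" for r and x :: 'x
    by (rule bounded_bilinear.scaleR_right[OF bounded_bilinear_scaleC])
  have B'scal: "B' (r *\<^sub>R x) z = r * B' x z" for r x z
    by (simp add: B'_def iR B.scaleR_left distrib_left)
  have B'low: "c * (norm x)\<^sup>2 \<le> B' x x" for x
    using low[of x] low[of "\<i> *\<^sub>C x"] by (simp add: B'_def norm_scaleC)
  obtain K where K: "0 < K" "\<And>a b. norm (B a b) \<le> norm a * norm b * K" using B.pos_bounded by blast
  have B'up: "B' x x \<le> K * (norm x)\<^sup>2" for x
    using K(2)[of x x] K(2)[of "\<i> *\<^sub>C x" "\<i> *\<^sub>C x"]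
    by (simp add: B'_def norm_scaleC power2_eq_square mult_ac)
  \<comment> \<open>A Hermitian product that is linear in its first argument is determined by its
    real part: the imaginary part at (x, y) is the real part at (x, i y).\<close>
  define ip where "ip x y = Complex (B' x y) (B' x (\<i> *\<^sub>C y))" for x y
  note sc = scaleC_Re_Im
  let ?d = "inner_dist (+) scaleC ip"
  have d: "?d x y = sqrt (B' (x - y) (x - y))" for x y
    by (simp add: inner_dist_def ip_def scaleC_minus_one Let_def)
  have d_low: "sqrt c * dist x y \<le> ?d x y" for x y
    using real_sqrt_le_mono[OF B'low[of "x - y"]] by (simp add: d real_sqrt_mult dist_norm)
  have d_up: "?d x y \<le> sqrt K * dist x y" for x y
    using real_sqrt_le_mono[OF B'up[of "x - y"]] by (simp add: d real_sqrt_mult dist_norm)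
  have ipa: "ip (x + y) z = ip x z + ip y z" for x y z
    by (simp add: ip_def complex_eq_iff B'add)
  have ips: "ip (a *\<^sub>C x) y = a * ip x y" for a x y
  proof -
    have "ip (a *\<^sub>C x) y = Re a * ip x y + Im a * ip (\<i> *\<^sub>C x) y"
      unfolding sc[of a x] by (simp add: ip_def complex_eq_iff B'add B'scal)
    also have "ip (\<i> *\<^sub>C x) y = \<i> * ip x y" 
      unfolding ip_def complex_eq_iff using B'i(1)[of x y] B'i(2)[of x y] by simp
    finally show ?thesis by (simp add: complex_eq_iff)
  qed
  have ipc: "ip y x = cnj (ip x y)" for x y
    using B'i(1)[of x y] B'sym[of y x] B'sym[of y "\<i> *\<^sub>C x"] by (simp add: ip_def complex_eq_iff)
  have ipn: "0 \<le> Re (ip x x)" for x using order_trans[OF _ B'low[of x]] c by (simp add: ip_def)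
  have ipd: "x = 0" if "ip x x = 0" for x
  proof -
    have "c * (norm x)\<^sup>2 \<le> 0" using B'low[of x] that by (simp add: ip_def complex_eq_iff)
    then show ?thesis using c by (simp add: mult_le_0_iff)
  qed
  interpret d: Metric_space UNIV ?d
    by (rule inner_dist_Metric_space[where zero = 0])
       (auto simp: scaleC_minus_one scaleC_add_right scaleC_scaleC scaleC_one ipa ips ipn ipd intro: ipc)
  have sc0: "0 < sqrt c" using c by simp
  have sK0: "0 < sqrt K" using K by simp
  have top: "d.mtopology = euclidean"
  proof (rule topology_eq[THEN iffD2], rule allI)
    fix S :: "'x set"
    show "openin d.mtopology S \<longleftrightarrow> openin euclidean S"
      unfolding d.openin_mtopology open_openin[symmetric] open_contains_ball
    proof (intro iffI ballI conjI allI impI subset_UNIV)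
      fix x assume S: "S \<subseteq> UNIV \<and> (\<forall>x. x \<in> S \<longrightarrow> (\<exists>r>0. d.mball x r \<subseteq> S))" and x: "x \<in> S"
      then obtain r where r: "0 < r" "d.mball x r \<subseteq> S" by blast
      have "ball x (r / sqrt K) \<subseteq> d.mball x r"
        using sK0 by (auto simp: field_simps intro: le_less_trans[OF d_up])
      then show "\<exists>e>0. ball x e \<subseteq> S" using r sK0 by (intro exI[of _ "r / sqrt K"]) auto
    next
      fix x assume S: "\<forall>x\<in>S. \<exists>e>0. ball x e \<subseteq> S" and x: "x \<in> S"
      then obtain r where r: "0 < r" "ball x r \<subseteq> S" by blast
      have "d.mball x (sqrt c * r) \<subseteq> ball x r"
      proof
        fix y assume "y \<in> d.mball x (sqrt c * r)"
        then have "sqrt c * dist x y < sqrt c * r" using d_low[of x y] by simp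
        then show "y \<in> ball x r" using sc0 by simp
      qed
      then show "\<exists>e>0. d.mball x e \<subseteq> S" using r sc0 by (intro exI[of _ "sqrt c * r"]) auto
    qed
  qed
  have "d.mcomplete" unfolding d.mcomplete_def
  proof (intro allI impI)
    fix \<sigma> assume \<sigma>: "d.MCauchy \<sigma>"
    have "Cauchy \<sigma>"
    proof (rule metric_CauchyI)
      fix e :: real assume "0 < e"
      then have "0 < sqrt c * e" using sc0 by simp
      then obtain N where N: "\<And>m n. N \<le> m \<Longrightarrow> N \<le> n \<Longrightarrow> ?d (\<sigma> m) (\<sigma> n) < sqrt c * e"
        using \<sigma> unfolding d.MCauchy_def by meson
      show "\<exists>M. \<forall>m\<ge>M. \<forall>n\<ge>M. dist (\<sigma> m) (\<sigma> n) < e"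
      proof (intro exI[of _ N] allI impI)
        fix m n assume "N \<le> m" "N \<le> n"
        then have "sqrt c * dist (\<sigma> m) (\<sigma> n) < sqrt c * e" using N[of m n] d_low[of "\<sigma> m" "\<sigma> n"] by simp
        then show "dist (\<sigma> m) (\<sigma> n) < e" using sc0 by simp
      qed
    qed
    then obtain l where "\<sigma> \<longlonglongrightarrow> l" using Cauchy_convergent convergent_def by blast
    then show "\<exists>x. limitin d.mtopology \<sigma> x sequentially" unfolding top by auto
  qed
  then have "complex_hilbert_space (+) 0 scaleC ip"
    by unfold_locales (auto simp: scaleC_minus_one scaleC_add_right scaleC_add_left scaleC_scaleC scaleC_one ipa ips ipn ipd
        intro: ipc)
  then show ?thesis unfolding isomorphic_to_hilbert_space_def
    by (intro exI[of _ "(+)"] exI[of _ 0] exI[of _ scaleC] exI[of _ ip] exI[of _ id]) (simp add: top)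
qed

text \<open>The real part of the inner product is pulled back along \<open>T\<close>. Continuity of
  \<open>T\<close> at 0 bounds it from above, and openness of \<open>T\<close> near 0 bounds it from
  below.\<close>

lemma bilinear_if_isomorphic_to_hilbert_space:
  assumes "isomorphic_to_hilbert_space TYPE('x)"
  obtains B :: "'x::complex_banach \<Rightarrow> 'x \<Rightarrow> real" and c where
    "bounded_bilinear B" "\<And>x y. B x y = B y x" "0 < c" "\<And>x. c * (norm x)\<^sup>2 \<le> B x x"
proof -
  from assms obtain add :: "'x \<Rightarrow> 'x \<Rightarrow> 'x" and zero cmult ip and T :: "'x \<Rightarrow> 'x" where
    H: "complex_hilbert_space add zero cmult ip" and Ta: "\<And>x y. T (x + y) = add (T x) (T y)"
    and Ts: "\<And>a x. T (a *\<^sub>C x) = cmult a (T x)"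
    and Th: "homeomorphic_map euclidean (Metric_space.mtopology UNIV (inner_dist add cmult ip)) T"
    unfolding isomorphic_to_hilbert_space_def by blast
  interpret H: complex_hilbert_space add zero cmult ip by (rule H)
  note metric = inner_dist_Metric_space[of add zero cmult ip, OF H.add_assoc H.add_commute H.add_zero H.add_inverse
      H.scale_add_right H.scale_scale H.scale_one H.ip_add_left H.ip_scale_left H.ip_cnj H.ip_nonneg H.ip_definite]
  let ?d = "inner_dist add cmult ip"
  interpret d: Metric_space UNIV ?d by (rule metric)
  define B where "B x y = Re (ip (T x) (T y))" for x y
  have sym: "B x y = B y x" for x y unfolding B_def using H.ip_cnj[of "T x" "T y"] by simp
  have add: "B (x + y) z = B x z + B y z" for x y z by (simp add: B_def Ta H.ip_add_left)
  have scal: "B (r *\<^sub>R x) z = r * B x z" for r x z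
    by (simp add: B_def Ts H.ip_scale_left flip: scaleC_of_real)
  have scal2: "B (r *\<^sub>R x) (r *\<^sub>R x) = r\<^sup>2 * B x x" for r x
    using scal[of r x "r *\<^sub>R x"] scal[of r x x] sym[of x "r *\<^sub>R x"] by (simp add: power2_eq_square)
  have pos: "0 \<le> B x x" for x by (simp add: B_def H.ip_nonneg)
  have T0: "T 0 = zero"
  proof -
    have "cmult (-1) (T 0) = T 0" unfolding Ts[symmetric] scaleC_zero_right ..
    then have "zero = T (0 + 0)" unfolding Ta using H.add_inverse[of "T 0"] by metis
    then show ?thesis by simp
  qed
  have d0: "?d (T 0) (T x) = sqrt (B x x)" for x
  proof -
    have "add (T 0) (cmult (-1) (T x)) = T (- x)" by (simp add: T0 H.add_zero scaleC_minus_one flip: Ts)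
    then have "?d (T 0) (T x) = sqrt (B (- x) (- x))" by (simp add: inner_dist_def B_def Let_def)
    also have "B (- x) (- x) = B x x" using scal2[of "-1" x] by simp
    finally show ?thesis .
  qed
  have cont: "continuous_map euclidean d.mtopology T" and opn: "open_map euclidean d.mtopology T" and inj: "inj T"
    using Th unfolding homeomorphic_eq_everything_map by simp_all
  have "openin euclidean {x \<in> topspace euclidean. T x \<in> d.mball (T 0) 1}"
    by (rule openin_continuous_map_preimage[OF cont d.openin_mball])
  then have "open {x. T x \<in> d.mball (T 0) 1}"
    by (simp only: topspace_euclidean UNIV_I simp_thms open_openin)
  moreover have "0 \<in> {x. T x \<in> d.mball (T 0) 1}" unfolding mem_Collect_eq d.centre_in_mball_iff by simp
  ultimately obtain e where e: "0 < e" "ball 0 e \<subseteq> {x. T x \<in> d.mball (T 0) 1}" by (rule openE)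
  have up1: "B x x < 1" if "norm x < e" for x
  proof -
    have "x \<in> ball 0 e" using that by simp
    then have "T x \<in> d.mball (T 0) 1" using e(2) by blast
    then show ?thesis unfolding d.in_mball d0 by simp
  qed
  have up: "B x x \<le> (2 / e)\<^sup>2 * (norm x)\<^sup>2" for x
  proof (cases "x = 0")
    case True
    then show ?thesis using scal[of 0 0 0] by simp
  next
    case False
    \<comment> \<open>Length e/2 keeps the vector strictly inside the ball of radius
      \<open>e\<close>; hence the constant (2/e)^2.\<close>
    let ?y = "(e / (2 * norm x)) *\<^sub>R x"
    have "norm ?y < e" using False e by simp
    from up1[OF this] have "(e / (2 * norm x))\<^sup>2 * B x x < 1" by (simp only: scal2)
    then show ?thesis using e False by (simp add: field_simps)
  qed
  have "openin d.mtopology (T ` ball 0 1)" using opn unfolding open_map_def by auto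
  moreover have "T 0 \<in> T ` ball 0 1" by simp
  ultimately obtain r where r: "0 < r" "d.mball (T 0) r \<subseteq> T ` ball 0 1"
    unfolding d.openin_mtopology by blast
  have low1: "norm x < 1" if "B x x < r\<^sup>2" for x
  proof -
    have "sqrt (B x x) < r" using real_sqrt_less_mono[OF that] r by simp
    then have "T x \<in> d.mball (T 0) r" unfolding d.in_mball d0 by simp
    then have "T x \<in> T ` ball 0 1" using r(2) by (rule subsetD[rotated])
    then have "x \<in> ball 0 1" using inj_image_mem_iff[OF inj] by blast
    then show ?thesis by simp
  qed
  have low: "r\<^sup>2 * (norm x)\<^sup>2 \<le> B x x" for x
  proof (rule ccontr)
    assume *: "\<not> r\<^sup>2 * (norm x)\<^sup>2 \<le> B x x"
    then have x: "x \<noteq> 0" using pos[of x] by auto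
    have "B x x / (norm x)\<^sup>2 < r\<^sup>2" using * x by (subst pos_divide_less_eq) auto
    then have "B (inverse (norm x) *\<^sub>R x) (inverse (norm x) *\<^sub>R x) < r\<^sup>2"
      unfolding scal2 by (simp only: divide_inverse power_inverse mult.commute)
    from low1[OF this] x show False by simp
  qed
  have "bounded_bilinear B"
  proof
    show "\<exists>K. \<forall>a b. norm (B a b) \<le> norm a * norm b * K"
    proof (intro exI[of _ "(2/e)\<^sup>2"] allI)
      fix a b
      have "(B a b)\<^sup>2 \<le> B a a * B b b" unfolding B_def by (rule metric)
      also have "\<dots> \<le> ((2 / e)\<^sup>2 * (norm a)\<^sup>2) * ((2 / e)\<^sup>2 * (norm b)\<^sup>2)" by (intro mult_mono up pos) auto
      also have "\<dots> = (norm a * norm b * (2/e)\<^sup>2)\<^sup>2" by (simp add: power_mult_distrib power2_eq_square mult_ac)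
      finally have "\<bar>B a b\<bar> \<le> \<bar>norm a * norm b * (2/e)\<^sup>2\<bar>" unfolding abs_le_square_iff .
      then show "norm (B a b) \<le> norm a * norm b * (2/e)\<^sup>2" by (simp add: abs_mult)
    qed
    show "B a (b + b') = B a b + B a b'" for a b b' using add sym by metis
    show "B a (s *\<^sub>R b) = s *\<^sub>R B a b" for a s b using scal sym by (metis real_scaleR_def)
  qed (auto simp: add scal)
  then show thesis using sym low r by (intro that[of B "r\<^sup>2"]) auto
qed

section \<open>Gaussian sums and Kwapien's theorem\<close>

text \<open>The rotation is split into two substitutions in one variable: u = c a - s b for fixed
  \<open>b\<close>, and v = (s u + b) / c for fixed \<open>u\<close>. Each produces the factor |c|,
  which cancels. The division by \<open>c\<close> excludes the quarter turns.\<close>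

lemma nn_integral_lborel_rotation:
  fixes f :: "real \<times> real \<Rightarrow> ennreal"
  assumes [measurable]: "f \<in> borel_measurable borel" and c: "c \<noteq> 0" and cs: "c\<^sup>2 + s\<^sup>2 = 1"
  shows "(\<integral>\<^sup>+b. \<integral>\<^sup>+a. f (c * a - s * b, s * a + c * b) \<partial>lborel \<partial>lborel) = (\<integral>\<^sup>+b. \<integral>\<^sup>+a. f (a, b) \<partial>lborel \<partial>lborel)"
proof -
  have s2: "s * s = 1 - c * c" using cs by (simp add: power2_eq_square)
  have m2: "f \<in> borel_measurable (lborel \<Otimes>\<^sub>M lborel)" by (simp add: lborel_prod)
  have inner: "(\<integral>\<^sup>+u. f (u, (s * u + b) / c) \<partial>lborel) = ennreal \<bar>c\<bar> * (\<integral>\<^sup>+a. f (c * a - s * b, s * a + c * b) \<partial>lborel)" for b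
  proof -
    have "(s * (- s * b + c * a) + b) / c = s * a + c * b" for a
    proof -
      have "s * (- s * b + c * a) + b = c * (s * a + c * b)" using s2 by algebra
      then show ?thesis using c by simp
    qed
    moreover have "- s * b + c * a = c * a - s * b" for a by simp
    ultimately show ?thesis
      using nn_integral_real_affine[of "\<lambda>u. f (u, (s * u + b) / c)" c "- s * b"] c by simp
  qed
  have inner2: "(\<integral>\<^sup>+b. f (u, (s * u + b) / c) \<partial>lborel) = ennreal \<bar>c\<bar> * (\<integral>\<^sup>+v. f (u, v) \<partial>lborel)" for u
  proof -
    have "ennreal \<bar>c\<bar> * (\<integral>\<^sup>+v. f (u, v) \<partial>lborel)
      = ennreal \<bar>c\<bar> * (ennreal \<bar>inverse c\<bar> * (\<integral>\<^sup>+b. f (u, s * u / c + inverse c * b) \<partial>lborel))"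
      using nn_integral_real_affine[of "\<lambda>v. f (u, v)" "inverse c" "s * u / c"] c by simp
    also have "\<dots> = ennreal (\<bar>c\<bar> * \<bar>inverse c\<bar>) * (\<integral>\<^sup>+b. f (u, s * u / c + inverse c * b) \<partial>lborel)"
      by (simp add: ennreal_mult mult.assoc)
    also have "\<bar>c\<bar> * \<bar>inverse c\<bar> = 1" using c by (simp flip: abs_mult)
    finally show ?thesis by (simp add: divide_inverse distrib_left mult.commute)
  qed
  have "ennreal \<bar>c\<bar> * (\<integral>\<^sup>+b. \<integral>\<^sup>+a. f (c * a - s * b, s * a + c * b) \<partial>lborel \<partial>lborel)
    = (\<integral>\<^sup>+b. \<integral>\<^sup>+u. f (u, (s * u + b) / c) \<partial>lborel \<partial>lborel)"
    by (subst nn_integral_cmult[symmetric]) (simp_all add: inner)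
  also have "\<dots> = (\<integral>\<^sup>+u. \<integral>\<^sup>+b. f (u, (s * u + b) / c) \<partial>lborel \<partial>lborel)"
    by (rule lborel_pair.Fubini') simp
  also have "\<dots> = ennreal \<bar>c\<bar> * (\<integral>\<^sup>+u. \<integral>\<^sup>+v. f (u, v) \<partial>lborel \<partial>lborel)"
    by (simp add: inner2 nn_integral_cmult)
  also have "(\<integral>\<^sup>+u. \<integral>\<^sup>+v. f (u, v) \<partial>lborel \<partial>lborel) = (\<integral>\<^sup>+b. \<integral>\<^sup>+a. f (a, b) \<partial>lborel \<partial>lborel)"
    by (rule lborel_pair.Fubini'[symmetric]) (simp add: m2)
  finally show ?thesis using c by (subst (asm) ennreal_mult_cancel_left) auto
qed

section \<open>Real and complex Gaussian measures and their rotations\<close>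

definition std_gaussian :: "real measure" where
  "std_gaussian = density lborel (\<lambda>x. ennreal (normal_density 0 1 x))"

lemma sets_std_gaussian [simp, measurable_cong]: "sets std_gaussian = sets borel"
  by (simp add: std_gaussian_def)

lemma space_std_gaussian [simp]: "space std_gaussian = UNIV"
  by (simp add: std_gaussian_def)

lemma prob_space_std_gaussian: "prob_space std_gaussian"
  unfolding std_gaussian_def by (rule prob_space_normal_density) simp

interpretation std_gaussian: prob_space std_gaussian
  by (rule prob_space_std_gaussian)

interpretation std_gaussian_pair: pair_sigma_finite std_gaussian std_gaussian ..

text \<open>The product density \<open>w\<close> depends only on a^2 + b^2, so it is carried along
  unchanged by the rotation of Lebesgue measure.\<close>

lemma nn_integral_std_gaussian_rotation:
  fixes f :: "real \<times> real \<Rightarrow> ennreal"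
  assumes [measurable]: "f \<in> borel_measurable borel" and c: "c \<noteq> 0" and cs: "c\<^sup>2 + s\<^sup>2 = 1"
  shows "(\<integral>\<^sup>+b. \<integral>\<^sup>+a. f (c * a - s * b, s * a + c * b) \<partial>std_gaussian \<partial>std_gaussian) =
    (\<integral>\<^sup>+b. \<integral>\<^sup>+a. f (a, b) \<partial>std_gaussian \<partial>std_gaussian)"
proof -
  have [measurable]: "(\<lambda>p. f (g p, h p)) \<in> borel_measurable M"
    if "g \<in> borel_measurable M" "h \<in> borel_measurable M" for g h :: "'b \<Rightarrow> real" and M
    using that by measurable
  define w where "w a b = ennreal (normal_density 0 1 a * normal_density 0 1 b)" for a b :: real
  have [measurable]: "(\<lambda>p. w (fst p) (snd p)) \<in> borel_measurable borel"
    unfolding w_def by (simp add: borel_prod[symmetric])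
  have w_eq: "w a b = ennreal (exp (- (a\<^sup>2 + b\<^sup>2) / 2) / (2 * pi))" for a b
    unfolding w_def normal_density_def
    by (rule arg_cong[where f = ennreal]) (simp add: exp_add[symmetric] add_divide_distrib)
  have rot: "w (c * a - s * b) (s * a + c * b) = w a b" for a b
  proof -
    have "(c * a - s * b)\<^sup>2 + (s * a + c * b)\<^sup>2 = (c\<^sup>2 + s\<^sup>2) * (a\<^sup>2 + b\<^sup>2)"
      by (simp add: power2_eq_square algebra_simps)
    then show ?thesis by (simp add: w_eq cs)
  qed
  have unfold: "(\<integral>\<^sup>+b. \<integral>\<^sup>+a. F a b \<partial>std_gaussian \<partial>std_gaussian) = (\<integral>\<^sup>+b. \<integral>\<^sup>+a. F a b * w a b \<partial>lborel \<partial>lborel)"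
    if *: "(\<lambda>p. F (fst p) (snd p)) \<in> borel_measurable borel" for F :: "real \<Rightarrow> real \<Rightarrow> ennreal"
  proof -
    have gen: "(\<lambda>p. F (g p) (h p)) \<in> borel_measurable N"
      if [measurable]: "g \<in> borel_measurable N" "h \<in> borel_measurable N" for g h :: "'b \<Rightarrow> real" and N
      using measurable_compose[OF borel_measurable_Pair[OF that] *] by simp
    have [measurable]: "(\<lambda>a. F a b) \<in> borel_measurable borel" for b by (rule gen) simp_all
    have [measurable]: "(\<lambda>b. \<integral>\<^sup>+a. F a b \<partial>std_gaussian) \<in> borel_measurable borel"
      by (intro std_gaussian.borel_measurable_nn_integral) (simp add: split_beta', intro gen, auto)
    show ?thesis unfolding std_gaussian_def
      apply (subst nn_integral_density)
        apply simp
       apply (fold std_gaussian_def, simp)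
      apply (unfold std_gaussian_def)
      apply (intro nn_integral_cong)
      apply (subst nn_integral_density, simp, simp)
      apply (subst nn_integral_cmult[symmetric], simp)
      apply (intro nn_integral_cong)
      apply (simp add: w_def ennreal_mult mult_ac)
      done
  qed
  have "(\<integral>\<^sup>+b. \<integral>\<^sup>+a. f (c * a - s * b, s * a + c * b) \<partial>std_gaussian \<partial>std_gaussian) =
     (\<integral>\<^sup>+b. \<integral>\<^sup>+a. f (c * a - s * b, s * a + c * b) * w (c * a - s * b) (s * a + c * b) \<partial>lborel \<partial>lborel)"
    by (subst unfold) (simp_all add: rot borel_prod[symmetric])
  also have "\<dots> = (\<integral>\<^sup>+b. \<integral>\<^sup>+a. f (a, b) * w a b \<partial>lborel \<partial>lborel)"
    using nn_integral_lborel_rotation[OF _ c cs, of "\<lambda>p. f p * w (fst p) (snd p)"] by simp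
  also have "\<dots> = (\<integral>\<^sup>+b. \<integral>\<^sup>+a. f (a, b) \<partial>std_gaussian \<partial>std_gaussian)"
    by (subst unfold) simp_all
  finally show ?thesis .
qed

lemma nn_integral_std_gaussian_rotation':
  fixes f :: "real \<Rightarrow> real \<Rightarrow> ennreal"
  assumes m: "(\<lambda>p. f (fst p) (snd p)) \<in> borel_measurable borel" and c: "c \<noteq> 0" and cs: "c\<^sup>2 + s\<^sup>2 = 1"
  shows "(\<integral>\<^sup>+a. \<integral>\<^sup>+b. f (c * a - s * b) (s * a + c * b) \<partial>std_gaussian \<partial>std_gaussian) =
    (\<integral>\<^sup>+a. \<integral>\<^sup>+b. f a b \<partial>std_gaussian \<partial>std_gaussian)"
proof -
  have gen: "(\<lambda>p. f (g p) (h p)) \<in> borel_measurable N"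
    if "g \<in> borel_measurable N" "h \<in> borel_measurable N" for g h :: "'b \<Rightarrow> real" and N
    using measurable_compose[OF borel_measurable_Pair[OF that] m] by simp
  have "(\<integral>\<^sup>+b. \<integral>\<^sup>+a. f (c * a - s * b) (s * a + c * b) \<partial>std_gaussian \<partial>std_gaussian) =
      (\<integral>\<^sup>+a. \<integral>\<^sup>+b. f (c * a - s * b) (s * a + c * b) \<partial>std_gaussian \<partial>std_gaussian)"
    by (rule std_gaussian_pair.Fubini') (simp add: split_beta', intro gen, auto)
  moreover have "(\<integral>\<^sup>+b. \<integral>\<^sup>+a. f a b \<partial>std_gaussian \<partial>std_gaussian) = (\<integral>\<^sup>+a. \<integral>\<^sup>+b. f a b \<partial>std_gaussian \<partial>std_gaussian)"
    by (rule std_gaussian_pair.Fubini') (simp add: split_beta', intro gen, auto)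
  ultimately show ?thesis using nn_integral_std_gaussian_rotation[OF m c cs] by simp
qed

lemma borel_measurable_Complex [measurable (raw)]:
  assumes "f \<in> borel_measurable M" "g \<in> borel_measurable M"
  shows "(\<lambda>x. Complex (f x) (g x)) \<in> borel_measurable M"
  unfolding Complex_eq using assms by measurable

text \<open>Real and imaginary part both have variance 1. The second absolute moment is therefore 2,
  which is the source of the factor 2 in the bounds for \<open>gauss2\<close>.\<close>

definition complex_gaussian :: "complex measure" where
  "complex_gaussian = distr (std_gaussian \<Otimes>\<^sub>M std_gaussian) borel (\<lambda>p. Complex (fst p) (snd p))"

lemma sets_complex_gaussian [simp, measurable_cong]: "sets complex_gaussian = sets borel"
  by (simp add: complex_gaussian_def)

lemma space_complex_gaussian [simp]: "space complex_gaussian = UNIV"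
  by (simp add: complex_gaussian_def)

lemma measurable_Complex_std_gaussian:
  "(\<lambda>p. Complex (fst p) (snd p)) \<in> std_gaussian \<Otimes>\<^sub>M std_gaussian \<rightarrow>\<^sub>M borel"
  by measurable

lemma prob_space_complex_gaussian: "prob_space complex_gaussian"
  unfolding complex_gaussian_def
  by (intro prob_space.prob_space_distr measurable_Complex_std_gaussian prob_space_pair prob_space_std_gaussian)

interpretation complex_gaussian: prob_space complex_gaussian
  by (rule prob_space_complex_gaussian)

lemma nn_integral_complex_gaussian:
  assumes f: "f \<in> borel_measurable borel"
  shows "(\<integral>\<^sup>+z. f z \<partial>complex_gaussian) = (\<integral>\<^sup>+a. \<integral>\<^sup>+b. f (Complex a b) \<partial>std_gaussian \<partial>std_gaussian)"
proof -
  have "(\<integral>\<^sup>+z. f z \<partial>complex_gaussian) = (\<integral>\<^sup>+p. f (Complex (fst p) (snd p)) \<partial>(std_gaussian \<Otimes>\<^sub>M std_gaussian))"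
    unfolding complex_gaussian_def by (rule nn_integral_distr[OF measurable_Complex_std_gaussian]) (simp add: f)
  also have "\<dots> = (\<integral>\<^sup>+a. \<integral>\<^sup>+b. f (Complex a b) \<partial>std_gaussian \<partial>std_gaussian)"
    using measurable_compose[OF measurable_Complex_std_gaussian f]
    by (subst std_gaussian.nn_integral_fst[symmetric]) auto
  finally show ?thesis .
qed

text \<open>Multiplication by \<open>w\<close> is a planar rotation of the real and imaginary parts,
  with cosine \<open>Re w\<close>.\<close>

lemma nn_integral_complex_gaussian_mult:
  assumes f: "f \<in> borel_measurable borel" and w: "cmod w = 1"
  shows "(\<integral>\<^sup>+z. f (w * z) \<partial>complex_gaussian) = (\<integral>\<^sup>+z. f z \<partial>complex_gaussian)"
proof -
  have *: "(\<integral>\<^sup>+z. f (w * z) \<partial>complex_gaussian) = (\<integral>\<^sup>+z. f z \<partial>complex_gaussian)"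
    if f: "f \<in> borel_measurable borel" and w: "cmod w = 1" and "Re w \<noteq> 0" for f :: "complex \<Rightarrow> ennreal" and w
  proof -
    have "(Re w)\<^sup>2 + (Im w)\<^sup>2 = 1" using w by (simp add: cmod_def)
    moreover have "(\<lambda>p. f (Complex (fst p) (snd p))) \<in> borel_measurable borel"
      using f unfolding borel_prod[symmetric] by measurable
    ultimately have "(\<integral>\<^sup>+a. \<integral>\<^sup>+b. f (Complex (Re w * a - Im w * b) (Im w * a + Re w * b)) \<partial>std_gaussian \<partial>std_gaussian) =
      (\<integral>\<^sup>+a. \<integral>\<^sup>+b. f (Complex a b) \<partial>std_gaussian \<partial>std_gaussian)"
      by (intro nn_integral_std_gaussian_rotation' that(3))
    moreover have "Complex (Re w * a - Im w * b) (Im w * a + Re w * b) = w * Complex a b" for a b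
      by (simp add: complex_eq_iff)
    moreover have "(\<lambda>z. f (w * z)) \<in> borel_measurable borel" using f by measurable
    ultimately show ?thesis using f by (simp add: nn_integral_complex_gaussian)
  qed
  show ?thesis
  proof (cases "Re w = 0")
    case False
    then show ?thesis using * f w by blast
  next
    case True
    \<comment> \<open>Multiplication by \<open>\<i>\<close> or \<open>-\<i>\<close> is a quarter
      turn, which the planar rotation lemma excludes. It is performed as two turns by the square
      root \<open>v\<close>, whose real part is 1 / sqrt 2.\<close>
    define v where "v = (1 + w) / complex_of_real (sqrt 2)"
    have im: "(Im w)\<^sup>2 = 1" using w True by (simp add: cmod_def abs_square_eq_1)
    then have "w\<^sup>2 = -1" using True by (simp add: complex_eq_iff power2_eq_square)
    then have v2: "v * v = w" unfolding v_def
      by (simp add: power2_eq_square algebra_simps flip: of_real_mult)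
    have "Re v = 1 / sqrt 2" using True by (simp add: v_def Re_divide_of_real)
    then have v0: "Re v \<noteq> 0" by simp
    have "(cmod v)\<^sup>2 = 1" using v2 w by (simp add: power2_eq_square flip: norm_mult)
    then have v1: "cmod v = 1" by (simp add: power2_eq_1_iff) (use norm_ge_zero[of v] in linarith)
    have "(\<lambda>z. f (v * z)) \<in> borel_measurable borel" using f by measurable
    from *[OF this v1 v0] *[OF f v1 v0] show ?thesis by (simp add: v2 flip: mult.assoc)
  qed
qed

text \<open>A rotation with real coefficients acts on the two real parts and on the two imaginary
  parts separately. Regrouping the four real integrals accordingly leaves two planar
  rotations.\<close>

lemma nn_integral_complex_gaussian_pair_rotation:
  fixes f :: "complex \<Rightarrow> complex \<Rightarrow> ennreal"
  assumes m: "(\<lambda>p. f (fst p) (snd p)) \<in> borel_measurable borel" and c: "c \<noteq> 0" and cs: "c\<^sup>2 + s\<^sup>2 = 1"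
  shows "(\<integral>\<^sup>+z. \<integral>\<^sup>+w. f (of_real c * z - of_real s * w) (of_real s * z + of_real c * w) \<partial>complex_gaussian \<partial>complex_gaussian) =
    (\<integral>\<^sup>+z. \<integral>\<^sup>+w. f z w \<partial>complex_gaussian \<partial>complex_gaussian)"
proof -
  have gen: "(\<lambda>p. h (g1 p) (g2 p)) \<in> borel_measurable N"
    if "g1 \<in> borel_measurable N" "g2 \<in> borel_measurable N" "(\<lambda>p. h (fst p) (snd p)) \<in> borel_measurable borel"
    for g1 g2 :: "'b \<Rightarrow> complex" and N and h :: "complex \<Rightarrow> complex \<Rightarrow> ennreal"
    using measurable_compose[OF borel_measurable_Pair[OF that(1,2)] that(3)] by simp
  let ?N = std_gaussian
  have unfold: "(\<integral>\<^sup>+z. \<integral>\<^sup>+w. h z w \<partial>complex_gaussian \<partial>complex_gaussian) =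
     (\<integral>\<^sup>+a. \<integral>\<^sup>+a'. \<integral>\<^sup>+b. \<integral>\<^sup>+b'. h (Complex a b) (Complex a' b') \<partial>?N \<partial>?N \<partial>?N \<partial>?N)"
    if h: "(\<lambda>p. h (fst p) (snd p)) \<in> borel_measurable borel" for h :: "complex \<Rightarrow> complex \<Rightarrow> ennreal"
  proof -
    have "(\<integral>\<^sup>+z. \<integral>\<^sup>+w. h z w \<partial>complex_gaussian \<partial>complex_gaussian)
      = (\<integral>\<^sup>+a. \<integral>\<^sup>+b. \<integral>\<^sup>+w. h (Complex a b) w \<partial>complex_gaussian \<partial>?N \<partial>?N)"
      by (rule nn_integral_complex_gaussian, rule complex_gaussian.borel_measurable_nn_integral)
         (simp add: split_beta', intro gen[OF _ _ h], auto)
    also have "\<dots> = (\<integral>\<^sup>+a. \<integral>\<^sup>+b. \<integral>\<^sup>+a'. \<integral>\<^sup>+b'. h (Complex a b) (Complex a' b') \<partial>?N \<partial>?N \<partial>?N \<partial>?N)"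
      by (intro nn_integral_cong nn_integral_complex_gaussian gen[OF _ _ h]) auto
    also have "\<dots> = (\<integral>\<^sup>+a. \<integral>\<^sup>+a'. \<integral>\<^sup>+b. \<integral>\<^sup>+b'. h (Complex a b) (Complex a' b') \<partial>?N \<partial>?N \<partial>?N \<partial>?N)"
      by (intro nn_integral_cong std_gaussian_pair.Fubini')
         (simp add: split_beta', rule std_gaussian.borel_measurable_nn_integral, simp add: split_beta', intro gen[OF _ _ h], measurable)
    finally show ?thesis .
  qed
  have m3: "(\<lambda>q. f (Complex (fst (fst (fst q))) (snd (fst q))) (Complex (snd (fst (fst q))) (snd q)))
      \<in> borel_measurable ((borel \<Otimes>\<^sub>M ?N) \<Otimes>\<^sub>M ?N)"
    by (rule gen[OF _ _ m]) (unfold borel_prod[symmetric], measurable)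
  have m2: "(\<lambda>q. \<integral>\<^sup>+b'. f (Complex (fst (fst q)) (snd q)) (Complex (snd (fst q)) b') \<partial>?N) \<in> borel_measurable (borel \<Otimes>\<^sub>M ?N)"
    using std_gaussian.borel_measurable_nn_integral_fst[OF m3] by simp
  have m1: "(\<lambda>p. \<integral>\<^sup>+b. \<integral>\<^sup>+b'. f (Complex (fst p) b) (Complex (snd p) b') \<partial>?N \<partial>?N) \<in> borel_measurable borel"
    using std_gaussian.borel_measurable_nn_integral_fst[OF m2] by simp
  let ?r1 = "\<lambda>a b. c * a - s * b" and ?r2 = "\<lambda>a b. s * a + c * b"
  have "(\<integral>\<^sup>+z. \<integral>\<^sup>+w. f (of_real c * z - of_real s * w) (of_real s * z + of_real c * w) \<partial>complex_gaussian \<partial>complex_gaussian)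
    = (\<integral>\<^sup>+a. \<integral>\<^sup>+a'. \<integral>\<^sup>+b. \<integral>\<^sup>+b'. f (Complex (?r1 a a') (?r1 b b')) (Complex (?r2 a a') (?r2 b b')) \<partial>?N \<partial>?N \<partial>?N \<partial>?N)"
  proof -
    have "of_real c * Complex a b - of_real s * Complex a' b' = Complex (?r1 a a') (?r1 b b')"
      "of_real s * Complex a b + of_real c * Complex a' b' = Complex (?r2 a a') (?r2 b b')" for a b a' b'
      by (auto simp: complex_eq_iff)
    moreover have "(\<lambda>p. f (of_real c * fst p - of_real s * snd p) (of_real s * fst p + of_real c * snd p)) \<in> borel_measurable borel"
      by (rule gen[OF _ _ m]) (intro borel_measurable_continuous_onI continuous_intros)+
    ultimately show ?thesis
      using unfold[of "\<lambda>z w. f (of_real c * z - of_real s * w) (of_real s * z + of_real c * w)"]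
      by simp
  qed
  also have "\<dots> = (\<integral>\<^sup>+a. \<integral>\<^sup>+a'. \<integral>\<^sup>+b. \<integral>\<^sup>+b'. f (Complex (?r1 a a') b) (Complex (?r2 a a') b') \<partial>?N \<partial>?N \<partial>?N \<partial>?N)"
  proof (rule nn_integral_cong, rule nn_integral_cong)
    fix a a'
    show "(\<integral>\<^sup>+b. \<integral>\<^sup>+b'. f (Complex (?r1 a a') (?r1 b b')) (Complex (?r2 a a') (?r2 b b')) \<partial>?N \<partial>?N) =
      (\<integral>\<^sup>+b. \<integral>\<^sup>+b'. f (Complex (?r1 a a') b) (Complex (?r2 a a') b') \<partial>?N \<partial>?N)"
      by (rule nn_integral_std_gaussian_rotation'[OF _ c cs, where f = "\<lambda>b b'. f (Complex (?r1 a a') b) (Complex (?r2 a a') b')"],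
          rule gen[OF _ _ m]) (unfold borel_prod[symmetric], measurable)
  qed
  also have "\<dots> = (\<integral>\<^sup>+a. \<integral>\<^sup>+a'. \<integral>\<^sup>+b. \<integral>\<^sup>+b'. f (Complex a b) (Complex a' b') \<partial>?N \<partial>?N \<partial>?N \<partial>?N)"
    by (rule nn_integral_std_gaussian_rotation'[OF _ c cs, where f = "\<lambda>a a'. \<integral>\<^sup>+b. \<integral>\<^sup>+b'. f (Complex a b) (Complex a' b') \<partial>?N \<partial>?N"])
       (rule m1)
  also have "\<dots> = (\<integral>\<^sup>+z. \<integral>\<^sup>+w. f z w \<partial>complex_gaussian \<partial>complex_gaussian)"
    by (rule unfold[OF m, symmetric])
  finally show ?thesis .
qed

lemma nn_integral_complex_gaussian_norm2: "(\<integral>\<^sup>+z. ennreal ((cmod z)\<^sup>2) \<partial>complex_gaussian) = 2"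
proof -
  have "has_bochner_integral lborel (\<lambda>x. normal_density 0 1 x * x ^ (2 * 1)) (fact (2 * 1) / ((2 / 1\<^sup>2) ^ 1 * fact 1))"
    using normal_moment_even[of 1 0 1] by simp
  then have "has_bochner_integral lborel (\<lambda>x. normal_density 0 1 x * x\<^sup>2) 1" by simp
  then have 1: "(\<integral>\<^sup>+a. ennreal (a\<^sup>2) \<partial>std_gaussian) = 1"
    unfolding std_gaussian_def
    by (subst nn_integral_density)
       (auto simp: ennreal_mult[symmetric] has_bochner_integral_iff nn_integral_eq_integral)
  have "(\<integral>\<^sup>+z. ennreal ((cmod z)\<^sup>2) \<partial>complex_gaussian) = (\<integral>\<^sup>+a. \<integral>\<^sup>+b. ennreal (a\<^sup>2) + ennreal (b\<^sup>2) \<partial>std_gaussian \<partial>std_gaussian)"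
    by (subst nn_integral_complex_gaussian) (auto simp: cmod_power2 ennreal_plus)
  also have "\<dots> = (\<integral>\<^sup>+a. ennreal (a\<^sup>2) + 1 \<partial>std_gaussian)"
    by (subst nn_integral_add) (auto simp: 1 std_gaussian.emeasure_space_1[simplified])
  also have "\<dots> = 2" by (subst nn_integral_add) (auto simp: 1 std_gaussian.emeasure_space_1[simplified])
  finally show ?thesis .
qed

section \<open>Sequences of independent complex Gaussians\<close>

interpretation gaussian_seq: sequence_space complex_gaussian ..

abbreviation gaussian_seq :: "(nat \<Rightarrow> complex) measure" where
  "gaussian_seq \<equiv> Pi\<^sub>M UNIV (\<lambda>_. complex_gaussian)"

lemma sets_gaussian_seq: "sets gaussian_seq = sets borel"
  using sets_PiM_cong[of UNIV UNIV "\<lambda>_. complex_gaussian" "\<lambda>_::nat. borel"] by (simp add: sets_PiM_equal_borel)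

lemma measurable_coordinate_borel: "(\<lambda>g::nat \<Rightarrow> complex. g i) \<in> borel_measurable borel"
  by (intro borel_measurable_continuous_onI continuous_on_product_coordinates)

text \<open>Continuity in the coefficients is used, because sums of measurable vector-valued
  functions are delicate when the range is not separable.\<close>

lemma borel_measurable_norm_sum_scaleC:
  fixes x :: "nat \<Rightarrow> 'x::complex_normed_vector"
  shows "(\<lambda>g::nat \<Rightarrow> complex. norm (\<Sum>i<n. g i *\<^sub>C x i)) \<in> borel_measurable borel"
  by (intro borel_measurable_continuous_onI continuous_intros
      bounded_bilinear.continuous_on[OF bounded_bilinear_scaleC] continuous_on_product_coordinates)

lemma borel_measurable_norm_sum_scaleC':
  fixes x :: "nat \<Rightarrow> 'x::complex_normed_vector"
  assumes "\<And>i. i < n \<Longrightarrow> (\<lambda>a. c a i) \<in> borel_measurable N"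
  shows "(\<lambda>a. norm (\<Sum>i<n. c a i *\<^sub>C x i)) \<in> borel_measurable N"
proof -
  have "(\<lambda>a i. if i < n then c a i else 0) \<in> N \<rightarrow>\<^sub>M Pi\<^sub>M UNIV (\<lambda>_::nat. borel)"
  proof (intro measurable_PiM_single')
    show "(\<lambda>a. if i < n then c a i else 0) \<in> borel_measurable N" for i
      by (cases "i < n") (auto intro: assms)
  qed auto
  then have "(\<lambda>a i. if i < n then c a i else 0) \<in> N \<rightarrow>\<^sub>M borel"
    by (simp cong: measurable_cong_sets add: sets_PiM_equal_borel)
  from measurable_compose[OF this borel_measurable_norm_sum_scaleC[where n = n and x = x]] show ?thesis
    by (simp cong: sum.cong_simp)
qed

lemma nn_integral_gaussian_seq_Cons:
  assumes f: "f \<in> borel_measurable borel"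
  shows "(\<integral>\<^sup>+g. f g \<partial>gaussian_seq) = (\<integral>\<^sup>+z. \<integral>\<^sup>+g. f (case_nat z g) \<partial>gaussian_seq \<partial>complex_gaussian)"
proof -
  have f': "f \<in> borel_measurable gaussian_seq" using f by (simp cong: measurable_cong_sets add: sets_gaussian_seq)
  have m: "(\<lambda>(z, g). case_nat z g) \<in> complex_gaussian \<Otimes>\<^sub>M gaussian_seq \<rightarrow>\<^sub>M gaussian_seq"
    by measurable
  have "(\<integral>\<^sup>+g. f g \<partial>gaussian_seq) = (\<integral>\<^sup>+p. f (case p of (z, g) \<Rightarrow> case_nat z g) \<partial>(complex_gaussian \<Otimes>\<^sub>M gaussian_seq))"
    by (subst gaussian_seq.PiM_iter[symmetric]) (rule nn_integral_distr[OF m], simp add: f')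
  also have "\<dots> = (\<integral>\<^sup>+z. \<integral>\<^sup>+g. f (case_nat z g) \<partial>gaussian_seq \<partial>complex_gaussian)"
    using measurable_compose[OF m f'] by (subst gaussian_seq.nn_integral_fst[symmetric]) auto
  finally show ?thesis .
qed

text \<open>Stated for a general rotation-invariant law, since both the Gaussian and the Rademacher
  sequence need it. Finite cylinders determine the product measure.\<close>

lemma distr_PiM_unimodular_mult:
  fixes N :: "complex measure"
  assumes N: "prob_space N" "sets N = sets borel" and w: "\<And>i. cmod (w i) = 1"
    and inv: "\<And>f w. f \<in> borel_measurable borel \<Longrightarrow> cmod w = 1 \<Longrightarrow> (\<integral>\<^sup>+z. f (w * z) \<partial>N) = (\<integral>\<^sup>+z. f z \<partial>N)"
  shows "distr (Pi\<^sub>M UNIV (\<lambda>_. N)) (Pi\<^sub>M UNIV (\<lambda>_. N)) (\<lambda>g i. w i * g i) = Pi\<^sub>M UNIV (\<lambda>_::'i. N)"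
    (is "distr ?P ?P ?T = _")
proof -
  interpret N: prob_space N by (rule N)
  interpret product_prob_space "\<lambda>_. N" UNIV ..
  have sp: "space N = UNIV" using sets_eq_imp_space_eq[OF N(2)] by simp
  note [measurable_cong] = N(2)
  show ?thesis
  proof (rule PiM_eq)
    have m: "?T \<in> ?P \<rightarrow>\<^sub>M ?P"
      by (intro measurable_PiM_single') (auto simp: sp intro!: borel_measurable_times)
    fix J :: "'i set" and E :: "'i \<Rightarrow> complex set"
    assume J: "finite J" "J \<subseteq> UNIV" "\<And>j. j \<in> J \<Longrightarrow> E j \<in> sets N"
    let ?E = "\<lambda>j. {z. w j * z \<in> E j}"
    have E': "?E j \<in> sets N" if "j \<in> J" for j
      using J(3)[OF that] measurable_sets[of "\<lambda>z. w j * z" borel borel "E j"] by (simp add: vimage_def N(2))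
    have em: "emeasure N (?E j) = emeasure N (E j)" if "j \<in> J" for j
    proof -
      have "(\<integral>\<^sup>+z. indicator (E j) (w j * z) \<partial>N) = (\<integral>\<^sup>+z. indicator (E j) z \<partial>N)"
        using J(3)[OF that] w by (intro inv) (auto simp: N(2))
      moreover have "indicator (E j) (w j * z) = (indicator (?E j) z :: ennreal)" for z by (simp add: indicator_def)
      ultimately show ?thesis using J(3)[OF that] E'[OF that] by simp
    qed
    have "emeasure (distr ?P ?P ?T) (prod_emb UNIV (\<lambda>_. N) J (\<Pi>\<^sub>E j\<in>J. E j))
      = emeasure ?P (?T -` prod_emb UNIV (\<lambda>_. N) J (\<Pi>\<^sub>E j\<in>J. E j) \<inter> space ?P)"
      using J by (intro emeasure_distr m sets_PiM_I) auto
    also have "?T -` prod_emb UNIV (\<lambda>_. N) J (\<Pi>\<^sub>E j\<in>J. E j) \<inter> space ?P = prod_emb UNIV (\<lambda>_. N) J (\<Pi>\<^sub>E j\<in>J. ?E j)"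
      by (auto simp: prod_emb_def space_PiM PiE_iff sp)
    also have "emeasure ?P \<dots> = (\<Prod>j\<in>J. emeasure N (?E j))"
      using J E' by (intro emeasure_PiM_emb) auto
    also have "\<dots> = (\<Prod>j\<in>J. emeasure N (E j))" by (intro prod.cong em) auto
    finally show "emeasure (distr ?P ?P ?T) (prod_emb UNIV (\<lambda>_. N) J (\<Pi>\<^sub>E j\<in>J. E j)) = (\<Prod>j\<in>J. emeasure N (E j))" .
  qed simp
qed

lemma distr_gaussian_seq_mult:
  "(\<And>i. cmod (w i) = 1) \<Longrightarrow> distr gaussian_seq gaussian_seq (\<lambda>g i. w i * g i) = gaussian_seq"
  by (rule distr_PiM_unimodular_mult) (auto simp: prob_space_complex_gaussian intro: nn_integral_complex_gaussian_mult)

definition gauss2 :: "'x::complex_normed_vector list \<Rightarrow> ennreal" where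
  "gauss2 xs = (\<integral>\<^sup>+g. ennreal ((norm (\<Sum>i<length xs. g i *\<^sub>C xs ! i))\<^sup>2) \<partial>gaussian_seq)"

lemma borel_measurable_gaussian_seq_norm_sum:
  "(\<lambda>g. ennreal ((norm (\<Sum>i<n. g i *\<^sub>C x i))\<^sup>2)) \<in> borel_measurable gaussian_seq"
  using borel_measurable_norm_sum_scaleC[where n = n and x = x] by (simp cong: measurable_cong_sets add: sets_gaussian_seq)

text \<open>The coordinates are independent and identically distributed, so a permutation of the
  vectors can be moved to the coordinates. This makes the square function a function of
  multisets.\<close>

lemma gauss2_perm:
  assumes "mset xs = mset ys"
  shows "gauss2 xs = gauss2 ys"
proof -
  let ?n = "length xs"
  have len: "length ys = ?n" using assms by (metis size_mset)
  obtain p where p: "p permutes {..<?n}" "permute_list p ys = xs"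
    using mset_eq_permutation[OF assms] len by auto
  have inj: "inj p" using permutes_inj[OF p(1)] .
  have xs: "xs ! i = ys ! p i" if "i < ?n" for i
    using p permute_list_nth[of p ys i] len that by auto
  let ?T = "\<lambda>g n. g (p n)"
  have d: "distr gaussian_seq gaussian_seq ?T = gaussian_seq"
    using distr_PiM_reindex[of UNIV "\<lambda>_. complex_gaussian" p UNIV] prob_space_complex_gaussian inj
    by (simp add: restrict_def)
  have m: "?T \<in> gaussian_seq \<rightarrow>\<^sub>M gaussian_seq"
    by (intro measurable_PiM_single') auto
  have "gauss2 xs = (\<integral>\<^sup>+g. ennreal ((norm (\<Sum>i<?n. g i *\<^sub>C xs ! i))\<^sup>2) \<partial>distr gaussian_seq gaussian_seq ?T)"
    unfolding d gauss2_def ..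
  also have "\<dots> = (\<integral>\<^sup>+g. ennreal ((norm (\<Sum>i<?n. g (p i) *\<^sub>C xs ! i))\<^sup>2) \<partial>gaussian_seq)"
    by (rule nn_integral_distr[OF m]) (simp add: borel_measurable_gaussian_seq_norm_sum)
  also have "\<dots> = (\<integral>\<^sup>+g. ennreal ((norm (\<Sum>i<?n. g i *\<^sub>C ys ! i))\<^sup>2) \<partial>gaussian_seq)"
  proof -
    have "(\<Sum>i<?n. g (p i) *\<^sub>C xs ! i) = (\<Sum>i<?n. g i *\<^sub>C ys ! i)" for g :: "nat \<Rightarrow> complex"
      using sum.permute[OF p(1), of "\<lambda>i. g i *\<^sub>C ys ! i"] xs by (simp add: o_def)
    then show ?thesis by simp
  qed
  finally show ?thesis by (simp add: gauss2_def len)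
qed

lemma gauss2_Cons2:
  "gauss2 (x # y # zs) = (\<integral>\<^sup>+z. \<integral>\<^sup>+w. \<integral>\<^sup>+g. ennreal ((norm (z *\<^sub>C x + w *\<^sub>C y + (\<Sum>i<length zs. g i *\<^sub>C zs ! i)))\<^sup>2)
    \<partial>gaussian_seq \<partial>complex_gaussian \<partial>complex_gaussian)"
proof -
  have m: "(\<lambda>g. ennreal ((norm (\<Sum>i<n. g i *\<^sub>C v i))\<^sup>2)) \<in> borel_measurable borel" for n and v :: "nat \<Rightarrow> 'a"
    using borel_measurable_norm_sum_scaleC[where n = n and x = v] by simp
  have m2: "(\<lambda>g. ennreal ((norm (\<Sum>i<n. case_nat z g i *\<^sub>C v i))\<^sup>2)) \<in> borel_measurable borel" for n z and v :: "nat \<Rightarrow> 'a"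
  proof -
    have "(\<lambda>g. case_nat z g i) \<in> borel_measurable borel" for i
      by (cases i) (auto intro: measurable_coordinate_borel)
    then show ?thesis using borel_measurable_norm_sum_scaleC'[where n = n and c = "\<lambda>g. case_nat z g" and N = borel and x = v] by simp
  qed
  have sum2: "(\<Sum>i<Suc (Suc n). case_nat z (case_nat w g) i *\<^sub>C (x # y # zs) ! i)
      = z *\<^sub>C x + w *\<^sub>C y + (\<Sum>i<n. g i *\<^sub>C zs ! i)" for n z w and g :: "nat \<Rightarrow> complex"
    by (simp add: sum.lessThan_Suc_shift add.assoc del: sum.lessThan_Suc)
  show ?thesis
    unfolding gauss2_def nn_integral_gaussian_seq_Cons[OF m] nn_integral_gaussian_seq_Cons[OF m2]
    by (simp only: length_Cons sum2)
qed

text \<open>The rotation of the two vectors is transferred to the two Gaussian coefficients in front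
  of them, whose joint law it preserves.\<close>

lemma gauss2_rotation:
  assumes c: "c \<noteq> 0" and cs: "c\<^sup>2 + s\<^sup>2 = 1"
  shows "gauss2 ((c *\<^sub>R x + s *\<^sub>R y) # (c *\<^sub>R y - s *\<^sub>R x) # zs) = gauss2 (x # y # zs)"
proof -
  define f where "f z w = (\<integral>\<^sup>+g. ennreal ((norm (z *\<^sub>C x + w *\<^sub>C y + (\<Sum>i<length zs. g i *\<^sub>C zs ! i)))\<^sup>2) \<partial>gaussian_seq)" for z w
  have "(\<lambda>q. norm (\<Sum>i<Suc (Suc (length zs)). case_nat (fst (fst q)) (case_nat (snd (fst q)) (snd q)) i *\<^sub>C (x # y # zs) ! i))
      \<in> borel_measurable (borel \<Otimes>\<^sub>M gaussian_seq)"
  proof (rule borel_measurable_norm_sum_scaleC')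
    fix i
    have "(\<lambda>q::(complex \<times> complex) \<times> (nat \<Rightarrow> complex). snd q j) \<in> borel_measurable (borel \<Otimes>\<^sub>M gaussian_seq)" for j
      by (rule measurable_compose[OF measurable_snd]) (simp add: measurable_coordinate_borel sets_gaussian_seq cong: measurable_cong_sets)
    moreover have "(\<lambda>q::(complex \<times> complex) \<times> (nat \<Rightarrow> complex). fst (fst q)) \<in> borel_measurable (borel \<Otimes>\<^sub>M gaussian_seq)"
        "(\<lambda>q::(complex \<times> complex) \<times> (nat \<Rightarrow> complex). snd (fst q)) \<in> borel_measurable (borel \<Otimes>\<^sub>M gaussian_seq)"
      unfolding borel_prod[symmetric] by measurable
    ultimately show "(\<lambda>q. case_nat (fst (fst q)) (case_nat (snd (fst q)) (snd q)) i) \<in> borel_measurable (borel \<Otimes>\<^sub>M gaussian_seq)"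
      by (auto split: nat.split)
  qed
  moreover have "(\<Sum>i<Suc (Suc n). case_nat z (case_nat w g) i *\<^sub>C (x # y # zs) ! i)
      = z *\<^sub>C x + w *\<^sub>C y + (\<Sum>i<n. g i *\<^sub>C zs ! i)" for n z w and g :: "nat \<Rightarrow> complex"
    by (simp add: sum.lessThan_Suc_shift add.assoc del: sum.lessThan_Suc)
  ultimately have m: "(\<lambda>p. f (fst p) (snd p)) \<in> borel_measurable borel"
    unfolding f_def by (intro gaussian_seq.borel_measurable_nn_integral) (simp add: split_beta')
  have "z *\<^sub>C (c *\<^sub>R x + s *\<^sub>R y) + w *\<^sub>C (c *\<^sub>R y - s *\<^sub>R x)
    = (of_real c * z - of_real s * w) *\<^sub>C x + (of_real s * z + of_real c * w) *\<^sub>C y" for z w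
    by (simp add: scaleC_add_right scaleC_diff_right scaleC_add_left scaleC_diff_left scaleC_scaleC mult.commute
        flip: scaleC_of_real)
  then have "gauss2 ((c *\<^sub>R x + s *\<^sub>R y) # (c *\<^sub>R y - s *\<^sub>R x) # zs)
    = (\<integral>\<^sup>+z. \<integral>\<^sup>+w. f (of_real c * z - of_real s * w) (of_real s * z + of_real c * w) \<partial>complex_gaussian \<partial>complex_gaussian)"
    unfolding gauss2_Cons2 f_def by simp
  also have "\<dots> = gauss2 (x # y # zs)"
    unfolding nn_integral_complex_gaussian_pair_rotation[OF m c cs] unfolding gauss2_Cons2 f_def ..
  finally show ?thesis .
qed

section \<open>Rademacher sums and their comparison with Gaussian sums\<close>

lemma sets_uniform_circle [simp, measurable_cong]: "sets uniform_circle = sets borel"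
  by (simp add: uniform_circle_def)

lemma space_uniform_circle [simp]: "space uniform_circle = UNIV"
  by (simp add: uniform_circle_def)

lemma measurable_cis_borel [measurable]: "cis \<in> borel_measurable borel"
  by (intro borel_measurable_continuous_onI continuous_intros)

lemma prob_space_angle: "prob_space (uniform_measure lborel {0..<2 * pi})"
  by (intro prob_space_uniform_measure) auto

lemma prob_space_uniform_circle: "prob_space uniform_circle"
  unfolding uniform_circle_def by (intro prob_space.prob_space_distr prob_space_angle) simp

interpretation uniform_circle: prob_space uniform_circle
  by (rule prob_space_uniform_circle)

interpretation rademacher_seq: sequence_space uniform_circle ..

lemma prob_space_rademacher: "prob_space rademacher"
  unfolding rademacher_def by (intro prob_space_PiM prob_space_uniform_circle)

interpretation rademacher: prob_space rademacher
  by (rule prob_space_rademacher)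

lemma sets_rademacher [simp, measurable_cong]: "sets rademacher = sets borel"
  using sets_PiM_cong[of UNIV UNIV "\<lambda>_. uniform_circle" "\<lambda>_::nat. borel"]
  by (simp add: rademacher_def sets_PiM_equal_borel)

lemma space_rademacher [simp]: "space rademacher = UNIV"
  using sets_eq_imp_space_eq[OF sets_rademacher] by simp

lemma AE_uniform_circle_norm: "AE z in uniform_circle. cmod z = 1"
  unfolding uniform_circle_def by (subst AE_distr_iff) auto

lemma AE_rademacher_norm: "AE \<epsilon> in rademacher. \<forall>i. cmod (\<epsilon> i) = 1"
  unfolding AE_all_countable rademacher_def
  by (intro allI rademacher_seq.AE_component AE_uniform_circle_norm) auto

lemma integrable_rademacher_norm_sum:
  fixes x :: "nat \<Rightarrow> 'x::complex_normed_vector"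
  shows "integrable rademacher (\<lambda>\<epsilon>. (norm (\<Sum>i<n. \<epsilon> i *\<^sub>C x i))\<^sup>2)"
proof (rule rademacher.integrable_const_bound[where B = "(\<Sum>i<n. norm (x i))\<^sup>2"])
  show "AE \<epsilon> in rademacher. norm ((norm (\<Sum>i<n. \<epsilon> i *\<^sub>C x i))\<^sup>2) \<le> (\<Sum>i<n. norm (x i))\<^sup>2"
    using AE_rademacher_norm
  proof eventually_elim
    case (elim \<epsilon>)
    have "norm (\<Sum>i<n. \<epsilon> i *\<^sub>C x i) \<le> (\<Sum>i<n. norm (x i))"
      by (rule order_trans[OF norm_sum]) (simp add: norm_scaleC elim)
    then show ?case by (simp add: power_mono)
  qed
  show "(\<lambda>\<epsilon>. (norm (\<Sum>i<n. \<epsilon> i *\<^sub>C x i))\<^sup>2) \<in> borel_measurable rademacher"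
    using borel_measurable_norm_sum_scaleC[where n = n and x = x] by (simp cong: measurable_cong_sets)
qed

lemma nn_integral_rademacher_norm_sum:
  fixes x :: "nat \<Rightarrow> 'x::complex_normed_vector"
  shows "(\<integral>\<^sup>+\<epsilon>. ennreal ((norm (\<Sum>i<n. \<epsilon> i *\<^sub>C x i))\<^sup>2) \<partial>rademacher)
    = ennreal (\<integral>\<epsilon>. (norm (\<Sum>i<n. \<epsilon> i *\<^sub>C x i))\<^sup>2 \<partial>rademacher)"
  by (intro nn_integral_eq_integral integrable_rademacher_norm_sum) auto

text \<open>Unimodular factors do not change the law of the Gaussians. Averaging over such factors
  and exchanging the integrals leaves, for fixed Gaussians, a Rademacher sum of the vectors
  \<open>g i *\<^sub>C xs ! i\<close>, to which type or cotype applies.\<close>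

lemma gauss2_eq_rademacher:
  "gauss2 xs = (\<integral>\<^sup>+g. ennreal (\<integral>\<epsilon>. (norm (\<Sum>i<length xs. \<epsilon> i *\<^sub>C (g i *\<^sub>C xs ! i)))\<^sup>2 \<partial>rademacher) \<partial>gaussian_seq)"
proof -
  let ?n = "length xs"
  interpret P: pair_sigma_finite rademacher gaussian_seq ..
  have c: "(\<integral>\<^sup>+g. ennreal ((norm (\<Sum>i<?n. (\<epsilon> i * g i) *\<^sub>C xs ! i))\<^sup>2) \<partial>gaussian_seq) = gauss2 xs"
    if "\<forall>i. cmod (\<epsilon> i) = 1" for \<epsilon>
  proof -
    have m: "(\<lambda>g i. \<epsilon> i * g i) \<in> gaussian_seq \<rightarrow>\<^sub>M gaussian_seq"
      by (intro measurable_PiM_single') (auto intro!: borel_measurable_times)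
    show ?thesis
      unfolding gauss2_def by (subst distr_gaussian_seq_mult[symmetric, of \<epsilon>], use that in simp)
        (rule nn_integral_distr[OF m, symmetric], simp add: borel_measurable_gaussian_seq_norm_sum)
  qed
  have "gauss2 xs = (\<integral>\<^sup>+\<epsilon>. gauss2 xs \<partial>rademacher)" by (simp add: rademacher.emeasure_space_1[simplified])
  also have "\<dots> = (\<integral>\<^sup>+\<epsilon>. \<integral>\<^sup>+g. ennreal ((norm (\<Sum>i<?n. (\<epsilon> i * g i) *\<^sub>C xs ! i))\<^sup>2) \<partial>gaussian_seq \<partial>rademacher)"
    by (rule nn_integral_cong_AE) (use AE_rademacher_norm in eventually_elim, simp add: c)
  also have "\<dots> = (\<integral>\<^sup>+g. \<integral>\<^sup>+\<epsilon>. ennreal ((norm (\<Sum>i<?n. (\<epsilon> i * g i) *\<^sub>C xs ! i))\<^sup>2) \<partial>rademacher \<partial>gaussian_seq)"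
  proof (rule P.Fubini'[symmetric])
    have "(\<lambda>p. norm (\<Sum>i<?n. (fst p i * snd p i) *\<^sub>C xs ! i)) \<in> borel_measurable (rademacher \<Otimes>\<^sub>M gaussian_seq)"
    proof (rule borel_measurable_norm_sum_scaleC')
      fix i
      have [measurable]: "(\<lambda>g. g i) \<in> borel_measurable rademacher"
        by (simp add: measurable_coordinate_borel cong: measurable_cong_sets)
      have [measurable]: "(\<lambda>g. g i) \<in> borel_measurable gaussian_seq"
        by (simp add: measurable_coordinate_borel sets_gaussian_seq cong: measurable_cong_sets)
      show "(\<lambda>p. fst p i * snd p i) \<in> borel_measurable (rademacher \<Otimes>\<^sub>M gaussian_seq)" by measurable
    qed
    then show "(\<lambda>(\<epsilon>, g). ennreal ((norm (\<Sum>i<?n. (\<epsilon> i * g i) *\<^sub>C xs ! i))\<^sup>2)) \<in> borel_measurable (rademacher \<Otimes>\<^sub>M gaussian_seq)"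
      by (simp add: split_beta')
  qed
  finally show ?thesis unfolding nn_integral_rademacher_norm_sum[symmetric] unfolding scaleC_scaleC .
qed

lemma nn_integral_gaussian_seq_norm2: "(\<integral>\<^sup>+g. ennreal (\<Sum>i<n. a i * (cmod (g i))\<^sup>2) \<partial>gaussian_seq) = ennreal (2 * (\<Sum>i<n. a i))"
  if "\<And>i. 0 \<le> a i"
proof -
  have m: "(\<lambda>g. g i) \<in> borel_measurable gaussian_seq" for i
    by (simp add: measurable_coordinate_borel sets_gaussian_seq cong: measurable_cong_sets)
  have "(\<integral>\<^sup>+g. ennreal ((cmod (g i))\<^sup>2) \<partial>gaussian_seq) = 2" for i
  proof -
    have "(\<integral>\<^sup>+g. ennreal ((cmod (g i))\<^sup>2) \<partial>gaussian_seq) =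
        (\<integral>\<^sup>+z. ennreal ((cmod z)\<^sup>2) \<partial>distr gaussian_seq complex_gaussian (\<lambda>g. g i))"
      by (subst nn_integral_distr) auto
    also have "distr gaussian_seq complex_gaussian (\<lambda>g. g i) = complex_gaussian"
      using gaussian_seq.PiM_component[of i] by simp
    finally show ?thesis by (simp add: nn_integral_complex_gaussian_norm2)
  qed
  moreover have "(\<integral>\<^sup>+g. ennreal (\<Sum>i<n. a i * (cmod (g i))\<^sup>2) \<partial>gaussian_seq)
    = (\<Sum>i<n. ennreal (a i) * (\<integral>\<^sup>+g. ennreal ((cmod (g i))\<^sup>2) \<partial>gaussian_seq))"
  proof -
    have "(\<integral>\<^sup>+g. ennreal (\<Sum>i<n. a i * (cmod (g i))\<^sup>2) \<partial>gaussian_seq)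
      = (\<integral>\<^sup>+g. (\<Sum>i<n. ennreal (a i) * ennreal ((cmod (g i))\<^sup>2)) \<partial>gaussian_seq)"
      by (simp add: that flip: ennreal_mult)
    also have "\<dots> = (\<Sum>i<n. \<integral>\<^sup>+g. ennreal (a i) * ennreal ((cmod (g i))\<^sup>2) \<partial>gaussian_seq)"
      by (rule nn_integral_sum) (use m in measurable)
    also have "\<dots> = (\<Sum>i<n. ennreal (a i) * (\<integral>\<^sup>+g. ennreal ((cmod (g i))\<^sup>2) \<partial>gaussian_seq))"
      by (intro sum.cong refl nn_integral_cmult) (use m in measurable)
    finally show ?thesis .
  qed
  moreover have "(\<Sum>i<n. ennreal (a i) * 2) = ennreal (2 * (\<Sum>i<n. a i))"
  proof -
    have "(\<Sum>i<n. ennreal (a i) * 2) = ennreal (\<Sum>i<n. a i) * 2"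
      using that by (simp flip: sum_distrib_right)
    also have "\<dots> = ennreal (2 * (\<Sum>i<n. a i))"
      using that by (simp add: ennreal_mult sum_nonneg mult.commute)
    finally show ?thesis .
  qed
  ultimately show ?thesis by simp
qed

text \<open>The hypothesis is applied with the Gaussians fixed; the factor 2 is the second moment of
  each of them.\<close>

lemma gauss2_le:
  fixes xs :: "'x::complex_normed_vector list"
  assumes "\<And>N (x :: nat \<Rightarrow> 'x). (\<integral>\<epsilon>. (norm (\<Sum>n<N. \<epsilon> n *\<^sub>C x n))\<^sup>2 \<partial>rademacher) \<le> C * (\<Sum>n<N. (norm (x n))\<^sup>2)"
    and "0 \<le> C"
  shows "gauss2 xs \<le> ennreal (2 * C * (\<Sum>i<length xs. (norm (xs ! i))\<^sup>2))"
proof -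
  have "gauss2 xs \<le> (\<integral>\<^sup>+g. ennreal (\<Sum>i<length xs. C * (norm (xs ! i))\<^sup>2 * (cmod (g i))\<^sup>2) \<partial>gaussian_seq)"
    unfolding gauss2_eq_rademacher
    by (intro nn_integral_mono ennreal_leI order_trans[OF assms(1)])
       (simp add: sum_distrib_left norm_scaleC power_mult_distrib mult_ac)
  also have "\<dots> = ennreal (2 * C * (\<Sum>i<length xs. (norm (xs ! i))\<^sup>2))"
    using assms(2) by (subst nn_integral_gaussian_seq_norm2) (auto simp: sum_distrib_left mult_ac)
  finally show ?thesis .
qed

lemma gauss2_ge:
  fixes xs :: "'x::complex_normed_vector list"
  assumes "\<And>N (x :: nat \<Rightarrow> 'x). c * (\<Sum>n<N. (norm (x n))\<^sup>2) \<le> (\<integral>\<epsilon>. (norm (\<Sum>n<N. \<epsilon> n *\<^sub>C x n))\<^sup>2 \<partial>rademacher)"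
    and "0 \<le> c"
  shows "ennreal (2 * c * (\<Sum>i<length xs. (norm (xs ! i))\<^sup>2)) \<le> gauss2 xs"
proof -
  have "ennreal (2 * c * (\<Sum>i<length xs. (norm (xs ! i))\<^sup>2)) = (\<integral>\<^sup>+g. ennreal (\<Sum>i<length xs. c * (norm (xs ! i))\<^sup>2 * (cmod (g i))\<^sup>2) \<partial>gaussian_seq)"
    using assms(2) by (subst nn_integral_gaussian_seq_norm2) (auto simp: sum_distrib_left mult_ac)
  also have "\<dots> \<le> gauss2 xs"
    unfolding gauss2_eq_rademacher
    by (intro nn_integral_mono ennreal_leI order_trans[OF _ assms(1)])
       (simp add: sum_distrib_left norm_scaleC power_mult_distrib mult_ac)
  finally show ?thesis .
qed

section \<open>Kwapien's theorem\<close>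

lemma isomorphic_to_hilbert_space_if_type_cotype:
  assumes type: "\<And>N (x :: nat \<Rightarrow> 'x::complex_banach).
      (\<integral>\<epsilon>. (norm (\<Sum>n<N. \<epsilon> n *\<^sub>C x n))\<^sup>2 \<partial>rademacher) \<le> C * (\<Sum>n<N. (norm (x n))\<^sup>2)"
    and cotype: "\<And>N (x :: nat \<Rightarrow> 'x). c * (\<Sum>n<N. (norm (x n))\<^sup>2) \<le>
      (\<integral>\<epsilon>. (norm (\<Sum>n<N. \<epsilon> n *\<^sub>C x n))\<^sup>2 \<partial>rademacher)"
    and c: "0 < c" and C: "0 \<le> C"
  shows "isomorphic_to_hilbert_space TYPE('x)"
proof -
  \<comment> \<open>The chosen enumeration is irrelevant by \<open>gauss2_perm\<close>, and
    \<open>enn2real\<close> loses nothing because type 2 makes \<open>gauss2\<close> finite.\<close>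
  define G where "G M = enn2real (gauss2 (SOME xs. mset xs = M))" for M :: "'x multiset"
  have G: "G (mset xs) = enn2real (gauss2 xs)" for xs
    unfolding G_def by (rule arg_cong[where f = enn2real], rule gauss2_perm) (rule someI[of _ xs], simp)
  have sum: "(\<Sum>x\<in>#mset xs. a * (norm x)\<^sup>2) = a * (\<Sum>i<length xs. (norm (xs ! i))\<^sup>2)" for a and xs :: "'x list"
    by (simp add: sum_mset_sum_list sum_list_sum_nth sum_distrib_left atLeast0LessThan flip: mset_map)
  have up: "G M \<le> (\<Sum>x\<in>#M. (2 * C) * (norm x)\<^sup>2)" for M
  proof -
    obtain xs where M: "mset xs = M" using ex_mset by blast
    have "enn2real (gauss2 xs) \<le> (2 * C) * (\<Sum>i<length xs. (norm (xs ! i))\<^sup>2)"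
      using gauss2_le[OF type C, of xs] C by (intro enn2real_leI) (auto intro!: mult_nonneg_nonneg sum_nonneg)
    then show ?thesis unfolding M[symmetric] G sum .
  qed
  have low: "(\<Sum>x\<in>#M. (2 * c) * (norm x)\<^sup>2) \<le> G M" for M
  proof -
    obtain xs where M: "mset xs = M" using ex_mset by blast
    have fin: "gauss2 xs < top" using gauss2_le[OF type C, of xs] by (rule le_less_trans) simp
    have nn: "0 \<le> (2 * c) * (\<Sum>i<length xs. (norm (xs ! i))\<^sup>2)"
      using c by (intro mult_nonneg_nonneg sum_nonneg) simp_all
    have "(2 * c) * (\<Sum>i<length xs. (norm (xs ! i))\<^sup>2) \<le> enn2real (gauss2 xs)"
      using enn2real_mono[OF gauss2_ge[OF cotype less_imp_le[OF c], of xs] fin] unfolding enn2real_ennreal[OF nn] .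
    then show ?thesis unfolding M[symmetric] G sum .
  qed
  obtain p where p: "\<And>x. (2 * c) * (norm x)\<^sup>2 \<le> p x" "\<And>x. p x \<le> (2 * C) * (norm x)\<^sup>2"
    "\<And>z w z' w'. (\<And>T. G ({#z, w#} + T) = G ({#z', w'#} + T)) \<Longrightarrow> p z + p w = p z' + p w'"
    using additive_between[OF low up] by blast
  \<comment> \<open>The rotation by 45 degrees; after rescaling by sqrt 2 it becomes the
    parallelogram law.\<close>
  define r where "r = 1 / sqrt 2"
  have r: "r \<noteq> 0" "r\<^sup>2 + r\<^sup>2 = 1" "r * sqrt 2 = 1" by (simp_all add: r_def power_divide)
  have rot: "p (r *\<^sub>R x + r *\<^sub>R y) + p (r *\<^sub>R y - r *\<^sub>R x) = p x + p y" for x y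
  proof (rule p(3))
    fix T :: "'x multiset"
    obtain zs where T: "mset zs = T" using ex_mset by blast
    show "G ({#r *\<^sub>R x + r *\<^sub>R y, r *\<^sub>R y - r *\<^sub>R x#} + T) = G ({#x, y#} + T)"
      using G[of "(r *\<^sub>R x + r *\<^sub>R y) # (r *\<^sub>R y - r *\<^sub>R x) # zs"] G[of "x # y # zs"]
        gauss2_rotation[OF r(1,2), of x y zs] by (simp add: T)
  qed
  have p0: "p 0 = 0" using p(1,2)[of 0] by simp
  \<comment> \<open>The rotation takes the pair (x, x) to (sqrt 2 x, 0).\<close>
  have p2: "p (sqrt 2 *\<^sub>R x) = 2 * p x" for x
    using rot[of "sqrt 2 *\<^sub>R x" 0] rot[of x x] p0
  proof -
    have "2 * r = sqrt 2" by (simp add: r_def real_div_sqrt)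
    then have "r *\<^sub>R x + r *\<^sub>R x = sqrt 2 *\<^sub>R x" by (simp flip: scaleR_add_left)
    then show ?thesis using rot[of x x] p0 by simp
  qed
  have par': "p (x + y) + p (y - x) = 2 * p x + 2 * p y" for x y
    using rot[of "sqrt 2 *\<^sub>R x" "sqrt 2 *\<^sub>R y"] by (simp add: r p2)
  have par: "p (x + y) + p (x - y) = 2 * p x + 2 * p y" for x y
    using par'[of y x] by (simp add: add.commute)
  have nn: "0 \<le> p x" for x using p(1)[of x] c by (meson mult_nonneg_nonneg order_trans zero_le_power2 less_imp_le zero_le_numeral)
  obtain B where B: "bounded_bilinear B" "\<And>x y. B x y = B y x" "\<And>x. B x x = p x"
    using parallelogram_imp_bilinear[OF par nn p(2)] by blast
  show ?thesis
    using c p(1) by (intro isomorphic_to_hilbert_space_if_bilinear[OF B(1,2), of "2 * c"]) (auto simp: B(3))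
qed

section \<open>Strong measurability and square integrability\<close>

lemma strongly_measurableE:
  assumes "strongly_measurable N f"
  obtains s where "\<And>i::nat. simple_function N (s i)" "\<And>a. a \<in> space N \<Longrightarrow> (\<lambda>i. s i a) \<longlonglongrightarrow> f a"
  using assms by (auto simp: strongly_measurable_def)

lemma strongly_measurable_simple_function: "simple_function N f \<Longrightarrow> strongly_measurable N f"
  unfolding strongly_measurable_def by (intro exI[of _ "\<lambda>_. f"]) auto

lemma strongly_measurable_const: "strongly_measurable N (\<lambda>_. x)"
  by (intro strongly_measurable_simple_function) simp

lemma strongly_measurable_if_borel_measurable:
  fixes f :: "'a \<Rightarrow> 'x::{real_normed_vector, second_countable_topology}"
  assumes "f \<in> borel_measurable N"
  shows "strongly_measurable N f"
  using borel_measurable_implies_sequence_metric[OF assms, of 0] unfolding strongly_measurable_def by blast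

lemma strongly_measurable_compose:
  assumes f: "strongly_measurable N f" and T: "T \<in> N' \<rightarrow>\<^sub>M N"
  shows "strongly_measurable N' (\<lambda>a. f (T a))"
proof -
  obtain s where s: "\<And>i::nat. simple_function N (s i)" "\<And>a. a \<in> space N \<Longrightarrow> (\<lambda>i. s i a) \<longlonglongrightarrow> f a"
    using strongly_measurableE[OF f] by blast
  show ?thesis unfolding strongly_measurable_def
    by (intro exI[of _ "\<lambda>i a. s i (T a)"] conjI allI ballI simple_function_comp[OF T] s measurable_space[OF T])
qed

lemma strongly_measurable_cong:
  "(\<And>a. a \<in> space N \<Longrightarrow> f a = g a) \<Longrightarrow> strongly_measurable N f \<longleftrightarrow> strongly_measurable N g"
  by (auto simp: strongly_measurable_def)

lemma strongly_measurable_mono: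
  assumes "strongly_measurable N f" "sets N \<subseteq> sets N'" "space N = space N'"
  shows "strongly_measurable N' f"
proof -
  have "(\<lambda>a. a) \<in> N' \<rightarrow>\<^sub>M N"
    by (rule measurableI) (use assms sets.sets_into_space in \<open>auto simp: Int_absorb2\<close>)
  from strongly_measurable_compose[OF assms(1) this] show ?thesis .
qed

lemma strongly_measurable_continuous2:
  assumes f: "strongly_measurable N f" and g: "strongly_measurable N g"
    and h: "\<And>X Y x y. X \<longlonglongrightarrow> x \<Longrightarrow> Y \<longlonglongrightarrow> y \<Longrightarrow> (\<lambda>i. h (X i) (Y i)) \<longlonglongrightarrow> h x y"
  shows "strongly_measurable N (\<lambda>a. h (f a) (g a))"
proof -
  obtain s where s: "\<And>i::nat. simple_function N (s i)" "\<And>a. a \<in> space N \<Longrightarrow> (\<lambda>i. s i a) \<longlonglongrightarrow> f a"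
    using strongly_measurableE[OF f] by blast
  obtain t where t: "\<And>i::nat. simple_function N (t i)" "\<And>a. a \<in> space N \<Longrightarrow> (\<lambda>i. t i a) \<longlonglongrightarrow> g a"
    using strongly_measurableE[OF g] by blast
  show ?thesis unfolding strongly_measurable_def
  proof (intro exI[of _ "\<lambda>i a. h (s i a) (t i a)"] conjI allI ballI)
    show "simple_function N (\<lambda>a. h (s i a) (t i a))" for i by (rule simple_function_compose2[OF s(1) t(1)])
    show "(\<lambda>i. h (s i a) (t i a)) \<longlonglongrightarrow> h (f a) (g a)" if "a \<in> space N" for a
      by (rule h[OF s(2)[OF that] t(2)[OF that]])
  qed
qed

lemma borel_measurable_continuous_strongly_measurable:
  fixes h :: "'x::real_normed_vector \<Rightarrow> 'y::metric_space"
  assumes f: "strongly_measurable N f" and h: "continuous_on UNIV h"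
  shows "(\<lambda>a. h (f a)) \<in> borel_measurable N"
proof -
  obtain s where s: "\<And>i::nat. simple_function N (s i)" "\<And>a. a \<in> space N \<Longrightarrow> (\<lambda>i. s i a) \<longlonglongrightarrow> f a"
    using strongly_measurableE[OF f] by blast
  show ?thesis
  proof (rule borel_measurable_LIMSEQ_metric)
    show "(\<lambda>a. h (s i a)) \<in> borel_measurable N" for i
      using simple_function_compose1[OF s(1), of h i] by (rule borel_measurable_simple_function)
    show "(\<lambda>i. h (s i a)) \<longlonglongrightarrow> h (f a)" if "a \<in> space N" for a
      using continuous_on_tendsto_compose[OF h s(2)[OF that]] by simp
  qed
qed

lemma borel_measurable_norm_strongly_measurable:
  "strongly_measurable N f \<Longrightarrow> (\<lambda>a. norm (f a)) \<in> borel_measurable N"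
  by (rule borel_measurable_continuous_strongly_measurable) (auto intro!: continuous_intros)

lemma borel_measurable_norm_diff_strongly_measurable:
  "strongly_measurable N f \<Longrightarrow> (\<lambda>a. norm (f a - x)) \<in> borel_measurable N"
  by (rule borel_measurable_continuous_strongly_measurable[where h = "\<lambda>y. norm (y - x)"]) (auto intro!: continuous_intros)

lemma strongly_measurable_add:
  "strongly_measurable N f \<Longrightarrow> strongly_measurable N g \<Longrightarrow> strongly_measurable N (\<lambda>a. f a + g a)"
  by (rule strongly_measurable_continuous2) (auto intro!: tendsto_intros)

lemma strongly_measurable_diff:
  "strongly_measurable N f \<Longrightarrow> strongly_measurable N g \<Longrightarrow> strongly_measurable N (\<lambda>a. f a - g a)"
  by (rule strongly_measurable_continuous2) (auto intro!: tendsto_intros)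

lemma strongly_measurable_sum:
  "(\<And>i. i \<in> I \<Longrightarrow> strongly_measurable N (f i)) \<Longrightarrow> strongly_measurable N (\<lambda>a. \<Sum>i\<in>I. f i a)"
  by (induction I rule: infinite_finite_induct) (auto intro: strongly_measurable_const strongly_measurable_add)

lemma strongly_measurable_scaleR:
  "c \<in> borel_measurable N \<Longrightarrow> strongly_measurable N f \<Longrightarrow> strongly_measurable N (\<lambda>a. c a *\<^sub>R f a)" for c :: "_ \<Rightarrow> real"
  by (rule strongly_measurable_continuous2[where f = c]) (auto intro!: tendsto_intros strongly_measurable_if_borel_measurable)

lemma strongly_measurable_scaleC:
  "c \<in> borel_measurable N \<Longrightarrow> strongly_measurable N f \<Longrightarrow> strongly_measurable N (\<lambda>a. c a *\<^sub>C f a)"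
  by (rule strongly_measurable_continuous2[where f = c])
     (auto intro: bounded_bilinear.tendsto[OF bounded_bilinear_scaleC] strongly_measurable_if_borel_measurable)

lemma strongly_measurable_separable:
  assumes f: "strongly_measurable N f"
  obtains D where "countable D" "\<And>a. a \<in> space N \<Longrightarrow> f a \<in> closure D"
proof -
  obtain s where s: "\<And>i::nat. simple_function N (s i)" "\<And>a. a \<in> space N \<Longrightarrow> (\<lambda>i. s i a) \<longlonglongrightarrow> f a"
    using strongly_measurableE[OF f] by blast
  let ?D = "\<Union>i. s i ` space N"
  have "countable ?D" using s(1) by (auto simp: simple_function_def intro: countable_finite)
  moreover have "f a \<in> closure ?D" if "a \<in> space N" for a
    using s(2)[OF that] that by (auto simp: closure_sequential intro!: exI[of _ "\<lambda>i. s i a"])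
  ultimately show thesis by (rule that)
qed

text \<open>The \<open>i\<close>-th approximation is the first among the nearest of finitely many
  points of a dense sequence. Only distances to fixed points have to be measurable, so the lemma
  applies to sigma-algebras for which no approximation by simple functions is known
  beforehand.\<close>

lemma nearest_point_approximation:
  fixes f :: "'a \<Rightarrow> 'x::real_normed_vector"
  assumes D: "countable D" "\<And>a. a \<in> space N \<Longrightarrow> f a \<in> closure D"
    and m: "\<And>x. (\<lambda>a. norm (f a - x)) \<in> borel_measurable N"
  obtains s where "\<And>i::nat. simple_function N (s i)" "\<And>a. a \<in> space N \<Longrightarrow> (\<lambda>i. s i a) \<longlonglongrightarrow> f a"
    "\<And>i a. norm (f a - s i a) \<le> norm (f a)"
proof -
  \<comment> \<open>With 0 as first candidate the nearest point is never farther from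
    \<open>f a\<close> than 0 is. This gives the third conclusion, a domination used for convergence
    in mean square.\<close>
  define d where "d = case_nat 0 (from_nat_into (insert 0 D))"
  have d: "\<exists>l. d l = x" if "x \<in> D" for x
  proof -
    have "\<exists>n. from_nat_into (insert 0 D) n = x" using D(1) that by (intro from_nat_into_surj) auto
    then obtain n where "from_nat_into (insert 0 D) n = x" ..
    then show ?thesis by (intro exI[of _ "Suc n"]) (simp add: d_def)
  qed
  define P where "P i j a \<longleftrightarrow> j \<le> i \<and> (\<forall>l\<le>i. norm (f a - d j) \<le> norm (f a - d l))" for i j :: nat and a
  define k where "k i a = (LEAST j. P i j a)" for i a
  have ex: "\<exists>j. P i j a" for i a
  proof -
    have "finite ((\<lambda>l. norm (f a - d l)) ` {..i})" "(\<lambda>l. norm (f a - d l)) ` {..i} \<noteq> {}" by auto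
    then obtain j where "j \<le> i" "norm (f a - d j) = Min ((\<lambda>l. norm (f a - d l)) ` {..i})"
      using Min_in by (metis (no_types, lifting) atMost_iff image_iff)
    then show ?thesis unfolding P_def by (intro exI[of _ j]) auto
  qed
  have k: "P i (k i a) a" for i a unfolding k_def using ex by (rule LeastI_ex)
  have [measurable]: "(\<lambda>a. norm (f a - d j)) \<in> borel_measurable N" for j by (rule m)
  have "Measurable.pred N (P i j)" for i j unfolding P_def by measurable
  then have km: "k i \<in> N \<rightarrow>\<^sub>M count_space UNIV" for i unfolding k_def by measurable
  have "simple_function N (k i)" for i
    unfolding simple_function_def
  proof (intro conjI ballI)
    have "k i ` space N \<subseteq> {..i}" using k by (auto simp: P_def)
    then show "finite (k i ` space N)" by (rule finite_subset) simp
    show "k i -` {x} \<inter> space N \<in> sets N" for x using km[of i] by (rule measurable_sets) simp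
  qed
  then have 1: "simple_function N (\<lambda>a. d (k i a))" for i by (rule simple_function_compose1)
  have 2: "(\<lambda>i. d (k i a)) \<longlonglongrightarrow> f a" if a: "a \<in> space N" for a
  proof (rule metric_LIMSEQ_I)
    fix e :: real assume "0 < e"
    then obtain x where x: "x \<in> D" "dist x (f a) < e" using D(2)[OF a] unfolding closure_approachable by blast
    then obtain l where l: "d l = x" using d by blast
    show "\<exists>n0. \<forall>n\<ge>n0. dist (d (k n a)) (f a) < e"
    proof (intro exI[of _ l] allI impI)
      fix n assume "l \<le> n"
      then have "norm (f a - d (k n a)) \<le> norm (f a - d l)" using k[of n a] by (simp add: P_def)
      then show "dist (d (k n a)) (f a) < e" using x l by (simp add: dist_norm norm_minus_commute)
    qed
  qed
  have 3: "norm (f a - d (k i a)) \<le> norm (f a)" for i a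
    using k[of i a] by (auto simp: P_def d_def dest: spec[of _ 0])
  show thesis using that[of "\<lambda>i a. d (k i a)"] 1 2 3 by blast
qed

text \<open>The range of the limit lies in the closure of countably many countable sets and its
  distances to points are limits of measurable functions, so nearest points give simple
  approximations.\<close>

lemma strongly_measurable_LIMSEQ:
  assumes f: "\<And>i::nat. strongly_measurable N (f i)" and lim: "\<And>a. a \<in> space N \<Longrightarrow> (\<lambda>i. f i a) \<longlonglongrightarrow> g a"
  shows "strongly_measurable N g"
proof -
  have "\<forall>i. \<exists>D. countable D \<and> (\<forall>a\<in>space N. f i a \<in> closure D)"
    using strongly_measurable_separable[OF f] by metis
  then obtain D where D: "\<And>i. countable (D i)" "\<And>i a. a \<in> space N \<Longrightarrow> f i a \<in> closure (D i)" by metis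
  let ?D = "\<Union>i. D i"
  have cl: "g a \<in> closure ?D" if a: "a \<in> space N" for a
  proof -
    have mem: "f i a \<in> closure ?D" for i
    proof -
      have "closure (D i) \<subseteq> closure ?D" by (rule closure_mono) (rule UN_upper, rule UNIV_I)
      then show ?thesis using D(2)[OF a, of i] by (rule subsetD)
    qed
    have "g a \<in> closure (closure ?D)"
      by (rule closure_sequential[THEN iffD2], rule exI[of _ "\<lambda>i. f i a"]) (simp add: mem lim[OF a] del: closure_closure)
    then show ?thesis by simp
  qed
  have cnt: "countable ?D" using D(1) by auto
  have mm: "(\<lambda>a. norm (g a - x)) \<in> borel_measurable N" for x
  proof (rule borel_measurable_LIMSEQ_metric)
    show "(\<lambda>a. norm (f i a - x)) \<in> borel_measurable N" for i
      by (rule borel_measurable_norm_diff_strongly_measurable[OF f])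
    show "(\<lambda>i. norm (f i a - x)) \<longlonglongrightarrow> norm (g a - x)" if "a \<in> space N" for a
      by (rule tendsto_norm[OF tendsto_diff[OF lim[OF that] tendsto_const]])
  qed
  show ?thesis
  proof (rule nearest_point_approximation[where f = g and N = N and D = ?D])
    show "countable ?D" by (rule cnt)
    show "\<And>a. a \<in> space N \<Longrightarrow> g a \<in> closure ?D" by (rule cl)
    show "\<And>x. (\<lambda>a. norm (g a - x)) \<in> borel_measurable N" by (rule mm)
    fix s assume s: "\<And>i::nat. simple_function N (s i)" "\<And>a. a \<in> space N \<Longrightarrow> (\<lambda>i. s i a) \<longlonglongrightarrow> g a"
    show "strongly_measurable N g"
      unfolding strongly_measurable_def by (intro exI[of _ s] conjI allI ballI s)
  qed
qed

section \<open>Square-integrable functions and Rademacher sums of them\<close>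

lemma L2_space_iff:
  "f \<in> L2_space N \<longleftrightarrow> strongly_measurable N f \<and> (\<integral>\<^sup>+a. ennreal ((norm (f a))\<^sup>2) \<partial>N) < \<infinity>"
  using borel_measurable_norm_strongly_measurable[of N f]
  by (auto simp: L2_space_def integrable_iff_bounded)

lemma L2_norm_sq: "(L2_norm N f)\<^sup>2 = (\<integral>a. (norm (f a))\<^sup>2 \<partial>N)"
  by (simp add: L2_norm_def)

lemma nn_integral_norm_sq_L2:
  "f \<in> L2_space N \<Longrightarrow> (\<integral>\<^sup>+a. ennreal ((norm (f a))\<^sup>2) \<partial>N) = ennreal ((L2_norm N f)\<^sup>2)"
  unfolding L2_norm_sq by (intro nn_integral_eq_integral) (auto simp: L2_space_def)

lemma norm_sq_add_le: "(norm (x + y))\<^sup>2 \<le> 2 * (norm x)\<^sup>2 + 2 * (norm (y::'x::real_normed_vector))\<^sup>2"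
proof -
  have "(norm (x + y))\<^sup>2 \<le> (norm x + norm y)\<^sup>2" by (intro power_mono norm_triangle_ineq) auto
  also have "\<dots> \<le> 2 * (norm x)\<^sup>2 + 2 * (norm y)\<^sup>2"
    using sum_squares_bound[of "norm x" "norm y"] by (simp add: power2_sum)
  finally show ?thesis .
qed

lemma nn_integral_norm_sq_add_le:
  assumes "strongly_measurable N f" "strongly_measurable N g"
  shows "(\<integral>\<^sup>+a. ennreal ((norm (f a + g a))\<^sup>2) \<partial>N) \<le>
    2 * (\<integral>\<^sup>+a. ennreal ((norm (f a))\<^sup>2) \<partial>N) + 2 * (\<integral>\<^sup>+a. ennreal ((norm (g a))\<^sup>2) \<partial>N)"
proof -
  note [measurable] = assms[THEN borel_measurable_norm_strongly_measurable]
  have "(\<integral>\<^sup>+a. ennreal ((norm (f a + g a))\<^sup>2) \<partial>N) \<le> (\<integral>\<^sup>+a. 2 * ennreal ((norm (f a))\<^sup>2) + 2 * ennreal ((norm (g a))\<^sup>2) \<partial>N)"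
    by (intro nn_integral_mono)
       (auto simp: norm_sq_add_le ennreal_mult[symmetric] ennreal_plus[symmetric] simp del: ennreal_plus
         simp flip: ennreal_numeral intro!: ennreal_leI)
  also have "\<dots> = 2 * (\<integral>\<^sup>+a. ennreal ((norm (f a))\<^sup>2) \<partial>N) + 2 * (\<integral>\<^sup>+a. ennreal ((norm (g a))\<^sup>2) \<partial>N)"
    by (simp add: nn_integral_add nn_integral_cmult)
  finally show ?thesis .
qed

lemma L2_space_add: "f \<in> L2_space N \<Longrightarrow> g \<in> L2_space N \<Longrightarrow> (\<lambda>a. f a + g a) \<in> L2_space N"
  unfolding L2_space_iff using nn_integral_norm_sq_add_le[of N f g]
  by (auto intro: strongly_measurable_add le_less_trans simp: ennreal_mult_less_top)

lemma L2_space_scaleC: "f \<in> L2_space N \<Longrightarrow> (\<lambda>a. c *\<^sub>C f a) \<in> L2_space N"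
  by (auto simp: L2_space_def norm_scaleC power_mult_distrib intro: strongly_measurable_scaleC)

lemma L2_space_zero: "(\<lambda>a. 0) \<in> L2_space N"
  by (auto simp: L2_space_def intro: strongly_measurable_const)

lemma L2_space_sum: "(\<And>i. i \<in> I \<Longrightarrow> f i \<in> L2_space N) \<Longrightarrow> (\<lambda>a. \<Sum>i\<in>I. f i a) \<in> L2_space N"
  by (induction I rule: infinite_finite_induct) (auto intro: L2_space_zero L2_space_add)

lemma borel_measurable_rademacher_norm_sum_pair:
  fixes f :: "nat \<Rightarrow> 'a \<Rightarrow> 'x::complex_normed_vector"
  assumes sm: "\<And>i. i < n \<Longrightarrow> strongly_measurable N (f i)"
  shows "(\<lambda>p. ennreal ((norm (\<Sum>i<n. fst p i *\<^sub>C f i (snd p)))\<^sup>2)) \<in> borel_measurable (rademacher \<Otimes>\<^sub>M N)"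
proof -
  have coord: "(\<lambda>\<epsilon>. \<epsilon> i) \<in> borel_measurable rademacher" for i
    by (simp add: measurable_coordinate_borel cong: measurable_cong_sets)
  have "strongly_measurable (rademacher \<Otimes>\<^sub>M N) (\<lambda>p. \<Sum>i<n. fst p i *\<^sub>C f i (snd p))"
  proof (intro strongly_measurable_sum strongly_measurable_scaleC)
    fix i assume "i \<in> {..<n}"
    then show "strongly_measurable (rademacher \<Otimes>\<^sub>M N) (\<lambda>p. f i (snd p))"
      by (intro strongly_measurable_compose[OF sm]) auto
    show "(\<lambda>p. fst p i) \<in> borel_measurable (rademacher \<Otimes>\<^sub>M N)"
      by (rule measurable_compose[OF measurable_fst coord])
  qed
  from borel_measurable_norm_strongly_measurable[OF this] show ?thesis by measurable
qed

lemma borel_measurable_rademacher_norm_sum: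
  fixes f :: "nat \<Rightarrow> 'a \<Rightarrow> 'x::complex_normed_vector"
  assumes N: "sigma_finite_measure N" and f: "\<And>i. i < n \<Longrightarrow> f i \<in> L2_space N"
  shows "(\<lambda>a. ennreal (\<integral>\<epsilon>. (norm (\<Sum>i<n. \<epsilon> i *\<^sub>C f i a))\<^sup>2 \<partial>rademacher)) \<in> borel_measurable N"
proof -
  have "(\<lambda>p. ennreal ((norm (\<Sum>i<n. fst p i *\<^sub>C f i (snd p)))\<^sup>2)) \<in> borel_measurable (rademacher \<Otimes>\<^sub>M N)"
    using f by (intro borel_measurable_rademacher_norm_sum_pair) (simp add: L2_space_iff)
  from measurable_pair_swap[OF this] show ?thesis
    unfolding nn_integral_rademacher_norm_sum[symmetric]
    by (intro rademacher.borel_measurable_nn_integral) (simp add: split_beta')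
qed

text \<open>The outer integral on the left is a Bochner integral, with value 0 for a nonintegrable
  function, so integrability has to be shown. Since almost surely all coefficients have modulus 1,
  the integral of the squared sum of norms is a constant bound.\<close>

lemma rademacher_L2_norm_Fubini:
  fixes f :: "nat \<Rightarrow> 'a \<Rightarrow> 'x::complex_normed_vector"
  assumes N: "sigma_finite_measure N" and f: "\<And>i. i < n \<Longrightarrow> f i \<in> L2_space N"
  shows "ennreal (\<integral>\<epsilon>. (L2_norm N (\<lambda>a. \<Sum>i<n. \<epsilon> i *\<^sub>C f i a))\<^sup>2 \<partial>rademacher) =
    (\<integral>\<^sup>+a. ennreal (\<integral>\<epsilon>. (norm (\<Sum>i<n. \<epsilon> i *\<^sub>C f i a))\<^sup>2 \<partial>rademacher) \<partial>N)" (is "ennreal ?I = ?J")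
proof -
  interpret N: sigma_finite_measure N by (rule N)
  interpret P: pair_sigma_finite rademacher N ..
  have sm: "strongly_measurable N (f i)" if "i < n" for i using f[OF that] by (simp add: L2_space_iff)
  have m: "(\<lambda>p. ennreal ((norm (\<Sum>i<n. fst p i *\<^sub>C f i (snd p)))\<^sup>2)) \<in> borel_measurable (rademacher \<Otimes>\<^sub>M N)"
    by (rule borel_measurable_rademacher_norm_sum_pair[OF sm])
  have L2: "(\<lambda>a. \<Sum>i<n. \<epsilon> i *\<^sub>C f i a) \<in> L2_space N" for \<epsilon> using f by (intro L2_space_sum L2_space_scaleC) auto
  note eq = nn_integral_norm_sq_L2[OF L2]
  let ?S = "\<lambda>\<epsilon>. (L2_norm N (\<lambda>a. \<Sum>i<n. \<epsilon> i *\<^sub>C f i a))\<^sup>2"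
  have meas: "(\<lambda>\<epsilon>. ennreal (?S \<epsilon>)) \<in> borel_measurable rademacher"
    unfolding eq[symmetric] using m by (intro N.borel_measurable_nn_integral) (simp add: split_beta')
  then have meas': "?S \<in> borel_measurable rademacher"
    using measurable_compose[OF meas borel_measurable_enn2real] by simp
  have J: "?J = (\<integral>\<^sup>+\<epsilon>. ennreal (?S \<epsilon>) \<partial>rademacher)"
  proof -
    have "?J = (\<integral>\<^sup>+a. \<integral>\<^sup>+\<epsilon>. ennreal ((norm (\<Sum>i<n. \<epsilon> i *\<^sub>C f i a))\<^sup>2) \<partial>rademacher \<partial>N)"
      by (simp add: nn_integral_rademacher_norm_sum)
    also have "\<dots> = (\<integral>\<^sup>+\<epsilon>. \<integral>\<^sup>+a. ennreal ((norm (\<Sum>i<n. \<epsilon> i *\<^sub>C f i a))\<^sup>2) \<partial>N \<partial>rademacher)"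
      using m by (intro P.Fubini') (simp add: split_beta')
    finally show ?thesis unfolding eq .
  qed
  have "integrable rademacher ?S"
  proof (rule rademacher.integrable_const_bound[OF _ meas'])
    let ?K = "enn2real (\<integral>\<^sup>+a. ennreal ((\<Sum>i<n. norm (f i a))\<^sup>2) \<partial>N)"
    have fin: "(\<integral>\<^sup>+a. ennreal ((\<Sum>i<n. norm (f i a))\<^sup>2) \<partial>N) < \<infinity>"
    proof -
      have "(\<lambda>a. \<Sum>i<n. norm (f i a)) \<in> L2_space N"
        using f by (intro L2_space_sum)
          (auto simp: L2_space_iff intro!: strongly_measurable_if_borel_measurable borel_measurable_norm_strongly_measurable)
      then show ?thesis by (simp add: L2_space_iff)
    qed
    show "AE \<epsilon> in rademacher. norm (?S \<epsilon>) \<le> ?K"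
      using AE_rademacher_norm
    proof eventually_elim
      case (elim \<epsilon>)
      have "ennreal (?S \<epsilon>) \<le> (\<integral>\<^sup>+a. ennreal ((\<Sum>i<n. norm (f i a))\<^sup>2) \<partial>N)"
        unfolding eq[symmetric]
      proof (rule nn_integral_mono, rule ennreal_leI, rule power_mono)
        show "norm (\<Sum>i<n. \<epsilon> i *\<^sub>C f i a) \<le> (\<Sum>i<n. norm (f i a))" for a
          by (rule order_trans[OF norm_sum]) (simp add: norm_scaleC elim)
      qed simp
      then have "enn2real (ennreal (?S \<epsilon>)) \<le> ?K" using fin by (intro enn2real_mono) auto
      then show ?case by simp
    qed
  qed
  then have "(\<integral>\<^sup>+\<epsilon>. ennreal (?S \<epsilon>) \<partial>rademacher) = ennreal ?I" by (intro nn_integral_eq_integral) auto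
  then show ?thesis using J by simp
qed

section \<open>Orthogonality of Rademacher variables\<close>

text \<open>The part of the shifted interval beyond 2 pi is moved back by one period and fills the
  gap at the beginning.\<close>

lemma nn_integral_circle_shift:
  assumes f: "f \<in> borel_measurable borel" and \<phi>: "0 \<le> \<phi>" "\<phi> \<le> 2 * pi"
  shows "(\<integral>\<^sup>+t. f (cis (\<phi> + t)) * indicator {0..<2 * pi} t \<partial>lborel) = (\<integral>\<^sup>+t. f (cis t) * indicator {0..<2 * pi} t \<partial>lborel)"
proof -
  have [measurable]: "(\<lambda>t. f (cis t)) \<in> borel_measurable borel" "(\<lambda>t. f (cis (c + t))) \<in> borel_measurable borel" for c
    using f by measurable
  have per: "f (cis (t - 2 * pi)) = f (cis t)" for t 
  proof -
    have "cis (t - 2 * pi) = cis t" by (simp add: complex_eq_iff cos_diff sin_diff)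
    then show ?thesis by simp
  qed
  have "(\<integral>\<^sup>+t. f (cis (\<phi> + t)) * indicator {0..<2 * pi} t \<partial>lborel)
    = (\<integral>\<^sup>+t. f (cis t) * indicator {\<phi>..<\<phi> + 2 * pi} t \<partial>lborel)"
    by (subst (2) nn_integral_real_affine[where c = 1 and t = \<phi>])
       (auto intro!: nn_integral_cong simp: indicator_def)
  also have "\<dots> = (\<integral>\<^sup>+t. f (cis t) * indicator {\<phi>..<2 * pi} t \<partial>lborel) + (\<integral>\<^sup>+t. f (cis t) * indicator {2 * pi..<\<phi> + 2 * pi} t \<partial>lborel)"
    using \<phi> by (subst nn_integral_add[symmetric]) (auto intro!: nn_integral_cong simp: indicator_def)
  also have "(\<integral>\<^sup>+t. f (cis t) * indicator {2 * pi..<\<phi> + 2 * pi} t \<partial>lborel) = (\<integral>\<^sup>+t. f (cis t) * indicator {0..<\<phi>} t \<partial>lborel)"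
    by (subst (2) nn_integral_real_affine[where c = 1 and t = "- 2 * pi"])
       (auto intro!: nn_integral_cong simp: per indicator_def simp del: mult_minus_left)
  also have "(\<integral>\<^sup>+t. f (cis t) * indicator {\<phi>..<2 * pi} t \<partial>lborel) + \<dots> = (\<integral>\<^sup>+t. f (cis t) * indicator {0..<2 * pi} t \<partial>lborel)"
    using \<phi> by (subst nn_integral_add[symmetric]) (auto intro!: nn_integral_cong simp: indicator_def)
  finally show ?thesis .
qed

lemma nn_integral_uniform_circle_mult:
  assumes f: "f \<in> borel_measurable borel" and w: "cmod w = 1"
  shows "(\<integral>\<^sup>+z. f (w * z) \<partial>uniform_circle) = (\<integral>\<^sup>+z. f z \<partial>uniform_circle)"
proof -
  obtain \<phi> where \<phi>: "0 \<le> \<phi>" "\<phi> \<le> 2 * pi" "w = cis \<phi>"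
  proof -
    obtain t where "0 \<le> t" "t < 2 * pi" "w = Complex (cos t) (sin t)" using complex_unimodular_polar[OF w] .
    then show thesis using that[of t] by (simp add: complex_eq_iff)
  qed
  have eq: "(\<integral>\<^sup>+z. g z \<partial>uniform_circle) = (\<integral>\<^sup>+t. g (cis t) * indicator {0..<2 * pi} t \<partial>lborel) / emeasure lborel {0..<2 * pi}"
    if g: "g \<in> borel_measurable borel" for g :: "complex \<Rightarrow> ennreal"
  proof -
    have [measurable]: "(\<lambda>t. g (cis t)) \<in> borel_measurable borel" using g by measurable
    show ?thesis unfolding uniform_circle_def
      by (subst nn_integral_distr) (simp_all add: g nn_integral_uniform_measure)
  qed
  have "(\<lambda>z. f (w * z)) \<in> borel_measurable borel" using f by measurable
  then show ?thesis using nn_integral_circle_shift[OF f \<phi>(1,2)] by (simp add: eq f \<phi>(3) cis_mult)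
qed

lemma distr_rademacher_mult:
  assumes w: "\<And>i. cmod (w i) = 1"
  shows "distr rademacher rademacher (\<lambda>\<epsilon> i. w i * \<epsilon> i) = rademacher"
  unfolding rademacher_def
  by (rule distr_PiM_unimodular_mult) (auto simp: prob_space_uniform_circle w intro: nn_integral_uniform_circle_mult)

lemma integral_rademacher_mult:
  fixes f :: "(nat \<Rightarrow> complex) \<Rightarrow> real"
  assumes w: "\<And>i. cmod (w i) = 1" and f: "f \<in> borel_measurable borel"
  shows "(\<integral>\<epsilon>. f (\<lambda>i. w i * \<epsilon> i) \<partial>rademacher) = (\<integral>\<epsilon>. f \<epsilon> \<partial>rademacher)"
proof -
  have m: "(\<lambda>\<epsilon> i. w i * \<epsilon> i) \<in> rademacher \<rightarrow>\<^sub>M rademacher"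
    unfolding rademacher_def by (intro measurable_PiM_single') (auto intro!: borel_measurable_times)
  have f': "f \<in> borel_measurable rademacher" using f by (simp cong: measurable_cong_sets)
  show ?thesis using integral_distr[OF m f'] unfolding distr_rademacher_mult[OF w] by simp
qed

lemma measurable_coordinate_rademacher: "(\<lambda>\<epsilon>. \<epsilon> i) \<in> borel_measurable rademacher"
  by (simp add: measurable_coordinate_borel cong: measurable_cong_sets)

lemma integrable_rademacher_prod:
  fixes u v :: "complex \<Rightarrow> real"
  assumes "u \<in> {Re, Im}" "v \<in> {Re, Im}"
  shows "integrable rademacher (\<lambda>\<epsilon>. u (\<epsilon> i) * v (\<epsilon> j))"
proof (rule rademacher.integrable_const_bound[where B = 1])
  show "AE \<epsilon> in rademacher. norm (u (\<epsilon> i) * v (\<epsilon> j)) \<le> 1"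
    using AE_rademacher_norm
  proof eventually_elim
    case (elim \<epsilon>)
    have "\<bar>u (\<epsilon> i)\<bar> \<le> 1" "\<bar>v (\<epsilon> j)\<bar> \<le> 1"
      using assms elim[rule_format, of i] elim[rule_format, of j] abs_Re_le_cmod[of "\<epsilon> i"] abs_Im_le_cmod[of "\<epsilon> i"]
        abs_Re_le_cmod[of "\<epsilon> j"] abs_Im_le_cmod[of "\<epsilon> j"] by auto
    then show ?case by (simp add: abs_mult mult_le_one)
  qed
  have uv: "u \<in> borel_measurable borel" "v \<in> borel_measurable borel" using assms by auto
  show "(\<lambda>\<epsilon>. u (\<epsilon> i) * v (\<epsilon> j)) \<in> borel_measurable rademacher"
    by (rule borel_measurable_times[OF measurable_compose[OF measurable_coordinate_rademacher uv(1)]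
          measurable_compose[OF measurable_coordinate_rademacher uv(2)]])
qed

lemma rademacher_orthogonal:
  fixes u v :: "complex \<Rightarrow> real"
  assumes uv: "u \<in> {Re, Im}" "v \<in> {Re, Im}" and ij: "i \<noteq> j"
  shows "(\<integral>\<epsilon>. u (\<epsilon> i) * v (\<epsilon> j) \<partial>rademacher) = 0"
proof -
  \<comment> \<open>Changing the sign of the \<open>i\<close>-th variable alone preserves the joint
    law and reverses the sign of the integrand.\<close>
  let ?w = "\<lambda>k. if k = i then -1 else 1 :: complex"
  have uv': "u \<in> borel_measurable borel" "v \<in> borel_measurable borel" using uv by auto
  have m: "(\<lambda>\<epsilon>. u (\<epsilon> i) * v (\<epsilon> j)) \<in> borel_measurable borel"
    by (rule borel_measurable_times[OF measurable_compose[OF measurable_coordinate_borel uv'(1)]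
          measurable_compose[OF measurable_coordinate_borel uv'(2)]])
  have "(\<integral>\<epsilon>. u (\<epsilon> i) * v (\<epsilon> j) \<partial>rademacher) = (\<integral>\<epsilon>. u (?w i * \<epsilon> i) * v (?w j * \<epsilon> j) \<partial>rademacher)"
    by (rule integral_rademacher_mult[OF _ m, symmetric, of ?w]) simp
  also have "\<dots> = - (\<integral>\<epsilon>. u (\<epsilon> i) * v (\<epsilon> j) \<partial>rademacher)"
  proof -
    have "u (?w i * z) * v (?w j * z') = - (u z * v z')" for z z' using uv ij by auto
    then show ?thesis by simp
  qed
  finally show ?thesis by simp
qed

lemma rademacher_diagonal:
  "(\<integral>\<epsilon>. Re (\<epsilon> i) * Re (\<epsilon> i) \<partial>rademacher) = 1 / 2" "(\<integral>\<epsilon>. Im (\<epsilon> i) * Im (\<epsilon> i) \<partial>rademacher) = 1 / 2"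
  "(\<integral>\<epsilon>. Re (\<epsilon> i) * Im (\<epsilon> i) \<partial>rademacher) = 0" "(\<integral>\<epsilon>. Im (\<epsilon> i) * Re (\<epsilon> i) \<partial>rademacher) = 0"
proof -
  have m: "(\<lambda>\<epsilon>. u (\<epsilon> i) * v (\<epsilon> i)) \<in> borel_measurable borel" if "u \<in> {Re, Im}" "v \<in> {Re, Im}" for u v :: "complex \<Rightarrow> real"
  proof -
    have uv: "u \<in> borel_measurable borel" "v \<in> borel_measurable borel" using that by auto
    show ?thesis
      by (rule borel_measurable_times[OF measurable_compose[OF measurable_coordinate_borel uv(1)]
            measurable_compose[OF measurable_coordinate_borel uv(2)]])
  qed
  \<comment> \<open>Multiplication by \<open>\<i>\<close> takes (Re, Im) to (-Im, Re). It exchanges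
    the two squares and reverses the sign of the mixed product.\<close>
  note rot = integral_rademacher_mult[where w = "\<lambda>_. \<i>", simplified]
  have 1: "(\<integral>\<epsilon>. Re (\<epsilon> i) * Re (\<epsilon> i) \<partial>rademacher) = (\<integral>\<epsilon>. Im (\<epsilon> i) * Im (\<epsilon> i) \<partial>rademacher)"
    using rot[OF m[of Re Re]] by simp
  have 2: "(\<integral>\<epsilon>. Re (\<epsilon> i) * Im (\<epsilon> i) \<partial>rademacher) = - (\<integral>\<epsilon>. Im (\<epsilon> i) * Re (\<epsilon> i) \<partial>rademacher)"
    using rot[OF m[of Re Im]] by simp
  have "(\<integral>\<epsilon>. Re (\<epsilon> i) * Re (\<epsilon> i) \<partial>rademacher) + (\<integral>\<epsilon>. Im (\<epsilon> i) * Im (\<epsilon> i) \<partial>rademacher)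
    = (\<integral>\<epsilon>. Re (\<epsilon> i) * Re (\<epsilon> i) + Im (\<epsilon> i) * Im (\<epsilon> i) \<partial>rademacher)"
    by (intro Bochner_Integration.integral_add[symmetric] integrable_rademacher_prod) auto
  also have "\<dots> = (\<integral>\<epsilon>. 1 \<partial>rademacher)"
  proof (rule integral_cong_AE)
    show "AE \<epsilon> in rademacher. Re (\<epsilon> i) * Re (\<epsilon> i) + Im (\<epsilon> i) * Im (\<epsilon> i) = 1"
      using AE_rademacher_norm
    proof eventually_elim
      case (elim \<epsilon>)
      then have "(cmod (\<epsilon> i))\<^sup>2 = 1" by simp
      then show ?case unfolding cmod_power2 by (simp add: power2_eq_square)
    qed
    show "(\<lambda>\<epsilon>. Re (\<epsilon> i) * Re (\<epsilon> i) + Im (\<epsilon> i) * Im (\<epsilon> i)) \<in> borel_measurable rademacher"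
      using m[of Re Re] m[of Im Im] by (simp cong: measurable_cong_sets)
  qed simp
  also have "\<dots> = 1" using rademacher.prob_space by simp
  finally show "(\<integral>\<epsilon>. Re (\<epsilon> i) * Re (\<epsilon> i) \<partial>rademacher) = 1 / 2" "(\<integral>\<epsilon>. Im (\<epsilon> i) * Im (\<epsilon> i) \<partial>rademacher) = 1 / 2"
    using 1 by simp_all
  show "(\<integral>\<epsilon>. Re (\<epsilon> i) * Im (\<epsilon> i) \<partial>rademacher) = 0" "(\<integral>\<epsilon>. Im (\<epsilon> i) * Re (\<epsilon> i) \<partial>rademacher) = 0"
    using 2 by (simp_all add: mult.commute)
qed

text \<open>In the expansion by real and imaginary parts only the squares survive, each with mean
  1/2. The two halves are exactly the average over 1 and \<open>\<i>\<close>.\<close>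

lemma integral_rademacher_bilinear:
  fixes B :: "'x::complex_normed_vector \<Rightarrow> 'x \<Rightarrow> real"
  assumes B: "bounded_bilinear B"
  shows "(\<integral>\<epsilon>. B (\<Sum>i<n. \<epsilon> i *\<^sub>C y i) (\<Sum>i<n. \<epsilon> i *\<^sub>C y i) \<partial>rademacher) =
      (\<Sum>i<n. (B (y i) (y i) + B (\<i> *\<^sub>C y i) (\<i> *\<^sub>C y i)) / 2)"
    and "integrable rademacher (\<lambda>\<epsilon>. B (\<Sum>i<n. \<epsilon> i *\<^sub>C y i) (\<Sum>i<n. \<epsilon> i *\<^sub>C y i))"
proof -
  interpret B: bounded_bilinear B by (rule B)
  let ?T = "\<lambda>\<epsilon> i j. Re (\<epsilon> i) * Re (\<epsilon> j) * B (y i) (y j) + Re (\<epsilon> i) * Im (\<epsilon> j) * B (y i) (\<i> *\<^sub>C y j) +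
      Im (\<epsilon> i) * Re (\<epsilon> j) * B (\<i> *\<^sub>C y i) (y j) + Im (\<epsilon> i) * Im (\<epsilon> j) * B (\<i> *\<^sub>C y i) (\<i> *\<^sub>C y j)"
  have sc: "a *\<^sub>C x = Re a *\<^sub>R x + Im a *\<^sub>R (\<i> *\<^sub>C x)" for a and x :: 'x
    by (rule scaleC_Re_Im)
  have eq: "B (\<Sum>i<n. \<epsilon> i *\<^sub>C y i) (\<Sum>i<n. \<epsilon> i *\<^sub>C y i) = (\<Sum>i<n. \<Sum>j<n. ?T \<epsilon> i j)" for \<epsilon>
    unfolding B.sum_left unfolding B.sum_right
    by (intro sum.cong refl, subst (1 2) sc) (simp add: B.add_left B.add_right B.scaleR_left B.scaleR_right algebra_simps)
  note int = integrable_rademacher_prod[of Re Re] integrable_rademacher_prod[of Re Im]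
    integrable_rademacher_prod[of Im Re] integrable_rademacher_prod[of Im Im]
  have intT: "integrable rademacher (\<lambda>\<epsilon>. ?T \<epsilon> i j)" for i j
    by (intro Bochner_Integration.integrable_add integrable_mult_left) (use int in simp_all)
  have T: "(\<integral>\<epsilon>. ?T \<epsilon> i j \<partial>rademacher) = (if i = j then (B (y i) (y i) + B (\<i> *\<^sub>C y i) (\<i> *\<^sub>C y i)) / 2 else 0)" for i j
    using int by (simp add: Bochner_Integration.integral_add rademacher_orthogonal rademacher_diagonal add_divide_distrib)
  show "integrable rademacher (\<lambda>\<epsilon>. B (\<Sum>i<n. \<epsilon> i *\<^sub>C y i) (\<Sum>i<n. \<epsilon> i *\<^sub>C y i))"
    unfolding eq by (intro Bochner_Integration.integrable_sum intT)
  have "(\<integral>\<epsilon>. (\<Sum>i<n. \<Sum>j<n. ?T \<epsilon> i j) \<partial>rademacher) = (\<Sum>i<n. \<Sum>j<n. \<integral>\<epsilon>. ?T \<epsilon> i j \<partial>rademacher)"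
    by (simp only: Bochner_Integration.integral_sum Bochner_Integration.integrable_sum intT)
  then show "(\<integral>\<epsilon>. B (\<Sum>i<n. \<epsilon> i *\<^sub>C y i) (\<Sum>i<n. \<epsilon> i *\<^sub>C y i) \<partial>rademacher) =
      (\<Sum>i<n. (B (y i) (y i) + B (\<i> *\<^sub>C y i) (\<i> *\<^sub>C y i)) / 2)"
    unfolding eq T by simp
qed

section \<open>The Ito isometry for bilinear forms\<close>

lemma integrable_mult_of_square_integrable:
  fixes X Y :: "'a \<Rightarrow> real"
  assumes [measurable]: "X \<in> borel_measurable N" "Y \<in> borel_measurable N"
    and "integrable N (\<lambda>a. (X a)\<^sup>2)" "integrable N (\<lambda>a. (Y a)\<^sup>2)"
  shows "integrable N (\<lambda>a. X a * Y a)"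
proof (rule Bochner_Integration.integrable_bound)
  show "integrable N (\<lambda>a. (X a)\<^sup>2 + (Y a)\<^sup>2)" using assms by simp
  show "AE a in N. norm (X a * Y a) \<le> norm ((X a)\<^sup>2 + (Y a)\<^sup>2)"
  proof (rule AE_I2)
    fix a
    have "2 * (\<bar>X a\<bar> * \<bar>Y a\<bar>) \<le> (X a)\<^sup>2 + (Y a)\<^sup>2"
      using sum_squares_bound[of "\<bar>X a\<bar>" "\<bar>Y a\<bar>"] by simp
    moreover have "0 \<le> \<bar>X a\<bar> * \<bar>Y a\<bar>" by simp
    ultimately have "\<bar>X a\<bar> * \<bar>Y a\<bar> \<le> (X a)\<^sup>2 + (Y a)\<^sup>2" by linarith
    then show "norm (X a * Y a) \<le> norm ((X a)\<^sup>2 + (Y a)\<^sup>2)" by (simp add: abs_mult)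
  qed
qed simp

section \<open>Moments and covariances of Brownian increments\<close>

locale brownian =
  fixes M :: "'w measure" and F :: "real \<Rightarrow> 'w measure" and W :: "real \<Rightarrow> 'w \<Rightarrow> real"
  assumes bm: "brownian_motion M F W"
begin

sublocale prob_space M using bm by (simp add: brownian_motion_def)

lemma subalgebra_F: "0 \<le> t \<Longrightarrow> subalgebra M (F t)"
  using bm by (simp add: brownian_motion_def)

lemma space_F: "0 \<le> t \<Longrightarrow> space (F t) = space M"
  using subalgebra_F by (simp add: subalgebra_def)

lemma sets_F: "0 \<le> t \<Longrightarrow> sets (F t) \<subseteq> sets M"
  using subalgebra_F by (simp add: subalgebra_def)

lemma sets_F_mono: "0 \<le> s \<Longrightarrow> s \<le> t \<Longrightarrow> sets (F s) \<subseteq> sets (F t)"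
  using bm by (simp add: brownian_motion_def)

lemma measurable_F_mono: "0 \<le> s \<Longrightarrow> s \<le> t \<Longrightarrow> f \<in> measurable (F s) N \<Longrightarrow> f \<in> measurable (F t) N"
  using sets_F_mono[of s t] space_F[of s] space_F[of t]
  by (auto simp: measurable_def)

lemma measurable_F_M: "0 \<le> s \<Longrightarrow> f \<in> measurable (F s) N \<Longrightarrow> f \<in> measurable M N"
  using sets_F[of s] space_F[of s] by (auto simp: measurable_def)

lemma W_measurable_F:
  assumes "0 \<le> s" "s \<le> t"
  shows "W s \<in> borel_measurable (F t)"
proof -
  have "W s \<in> borel_measurable (F s)" using bm assms(1) by (simp add: brownian_motion_def)
  then show ?thesis by (rule measurable_F_mono[OF assms])
qed

lemma W_measurable [measurable]: "0 \<le> s \<Longrightarrow> W s \<in> borel_measurable M"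
  using W_measurable_F[of s s] measurable_F_M[of s] by simp

lemma increment_distributed:
  "0 \<le> s \<Longrightarrow> s < t \<Longrightarrow> distributed M lborel (\<lambda>\<omega>. W t \<omega> - W s \<omega>) (normal_density 0 (sqrt (t - s)))"
  using bm by (simp add: brownian_motion_def)

lemma increment_moments:
  assumes "0 \<le> s" "s \<le> t"
  shows "integrable M (\<lambda>\<omega>. W t \<omega> - W s \<omega>)" "expectation (\<lambda>\<omega>. W t \<omega> - W s \<omega>) = 0"
    "integrable M (\<lambda>\<omega>. (W t \<omega> - W s \<omega>)\<^sup>2)" "expectation (\<lambda>\<omega>. (W t \<omega> - W s \<omega>)\<^sup>2) = t - s"
proof -
  let ?D = "\<lambda>\<omega>. W t \<omega> - W s \<omega>"
  have "integrable M ?D \<and> expectation ?D = 0 \<and> integrable M (\<lambda>\<omega>. (?D \<omega>)\<^sup>2) \<and> expectation (\<lambda>\<omega>. (?D \<omega>)\<^sup>2) = t - s"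
  proof (cases "s = t")
    case True
    then show ?thesis by simp
  next
    case False
    then have st: "s < t" using assms by simp
    then have \<sigma>: "0 < sqrt (t - s)" by simp
    note D = increment_distributed[OF assms(1) st]
    have i1: "integrable M ?D"
      using distributed_integrable[OF D, of "\<lambda>x. x"] integrable_normal_moment_nz_1[OF \<sigma>, of 0] by simp
    have i2: "integrable M (\<lambda>\<omega>. (?D \<omega>)\<^sup>2)"
      using distributed_integrable[OF D, of "\<lambda>x. x\<^sup>2"] integrable_normal_moment[OF \<sigma>, of 0 2] by simp
    have e1: "expectation ?D = 0" by (rule normal_distributed_expectation[OF \<sigma> D])
    have "variance ?D = (sqrt (t - s))\<^sup>2" by (rule normal_distributed_variance[OF \<sigma> D])
    then show ?thesis using i1 i2 e1 st by simp
  qed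
  then show "integrable M ?D" "expectation ?D = 0" "integrable M (\<lambda>\<omega>. (?D \<omega>)\<^sup>2)" "expectation (\<lambda>\<omega>. (?D \<omega>)\<^sup>2) = t - s"
    by blast+
qed

text \<open>Independence is given for two families that are stable under intersection. It extends to
  the generated sigma-algebras and then passes to the smaller one generated by
  \<open>Z\<close>.\<close>

lemma indep_var_increment:
  assumes "0 \<le> s" "s < t" and Z: "Z \<in> borel_measurable (F s)"
  shows "indep_var borel Z borel (\<lambda>\<omega>. W t \<omega> - W s \<omega>)"
proof -
  let ?D = "\<lambda>\<omega>. W t \<omega> - W s \<omega>"
  have mZ: "Z \<in> borel_measurable M" using measurable_F_M[OF assms(1) Z] .
  have mD: "?D \<in> borel_measurable M" using assms by (intro borel_measurable_diff W_measurable) auto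
  have ind: "indep_set (sets (F s)) {?D -` A \<inter> space M | A. A \<in> sets borel}"
    using bm assms by (simp add: brownian_motion_def)
  have "Int_stable {?D -` A \<inter> space M | A. A \<in> sets borel}"
  proof (rule Int_stableI)
    fix a b assume "a \<in> {?D -` A \<inter> space M | A. A \<in> sets borel}" "b \<in> {?D -` A \<inter> space M | A. A \<in> sets borel}"
    then obtain A B where "A \<in> sets borel" "B \<in> sets borel" "a = ?D -` A \<inter> space M" "b = ?D -` B \<inter> space M" by blast
    then show "a \<inter> b \<in> {?D -` A \<inter> space M | A. A \<in> sets borel}"
      by (intro CollectI exI[of _ "A \<inter> B"]) auto
  qed
  moreover have "Int_stable (sets (F s))" by (auto intro: Int_stableI)
  ultimately have "indep_set (sigma_sets (space M) (sets (F s)))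
      (sigma_sets (space M) {?D -` A \<inter> space M | A. A \<in> sets borel})"
    using ind by (intro indep_set_sigma_sets) auto
  moreover have "sigma_sets (space M) {Z -` A \<inter> space M | A. A \<in> sets borel} \<subseteq> sigma_sets (space M) (sets (F s))"
    using measurable_sets[OF Z] space_F[OF assms(1)] by (intro sigma_sets_mono') auto
  ultimately have "indep_set (sigma_sets (space M) {Z -` A \<inter> space M | A. A \<in> sets borel})
      (sigma_sets (space M) {?D -` A \<inter> space M | A. A \<in> sets borel})"
    unfolding indep_set_def by (elim indep_sets_mono_sets) (auto split: bool.split)
  then show ?thesis using mZ mD by (simp add: indep_var_eq)
qed

lemma expectation_mult_increment:
  assumes "0 \<le> s" "s \<le> t" and Z: "Z \<in> borel_measurable (F s)" "integrable M Z"
  shows "expectation (\<lambda>\<omega>. Z \<omega> * (W t \<omega> - W s \<omega>)) = 0"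
    and "expectation (\<lambda>\<omega>. Z \<omega> * (W t \<omega> - W s \<omega>)\<^sup>2) = expectation Z * (t - s)"
proof -
  have "expectation (\<lambda>\<omega>. Z \<omega> * (W t \<omega> - W s \<omega>)) = 0 \<and>
    expectation (\<lambda>\<omega>. Z \<omega> * (W t \<omega> - W s \<omega>)\<^sup>2) = expectation Z * (t - s)"
  proof (cases "s = t")
    case True
    then show ?thesis by simp
  next
    case False
    then have st: "s < t" using assms by simp
    note ind = indep_var_increment[OF assms(1) st Z(1)]
    note mom = increment_moments[OF assms(1,2)]
    have "indep_var borel ((\<lambda>x. x) \<circ> Z) borel ((\<lambda>x. x\<^sup>2) \<circ> (\<lambda>\<omega>. W t \<omega> - W s \<omega>))"
      by (rule indep_var_compose[OF ind]) auto
    then have ind2: "indep_var borel Z borel (\<lambda>\<omega>. (W t \<omega> - W s \<omega>)\<^sup>2)" by (simp add: o_def)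
    show ?thesis
      using indep_var_lebesgue_integral[OF ind Z(2) mom(1)] indep_var_lebesgue_integral[OF ind2 Z(2) mom(3)]
      by (simp add: mom)
  qed
  then show "expectation (\<lambda>\<omega>. Z \<omega> * (W t \<omega> - W s \<omega>)) = 0"
    "expectation (\<lambda>\<omega>. Z \<omega> * (W t \<omega> - W s \<omega>)\<^sup>2) = expectation Z * (t - s)" by blast+
qed

lemma indicator_measurable_F: "A \<in> sets (F s) \<Longrightarrow> (indicator A :: 'w \<Rightarrow> real) \<in> borel_measurable (F s)"
  by simp

lemma increment_product_integrable:
  assumes "0 \<le> s" "s \<le> t" "0 \<le> u" "u \<le> v" and D: "D \<in> sets M"
  shows "integrable M (\<lambda>\<omega>. indicator D \<omega> * ((W t \<omega> - W s \<omega>) * (W v \<omega> - W u \<omega>)))"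
proof -
  have "integrable M (\<lambda>\<omega>. (W t \<omega> - W s \<omega>) * (W v \<omega> - W u \<omega>))"
    using assms by (intro integrable_mult_of_square_integrable increment_moments) auto
  from integrable_real_mult_indicator[OF D this] show ?thesis by (simp add: mult.commute)
qed

lemma increment_indicator_integrable:
  assumes "0 \<le> s" "s \<le> t" and D: "D \<in> sets M"
  shows "integrable M (\<lambda>\<omega>. indicator D \<omega> * (W t \<omega> - W s \<omega>))"
  using integrable_real_mult_indicator[OF D increment_moments(1)[OF assms(1,2)]] by (simp add: mult.commute)

text \<open>Everything except the last increment is known at time \<open>u\<close>.\<close>

lemma covariance_separated:
  assumes st: "0 \<le> s" "s \<le> t" and uv: "t \<le> u" "u \<le> v" and D: "D \<in> sets (F u)"
  shows "expectation (\<lambda>\<omega>. indicator D \<omega> * ((W t \<omega> - W s \<omega>) * (W v \<omega> - W u \<omega>))) = 0"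
proof -
  have "(\<lambda>\<omega>. indicator D \<omega> * (W t \<omega> - W s \<omega>)) \<in> borel_measurable (F u)"
    using st uv D by (intro borel_measurable_times borel_measurable_diff W_measurable_F indicator_measurable_F) auto
  moreover have "D \<in> sets M" using D sets_F[of u] st uv by auto
  ultimately have "expectation (\<lambda>\<omega>. (indicator D \<omega> * (W t \<omega> - W s \<omega>)) * (W v \<omega> - W u \<omega>)) = 0"
    using st uv by (intro expectation_mult_increment increment_indicator_integrable) auto
  then show ?thesis by (simp add: mult.assoc)
qed

text \<open>The longer increment is cut at \<open>b\<close>; its second piece is uncorrelated with
  what happened up to \<open>b\<close>, and the first piece contributes its variance.\<close>

lemma covariance_nested:
  assumes c: "0 \<le> c" "c \<le> b" "b \<le> d" and D: "D \<in> sets (F c)"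
  shows "expectation (\<lambda>\<omega>. indicator D \<omega> * ((W b \<omega> - W c \<omega>) * (W d \<omega> - W c \<omega>))) = prob D * (b - c)"
proof -
  have DM: "D \<in> sets M" using D sets_F[of c] c by auto
  have Db: "D \<in> sets (F b)" using D sets_F_mono[of c b] c by auto
  have "expectation (\<lambda>\<omega>. indicator D \<omega> * ((W b \<omega> - W c \<omega>) * (W d \<omega> - W c \<omega>))) =
    expectation (\<lambda>\<omega>. indicator D \<omega> * (W b \<omega> - W c \<omega>)\<^sup>2 + indicator D \<omega> * ((W b \<omega> - W c \<omega>) * (W d \<omega> - W b \<omega>)))"
    by (rule arg_cong[where f = expectation]) (simp add: fun_eq_iff power2_eq_square algebra_simps)
  also have "\<dots> = expectation (\<lambda>\<omega>. indicator D \<omega> * (W b \<omega> - W c \<omega>)\<^sup>2)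
    + expectation (\<lambda>\<omega>. indicator D \<omega> * ((W b \<omega> - W c \<omega>) * (W d \<omega> - W b \<omega>)))"
    using c DM increment_product_integrable[of c b c b D]
    by (intro Bochner_Integration.integral_add increment_product_integrable) (auto simp: power2_eq_square)
  also have "expectation (\<lambda>\<omega>. indicator D \<omega> * ((W b \<omega> - W c \<omega>) * (W d \<omega> - W b \<omega>))) = 0"
    using c Db by (intro covariance_separated) auto
  also have "expectation (\<lambda>\<omega>. indicator D \<omega> * (W b \<omega> - W c \<omega>)\<^sup>2) = expectation (indicator D) * (b - c)"
    using c D DM by (intro expectation_mult_increment indicator_measurable_F integrable_real_indicator) (auto simp: emeasure_eq_measure)
  finally show ?thesis using DM by simp
qed

text \<open>The last factor is the length of the intersection of the intervals (a, b] and (c, d]. By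
  symmetry the first interval may start earlier; it is then cut at \<open>c\<close>, and only the
  piece after \<open>c\<close> is correlated with the second increment.\<close>

lemma covariance_increments:
  assumes ab: "0 \<le> a" "a \<le> b" and A: "A \<in> sets M" "a < b \<Longrightarrow> A \<in> sets (F a)"
    and cd: "0 \<le> c" "c \<le> d" and C: "C \<in> sets M" "c < d \<Longrightarrow> C \<in> sets (F c)"
  shows "expectation (\<lambda>\<omega>. indicator (A \<inter> C) \<omega> * ((W b \<omega> - W a \<omega>) * (W d \<omega> - W c \<omega>))) =
    prob (A \<inter> C) * max 0 (min b d - max a c)"
proof -
  have main: "expectation (\<lambda>\<omega>. indicator (A \<inter> C) \<omega> * ((W b \<omega> - W a \<omega>) * (W d \<omega> - W c \<omega>))) =
      prob (A \<inter> C) * max 0 (min b d - c)"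
    if ac: "0 \<le> a" "a \<le> c" and ab: "a < b" and cd: "c < d"
      and AC: "A \<in> sets M" "C \<in> sets M" "A \<in> sets (F a)" "C \<in> sets (F c)" for a b c d A C
  proof -
    have D: "A \<inter> C \<in> sets (F c)" using AC sets_F_mono[of a c] ac by auto
    have DM: "A \<inter> C \<in> sets M" using AC by auto
    show ?thesis
    proof (cases "b \<le> c")
      case True
      then have "expectation (\<lambda>\<omega>. indicator (A \<inter> C) \<omega> * ((W b \<omega> - W a \<omega>) * (W d \<omega> - W c \<omega>))) = 0"
        using ac ab cd D by (intro covariance_separated) auto
      then show ?thesis using True by (simp add: max_def)
    next
      case False
      then have cb: "c < b" by simp
      have "expectation (\<lambda>\<omega>. indicator (A \<inter> C) \<omega> * ((W b \<omega> - W a \<omega>) * (W d \<omega> - W c \<omega>))) =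
        expectation (\<lambda>\<omega>. indicator (A \<inter> C) \<omega> * ((W c \<omega> - W a \<omega>) * (W d \<omega> - W c \<omega>)) +
          indicator (A \<inter> C) \<omega> * ((W b \<omega> - W c \<omega>) * (W d \<omega> - W c \<omega>)))"
        by (rule arg_cong[where f = expectation]) (simp add: fun_eq_iff algebra_simps)
      also have "\<dots> = expectation (\<lambda>\<omega>. indicator (A \<inter> C) \<omega> * ((W c \<omega> - W a \<omega>) * (W d \<omega> - W c \<omega>))) +
          expectation (\<lambda>\<omega>. indicator (A \<inter> C) \<omega> * ((W b \<omega> - W c \<omega>) * (W d \<omega> - W c \<omega>)))"
        using ac cb cd DM by (intro Bochner_Integration.integral_add increment_product_integrable) auto
      also have "expectation (\<lambda>\<omega>. indicator (A \<inter> C) \<omega> * ((W c \<omega> - W a \<omega>) * (W d \<omega> - W c \<omega>))) = 0"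
        using ac cd D by (intro covariance_separated) auto
      also have "expectation (\<lambda>\<omega>. indicator (A \<inter> C) \<omega> * ((W b \<omega> - W c \<omega>) * (W d \<omega> - W c \<omega>))) = prob (A \<inter> C) * (min b d - c)"
      proof (cases "b \<le> d")
        case True
        then show ?thesis using covariance_nested[of c b d "A \<inter> C"] ac cb D by (simp add: min_def)
      next
        case False
        then show ?thesis using covariance_nested[of c d b "A \<inter> C"] ac cd D by (simp add: min_def mult.commute)
      qed
      finally show ?thesis using cb cd by (simp add: max_def)
    qed
  qed
  show ?thesis
  proof (cases "a < b \<and> c < d")
    case True
    show ?thesis
    proof (cases "a \<le> c")
      case True
      then show ?thesis using main[of a c b d A C] assms \<open>a < b \<and> c < d\<close> by (simp add: max_def)
    next
      case False
      then show ?thesis using main[of c a d b C A] assms \<open>a < b \<and> c < d\<close>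
        by (simp add: max_def mult.commute Int_commute min.commute)
    qed
  next
    case False
    then have "a = b \<or> c = d" using ab cd by auto
    then show ?thesis
    proof
      assume "a = b"
      then have "min b d - max a c \<le> 0" by (simp add: min_def max_def)
      then show ?thesis using \<open>a = b\<close> by simp
    next
      assume "c = d"
      then have "min b d - max a c \<le> 0" by (simp add: min_def max_def)
      then show ?thesis using \<open>c = d\<close> by simp
    qed
  qed
qed

end

section \<open>Elementary processes and the Ito isometry for them\<close>

type_synonym ('w, 'x) elementary = "(real \<times> real \<times> 'w set \<times> 'x) list"

text \<open>A list of single rectangles with vector weights. Unlike adapted step processes, such
  lists are added by concatenation, without a common refinement of the partitions.\<close>

definition elementary_process :: "('w, 'x::real_normed_vector) elementary \<Rightarrow> 'w \<times> real \<Rightarrow> 'x" where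
  "elementary_process L = (\<lambda>(\<omega>, s). \<Sum>(a, b, A, v)\<leftarrow>L. (indicator A \<omega> * indicator {a<..b} s) *\<^sub>R v)"

definition elementary_integral ::
  "(real \<Rightarrow> 'w \<Rightarrow> real) \<Rightarrow> ('w, 'x::real_normed_vector) elementary \<Rightarrow> 'w \<Rightarrow> 'x" where
  "elementary_integral W L = (\<lambda>\<omega>. \<Sum>(a, b, A, v)\<leftarrow>L. (indicator A \<omega> * (W b \<omega> - W a \<omega>)) *\<^sub>R v)"

definition uminus_elementary :: "('w, 'x::real_normed_vector) elementary \<Rightarrow> ('w, 'x) elementary" where
  "uminus_elementary L = map (\<lambda>(a, b, A, v). (a, b, A, - v)) L"

definition map_time :: "(real \<Rightarrow> real) \<Rightarrow> ('w, 'x) elementary \<Rightarrow> ('w, 'x) elementary" where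
  "map_time g L = map (\<lambda>(a, b, A, v). (g a, g b, A, v)) L"

lemma map_time_append: "map_time g (L @ L') = map_time g L @ map_time g L'"
  by (simp add: map_time_def)

lemma map_time_uminus: "map_time g (uminus_elementary L) = uminus_elementary (map_time g L)"
  by (simp add: map_time_def uminus_elementary_def case_prod_beta)

lemma map_time_id: "map_time (\<lambda>x. x) L = L"
  by (simp add: map_time_def)

lemma elementary_append:
  "elementary_process (L @ L') z = elementary_process L z + elementary_process L' z"
  "elementary_integral W (L @ L') \<omega> = elementary_integral W L \<omega> + elementary_integral W L' \<omega>"
  by (simp_all add: elementary_process_def elementary_integral_def split: prod.split)

lemma elementary_uminus:
  "elementary_process (uminus_elementary L) z = - elementary_process L z"
  "elementary_integral W (uminus_elementary L) \<omega> = - elementary_integral W L \<omega>"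
  by (induction L) (auto simp: uminus_elementary_def elementary_process_def elementary_integral_def split: prod.split)

context brownian
begin

text \<open>Clipping the times collapses some intervals to a point, which need not lie after the time to which
  the set \<open>A\<close> is adapted; hence the condition \<open>a < b\<close>.\<close>

definition admissible :: "('w, 'x::real_normed_vector) elementary \<Rightarrow> bool" where
  "admissible L \<longleftrightarrow> (\<forall>(a, b, A, v)\<in>set L. 0 \<le> a \<and> a \<le> b \<and> A \<in> sets M \<and> (a < b \<longrightarrow> A \<in> sets (F a)))"

lemma admissible_append: "admissible (L @ L') \<longleftrightarrow> admissible L \<and> admissible L'"
  by (simp add: admissible_def ball_Un)

lemma admissible_uminus: "admissible L \<Longrightarrow> admissible (uminus_elementary L)"
  by (auto simp: admissible_def uminus_elementary_def)

abbreviation space_time :: "('w \<times> real) measure" where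
  "space_time \<equiv> M \<Otimes>\<^sub>M lborel_pos"

lemma sigma_finite_lborel_pos: "sigma_finite_measure lborel_pos"
  unfolding lborel_pos_def by (rule sigma_finite_measure_restrict_space) (auto simp: sigma_finite_lborel)

sublocale lp: sigma_finite_measure lborel_pos by (rule sigma_finite_lborel_pos)

sublocale st: pair_sigma_finite M lborel_pos ..

lemma space_lborel_pos [simp]: "space lborel_pos = {0<..}"
  by (simp add: lborel_pos_def space_restrict_space)

lemma sets_lborel_pos: "A \<in> sets lborel_pos \<longleftrightarrow> A \<in> sets borel \<and> A \<subseteq> {0<..}"
  by (auto simp: lborel_pos_def sets_restrict_space_iff)

lemma emeasure_lborel_pos: "A \<in> sets borel \<Longrightarrow> A \<subseteq> {0<..} \<Longrightarrow> emeasure lborel_pos A = emeasure lborel A"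
  unfolding lborel_pos_def by (rule emeasure_restrict_space) auto

lemma rectangle_sets: "A \<in> sets M \<Longrightarrow> 0 \<le> a \<Longrightarrow> A \<times> {a<..b} \<in> sets space_time"
  by (intro pair_measureI) (auto simp: sets_lborel_pos)

lemma emeasure_rectangle:
  assumes "A \<in> sets M" "0 \<le> a"
  shows "emeasure space_time (A \<times> {a<..b}) = ennreal (prob A * max 0 (b - a))"
proof -
  have I: "{a<..b} \<in> sets borel" "{a<..b} \<subseteq> {0<..}" using assms by auto
  have "emeasure lborel {a<..b} = ennreal (max 0 (b - a))" by (cases "a \<le> b") (auto simp: max_def ennreal_neg)
  then show ?thesis
    using assms I by (simp add: lp.emeasure_pair_measure_Times sets_lborel_pos emeasure_lborel_pos
        emeasure_eq_measure ennreal_mult)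
qed

lemma indicator_rectangle_product:
  fixes a b c d s :: real
  shows "(indicator A \<omega> * indicator {a<..b} s) * (indicator C \<omega> * indicator {c<..d} s) =
    (indicator ((A \<inter> C) \<times> {max a c<..min b d}) (\<omega>, s) :: real)"
  by (auto simp: indicator_def min_def max_def split: if_splits)

lemma integral_rectangle_product:
  assumes "A \<in> sets M" "C \<in> sets M" "0 \<le> a"
  shows "integrable space_time (\<lambda>z. (indicator A (fst z) * indicator {a<..b} (snd z)) * (indicator C (fst z) * indicator {c<..d} (snd z)) :: real)"
    and "(\<integral>z. (indicator A (fst z) * indicator {a<..b} (snd z)) * (indicator C (fst z) * indicator {c<..d} (snd z)) \<partial>space_time) =
      prob (A \<inter> C) * max 0 (min b d - max a c)"
proof -
  let ?R = "(A \<inter> C) \<times> {max a c<..min b d}"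
  have R: "?R \<in> sets space_time" using assms by (intro rectangle_sets) auto
  have em: "emeasure space_time ?R = ennreal (prob (A \<inter> C) * max 0 (min b d - max a c))"
    using assms by (intro emeasure_rectangle) auto
  have eq: "(\<lambda>z. (indicator A (fst z) * indicator {a<..b} (snd z)) * (indicator C (fst z) * indicator {c<..d} (snd z)) :: real) = indicator ?R"
    by (auto simp: fun_eq_iff indicator_rectangle_product)
  show "integrable space_time (\<lambda>z. (indicator A (fst z) * indicator {a<..b} (snd z)) * (indicator C (fst z) * indicator {c<..d} (snd z)) :: real)"
    unfolding eq using R em by (intro integrable_real_indicator) auto
  show "(\<integral>z. (indicator A (fst z) * indicator {a<..b} (snd z)) * (indicator C (fst z) * indicator {c<..d} (snd z)) \<partial>space_time) =
      prob (A \<inter> C) * max 0 (min b d - max a c)"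
    unfolding eq using R em by (simp add: measure_def)
qed

text \<open>Both sides expand into the same double sum: the covariance of two increments on the
  common event equals the measure of the intersection of the two rectangles. The form is not tied to
  the norm, so squares of functionals are allowed.\<close>

lemma elementary_ito:
  fixes B :: "'x::real_normed_vector \<Rightarrow> 'x \<Rightarrow> real"
  assumes B: "bounded_bilinear B" and L: "admissible L"
  shows "integrable M (\<lambda>\<omega>. B (elementary_integral W L \<omega>) (elementary_integral W L \<omega>))"
    and "integrable space_time (\<lambda>z. B (elementary_process L z) (elementary_process L z))"
    and "expectation (\<lambda>\<omega>. B (elementary_integral W L \<omega>) (elementary_integral W L \<omega>)) =
      (\<integral>z. B (elementary_process L z) (elementary_process L z) \<partial>space_time)"
proof -
  interpret B: bounded_bilinear B by (rule B)
  define n where "n = length L"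
  define a b A v where "a i = fst (L ! i)" and "b i = fst (snd (L ! i))" and "A i = fst (snd (snd (L ! i)))"
    and "v i = snd (snd (snd (L ! i)))" for i
  have ok: "0 \<le> a i" "a i \<le> b i" "A i \<in> sets M" "a i < b i \<Longrightarrow> A i \<in> sets (F (a i))" if "i < n" for i
    using L that nth_mem[of i L] unfolding admissible_def a_def b_def A_def n_def by (auto simp: case_prod_beta)
  have I: "elementary_integral W L \<omega> = (\<Sum>i<n. (indicator (A i) \<omega> * (W (b i) \<omega> - W (a i) \<omega>)) *\<^sub>R v i)" for \<omega>
    unfolding elementary_integral_def sum_list_sum_nth a_def b_def A_def v_def n_def
    by (auto simp: case_prod_beta atLeast0LessThan intro!: sum.cong)
  have P: "elementary_process L z = (\<Sum>i<n. (indicator (A i) (fst z) * indicator {a i<..b i} (snd z)) *\<^sub>R v i)" for z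
    unfolding elementary_process_def sum_list_sum_nth a_def b_def A_def v_def n_def
    by (auto simp: case_prod_beta atLeast0LessThan intro!: sum.cong)
  have BI: "B (elementary_integral W L \<omega>) (elementary_integral W L \<omega>) = (\<Sum>i<n. \<Sum>j<n.
      (indicator (A i \<inter> A j) \<omega> * ((W (b i) \<omega> - W (a i) \<omega>) * (W (b j) \<omega> - W (a j) \<omega>))) * B (v i) (v j))" for \<omega>
    unfolding I B.sum_left unfolding B.sum_right B.scaleR_left B.scaleR_right
    by (intro sum.cong refl) (simp add: indicator_inter_arith mult_ac)
  have BP: "B (elementary_process L z) (elementary_process L z) = (\<Sum>i<n. \<Sum>j<n.
      ((indicator (A i) (fst z) * indicator {a i<..b i} (snd z)) * (indicator (A j) (fst z) * indicator {a j<..b j} (snd z))) * B (v i) (v j))" for z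
    unfolding P B.sum_left unfolding B.sum_right B.scaleR_left B.scaleR_right
    by (intro sum.cong refl) simp
  have i1: "integrable M (\<lambda>\<omega>. (indicator (A i \<inter> A j) \<omega> * ((W (b i) \<omega> - W (a i) \<omega>) * (W (b j) \<omega> - W (a j) \<omega>))) * B (v i) (v j))"
    if "i < n" "j < n" for i j
    using that ok by (intro integrable_mult_left increment_product_integrable) auto
  have i2: "integrable space_time (\<lambda>z. ((indicator (A i) (fst z) * indicator {a i<..b i} (snd z)) *
      (indicator (A j) (fst z) * indicator {a j<..b j} (snd z))) * B (v i) (v j))"
    if "i < n" "j < n" for i j
    using that ok by (intro integrable_mult_left integral_rectangle_product) auto
  show "integrable M (\<lambda>\<omega>. B (elementary_integral W L \<omega>) (elementary_integral W L \<omega>))"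
    unfolding BI by (intro Bochner_Integration.integrable_sum i1) auto
  show "integrable space_time (\<lambda>z. B (elementary_process L z) (elementary_process L z))"
    unfolding BP by (intro Bochner_Integration.integrable_sum i2) auto
  have e1: "expectation (\<lambda>\<omega>. B (elementary_integral W L \<omega>) (elementary_integral W L \<omega>)) =
      (\<Sum>i<n. \<Sum>j<n. prob (A i \<inter> A j) * max 0 (min (b i) (b j) - max (a i) (a j)) * B (v i) (v j))"
  proof -
    have "expectation (\<lambda>\<omega>. B (elementary_integral W L \<omega>) (elementary_integral W L \<omega>)) =
      (\<Sum>i<n. \<Sum>j<n. expectation (\<lambda>\<omega>. (indicator (A i \<inter> A j) \<omega> * ((W (b i) \<omega> - W (a i) \<omega>) * (W (b j) \<omega> - W (a j) \<omega>))) * B (v i) (v j)))"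
      unfolding BI using i1
      by (subst Bochner_Integration.integral_sum) (auto intro!: Bochner_Integration.integrable_sum sum.cong Bochner_Integration.integral_sum)
    also have "\<dots> = (\<Sum>i<n. \<Sum>j<n. prob (A i \<inter> A j) * max 0 (min (b i) (b j) - max (a i) (a j)) * B (v i) (v j))"
      using ok by (intro sum.cong refl) (simp add: covariance_increments)
    finally show ?thesis .
  qed
  have e2: "(\<integral>z. B (elementary_process L z) (elementary_process L z) \<partial>space_time) =
      (\<Sum>i<n. \<Sum>j<n. prob (A i \<inter> A j) * max 0 (min (b i) (b j) - max (a i) (a j)) * B (v i) (v j))"
  proof -
    have "(\<integral>z. B (elementary_process L z) (elementary_process L z) \<partial>space_time) =
      (\<Sum>i<n. \<Sum>j<n. (\<integral>z. ((indicator (A i) (fst z) * indicator {a i<..b i} (snd z)) *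
        (indicator (A j) (fst z) * indicator {a j<..b j} (snd z))) * B (v i) (v j) \<partial>space_time))"
      unfolding BP using i2
      by (subst Bochner_Integration.integral_sum) (auto intro!: Bochner_Integration.integrable_sum sum.cong Bochner_Integration.integral_sum)
    also have "\<dots> = (\<Sum>i<n. \<Sum>j<n. prob (A i \<inter> A j) * max 0 (min (b i) (b j) - max (a i) (a j)) * B (v i) (v j))"
      using ok by (intro sum.cong refl) (simp add: integral_rectangle_product)
    finally show ?thesis .
  qed
  show "expectation (\<lambda>\<omega>. B (elementary_integral W L \<omega>) (elementary_integral W L \<omega>)) =
      (\<integral>z. B (elementary_process L z) (elementary_process L z) \<partial>space_time)"
    unfolding e1 e2 ..
qed

text \<open>Each simple function is split into its level sets. The last conclusion allows any
  process \<open>V\<close> and any time change \<open>g\<close>, since convolutions need clipped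
  times and a version of \<open>W\<close> with continuous paths.\<close>

lemma adapted_step_elementary:
  fixes \<xi> :: "nat \<Rightarrow> 'w \<Rightarrow> 'x::real_normed_vector"
  assumes "adapted_step F m t \<xi>"
  obtains L where "admissible L" "\<And>\<omega> s. \<omega> \<in> space M \<Longrightarrow> elementary_process L (\<omega>, s) = step_process m t \<xi> (\<omega>, s)"
    "\<And>V g \<omega>. \<omega> \<in> space M \<Longrightarrow> elementary_integral V (map_time g L) \<omega> = step_integral V m (\<lambda>j. g (t j)) \<xi> \<omega>"
proof -
  have "\<exists>L. admissible L \<and> (\<forall>\<omega>\<in>space M. (\<forall>s. elementary_process L (\<omega>, s) = step_process m t \<xi> (\<omega>, s)) \<and>
    (\<forall>V g. elementary_integral V (map_time g L) \<omega> = step_integral V m (\<lambda>j. g (t j)) \<xi> \<omega>))"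
    using assms
  proof (induction m)
    case 0
    show ?case
      by (intro exI[of _ "[]"]) (simp add: admissible_def elementary_process_def elementary_integral_def step_process_def step_integral_def map_time_def)
  next
    case (Suc m)
    then have "adapted_step F m t \<xi>" by (simp add: adapted_step_def)
    with Suc.IH obtain L where L: "admissible L"
      "\<And>\<omega> s. \<omega> \<in> space M \<Longrightarrow> elementary_process L (\<omega>, s) = step_process m t \<xi> (\<omega>, s)"
      "\<And>V g \<omega>. \<omega> \<in> space M \<Longrightarrow> elementary_integral V (map_time g L) \<omega> = step_integral V m (\<lambda>j. g (t j)) \<xi> \<omega>" by blast
    have t0: "0 \<le> t j" if "j \<le> m" for j
      using that
    proof (induction j)
      case 0
      then show ?case using Suc.prems by (simp add: adapted_step_def)
    next
      case (Suc j)
      then show ?case using \<open>adapted_step F (Suc m) t \<xi>\<close> by (auto simp: adapted_step_def dest!: spec[of _ j])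
    qed
    have tm: "0 \<le> t m" "t m \<le> t (Suc m)" and sf: "simple_function (F (t m)) (\<xi> m)"
      using t0[of m] Suc.prems by (auto simp: adapted_step_def)
    then have fin: "finite (\<xi> m ` space M)" using space_F[OF tm(1)] by (simp add: simple_function_def)
    then obtain vs where vs: "set vs = \<xi> m ` space M" "distinct vs" using finite_distinct_list by blast
    let ?A = "\<lambda>v. \<xi> m -` {v} \<inter> space M"
    define L' where "L' = map (\<lambda>v. (t m, t (Suc m), ?A v, v)) vs"
    have A: "?A v \<in> sets (F (t m))" if "v \<in> \<xi> m ` space M" for v
      using sf that space_F[OF tm(1)] by (auto simp: simple_function_def)
    then have "admissible L'" using tm sets_F[OF tm(1)] by (auto simp: admissible_def L'_def vs)
    have sum: "(\<Sum>v\<leftarrow>vs. (indicator (?A v) \<omega> * c) *\<^sub>R v) = c *\<^sub>R \<xi> m \<omega>" if "\<omega> \<in> space M" for \<omega> and c :: real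
    proof -
      have "(\<Sum>v\<leftarrow>vs. (indicator (?A v) \<omega> * c) *\<^sub>R v) = (\<Sum>v\<in>\<xi> m ` space M. (indicator (?A v) \<omega> * c) *\<^sub>R v)"
        using vs by (simp add: sum_list_distinct_conv_sum_set)
      also have "\<dots> = (\<Sum>v\<in>{\<xi> m \<omega>}. (indicator (?A v) \<omega> * c) *\<^sub>R v)"
        using that fin by (intro sum.mono_neutral_right) (auto simp: indicator_def)
      finally show ?thesis using that by simp
    qed
    show ?case
    proof (intro exI[of _ "L @ L'"] conjI ballI allI)
      show "admissible (L @ L')" using L \<open>admissible L'\<close> by (simp add: admissible_append)
      fix \<omega> assume \<omega>: "\<omega> \<in> space M"
      show "elementary_process (L @ L') (\<omega>, s) = step_process (Suc m) t \<xi> (\<omega>, s)" for s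
        using sum[OF \<omega>, of "indicator {t m<..t (Suc m)} s"]
        unfolding elementary_append L(2)[OF \<omega>]
        by (simp add: elementary_process_def L'_def step_process_def o_def)
      show "elementary_integral V (map_time g (L @ L')) \<omega> = step_integral V (Suc m) (\<lambda>j. g (t j)) \<xi> \<omega>" for V g
        using sum[OF \<omega>, of "V (g (t (Suc m))) \<omega> - V (g (t m)) \<omega>"]
        unfolding map_time_append elementary_append L(3)[OF \<omega>]
        by (simp add: elementary_integral_def L'_def step_integral_def o_def map_time_def)
    qed
  qed
  then show thesis using that by blast
qed

lemma strongly_measurable_elementary_integral:
  assumes "admissible L"
  shows "strongly_measurable M (elementary_integral W L)"
  using assms
proof (induction L)
  case Nil
  then show ?case by (simp add: elementary_integral_def strongly_measurable_const)
next
  case (Cons p L)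
  obtain a b A v where p: "p = (a, b, A, v)" by (cases p) auto
  have "elementary_integral W (p # L) = (\<lambda>\<omega>. (indicator A \<omega> * (W b \<omega> - W a \<omega>)) *\<^sub>R v + elementary_integral W L \<omega>)"
    by (simp add: elementary_integral_def p fun_eq_iff)
  moreover have "(\<lambda>\<omega>. indicator A \<omega> * (W b \<omega> - W a \<omega>)) \<in> borel_measurable M"
    using Cons.prems by (intro borel_measurable_times borel_measurable_diff W_measurable) (auto simp: admissible_def p)
  ultimately show ?case
    using Cons by (auto intro!: strongly_measurable_add strongly_measurable_scaleR strongly_measurable_const simp: admissible_def)
qed

lemma strongly_measurable_elementary_process:
  assumes "admissible L"
  shows "strongly_measurable space_time (elementary_process L)"
  using assms
proof (induction L)
  case Nil
  then show ?case by (simp add: elementary_process_def strongly_measurable_const case_prod_beta)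
next
  case (Cons p L)
  obtain a b A v where p: "p = (a, b, A, v)" by (cases p) auto
  have eq: "elementary_process (p # L) = (\<lambda>z. (indicator (A \<times> {a<..b}) z) *\<^sub>R v + elementary_process L z)"
    by (auto simp: elementary_process_def p fun_eq_iff indicator_def)
  have "A \<times> {a<..b} \<in> sets space_time" using Cons.prems by (intro rectangle_sets) (auto simp: admissible_def p)
  then have "(indicator (A \<times> {a<..b}) :: _ \<Rightarrow> real) \<in> borel_measurable space_time" by simp
  then show ?case unfolding eq
    using Cons by (intro strongly_measurable_add strongly_measurable_scaleR strongly_measurable_const) (auto simp: admissible_def)
qed

end

section \<open>Continuity of quadratic forms in mean square\<close>

lemma integrable_bilinear_L2:
  fixes B :: "'x::real_normed_vector \<Rightarrow> 'x \<Rightarrow> real"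
  assumes B: "bounded_bilinear B" and h: "h \<in> L2_space N"
  shows "integrable N (\<lambda>a. B (h a) (h a))"
proof -
  interpret B: bounded_bilinear B by (rule B)
  obtain K where K: "0 < K" "\<And>x y. norm (B x y) \<le> norm x * norm y * K" using B.pos_bounded by blast
  show ?thesis
  proof (rule Bochner_Integration.integrable_bound)
    show "integrable N (\<lambda>a. K * (norm (h a))\<^sup>2)" using h by (simp add: L2_space_def)
    have "continuous_on UNIV (\<lambda>x. B x x)" by (intro B.continuous_on continuous_on_id)
    then show "(\<lambda>a. B (h a) (h a)) \<in> borel_measurable N"
      using h by (intro borel_measurable_continuous_strongly_measurable[where h = "\<lambda>x. B x x"]) (auto simp: L2_space_def)
    show "AE a in N. norm (B (h a) (h a)) \<le> norm (K * (norm (h a))\<^sup>2)"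
      using K(1) K(2) by (intro AE_I2) (simp add: power2_eq_square mult_ac)
  qed
qed

lemma bilinear_integral_tendsto:
  fixes B :: "'x::real_normed_vector \<Rightarrow> 'x \<Rightarrow> real"
  assumes B: "bounded_bilinear B" and f: "f \<in> L2_space N" and g: "\<And>i::nat. strongly_measurable N (g i)"
    and lim: "(\<lambda>i. \<integral>\<^sup>+a. ennreal ((norm (f a - g i a))\<^sup>2) \<partial>N) \<longlonglongrightarrow> 0"
  shows "(\<lambda>i. \<integral>a. B (g i a) (g i a) \<partial>N) \<longlonglongrightarrow> (\<integral>a. B (f a) (f a) \<partial>N)"
proof (rule LIMSEQ_I)
  interpret B: bounded_bilinear B by (rule B)
  obtain K where K: "0 < K" "\<And>x y. norm (B x y) \<le> norm x * norm y * K" using B.pos_bounded by blast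
  note Bint = integrable_bilinear_L2[OF B]
  fix e :: real assume e: "0 < e"
  define I where "I = (\<integral>a. (norm (f a))\<^sup>2 \<partial>N)"
  have I: "0 \<le> I" unfolding I_def by simp
  \<comment> \<open>The weight \<open>\<eta>\<close> makes the part with the norm of
    \<open>f\<close> cost at most e/2. Then \<open>\<theta>\<close> bounds the distance so that the
    part with \<open>d\<close>, whose factor 1/\<open>\<eta>\<close> is now fixed, costs e/2 as
    well.\<close>
  define \<eta> where "\<eta> = e / (2 * K * (I + 1))"
  have \<eta>: "0 < \<eta>" unfolding \<eta>_def using e K I by simp
  define \<theta> where "\<theta> = e / (2 * K * (1 / \<eta> + 1))"
  have \<theta>: "0 < \<theta>" unfolding \<theta>_def using e K \<eta> by (simp add: add_pos_pos)
  have "\<forall>\<^sub>F i in sequentially. (\<integral>\<^sup>+a. ennreal ((norm (f a - g i a))\<^sup>2) \<partial>N) < ennreal \<theta>"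
    using lim \<theta> by (intro order_tendstoD) auto
  then obtain n0 where n0: "\<And>i. n0 \<le> i \<Longrightarrow> (\<integral>\<^sup>+a. ennreal ((norm (f a - g i a))\<^sup>2) \<partial>N) < ennreal \<theta>"
    unfolding eventually_sequentially by blast
  show "\<exists>n0. \<forall>n\<ge>n0. norm ((\<integral>a. B (g n a) (g n a) \<partial>N) - (\<integral>a. B (f a) (f a) \<partial>N)) < e"
  proof (intro exI[of _ n0] allI impI)
    fix i assume i: "n0 \<le> i"
    define d where "d a = f a - g i a" for a
    have d_meas: "strongly_measurable N d" unfolding d_def using f g by (intro strongly_measurable_diff) (auto simp: L2_space_def)
    have d_fin: "(\<integral>\<^sup>+a. ennreal ((norm (d a))\<^sup>2) \<partial>N) < ennreal \<theta>" using n0[OF i] by (simp add: d_def)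
    then have d: "d \<in> L2_space N" using d_meas by (auto simp: L2_space_iff intro: less_trans)
    have dI: "(\<integral>a. (norm (d a))\<^sup>2 \<partial>N) < \<theta>"
      using d_fin d unfolding nn_integral_norm_sq_L2[OF d] L2_norm_sq by (simp add: ennreal_less_iff)
    have "(\<lambda>a. f a + - 1 *\<^sub>R d a) \<in> L2_space N"
    proof -
      have "(\<lambda>a. - 1 *\<^sub>R d a) \<in> L2_space N"
        using d by (auto simp: L2_space_def intro!: strongly_measurable_scaleR[where c = "\<lambda>_. -1", simplified])
      from L2_space_add[OF f this] show ?thesis .
    qed
    then have gi: "g i \<in> L2_space N" by (simp add: d_def)
    have bound: "norm (B (g i a) (g i a) - B (f a) (f a)) \<le> K * (\<eta> * (norm (f a))\<^sup>2 + (1 / \<eta> + 1) * (norm (d a))\<^sup>2)" for a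
    proof -
      have "g i a = f a - d a" by (simp add: d_def)
      then have "B (g i a) (g i a) - B (f a) (f a) = B (d a) (d a) - B (f a) (d a) - B (d a) (f a)"
        by (simp add: B.diff_left B.diff_right)
      then have "norm (B (g i a) (g i a) - B (f a) (f a)) \<le> norm (B (d a) (d a)) + norm (B (f a) (d a)) + norm (B (d a) (f a))"
        by (simp add: abs_le_iff) linarith
      also have "\<dots> \<le> K * (norm (d a))\<^sup>2 + K * (2 * (norm (f a) * norm (d a)))"
        using K(2)[of "d a" "d a"] K(2)[of "f a" "d a"] K(2)[of "d a" "f a"]
        by (simp add: power2_eq_square algebra_simps)
      also have "\<dots> \<le> K * (norm (d a))\<^sup>2 + K * (\<eta> * (norm (f a))\<^sup>2 + (1 / \<eta>) * (norm (d a))\<^sup>2)"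
      proof -
        \<comment> \<open>The mixed terms are split by the weighted inequality 2 u v <= \<eta> u^2 +
          v^2 / \<eta>.\<close>
        have "0 \<le> (sqrt \<eta> * norm (f a) - norm (d a) / sqrt \<eta>)\<^sup>2" by simp
        also have "\<dots> = \<eta> * (norm (f a))\<^sup>2 + (1 / \<eta>) * (norm (d a))\<^sup>2 - 2 * (norm (f a) * norm (d a))"
          using \<eta> by (simp add: power2_diff power_mult_distrib power_divide)
        finally show ?thesis using K(1) by simp
      qed
      finally show ?thesis by (simp add: algebra_simps)
    qed
    have "norm ((\<integral>a. B (g i a) (g i a) \<partial>N) - (\<integral>a. B (f a) (f a) \<partial>N)) = norm (\<integral>a. B (g i a) (g i a) - B (f a) (f a) \<partial>N)"
      using Bint[OF gi] Bint[OF f] by simp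
    also have "\<dots> \<le> (\<integral>a. norm (B (g i a) (g i a) - B (f a) (f a)) \<partial>N)" by (rule integral_norm_bound)
    also have "\<dots> \<le> (\<integral>a. K * (\<eta> * (norm (f a))\<^sup>2 + (1 / \<eta> + 1) * (norm (d a))\<^sup>2) \<partial>N)"
      using Bint[OF gi] Bint[OF f] f d bound by (intro integral_mono) (auto simp: L2_space_def)
    also have "\<dots> = K * (\<eta> * I + (1 / \<eta> + 1) * (\<integral>a. (norm (d a))\<^sup>2 \<partial>N))"
      unfolding I_def using f d by (simp add: L2_space_def)
    also have "\<dots> < K * (\<eta> * (I + 1) + (1 / \<eta> + 1) * \<theta>)"
    proof -
      have "\<eta> * I \<le> \<eta> * (I + 1)" using \<eta> by simp
      moreover have "(1 / \<eta> + 1) * (\<integral>a. (norm (d a))\<^sup>2 \<partial>N) < (1 / \<eta> + 1) * \<theta>"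
        using dI \<eta> by (intro mult_strict_left_mono) (auto intro: add_pos_pos)
      ultimately show ?thesis using K(1) by simp
    qed
    also have "\<dots> = e"
    proof -
      have "I + 1 \<noteq> 0" using I by linarith
      then have "K * (\<eta> * (I + 1)) = e / 2" unfolding \<eta>_def using K(1) by simp
      moreover have "1 / \<eta> + 1 \<noteq> 0" using \<eta> by (metis add_pos_pos less_irrefl zero_less_divide_1_iff zero_less_one)
      then have "K * ((1 / \<eta> + 1) * \<theta>) = e / 2" unfolding \<theta>_def using K(1) by simp
      ultimately show ?thesis by (simp only: distrib_left)
    qed
    finally show "norm ((\<integral>a. B (g i a) (g i a) \<partial>N) - (\<integral>a. B (f a) (f a) \<partial>N)) < e" .
  qed
qed

text \<open>For positive \<open>\<delta>\<close> and \<open>t\<close> this is the nearest-point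
  projection onto [max 0 (t - \<delta>), t]. Applied to both endpoints it cuts an interval (a, b]
  down to the times that the kernel sees from \<open>t\<close>, up to the endpoint
  \<open>t\<close>.\<close>

definition clip :: "real \<Rightarrow> real \<Rightarrow> real \<Rightarrow> real" where
  "clip \<delta> t x = max (max 0 (t - \<delta>)) (min x t)"

lemma clip_bounds: "0 < \<delta> \<Longrightarrow> 0 < t \<Longrightarrow> 0 \<le> clip \<delta> t x \<and> clip \<delta> t x \<le> t"
  by (auto simp: clip_def)

lemma clip_mono: "x \<le> y \<Longrightarrow> clip \<delta> t x \<le> clip \<delta> t y"
  by (auto simp: clip_def)

lemma clip_ge: "x < t \<Longrightarrow> x \<le> clip \<delta> t x"
  by (auto simp: clip_def)

lemma clip_eq_top: "0 < \<delta> \<Longrightarrow> 0 < t \<Longrightarrow> t \<le> x \<Longrightarrow> clip \<delta> t x = t"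
  by (auto simp: clip_def)

lemma indicator_clip:
  "0 < \<delta> \<Longrightarrow> 0 < t \<Longrightarrow> indicator {clip \<delta> t a<..clip \<delta> t b} s =
    (indicator {a<..b} s * indicator {max 0 (t - \<delta>)<..t} s :: real)"
  by (auto simp: clip_def indicator_def)

lemma elementary_process_map_time_clip:
  assumes "0 < \<delta>" "0 < t"
  shows "elementary_process (map_time (clip \<delta> t) L) (\<omega>, s) = indicator {max 0 (t - \<delta>)<..t} s *\<^sub>R elementary_process L (\<omega>, s)"
  using assms
  by (induction L) (auto simp: elementary_process_def map_time_def indicator_clip scaleR_add_right mult_ac split: prod.split)

context brownian
begin

text \<open>An interval that keeps positive length starts before \<open>t\<close>. Its left endpoint
  has then only moved forward in time, so the event belongs to the later sigma-algebra too.\<close>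

lemma admissible_map_time_clip:
  assumes "admissible L" "0 < \<delta>" "0 < t"
  shows "admissible (map_time (clip \<delta> t) L)"
  unfolding admissible_def
proof safe
  fix a' b' A v assume "(a', b', A, v) \<in> set (map_time (clip \<delta> t) L)"
  then obtain a b where ab: "(a, b, A, v) \<in> set L" "a' = clip \<delta> t a" "b' = clip \<delta> t b"
    by (auto simp: map_time_def)
  then have ok: "0 \<le> a" "a \<le> b" "A \<in> sets M" "a < b \<Longrightarrow> A \<in> sets (F a)" using assms(1) by (auto simp: admissible_def)
  show "0 \<le> a'" "a' \<le> b'" "A \<in> sets M"
    using ab ok clip_bounds[OF assms(2,3)] clip_mono by auto
  assume lt: "a' < b'"
  then have "a < b" using ab ok by (cases "a = b") auto
  moreover have "a < t"
  proof (rule ccontr)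
    assume "\<not> a < t"
    then show False using lt ab ok assms clip_eq_top[of \<delta> t a] clip_eq_top[of \<delta> t b] by simp
  qed
  ultimately show "A \<in> sets (F a')" using ok sets_F_mono[of a a'] clip_ge[of a t \<delta>] ab by auto
qed

text \<open>Existence of the integral is part of the hypothesis. Both sides are then limits of the
  identity for elementary processes along the approximating sequence.\<close>

lemma ito_stochastic_integral:
  fixes B :: "'x::real_normed_vector \<Rightarrow> 'x \<Rightarrow> real"
  assumes B: "bounded_bilinear B" and Y: "stochastic_integral_is M F W \<phi> Y"
  shows "expectation (\<lambda>\<omega>. B (Y \<omega>) (Y \<omega>)) = (\<integral>z. B (\<phi> z) (\<phi> z) \<partial>space_time)"
proof -
  from Y obtain m t \<xi> where st: "\<And>i::nat. adapted_step F (m i) (t i) (\<xi> i)"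
    and l1: "(\<lambda>i. \<integral>\<^sup>+z. ennreal ((norm (\<phi> z - step_process (m i) (t i) (\<xi> i) z))\<^sup>2) \<partial>space_time) \<longlonglongrightarrow> 0"
    and l2: "(\<lambda>i. \<integral>\<^sup>+\<omega>. ennreal ((norm (Y \<omega> - step_integral W (m i) (t i) (\<xi> i) \<omega>))\<^sup>2) \<partial>M) \<longlonglongrightarrow> 0"
    and L2: "\<phi> \<in> L2_space space_time" "Y \<in> L2_space M"
    unfolding stochastic_integral_is_def L2_progressive_def by blast
  have "\<exists>L. admissible L \<and> (\<forall>\<omega> s. \<omega> \<in> space M \<longrightarrow> elementary_process L (\<omega>, s) = step_process (m i) (t i) (\<xi> i) (\<omega>, s)) \<and>
      (\<forall>\<omega>\<in>space M. elementary_integral W L \<omega> = step_integral W (m i) (t i) (\<xi> i) \<omega>)" for i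
  proof -
    obtain L where "admissible L" "\<And>\<omega> s. \<omega> \<in> space M \<Longrightarrow> elementary_process L (\<omega>, s) = step_process (m i) (t i) (\<xi> i) (\<omega>, s)"
      "\<And>V g \<omega>. \<omega> \<in> space M \<Longrightarrow> elementary_integral V (map_time g L) \<omega> = step_integral V (m i) (\<lambda>j. g (t i j)) (\<xi> i) \<omega>"
      using adapted_step_elementary[OF st] by blast
    from this(1,2) this(3)[of _ W "\<lambda>x. x"] show ?thesis unfolding map_time_id by blast
  qed
  then obtain L where L: "\<And>i. admissible (L i)"
    "\<And>i \<omega> s. \<omega> \<in> space M \<Longrightarrow> elementary_process (L i) (\<omega>, s) = step_process (m i) (t i) (\<xi> i) (\<omega>, s)"
    "\<And>i \<omega>. \<omega> \<in> space M \<Longrightarrow> elementary_integral W (L i) \<omega> = step_integral W (m i) (t i) (\<xi> i) \<omega>" by metis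
  have "(\<integral>\<^sup>+z. ennreal ((norm (\<phi> z - step_process (m i) (t i) (\<xi> i) z))\<^sup>2) \<partial>space_time) =
      (\<integral>\<^sup>+z. ennreal ((norm (\<phi> z - elementary_process (L i) z))\<^sup>2) \<partial>space_time)" for i
    by (intro nn_integral_cong) (auto simp: space_pair_measure L(2))
  then have 1: "(\<lambda>i. \<integral>z. B (elementary_process (L i) z) (elementary_process (L i) z) \<partial>space_time) \<longlonglongrightarrow> (\<integral>z. B (\<phi> z) (\<phi> z) \<partial>space_time)"
    using l1 by (intro bilinear_integral_tendsto[OF B L2(1)] strongly_measurable_elementary_process L) simp
  have "(\<integral>\<^sup>+\<omega>. ennreal ((norm (Y \<omega> - step_integral W (m i) (t i) (\<xi> i) \<omega>))\<^sup>2) \<partial>M) =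
      (\<integral>\<^sup>+\<omega>. ennreal ((norm (Y \<omega> - elementary_integral W (L i) \<omega>))\<^sup>2) \<partial>M)" for i
    by (intro nn_integral_cong) (auto simp: L(3))
  then have 2: "(\<lambda>i. expectation (\<lambda>\<omega>. B (elementary_integral W (L i) \<omega>) (elementary_integral W (L i) \<omega>))) \<longlonglongrightarrow> expectation (\<lambda>\<omega>. B (Y \<omega>) (Y \<omega>))"
    using l2 by (intro bilinear_integral_tendsto[OF B L2(2)] strongly_measurable_elementary_integral L) simp
  show ?thesis using LIMSEQ_unique[OF 2] 1 by (simp add: elementary_ito(3)[OF B L(1)])
qed

end

section \<open>Stochastic convolutions of step processes\<close>

context brownian
begin

text \<open>A version of \<open>W\<close> all of whose paths are continuous makes the stochastic convolution of a
  step process jointly measurable.\<close>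

lemma continuous_version:
  obtains V where "\<And>t. 0 \<le> t \<Longrightarrow> V t \<in> borel_measurable M" "\<And>\<omega>. continuous_on {0..} (\<lambda>t. V t \<omega>)"
    "AE \<omega> in M. \<forall>t. V t \<omega> = W t \<omega>"
proof -
  have "AE \<omega> in M. continuous_on {0..} (\<lambda>t. W t \<omega>)" using bm by (simp add: brownian_motion_def)
  then obtain N where N: "{\<omega>\<in>space M. \<not> continuous_on {0..} (\<lambda>t. W t \<omega>)} \<subseteq> N" "N \<in> null_sets M"
    by (auto simp: eventually_ae_filter)
  \<comment> \<open>Exceptional paths are replaced by the zero path. They are enclosed in a null set
    \<open>N\<close>, because the set of discontinuous paths need not be measurable itself.\<close>
  define V where "V t \<omega> = (if \<omega> \<in> space M - N then W t \<omega> else 0)" for t \<omega>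
  show thesis
  proof
    show "V t \<in> borel_measurable M" if "0 \<le> t" for t
      unfolding V_def using N W_measurable[OF that] by (intro measurable_If_set) auto
    show "continuous_on {0..} (\<lambda>t. V t \<omega>)" for \<omega>
      using N(1) by (cases "\<omega> \<in> space M - N") (auto simp: V_def)
    show "AE \<omega> in M. \<forall>t. V t \<omega> = W t \<omega>"
      using AE_not_in[OF N(2)] AE_space by eventually_elim (simp add: V_def)
  qed
qed

text \<open>The time \<open>g\<close> is rounded up to a grid of mesh 1/(i + 1). There are only
  countably many grid times, and path continuity gives the limit. Rounding upwards stays within the
  nonnegative times.\<close>

lemma jointly_measurable_continuous:
  fixes V :: "real \<Rightarrow> 'w \<Rightarrow> real" and g :: "real \<Rightarrow> real"
  assumes V: "\<And>t. 0 \<le> t \<Longrightarrow> V t \<in> borel_measurable M" "\<And>\<omega>. continuous_on {0..} (\<lambda>t. V t \<omega>)"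
    and g: "g \<in> borel_measurable lborel_pos" "\<And>t. 0 \<le> g t"
  shows "(\<lambda>z. V (g (snd z)) (fst z)) \<in> borel_measurable space_time"
proof (rule borel_measurable_LIMSEQ_metric)
  let ?k = "\<lambda>i z. nat \<lceil>g (snd z) * real (Suc i)\<rceil>"
  fix i
  have [measurable]: "g \<in> borel_measurable lborel_pos" by (rule g)
  show "(\<lambda>z. V (real (?k i z) / real (Suc i)) (fst z)) \<in> borel_measurable space_time"
  proof (rule measurable_compose_countable[where f = "\<lambda>k z. V (real k / real (Suc i)) (fst z)" and g = "?k i"])
    show "(\<lambda>z. V (real k / real (Suc i)) (fst z)) \<in> borel_measurable space_time" for k
      by (rule measurable_compose[OF measurable_fst V(1)]) simp
    show "?k i \<in> space_time \<rightarrow>\<^sub>M count_space UNIV" by measurable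
  qed
next
  fix z :: "'w \<times> real"
  let ?s = "\<lambda>i. real (nat \<lceil>g (snd z) * real (Suc i)\<rceil>) / real (Suc i)"
  have "?s \<longlonglongrightarrow> g (snd z)"
  proof (rule tendsto_sandwich[of "\<lambda>_. g (snd z)" _ _ "\<lambda>i. g (snd z) + 1 / real (Suc i)"])
    have "g (snd z) \<le> ?s i \<and> ?s i \<le> g (snd z) + 1 / real (Suc i)" for i
    proof -
      have "0 \<le> g (snd z) * real (Suc i)" using g(2) by simp
      then have "g (snd z) * real (Suc i) \<le> real (nat \<lceil>g (snd z) * real (Suc i)\<rceil>)"
        "real (nat \<lceil>g (snd z) * real (Suc i)\<rceil>) \<le> g (snd z) * real (Suc i) + 1"
        by (auto simp: of_nat_nat intro: le_of_int_ceiling ceiling_correct[THEN conjunct1] less_imp_le)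
      moreover have "x \<le> k / c \<and> k / c \<le> x + 1 / c" if "x * c \<le> k" "k \<le> x * c + 1" "0 < c" for x k c :: real
        using that by (simp add: pos_le_divide_eq pos_divide_le_eq distrib_right)
      ultimately show ?thesis by simp
    qed
    then show "\<forall>\<^sub>F i in sequentially. g (snd z) \<le> ?s i" "\<forall>\<^sub>F i in sequentially. ?s i \<le> g (snd z) + 1 / real (Suc i)"
      by auto
    show "(\<lambda>i. g (snd z) + 1 / real (Suc i)) \<longlonglongrightarrow> g (snd z)"
      using tendsto_add[OF tendsto_const LIMSEQ_inverse_real_of_nat] by (simp add: inverse_eq_divide)
  qed simp
  then show "(\<lambda>i. V (?s i) (fst z)) \<longlonglongrightarrow> V (g (snd z)) (fst z)"
  proof (rule continuous_on_tendsto_compose[OF V(2)])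
    show "g (snd z) \<in> {0..}" using g(2) by simp
    show "\<forall>\<^sub>F i in sequentially. ?s i \<in> {0..}"
      unfolding atLeast_iff by (intro always_eventually allI divide_nonneg_nonneg of_nat_0_le_iff)
  qed
qed

lemma strongly_measurable_convolution:
  fixes L :: "('w, 'x::real_normed_vector) elementary" and V :: "real \<Rightarrow> 'w \<Rightarrow> real"
  assumes V: "\<And>t. 0 \<le> t \<Longrightarrow> V t \<in> borel_measurable M" "\<And>\<omega>. continuous_on {0..} (\<lambda>t. V t \<omega>)"
    and L: "admissible L"
  shows "strongly_measurable space_time (\<lambda>z. elementary_integral V (map_time (clip \<delta> (snd z)) L) (fst z))"
  using L
proof (induction L)
  case Nil
  then show ?case by (simp add: elementary_integral_def map_time_def strongly_measurable_const)
next
  case (Cons p L)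
  obtain a b A v where p: "p = (a, b, A, v)" by (cases p) auto
  have eq: "elementary_integral V (map_time (clip \<delta> (snd z)) (p # L)) (fst z) =
    (indicator A (fst z) * (V (clip \<delta> (snd z) b) (fst z) - V (clip \<delta> (snd z) a) (fst z))) *\<^sub>R v +
    elementary_integral V (map_time (clip \<delta> (snd z)) L) (fst z)" for z
    by (simp add: elementary_integral_def map_time_def p)
  have "(\<lambda>z. V (clip \<delta> (snd z) x) (fst z)) \<in> borel_measurable space_time" for x
    by (rule jointly_measurable_continuous[OF V]) (auto simp: clip_def lborel_pos_def intro!: measurable_restrict_space1)
  moreover have "A \<in> sets M" using Cons.prems by (simp add: admissible_def p)
  then have "(\<lambda>z. indicator A (fst z) :: real) \<in> borel_measurable space_time" by measurable
  ultimately have "(\<lambda>z. indicator A (fst z) * (V (clip \<delta> (snd z) b) (fst z) - V (clip \<delta> (snd z) a) (fst z))) \<in> borel_measurable space_time"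
    by (intro borel_measurable_times borel_measurable_diff)
  then show ?case unfolding eq
    using Cons by (intro strongly_measurable_add strongly_measurable_scaleR strongly_measurable_const) (auto simp: admissible_def)
qed

text \<open>Clipped step processes live on intervals closed on the right, whereas the kernel window
  is open at \<open>t\<close>; the difference is a null set.\<close>

lemma AE_snd_neq: "AE z in space_time. snd z \<noteq> t"
proof -
  have "emeasure space_time (space M \<times> ({t} \<inter> {0<..})) = 0"
    by (subst lp.emeasure_pair_measure_Times) (auto simp: sets_lborel_pos emeasure_lborel_pos emeasure_lborel_countable)
  then have "space M \<times> ({t} \<inter> {0<..}) \<in> null_sets space_time"
    by (intro null_setsI) (auto intro!: pair_measureI simp: sets_lborel_pos)
  then show ?thesis by (rule AE_I') (auto simp: space_pair_measure)
qed

section \<open>The integrand of the convolution at a fixed time\<close>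

definition window :: "real \<Rightarrow> real \<Rightarrow> ('w \<times> real \<Rightarrow> 'x::complex_normed_vector) \<Rightarrow> 'w \<times> real \<Rightarrow> 'x" where
  "window \<delta> t G = (\<lambda>(\<omega>, s). indicator {0<..<t} s *\<^sub>R (h_kernel \<delta> (t - s) *\<^sub>C G (\<omega>, s)))"

lemma window_eq:
  assumes "0 < \<delta>"
  shows "window \<delta> t G z = (\<delta> powr (-1/2) * indicator {max 0 (t - \<delta>)<..<t} (snd z)) *\<^sub>R G z"
proof -
  obtain \<omega> s where z: "z = (\<omega>, s)" by (cases z)
  have "indicator {0<..<t} s * indicator {0<..<\<delta>} (t - s) = (indicator {max 0 (t - \<delta>)<..<t} s :: real)"
    using assms by (auto simp: indicator_def)
  then show ?thesis
    unfolding window_def h_kernel_def z case_prod_conv scaleC_of_real scaleR_scaleR snd_conv by (simp add: mult_ac)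
qed

lemma powr_half_sq: "0 < \<delta> \<Longrightarrow> (\<delta> powr (-1/2))\<^sup>2 = 1 / (\<delta>::real)"
proof -
  assume \<delta>: "0 < \<delta>"
  have "(\<delta> powr (-1/2))\<^sup>2 = \<delta> powr (-1/2 + -1/2)" unfolding power2_eq_square powr_add ..
  also have "\<dots> = \<delta> powr (- 1)" by simp
  also have "\<dots> = 1 / \<delta>" using \<delta> by (subst powr_minus_divide) simp
  finally show ?thesis .
qed

lemma window_L2_progressive:
  assumes \<delta>: "0 < \<delta>" and G: "G \<in> L2_progressive M F"
  shows "window \<delta> t G \<in> L2_progressive M F"
proof -
  let ?c = "\<lambda>s. \<delta> powr (-1/2) * indicator {max 0 (t - \<delta>)<..<t} s"
  have eq: "window \<delta> t G = (\<lambda>z. ?c (snd z) *\<^sub>R G z)" using window_eq[OF \<delta>, of t G] by (simp add: fun_eq_iff)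
  have [measurable]: "?c \<in> borel_measurable borel" by measurable
  have GL: "G \<in> L2_space space_time" and Gp: "progressive F G" using G by (auto simp: L2_progressive_def)
  have c1: "?c \<in> borel_measurable lborel_pos"
    unfolding lborel_pos_def by (rule measurable_restrict_space1) simp
  have c2: "?c \<in> borel_measurable (restrict_space borel {0<..r})" for r
    by (rule measurable_restrict_space1) simp
  have "strongly_measurable space_time (\<lambda>z. ?c (snd z) *\<^sub>R G z)"
    using GL by (intro strongly_measurable_scaleR measurable_compose[OF measurable_snd c1]) (simp add: L2_space_def)
  moreover have "(\<integral>\<^sup>+z. ennreal ((norm (?c (snd z) *\<^sub>R G z))\<^sup>2) \<partial>space_time) < \<infinity>"
  proof -
    have "(\<integral>\<^sup>+z. ennreal ((norm (?c (snd z) *\<^sub>R G z))\<^sup>2) \<partial>space_time) \<le> (\<integral>\<^sup>+z. ennreal ((norm (\<delta> powr (-1/2) *\<^sub>R G z))\<^sup>2) \<partial>space_time)"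
      by (intro nn_integral_mono ennreal_leI power_mono) (auto simp: indicator_def)
    also have "(\<lambda>z. \<delta> powr (-1/2) *\<^sub>R G z) \<in> L2_space space_time"
      using L2_space_scaleC[OF GL, of "complex_of_real (\<delta> powr (-1/2))"] by (simp add: scaleC_of_real)
    then have "(\<integral>\<^sup>+z. ennreal ((norm (\<delta> powr (-1/2) *\<^sub>R G z))\<^sup>2) \<partial>space_time) < \<infinity>" by (simp add: L2_space_iff)
    finally show ?thesis .
  qed
  ultimately have "(\<lambda>z. ?c (snd z) *\<^sub>R G z) \<in> L2_space space_time" by (simp add: L2_space_iff)
  moreover have "progressive F (\<lambda>z. ?c (snd z) *\<^sub>R G z)"
    unfolding progressive_def
  proof (intro allI impI strongly_measurable_scaleR)
    fix r :: real assume "0 < r"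
    then show "strongly_measurable (F r \<Otimes>\<^sub>M restrict_space borel {0<..r}) G" using Gp by (simp add: progressive_def)
    show "(\<lambda>z. ?c (snd z)) \<in> borel_measurable (F r \<Otimes>\<^sub>M restrict_space borel {0<..r})"
      by (rule measurable_compose[OF measurable_snd c2])
  qed
  ultimately show ?thesis by (simp add: L2_progressive_def eq)
qed

text \<open>Clipping its partition turns a step process close to \<open>G\<close> into one close to
  the integrand at time \<open>t\<close>. A single sequence of approximations of \<open>G\<close>
  thus serves every \<open>t\<close>, and only convergence of the clipped integrals remains as a
  hypothesis.\<close>

lemma stochastic_integral_window:
  fixes G :: "'w \<times> real \<Rightarrow> 'x::complex_normed_vector"
  assumes \<delta>: "0 < \<delta>" and t: "0 < t" and G: "G \<in> L2_progressive M F"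
    and st: "\<And>i::nat. adapted_step F (m i) (\<tau> i) (\<xi> i)"
    and lim: "(\<lambda>i. \<integral>\<^sup>+z. ennreal ((norm (G z - step_process (m i) (\<tau> i) (\<xi> i) z))\<^sup>2) \<partial>space_time) \<longlonglongrightarrow> 0"
    and Y: "Y \<in> L2_space M"
    and limY: "(\<lambda>i. \<integral>\<^sup>+\<omega>. ennreal ((norm (Y \<omega> - \<delta> powr (-1/2) *\<^sub>R step_integral W (m i) (\<lambda>j. clip \<delta> t (\<tau> i j)) (\<xi> i) \<omega>))\<^sup>2) \<partial>M) \<longlonglongrightarrow> 0"
  shows "stochastic_integral_is M F W (window \<delta> t G) Y"
proof -
  let ?d = "\<delta> powr (-1/2)"
  define \<tau>' where "\<tau>' i j = clip \<delta> t (\<tau> i j)" for i j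
  \<comment> \<open>A summand starting at \<open>t\<close> or later is clipped to an interval
    without length at \<open>t\<close>, where its coefficient need not be measurable yet. Setting
    the coefficient to 0 restores adaptedness and changes neither process nor integral.\<close>
  define \<xi>' where "\<xi>' i j \<omega> = (if \<tau> i j < t then ?d *\<^sub>R \<xi> i j \<omega> else 0)" for i j \<omega>
  have \<tau>_mono: "\<tau> i j \<le> \<tau> i (Suc j)" if "j < m i" for i j using st[of i] that by (simp add: adapted_step_def)
  have \<tau>_nonneg: "0 \<le> \<tau> i j" if "j \<le> m i" for i j
    using that
  proof (induction j)
    case 0
    then show ?case using st[of i] by (simp add: adapted_step_def)
  next
    case (Suc j)
    then show ?case using \<tau>_mono[of j i] by simp
  qed
  have \<xi>'_eq: "\<xi>' i j = (if \<tau> i j < t then (\<lambda>\<omega>. ?d *\<^sub>R \<xi> i j \<omega>) else (\<lambda>_. 0))" for i j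
    by (auto simp: \<xi>'_def fun_eq_iff)
  have step': "adapted_step F (m i) (\<tau>' i) (\<xi>' i)" for i
    unfolding adapted_step_def
  proof (intro conjI allI impI)
    show "0 \<le> \<tau>' i 0" using clip_bounds[OF \<delta> t] by (simp add: \<tau>'_def)
    fix j assume j: "j < m i"
    show "\<tau>' i j \<le> \<tau>' i (Suc j)" unfolding \<tau>'_def by (rule clip_mono[OF \<tau>_mono[OF j]])
    show "simple_function (F (\<tau>' i j)) (\<xi>' i j)"
    proof (cases "\<tau> i j < t")
      case True
      have sf: "simple_function (F (\<tau> i j)) (\<xi> i j)" using st[of i] j by (simp add: adapted_step_def)
      have le: "\<tau> i j \<le> \<tau>' i j" unfolding \<tau>'_def by (rule clip_ge[OF True])
      have nn: "0 \<le> \<tau> i j" using \<tau>_nonneg[of j i] j by simp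
      have "simple_function (F (\<tau>' i j)) (\<xi> i j)"
        using sf sets_F_mono[OF nn le] space_F[OF nn] space_F[of "\<tau>' i j"] nn le by (auto simp: simple_function_def)
      from simple_function_compose1[OF this, of "\<lambda>x. ?d *\<^sub>R x"] show ?thesis using True by (simp add: \<xi>'_eq)
    next
      case False
      then show ?thesis by (simp add: \<xi>'_eq)
    qed
  qed
  have proc: "step_process (m i) (\<tau>' i) (\<xi>' i) (\<omega>, s) = (?d * indicator {max 0 (t - \<delta>)<..t} s) *\<^sub>R step_process (m i) (\<tau> i) (\<xi> i) (\<omega>, s)" for i \<omega> s
  proof -
    have "indicator {\<tau>' i j<..\<tau>' i (Suc j)} s *\<^sub>R \<xi>' i j \<omega> = (?d * indicator {max 0 (t - \<delta>)<..t} s) *\<^sub>R (indicator {\<tau> i j<..\<tau> i (Suc j)} s *\<^sub>R \<xi> i j \<omega>)" for j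
    proof (cases "\<tau> i j < t")
      case True
      then show ?thesis by (simp add: \<tau>'_def \<xi>'_def indicator_clip[OF \<delta> t])
    next
      case False
      then show ?thesis by (simp add: \<xi>'_def indicator_def)
    qed
    then show ?thesis unfolding step_process_def case_prod_conv scaleR_sum_right by (simp only:)
  qed
  have int: "step_integral W (m i) (\<tau>' i) (\<xi>' i) \<omega> = ?d *\<^sub>R step_integral W (m i) (\<lambda>j. clip \<delta> t (\<tau> i j)) (\<xi> i) \<omega>" for i \<omega>
  proof -
    have "(W (\<tau>' i (Suc j)) \<omega> - W (\<tau>' i j) \<omega>) *\<^sub>R \<xi>' i j \<omega> =
        ?d *\<^sub>R ((W (clip \<delta> t (\<tau> i (Suc j))) \<omega> - W (clip \<delta> t (\<tau> i j)) \<omega>) *\<^sub>R \<xi> i j \<omega>)" if "j < m i" for j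
    proof (cases "\<tau> i j < t")
      case True
      then show ?thesis by (simp add: \<tau>'_def \<xi>'_def mult.commute)
    next
      case False
      then have "clip \<delta> t (\<tau> i j) = t" "clip \<delta> t (\<tau> i (Suc j)) = t"
        using \<tau>_mono[OF that] by (auto intro!: clip_eq_top \<delta> t)
      then show ?thesis using False by (simp add: \<xi>'_def)
    qed
    then show ?thesis unfolding step_integral_def scaleR_sum_right by (intro sum.cong) auto
  qed
  have le: "(\<integral>\<^sup>+z. ennreal ((norm (window \<delta> t G z - step_process (m i) (\<tau>' i) (\<xi>' i) z))\<^sup>2) \<partial>space_time) \<le>
      ennreal (1 / \<delta>) * (\<integral>\<^sup>+z. ennreal ((norm (G z - step_process (m i) (\<tau> i) (\<xi> i) z))\<^sup>2) \<partial>space_time)" for i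
  proof -
    obtain L where L: "admissible L" "\<And>\<omega> s. \<omega> \<in> space M \<Longrightarrow> elementary_process L (\<omega>, s) = step_process (m i) (\<tau> i) (\<xi> i) (\<omega>, s)"
      "\<And>V g \<omega>. \<omega> \<in> space M \<Longrightarrow> elementary_integral V (map_time g L) \<omega> = step_integral V (m i) (\<lambda>j. g (\<tau> i j)) (\<xi> i) \<omega>"
      using adapted_step_elementary[OF st] by blast
    have "strongly_measurable space_time (\<lambda>z. G z - elementary_process L z)"
      using G by (intro strongly_measurable_diff strongly_measurable_elementary_process L) (auto simp: L2_progressive_def L2_space_def)
    then have "strongly_measurable space_time (\<lambda>z. G z - step_process (m i) (\<tau> i) (\<xi> i) z)"
      by (subst strongly_measurable_cong[where g = "\<lambda>z. G z - elementary_process L z"]) (auto simp: space_pair_measure L(2))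
    note [measurable] = borel_measurable_norm_strongly_measurable[OF this]
    have "(\<integral>\<^sup>+z. ennreal ((norm (window \<delta> t G z - step_process (m i) (\<tau>' i) (\<xi>' i) z))\<^sup>2) \<partial>space_time) \<le>
      (\<integral>\<^sup>+z. ennreal (1 / \<delta>) * ennreal ((norm (G z - step_process (m i) (\<tau> i) (\<xi> i) z))\<^sup>2) \<partial>space_time)"
    proof (rule nn_integral_mono_AE)
      show "AE z in space_time. ennreal ((norm (window \<delta> t G z - step_process (m i) (\<tau>' i) (\<xi>' i) z))\<^sup>2) \<le>
        ennreal (1 / \<delta>) * ennreal ((norm (G z - step_process (m i) (\<tau> i) (\<xi> i) z))\<^sup>2)"
        using AE_snd_neq[of t]
      proof eventually_elim
        case (elim z)
        obtain \<omega> s where z: "z = (\<omega>, s)" by (cases z)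
        have ind: "indicator {max 0 (t - \<delta>)<..t} s = (indicator {max 0 (t - \<delta>)<..<t} s :: real)"
          using elim by (auto simp: z indicator_def)
        have "window \<delta> t G z - step_process (m i) (\<tau>' i) (\<xi>' i) z =
            (?d * indicator {max 0 (t - \<delta>)<..<t} s) *\<^sub>R (G z - step_process (m i) (\<tau> i) (\<xi> i) z)"
          unfolding window_eq[OF \<delta>] z proc ind by (simp add: scaleR_diff_right)
        then have "(norm (window \<delta> t G z - step_process (m i) (\<tau>' i) (\<xi>' i) z))\<^sup>2
          = (1 / \<delta>) * (indicator {max 0 (t - \<delta>)<..<t} s)\<^sup>2 * (norm (G z - step_process (m i) (\<tau> i) (\<xi> i) z))\<^sup>2"
          using \<delta> by (simp add: power_mult_distrib powr_half_sq[simplified] abs_mult)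
        also have "\<dots> \<le> (1 / \<delta>) * (norm (G z - step_process (m i) (\<tau> i) (\<xi> i) z))\<^sup>2"
          using \<delta> by (auto simp: indicator_def)
        finally show ?case using \<delta> by (simp add: ennreal_leI flip: ennreal_mult)
      qed
    qed
    also have "\<dots> = ennreal (1 / \<delta>) * (\<integral>\<^sup>+z. ennreal ((norm (G z - step_process (m i) (\<tau> i) (\<xi> i) z))\<^sup>2) \<partial>space_time)"
      by (intro nn_integral_cmult) measurable
    finally show ?thesis .
  qed
  have "(\<lambda>i. ennreal (1 / \<delta>) * (\<integral>\<^sup>+z. ennreal ((norm (G z - step_process (m i) (\<tau> i) (\<xi> i) z))\<^sup>2) \<partial>space_time)) \<longlonglongrightarrow> ennreal (1 / \<delta>) * 0"
    by (rule ennreal_tendsto_cmult[OF _ lim]) simp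
  then have lim': "(\<lambda>i. \<integral>\<^sup>+z. ennreal ((norm (window \<delta> t G z - step_process (m i) (\<tau>' i) (\<xi>' i) z))\<^sup>2) \<partial>space_time) \<longlonglongrightarrow> 0"
    (is "?f \<longlonglongrightarrow> 0")
  proof -
    assume *: "(\<lambda>i. ennreal (1 / \<delta>) * (\<integral>\<^sup>+z. ennreal ((norm (G z - step_process (m i) (\<tau> i) (\<xi> i) z))\<^sup>2) \<partial>space_time)) \<longlonglongrightarrow> ennreal (1 / \<delta>) * 0"
    show "?f \<longlonglongrightarrow> 0"
    proof (rule tendsto_sandwich)
      show "\<forall>\<^sub>F i in sequentially. 0 \<le> ?f i" by simp
      show "\<forall>\<^sub>F i in sequentially. ?f i \<le> ennreal (1 / \<delta>) * (\<integral>\<^sup>+z. ennreal ((norm (G z - step_process (m i) (\<tau> i) (\<xi> i) z))\<^sup>2) \<partial>space_time)"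
        using le by (intro always_eventually allI)
      show "(\<lambda>_. 0 :: ennreal) \<longlonglongrightarrow> 0" by (rule tendsto_const)
      show "(\<lambda>i. ennreal (1 / \<delta>) * (\<integral>\<^sup>+z. ennreal ((norm (G z - step_process (m i) (\<tau> i) (\<xi> i) z))\<^sup>2) \<partial>space_time)) \<longlonglongrightarrow> 0"
        using * by simp
    qed
  qed
  have limY': "(\<lambda>i. \<integral>\<^sup>+\<omega>. ennreal ((norm (Y \<omega> - step_integral W (m i) (\<tau>' i) (\<xi>' i) \<omega>))\<^sup>2) \<partial>M) \<longlonglongrightarrow> 0"
    unfolding int by (rule limY)
  show ?thesis
    unfolding stochastic_integral_is_def
    by (rule conjI[OF window_L2_progressive[OF \<delta> G] conjI[OF Y]], rule exI[of _ m], rule exI[of _ \<tau>'], rule exI[of _ \<xi>'],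
        rule conjI[OF allI[OF step'] conjI[OF lim' limY']])
qed

lemma measurable_window_indicator:
  "(\<lambda>p. indicator {max 0 (snd p - \<delta>)<..snd p} (snd (fst p)) :: ennreal) \<in> borel_measurable (space_time \<Otimes>\<^sub>M lborel_pos)"
proof -
  have "(\<lambda>t. t) \<in> borel_measurable lborel_pos" unfolding lborel_pos_def by (rule measurable_restrict_space1) simp
  note [measurable] = measurable_compose[OF measurable_snd this] measurable_compose[OF measurable_fst measurable_compose[OF measurable_snd this]]
  have eq: "(\<lambda>p::('w \<times> real) \<times> real. indicator {max 0 (snd p - \<delta>)<..snd p} (snd (fst p)) :: ennreal) =
      (\<lambda>p. if max 0 (snd p - \<delta>) < snd (fst p) \<and> snd (fst p) \<le> snd p then 1 else 0)"
    by (auto simp: fun_eq_iff indicator_def)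
  show ?thesis unfolding eq by measurable
qed

text \<open>A time s > 0 lies in the window of exactly those \<open>t\<close> with s <= t < s +
  \<delta>, a set of length \<open>\<delta>\<close>. This length cancels the squared height
  1/\<delta> of the kernel, so that the bounds below do not depend on
  \<open>\<delta>\<close>.\<close>

lemma nn_integral_window:
  assumes \<delta>: "0 < \<delta>" and [measurable]: "u \<in> borel_measurable space_time"
  shows "(\<integral>\<^sup>+t. \<integral>\<^sup>+z. indicator {max 0 (t - \<delta>)<..t} (snd z) * u z \<partial>space_time \<partial>lborel_pos) = ennreal \<delta> * (\<integral>\<^sup>+z. u z \<partial>space_time)"
proof -
  have "sigma_finite_measure space_time" by (rule sigma_finite_pair_measure) unfold_locales
  then interpret P: pair_sigma_finite space_time lborel_pos
    by (intro pair_sigma_finite.intro sigma_finite_lborel_pos)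
  note [measurable] = measurable_window_indicator[of \<delta>]
  have "(\<integral>\<^sup>+t. \<integral>\<^sup>+z. indicator {max 0 (t - \<delta>)<..t} (snd z) * u z \<partial>space_time \<partial>lborel_pos) =
    (\<integral>\<^sup>+z. \<integral>\<^sup>+t. indicator {max 0 (t - \<delta>)<..t} (snd z) * u z \<partial>lborel_pos \<partial>space_time)"
    by (rule P.Fubini') (simp add: split_beta')
  also have "\<dots> = (\<integral>\<^sup>+z. ennreal \<delta> * u z \<partial>space_time)"
  proof (rule nn_integral_cong)
    fix z assume "z \<in> space space_time"
    then have s: "0 < snd z" by (auto simp: space_pair_measure)
    have sets: "{snd z..<snd z + \<delta>} \<in> sets lborel_pos" using s by (auto simp: sets_lborel_pos)
    have "(\<integral>\<^sup>+t. indicator {max 0 (t - \<delta>)<..t} (snd z) * u z \<partial>lborel_pos) =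
      (\<integral>\<^sup>+t. u z * indicator {snd z..<snd z + \<delta>} t \<partial>lborel_pos)"
      using s by (intro nn_integral_cong) (auto simp: indicator_def)
    also have "\<dots> = u z * emeasure lborel_pos {snd z..<snd z + \<delta>}"
      using sets by (intro nn_integral_cmult_indicator)
    also have "emeasure lborel_pos {snd z..<snd z + \<delta>} = ennreal \<delta>"
      using s \<delta> by (subst emeasure_lborel_pos) auto
    finally show "(\<integral>\<^sup>+t. indicator {max 0 (t - \<delta>)<..t} (snd z) * u z \<partial>lborel_pos) = ennreal \<delta> * u z"
      by (simp add: mult.commute)
  qed
  also have "\<dots> = ennreal \<delta> * (\<integral>\<^sup>+z. u z \<partial>space_time)" by (rule nn_integral_cmult) simp
  finally show ?thesis .
qed

lemma borel_measurable_nn_integral_window: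
  assumes [measurable]: "u \<in> borel_measurable space_time"
  shows "(\<lambda>t. \<integral>\<^sup>+z. indicator {max 0 (t - \<delta>)<..t} (snd z) * u z \<partial>space_time) \<in> borel_measurable lborel_pos"
proof -
  have sf: "sigma_finite_measure space_time" by (rule sigma_finite_pair_measure) unfold_locales
  have "(\<lambda>p. indicator {max 0 (snd p - \<delta>)<..snd p} (snd (fst p)) * u (fst p)) \<in> borel_measurable (space_time \<Otimes>\<^sub>M lborel_pos)"
    using measurable_window_indicator[of \<delta>] by measurable
  from measurable_pair_swap[OF this] show ?thesis by (intro sigma_finite_measure.borel_measurable_nn_integral[OF sf]) (simp add: split_beta')
qed

lemma nn_integral_space_time:
  assumes u: "u \<in> borel_measurable space_time"
  shows "(\<integral>\<^sup>+z. u z \<partial>space_time) = (\<integral>\<^sup>+t. \<integral>\<^sup>+\<omega>. u (\<omega>, t) \<partial>M \<partial>lborel_pos)"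
  by (rule st.nn_integral_snd[OF u, symmetric])

lemma borel_measurable_nn_integral_section:
  assumes "u \<in> borel_measurable space_time"
  shows "(\<lambda>t. \<integral>\<^sup>+\<omega>. u (\<omega>, t) \<partial>M) \<in> borel_measurable lborel_pos"
  using measurable_pair_swap[OF assms] by (intro borel_measurable_nn_integral) simp

text \<open>The convolution of an elementary process computed path by path. With a version
  \<open>V\<close> that has continuous paths it is strongly measurable in both variables
  together.\<close>

definition convolution_version ::
  "(real \<Rightarrow> 'w \<Rightarrow> real) \<Rightarrow> real \<Rightarrow> ('w, 'x::real_normed_vector) elementary \<Rightarrow> 'w \<times> real \<Rightarrow> 'x" where
  "convolution_version V \<delta> L z = \<delta> powr (-1/2) *\<^sub>R elementary_integral V (map_time (clip \<delta> (snd z)) L) (fst z)"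

lemma elementary_integral_cong_version:
  assumes "AE \<omega> in M. \<forall>t. V t \<omega> = W t \<omega>"
  shows "AE \<omega> in M. elementary_integral V L \<omega> = elementary_integral W L \<omega>"
  using assms by eventually_elim (simp add: elementary_integral_def)

lemma nn_integral_elementary_integral_le:
  fixes B :: "'x::real_normed_vector \<Rightarrow> 'x \<Rightarrow> real" and L :: "('w, 'x) elementary"
  assumes B: "bounded_bilinear B" and c: "0 < c" and low: "\<And>x. c * (norm x)\<^sup>2 \<le> B x x"
    and up: "\<And>x. B x x \<le> K * (norm x)\<^sup>2" and L: "admissible L"
  shows "(\<integral>\<^sup>+\<omega>. ennreal ((norm (elementary_integral W L \<omega>))\<^sup>2) \<partial>M) \<le>
    ennreal (K / c) * (\<integral>\<^sup>+z. ennreal ((norm (elementary_process L z))\<^sup>2) \<partial>space_time)"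
proof -
  note ito = elementary_ito[OF B L]
  have nn: "0 \<le> B x x" for x using low[of x] c by (meson less_imp_le mult_nonneg_nonneg order_trans zero_le_power2)
  note [measurable] = borel_measurable_norm_strongly_measurable[OF strongly_measurable_elementary_process[OF L]]
  have "(norm x)\<^sup>2 \<le> (1 / c) * B x x" for x using low[of x] c by (simp add: field_simps)
  then have "(\<integral>\<^sup>+\<omega>. ennreal ((norm (elementary_integral W L \<omega>))\<^sup>2) \<partial>M) \<le>
      (\<integral>\<^sup>+\<omega>. ennreal ((1 / c) * B (elementary_integral W L \<omega>) (elementary_integral W L \<omega>)) \<partial>M)"
    by (intro nn_integral_mono ennreal_leI)
  also have "\<dots> = ennreal ((1 / c) * expectation (\<lambda>\<omega>. B (elementary_integral W L \<omega>) (elementary_integral W L \<omega>)))"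
    using ito(1) c nn by (subst nn_integral_eq_integral) auto
  also have "\<dots> = (\<integral>\<^sup>+z. ennreal ((1 / c) * B (elementary_process L z) (elementary_process L z)) \<partial>space_time)"
    unfolding ito(3) using ito(2) c nn by (subst nn_integral_eq_integral) auto
  also have "\<dots> \<le> (\<integral>\<^sup>+z. ennreal (K / c) * ennreal ((norm (elementary_process L z))\<^sup>2) \<partial>space_time)"
  proof (rule nn_integral_mono)
    fix z
    have "(1 / c) * B (elementary_process L z) (elementary_process L z) \<le> (K / c) * (norm (elementary_process L z))\<^sup>2"
      using up[of "elementary_process L z"] c by (simp add: divide_right_mono)
    then show "ennreal ((1 / c) * B (elementary_process L z) (elementary_process L z)) \<le> ennreal (K / c) * ennreal ((norm (elementary_process L z))\<^sup>2)"
      by (metis ennreal_leI ennreal_mult'' zero_le_power2)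
  qed
  also have "\<dots> = ennreal (K / c) * (\<integral>\<^sup>+z. ennreal ((norm (elementary_process L z))\<^sup>2) \<partial>space_time)"
    by (rule nn_integral_cmult) measurable
  finally show ?thesis .
qed

lemma strongly_measurable_convolution_version:
  fixes V :: "real \<Rightarrow> 'w \<Rightarrow> real"
  assumes V: "\<And>t. 0 \<le> t \<Longrightarrow> V t \<in> borel_measurable M" "\<And>\<omega>. continuous_on {0..} (\<lambda>t. V t \<omega>)"
    and L: "admissible L"
  shows "strongly_measurable space_time (convolution_version V \<delta> L)"
proof -
  have "convolution_version V \<delta> L = (\<lambda>z. \<delta> powr (-1/2) *\<^sub>R elementary_integral V (map_time (clip \<delta> (snd z)) L) (fst z))"
    by (simp add: convolution_version_def fun_eq_iff)
  then show ?thesis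
    using strongly_measurable_scaleR[OF borel_measurable_const strongly_measurable_convolution[OF V L]] by simp
qed

text \<open>Applied to differences of elementary processes, this makes the approximating
  convolutions a Cauchy sequence.\<close>

lemma nn_integral_convolution_version_le:
  fixes B :: "'x::real_normed_vector \<Rightarrow> 'x \<Rightarrow> real" and V :: "real \<Rightarrow> 'w \<Rightarrow> real"
    and L :: "('w, 'x) elementary"
  assumes B: "bounded_bilinear B" and c: "0 < c" and low: "\<And>x. c * (norm x)\<^sup>2 \<le> B x x"
    and up: "\<And>x. B x x \<le> K * (norm x)\<^sup>2" and L: "admissible L" and \<delta>: "0 < \<delta>"
    and V: "\<And>t. 0 \<le> t \<Longrightarrow> V t \<in> borel_measurable M" "\<And>\<omega>. continuous_on {0..} (\<lambda>t. V t \<omega>)"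
      "AE \<omega> in M. \<forall>t. V t \<omega> = W t \<omega>"
  shows "(\<integral>\<^sup>+z. ennreal ((norm (convolution_version V \<delta> L z))\<^sup>2) \<partial>space_time) \<le>
    ennreal (K / c) * (\<integral>\<^sup>+z. ennreal ((norm (elementary_process L z))\<^sup>2) \<partial>space_time)"
proof -
  note [measurable] = borel_measurable_norm_strongly_measurable[OF strongly_measurable_elementary_process[OF L]]
    borel_measurable_norm_strongly_measurable[OF strongly_measurable_convolution_version[OF V(1,2) L]]
  have inner: "(\<integral>\<^sup>+\<omega>. ennreal ((norm (convolution_version V \<delta> L (\<omega>, t)))\<^sup>2) \<partial>M) \<le>
    ennreal (1 / \<delta>) * (ennreal (K / c) * (\<integral>\<^sup>+z. indicator {max 0 (t - \<delta>)<..t} (snd z) * ennreal ((norm (elementary_process L z))\<^sup>2) \<partial>space_time))"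
    if t: "0 < t" for t
  proof -
    let ?L = "map_time (clip \<delta> t) L"
    have L': "admissible ?L" by (rule admissible_map_time_clip[OF L \<delta> t])
    note [measurable] = borel_measurable_norm_strongly_measurable[OF strongly_measurable_elementary_integral[OF L']]
    have "(\<integral>\<^sup>+\<omega>. ennreal ((norm (convolution_version V \<delta> L (\<omega>, t)))\<^sup>2) \<partial>M) =
      (\<integral>\<^sup>+\<omega>. ennreal (1 / \<delta>) * ennreal ((norm (elementary_integral W ?L \<omega>))\<^sup>2) \<partial>M)"
    proof (rule nn_integral_cong_AE)
      show "AE \<omega> in M. ennreal ((norm (convolution_version V \<delta> L (\<omega>, t)))\<^sup>2) = ennreal (1 / \<delta>) * ennreal ((norm (elementary_integral W ?L \<omega>))\<^sup>2)"
        using elementary_integral_cong_version[OF V(3), of ?L]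
      proof eventually_elim
        case (elim \<omega>)
        show ?case using \<delta>
          by (simp add: convolution_version_def elim power_mult_distrib powr_half_sq[simplified] flip: ennreal_mult)
      qed
    qed
    also have "\<dots> = ennreal (1 / \<delta>) * (\<integral>\<^sup>+\<omega>. ennreal ((norm (elementary_integral W ?L \<omega>))\<^sup>2) \<partial>M)"
      by (rule nn_integral_cmult) measurable
    also have "\<dots> \<le> ennreal (1 / \<delta>) * (ennreal (K / c) * (\<integral>\<^sup>+z. ennreal ((norm (elementary_process ?L z))\<^sup>2) \<partial>space_time))"
      by (intro mult_left_mono nn_integral_elementary_integral_le[OF B c low up L']) simp
    also have "(\<integral>\<^sup>+z. ennreal ((norm (elementary_process ?L z))\<^sup>2) \<partial>space_time) =
      (\<integral>\<^sup>+z. indicator {max 0 (t - \<delta>)<..t} (snd z) * ennreal ((norm (elementary_process L z))\<^sup>2) \<partial>space_time)"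
    proof (rule nn_integral_cong)
      fix z :: "'w \<times> real"
      obtain \<omega> s where z: "z = (\<omega>, s)" by (cases z)
      show "ennreal ((norm (elementary_process ?L z))\<^sup>2) = indicator {max 0 (t - \<delta>)<..t} (snd z) * ennreal ((norm (elementary_process L z))\<^sup>2)"
        unfolding z elementary_process_map_time_clip[OF \<delta> t] by (simp add: indicator_def)
    qed
    finally show ?thesis .
  qed
  have m1: "(\<lambda>t. \<integral>\<^sup>+z. indicator {max 0 (t - \<delta>)<..t} (snd z) * ennreal ((norm (elementary_process L z))\<^sup>2) \<partial>space_time) \<in> borel_measurable lborel_pos"
    by (rule borel_measurable_nn_integral_window) measurable
  have "(\<integral>\<^sup>+z. ennreal ((norm (convolution_version V \<delta> L z))\<^sup>2) \<partial>space_time) =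
      (\<integral>\<^sup>+t. \<integral>\<^sup>+\<omega>. ennreal ((norm (convolution_version V \<delta> L (\<omega>, t)))\<^sup>2) \<partial>M \<partial>lborel_pos)"
    by (rule nn_integral_space_time) measurable
  also have "\<dots> \<le> (\<integral>\<^sup>+t. ennreal (1 / \<delta>) * (ennreal (K / c) * (\<integral>\<^sup>+z. indicator {max 0 (t - \<delta>)<..t} (snd z) * ennreal ((norm (elementary_process L z))\<^sup>2) \<partial>space_time)) \<partial>lborel_pos)"
    by (intro nn_integral_mono inner) simp
  also have "\<dots> = ennreal (1 / \<delta>) * (ennreal (K / c) * (ennreal \<delta> * (\<integral>\<^sup>+z. ennreal ((norm (elementary_process L z))\<^sup>2) \<partial>space_time)))"
    using m1 by (simp add: nn_integral_cmult nn_integral_window[OF \<delta>])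
  also have "\<dots> = (ennreal (1 / \<delta>) * ennreal \<delta>) * (ennreal (K / c) * (\<integral>\<^sup>+z. ennreal ((norm (elementary_process L z))\<^sup>2) \<partial>space_time))"
    by (simp only: mult_ac)
  also have "ennreal (1 / \<delta>) * ennreal \<delta> = 1" using \<delta> by (simp flip: ennreal_mult)
  finally show ?thesis by simp
qed

definition is_convolution :: "real \<Rightarrow> ('w \<times> real \<Rightarrow> 'x::complex_normed_vector) \<Rightarrow> ('w \<times> real \<Rightarrow> 'x) \<Rightarrow> bool" where
  "is_convolution \<delta> G S \<longleftrightarrow> S \<in> L2_space space_time \<and>
    (AE t in lborel_pos. stochastic_integral_is M F W (window \<delta> t G) (\<lambda>\<omega>. S (\<omega>, t)))"

text \<open>The predicate \<open>is_convolution\<close> is the property under the choice operator.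
  The chosen representative is known to have it only after some \<open>S\<close> has been
  found.\<close>

lemma is_convolution_stochastic_convolution:
  assumes "is_convolution \<delta> G S"
  shows "is_convolution \<delta> G (stochastic_convolution M F W (h_kernel \<delta>) G)"
proof -
  have eq: "stochastic_convolution M F W (h_kernel \<delta>) G = (SOME S. is_convolution \<delta> G S)"
    unfolding is_convolution_def stochastic_convolution_def window_def ..
  show ?thesis unfolding eq by (rule someI[of "is_convolution \<delta> G", OF assms])
qed

text \<open>Convergence is demanded at almost every fixed time, as in the definition of the
  convolution; convergence in mean square over space and time together would be too weak for a fixed
  sequence.\<close>

lemma is_convolution_if_limit:
  fixes G :: "'w \<times> real \<Rightarrow> 'x::complex_normed_vector"
  assumes \<delta>: "0 < \<delta>" and G: "G \<in> L2_progressive M F" and S: "S \<in> L2_space space_time"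
    and st: "\<And>i::nat. adapted_step F (m i) (\<tau> i) (\<xi> i)"
    and lim: "(\<lambda>i. \<integral>\<^sup>+z. ennreal ((norm (G z - step_process (m i) (\<tau> i) (\<xi> i) z))\<^sup>2) \<partial>space_time) \<longlonglongrightarrow> 0"
    and L: "\<And>i V g \<omega>. \<omega> \<in> space M \<Longrightarrow> elementary_integral V (map_time g (L i)) \<omega> = step_integral V (m i) (\<lambda>j. g (\<tau> i j)) (\<xi> i) \<omega>"
    and V: "AE \<omega> in M. \<forall>t. V t \<omega> = W t \<omega>"
    and limS: "AE t in lborel_pos. (\<lambda>i. \<integral>\<^sup>+\<omega>. ennreal ((norm (S (\<omega>, t) - convolution_version V \<delta> (L i) (\<omega>, t)))\<^sup>2) \<partial>M) \<longlonglongrightarrow> 0"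
  shows "is_convolution \<delta> G S"
proof -
  have sm: "strongly_measurable space_time S" and fin: "(\<integral>\<^sup>+z. ennreal ((norm (S z))\<^sup>2) \<partial>space_time) < \<infinity>"
    using S by (simp_all add: L2_space_iff)
  note [measurable] = borel_measurable_norm_strongly_measurable[OF sm]
  have "(\<integral>\<^sup>+t. \<integral>\<^sup>+\<omega>. ennreal ((norm (S (\<omega>, t)))\<^sup>2) \<partial>M \<partial>lborel_pos) < \<infinity>"
    using fin by (subst (asm) nn_integral_space_time) measurable
  moreover have "(\<lambda>t. \<integral>\<^sup>+\<omega>. ennreal ((norm (S (\<omega>, t)))\<^sup>2) \<partial>M) \<in> borel_measurable lborel_pos"
    by (rule borel_measurable_nn_integral_section) measurable
  ultimately have "AE t in lborel_pos. (\<integral>\<^sup>+\<omega>. ennreal ((norm (S (\<omega>, t)))\<^sup>2) \<partial>M) \<noteq> \<infinity>"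
    by (intro nn_integral_PInf_AE) auto
  then have "AE t in lborel_pos. stochastic_integral_is M F W (window \<delta> t G) (\<lambda>\<omega>. S (\<omega>, t))"
    using limS AE_space
  proof eventually_elim
    case (elim t)
    then have t: "0 < t" by simp
    have "(\<lambda>\<omega>. (\<omega>, t)) \<in> M \<rightarrow>\<^sub>M space_time" using t by (intro measurable_Pair2') simp
    then have "strongly_measurable M (\<lambda>\<omega>. S (\<omega>, t))" by (rule strongly_measurable_compose[OF sm])
    then have Y: "(\<lambda>\<omega>. S (\<omega>, t)) \<in> L2_space M" using elim by (simp add: L2_space_iff less_top)
    have eq: "(\<integral>\<^sup>+\<omega>. ennreal ((norm (S (\<omega>, t) - convolution_version V \<delta> (L i) (\<omega>, t)))\<^sup>2) \<partial>M) =
      (\<integral>\<^sup>+\<omega>. ennreal ((norm (S (\<omega>, t) - \<delta> powr (-1/2) *\<^sub>R step_integral W (m i) (\<lambda>j. clip \<delta> t (\<tau> i j)) (\<xi> i) \<omega>))\<^sup>2) \<partial>M)" for i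
    proof (rule nn_integral_cong_AE)
      show "AE \<omega> in M. ennreal ((norm (S (\<omega>, t) - convolution_version V \<delta> (L i) (\<omega>, t)))\<^sup>2) =
        ennreal ((norm (S (\<omega>, t) - \<delta> powr (-1/2) *\<^sub>R step_integral W (m i) (\<lambda>j. clip \<delta> t (\<tau> i j)) (\<xi> i) \<omega>))\<^sup>2)"
        using elementary_integral_cong_version[OF V, of "map_time (clip \<delta> t) (L i)"] AE_space
        by eventually_elim (simp add: convolution_version_def L)
    qed
    show ?case
      by (rule stochastic_integral_window[OF \<delta> t G st lim Y]) (use elim(2) in \<open>simp only: eq\<close>)
  qed
  with S show ?thesis by (simp add: is_convolution_def)
qed

end

section \<open>Cotype 2 from condition $(S_2)$\<close>

text \<open>The square of a norming functional is a form that lies below the squared norm, with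
  equality at \<open>x\<close>. Through it the Ito isometry bounds norms from below where the norm
  is not equivalent to a quadratic form.\<close>

lemma norming_bilinear_form:
  fixes x :: "'x::real_normed_vector"
  obtains f :: "'x \<Rightarrow> real" where "bounded_bilinear (\<lambda>y z. f y * f z)" "\<And>y. (f y)\<^sup>2 \<le> (norm y)\<^sup>2" "(f x)\<^sup>2 = (norm x)\<^sup>2"
    "\<And>c y. f (c *\<^sub>R y) = c * f y"
proof -
  obtain f :: "'x \<Rightarrow> real" where f: "linear f" "\<And>y. \<bar>f y\<bar> \<le> norm y" "f x = norm x"
    using norming_functional_exists[of x] by blast
  have bl: "bounded_linear f"
    by (rule bounded_linear_intro[where K = 1]) (use f linear_add[OF f(1)] linear_scale[OF f(1)] in auto)
  have "bounded_bilinear (\<lambda>y z. f y * f z)" by (rule bounded_bilinear.comp[OF bounded_bilinear_mult bl bl])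
  moreover have "(f y)\<^sup>2 \<le> (norm y)\<^sup>2" for y using f(2)[of y] by (metis abs_le_square_iff abs_norm_cancel)
  ultimately show thesis using that[of f] f(3) linear_scale[OF f(1)] by simp
qed

text \<open>The form of a functional that norms \<open>y k\<close> is averaged over 1 and
  \<open>\<i>\<close>. Only the first of these two terms is controlled, hence the factor
  1/2.\<close>

lemma rademacher_norm_sum_lower:
  fixes y :: "nat \<Rightarrow> 'x::complex_normed_vector"
  assumes "k < n"
  shows "(norm (y k))\<^sup>2 / 2 \<le> (\<integral>\<epsilon>. (norm (\<Sum>i<n. \<epsilon> i *\<^sub>C y i))\<^sup>2 \<partial>rademacher)"
proof -
  obtain f :: "'x \<Rightarrow> real" where f: "bounded_bilinear (\<lambda>y z. f y * f z)" "\<And>y. (f y)\<^sup>2 \<le> (norm y)\<^sup>2" "(f (y k))\<^sup>2 = (norm (y k))\<^sup>2"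
    "\<And>c z. f (c *\<^sub>R z) = c * f z"
    using norming_bilinear_form[of "y k"] by blast
  have "(norm (y k))\<^sup>2 / 2 \<le> ((f (y k))\<^sup>2 + (f (\<i> *\<^sub>C y k))\<^sup>2) / 2" using f(3) by simp
  also have "\<dots> \<le> (\<Sum>i<n. ((f (y i))\<^sup>2 + (f (\<i> *\<^sub>C y i))\<^sup>2) / 2)"
    using assms by (intro member_le_sum[of k "{..<n}" "\<lambda>i. ((f (y i))\<^sup>2 + (f (\<i> *\<^sub>C y i))\<^sup>2) / 2"]) auto
  also have "\<dots> = (\<integral>\<epsilon>. f (\<Sum>i<n. \<epsilon> i *\<^sub>C y i) * f (\<Sum>i<n. \<epsilon> i *\<^sub>C y i) \<partial>rademacher)"
    unfolding integral_rademacher_bilinear(1)[OF f(1)] by (simp add: power2_eq_square)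
  also have "\<dots> \<le> (\<integral>\<epsilon>. (norm (\<Sum>i<n. \<epsilon> i *\<^sub>C y i))\<^sup>2 \<partial>rademacher)"
    using f(2) by (intro integral_mono integral_rademacher_bilinear(2)[OF f(1)] integrable_rademacher_norm_sum)
      (simp add: power2_eq_square)
  finally show ?thesis .
qed

context brownian
begin

definition unit_process :: "'x::real_normed_vector \<Rightarrow> 'w \<times> real \<Rightarrow> 'x" where
  "unit_process x = (\<lambda>z. indicator {0<..1} (snd z) *\<^sub>R x)"

lemma nn_integral_unit_process: "(\<integral>\<^sup>+z. ennreal ((norm (unit_process x z))\<^sup>2) \<partial>space_time) = ennreal ((norm x)\<^sup>2)"
proof -
  have R: "space M \<times> {0<..1} \<in> sets space_time" by (rule rectangle_sets) auto
  have "(\<integral>\<^sup>+z. ennreal ((norm (unit_process x z))\<^sup>2) \<partial>space_time) =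
      (\<integral>\<^sup>+z. ennreal ((norm x)\<^sup>2) * indicator (space M \<times> {0<..1}) z \<partial>space_time)"
    by (intro nn_integral_cong) (auto simp: unit_process_def indicator_def space_pair_measure)
  also have "\<dots> = ennreal ((norm x)\<^sup>2) * emeasure space_time (space M \<times> {0<..1})"
    using R by (rule nn_integral_cmult_indicator)
  also have "emeasure space_time (space M \<times> {0<..1}) = 1"
    by (subst emeasure_rectangle) (auto simp: prob_space)
  finally show ?thesis by simp
qed

lemma unit_process_L2: "unit_process x \<in> L2_space space_time"
proof -
  have "(\<lambda>s. indicator {0<..1} s :: real) \<in> borel_measurable lborel_pos"
    unfolding lborel_pos_def by (rule measurable_restrict_space1) simp
  then have "strongly_measurable space_time (unit_process x)"
    unfolding unit_process_def
    by (intro strongly_measurable_scaleR measurable_compose[OF measurable_snd] strongly_measurable_const)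
  then show ?thesis by (simp add: L2_space_iff nn_integral_unit_process)
qed

lemma unit_process_L2_progressive: "unit_process x \<in> L2_progressive M F"
proof -
  have "(\<lambda>s. indicator {0<..1} s :: real) \<in> borel_measurable (restrict_space borel {0<..r})" for r :: real
    by (rule measurable_restrict_space1) simp
  then have "progressive F (unit_process x)"
    unfolding progressive_def unit_process_def
    by (intro allI impI strongly_measurable_scaleR measurable_compose[OF measurable_snd] strongly_measurable_const)
  then show ?thesis by (simp add: L2_progressive_def unit_process_L2)
qed

text \<open>No form equivalent to the norm is available on the range. The process is a scalar
  process times \<open>x\<close>, so the bound is taken from the real line, with multiplication as
  the form.\<close>

lemma is_convolution_unit_process:
  fixes x :: "'x::complex_normed_vector"
  assumes \<delta>: "0 < \<delta>"
  shows "\<exists>S. is_convolution \<delta> (unit_process x) S"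
proof -
  obtain V where V: "\<And>t. 0 \<le> t \<Longrightarrow> V t \<in> borel_measurable M" "\<And>\<omega>. continuous_on {0..} (\<lambda>t. V t \<omega>)"
    "AE \<omega> in M. \<forall>t. V t \<omega> = W t \<omega>"
    using continuous_version by blast
  define L0 :: "('w, real) elementary" where "L0 = [(0, 1, space M, 1)]"
  define L :: "('w, 'x) elementary" where "L = [(0, 1, space M, x)]"
  have "space M \<in> sets (F 0)" using space_F[of 0] sets.top[of "F 0"] by simp
  then have adm: "admissible L0" "admissible L" by (auto simp: admissible_def L0_def L_def)
  let ?S = "convolution_version V \<delta> L"
  have S_eq: "?S z = convolution_version V \<delta> L0 z *\<^sub>R x" for z
    by (simp add: convolution_version_def L0_def L_def map_time_def elementary_integral_def)
  have "(\<integral>\<^sup>+z. ennreal ((norm (convolution_version V \<delta> L0 z))\<^sup>2) \<partial>space_time) \<le>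
      ennreal (1 / 1) * (\<integral>\<^sup>+z. ennreal ((norm (elementary_process L0 z))\<^sup>2) \<partial>space_time)"
    by (rule nn_integral_convolution_version_le[OF bounded_bilinear_mult _ _ _ adm(1) \<delta> V]) (auto simp: power2_eq_square)
  also have "(\<integral>\<^sup>+z. ennreal ((norm (elementary_process L0 z))\<^sup>2) \<partial>space_time) = (\<integral>\<^sup>+z. ennreal ((norm (unit_process (1::real) z))\<^sup>2) \<partial>space_time)"
    by (intro nn_integral_cong) (auto simp: elementary_process_def L0_def unit_process_def space_pair_measure indicator_def)
  finally have fin0: "(\<integral>\<^sup>+z. ennreal ((norm (convolution_version V \<delta> L0 z))\<^sup>2) \<partial>space_time) \<le> 1"
    using nn_integral_unit_process[of "1::real"] by simp
  note [measurable] = borel_measurable_norm_strongly_measurable[OF strongly_measurable_convolution_version[OF V(1,2) adm(1)]]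
  have "(\<integral>\<^sup>+z. ennreal ((norm (?S z))\<^sup>2) \<partial>space_time) =
      (\<integral>\<^sup>+z. ennreal ((norm x)\<^sup>2) * ennreal ((norm (convolution_version V \<delta> L0 z))\<^sup>2) \<partial>space_time)"
    by (intro nn_integral_cong) (simp add: S_eq power_mult_distrib mult.commute flip: ennreal_mult)
  also have "\<dots> = ennreal ((norm x)\<^sup>2) * (\<integral>\<^sup>+z. ennreal ((norm (convolution_version V \<delta> L0 z))\<^sup>2) \<partial>space_time)"
    by (rule nn_integral_cmult) measurable
  also have "\<dots> < \<infinity>" using fin0 by (auto simp: ennreal_mult_less_top intro: le_less_trans)
  finally have S: "?S \<in> L2_space space_time"
    using strongly_measurable_convolution_version[OF V(1,2) adm(2)] by (simp add: L2_space_iff)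
  have "is_convolution \<delta> (unit_process x) ?S"
  proof (rule is_convolution_if_limit[OF \<delta> unit_process_L2_progressive S])
    \<comment> \<open>The grid \<open>real\<close> has the nodes 0 and 1, and a single step
      represents the process exactly; the approximating sequence is constant.\<close>
    show "adapted_step F 1 real (\<lambda>_ _. x)" for i :: nat by (simp add: adapted_step_def)
    have "unit_process x z - step_process 1 real (\<lambda>_ _. x) z = 0" for z
      by (cases z) (simp add: unit_process_def step_process_def)
    then show "(\<lambda>i::nat. \<integral>\<^sup>+z. ennreal ((norm (unit_process x z - step_process 1 real (\<lambda>_ _. x) z))\<^sup>2) \<partial>space_time) \<longlonglongrightarrow> 0"
      by simp
    show "elementary_integral V' (map_time g L) \<omega> = step_integral V' 1 (\<lambda>j. g (real j)) (\<lambda>_ _. x) \<omega>"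
      if "\<omega> \<in> space M" for i :: nat and V' g \<omega>
      using that by (simp add: elementary_integral_def map_time_def L_def step_integral_def)
    show "AE \<omega> in M. \<forall>t. V t \<omega> = W t \<omega>" by (rule V(3))
    show "AE t in lborel_pos. (\<lambda>i::nat. \<integral>\<^sup>+\<omega>. ennreal ((norm (?S (\<omega>, t) - convolution_version V \<delta> L (\<omega>, t)))\<^sup>2) \<partial>M) \<longlonglongrightarrow> 0"
      by simp
  qed
  then show ?thesis by blast
qed

text \<open>For t in (\<delta>/2, \<delta>) the window covers all of (0, 1], since t > 1 and t -
  \<delta> < 0. The mean square at such a \<open>t\<close> is at least the squared norm divided by
  \<open>\<delta>\<close>, and these times fill an interval of length \<delta>/2.\<close>

lemma convolution_unit_process_lower:
  fixes x :: "'x::complex_normed_vector"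
  assumes \<delta>: "2 \<le> \<delta>" and S: "is_convolution \<delta> (unit_process x) S"
  shows "ennreal ((norm x)\<^sup>2 / 2) \<le> (\<integral>\<^sup>+z. indicator {\<delta> / 2<..<\<delta>} (snd z) * ennreal ((norm (S z))\<^sup>2) \<partial>space_time)"
proof -
  have SL2: "S \<in> L2_space space_time"
    and AE: "AE t in lborel_pos. stochastic_integral_is M F W (window \<delta> t (unit_process x)) (\<lambda>\<omega>. S (\<omega>, t))"
    using S by (simp_all add: is_convolution_def)
  note [measurable] = borel_measurable_norm_strongly_measurable[of space_time S]
  have sm: "strongly_measurable space_time S" using SL2 by (simp add: L2_space_iff)
  note nm[measurable] = borel_measurable_norm_strongly_measurable[OF sm]
  obtain f :: "'x \<Rightarrow> real" where f: "bounded_bilinear (\<lambda>y z. f y * f z)" "\<And>y. (f y)\<^sup>2 \<le> (norm y)\<^sup>2" "(f x)\<^sup>2 = (norm x)\<^sup>2"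
    "\<And>c y. f (c *\<^sub>R y) = c * f y"
    using norming_bilinear_form[of x] by blast
  have low: "ennreal ((norm x)\<^sup>2 / \<delta>) \<le> (\<integral>\<^sup>+\<omega>. ennreal ((norm (S (\<omega>, t)))\<^sup>2) \<partial>M)"
    if t: "\<delta> / 2 < t" "t < \<delta>" and si: "stochastic_integral_is M F W (window \<delta> t (unit_process x)) (\<lambda>\<omega>. S (\<omega>, t))" for t
  proof -
    let ?Y = "\<lambda>\<omega>. S (\<omega>, t)"
    have Y: "?Y \<in> L2_space M" using si by (simp add: stochastic_integral_is_def)
    then have Yint: "integrable M (\<lambda>\<omega>. (norm (?Y \<omega>))\<^sup>2)" and Ysm: "strongly_measurable M ?Y" by (simp_all add: L2_space_def)
    have w: "window \<delta> t (unit_process x) z = (\<delta> powr (-1/2) * indicator (space M \<times> {0<..1}) z) *\<^sub>R x" if "z \<in> space space_time" for z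
      using that t \<delta> by (subst window_eq) (auto simp: unit_process_def indicator_def space_pair_measure)
    have R: "space M \<times> {0<..1} \<in> sets space_time" by (rule rectangle_sets) auto
    have em: "emeasure space_time (space M \<times> {0<..1}) = 1" by (subst emeasure_rectangle) (auto simp: prob_space)
    have "expectation (\<lambda>\<omega>. f (?Y \<omega>) * f (?Y \<omega>)) =
        (\<integral>z. f (window \<delta> t (unit_process x) z) * f (window \<delta> t (unit_process x) z) \<partial>space_time)"
      by (rule ito_stochastic_integral[OF f(1) si])
    also have "\<dots> = (\<integral>z. (norm x)\<^sup>2 / \<delta> * indicator (space M \<times> {0<..1}) z \<partial>space_time)"
    proof (rule Bochner_Integration.integral_cong[OF refl])
      fix z assume "z \<in> space space_time"
      then have "f (window \<delta> t (unit_process x) z) * f (window \<delta> t (unit_process x) z) =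
          (\<delta> powr (-1/2))\<^sup>2 * (indicator (space M \<times> {0<..1}) z)\<^sup>2 * (f x)\<^sup>2"
        by (simp add: w f(4) power2_eq_square mult_ac)
      also have "\<dots> = (norm x)\<^sup>2 / \<delta> * indicator (space M \<times> {0<..1}) z"
        using \<delta> by (simp add: powr_half_sq[simplified] f(3) indicator_def)
      finally show "f (window \<delta> t (unit_process x) z) * f (window \<delta> t (unit_process x) z) =
          (norm x)\<^sup>2 / \<delta> * indicator (space M \<times> {0<..1}) z" .
    qed
    also have "\<dots> = (norm x)\<^sup>2 / \<delta>" using R em by (simp add: measure_def)
    finally have "(norm x)\<^sup>2 / \<delta> = expectation (\<lambda>\<omega>. f (?Y \<omega>) * f (?Y \<omega>))" by simp
    also have "\<dots> \<le> expectation (\<lambda>\<omega>. (norm (?Y \<omega>))\<^sup>2)"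
    proof (rule integral_mono_AE'[OF Yint])
      show "AE \<omega> in M. f (?Y \<omega>) * f (?Y \<omega>) \<le> (norm (?Y \<omega>))\<^sup>2" using f(2) by (simp add: power2_eq_square)
      show "AE \<omega> in M. 0 \<le> (norm (?Y \<omega>))\<^sup>2" by simp
    qed
    finally have "ennreal ((norm x)\<^sup>2 / \<delta>) \<le> ennreal (expectation (\<lambda>\<omega>. (norm (?Y \<omega>))\<^sup>2))" by (rule ennreal_leI)
    also have "\<dots> = (\<integral>\<^sup>+\<omega>. ennreal ((norm (?Y \<omega>))\<^sup>2) \<partial>M)" using Yint by (subst nn_integral_eq_integral) auto
    finally show ?thesis .
  qed
  have I: "{\<delta> / 2<..<\<delta>} \<in> sets lborel_pos" using \<delta> by (auto simp: sets_lborel_pos)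
  have "ennreal ((norm x)\<^sup>2 / 2) = ennreal ((norm x)\<^sup>2 / \<delta>) * emeasure lborel_pos {\<delta> / 2<..<\<delta>}"
    using \<delta> by (subst emeasure_lborel_pos) (auto simp flip: ennreal_mult)
  also have "\<dots> = (\<integral>\<^sup>+t. ennreal ((norm x)\<^sup>2 / \<delta>) * indicator {\<delta> / 2<..<\<delta>} t \<partial>lborel_pos)"
    using I by (simp add: nn_integral_cmult_indicator)
  also have "\<dots> \<le> (\<integral>\<^sup>+t. \<integral>\<^sup>+\<omega>. indicator {\<delta> / 2<..<\<delta>} t * ennreal ((norm (S (\<omega>, t)))\<^sup>2) \<partial>M \<partial>lborel_pos)"
  proof (rule nn_integral_mono_AE)
    show "AE t in lborel_pos. ennreal ((norm x)\<^sup>2 / \<delta>) * indicator {\<delta> / 2<..<\<delta>} t \<le>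
        (\<integral>\<^sup>+\<omega>. indicator {\<delta> / 2<..<\<delta>} t * ennreal ((norm (S (\<omega>, t)))\<^sup>2) \<partial>M)"
      using AE
    proof eventually_elim
      case (elim t)
      then show ?case using low[of t] by (cases "t \<in> {\<delta> / 2<..<\<delta>}") auto
    qed
  qed
  also have "\<dots> = (\<integral>\<^sup>+z. indicator {\<delta> / 2<..<\<delta>} (snd z) * ennreal ((norm (S z))\<^sup>2) \<partial>space_time)"
  proof -
    have "(indicator {\<delta> / 2<..<\<delta>} :: real \<Rightarrow> ennreal) \<in> borel_measurable lborel_pos" using I by simp
    note [measurable] = measurable_compose[OF measurable_snd this]
    have "(\<lambda>z. indicator {\<delta> / 2<..<\<delta>} (snd z) * ennreal ((norm (S z))\<^sup>2)) \<in> borel_measurable space_time"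
      by measurable
    from nn_integral_space_time[OF this] show ?thesis by simp
  qed
  finally show ?thesis .
qed

lemma cotype_if_condition_S2:
  assumes "condition_S2 M F W TYPE('x::complex_banach)"
  shows "\<exists>c>0. \<forall>N (x :: nat \<Rightarrow> 'x). c * (\<Sum>n<N. (norm (x n))\<^sup>2) \<le> (\<integral>\<epsilon>. (norm (\<Sum>n<N. \<epsilon> n *\<^sub>C x n))\<^sup>2 \<partial>rademacher)"
proof -
  obtain C where C: "\<And>N T (x :: nat \<Rightarrow> 'w \<times> real \<Rightarrow> 'x). 1 \<le> N \<Longrightarrow>
      (\<forall>n<N. T n \<in> {stochastic_convolution M F W (h_kernel \<delta>) | \<delta>. 0 < \<delta>} \<and> x n \<in> L2_progressive M F) \<Longrightarrow>
      sqrt (\<integral>\<epsilon>. (L2_norm space_time (\<lambda>t. \<Sum>n<N. \<epsilon> n *\<^sub>C T n (x n) t))\<^sup>2 \<partial>rademacher)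
          \<le> C * sqrt (\<integral>\<epsilon>. (L2_norm space_time (\<lambda>s. \<Sum>n<N. \<epsilon> n *\<^sub>C x n s))\<^sup>2 \<partial>rademacher)"
    using assms unfolding condition_S2_def R_bounded_def by blast
  have sf: "sigma_finite_measure space_time" by (rule sigma_finite_pair_measure) unfold_locales
  \<comment> \<open>The factor 4 collects the loss of 2 in
    \<open>convolution_unit_process_lower\<close> and the loss of 2 in
    \<open>rademacher_norm_sum_lower\<close>.\<close>
  have main: "(\<Sum>n<N. (norm (x n))\<^sup>2) \<le> 4 * C\<^sup>2 * (\<integral>\<epsilon>. (norm (\<Sum>n<N. \<epsilon> n *\<^sub>C x n))\<^sup>2 \<partial>rademacher)"
    if N: "1 \<le> N" for N and x :: "nat \<Rightarrow> 'x"
  proof -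
    define \<delta> where "\<delta> n = (2::real) ^ Suc n" for n
    have \<delta>: "2 \<le> \<delta> n" for n by (simp add: \<delta>_def)
    define S where "S n = stochastic_convolution M F W (h_kernel (\<delta> n)) (unit_process (x n))" for n
    have S: "is_convolution (\<delta> n) (unit_process (x n)) (S n)" for n
    proof -
      have "0 < \<delta> n" using \<delta>[of n] by linarith
      then show ?thesis unfolding S_def using is_convolution_unit_process is_convolution_stochastic_convolution by blast
    qed
    then have SL2: "S n \<in> L2_space space_time" for n by (simp add: is_convolution_def)
    let ?A = "\<integral>\<epsilon>. (L2_norm space_time (\<lambda>t. \<Sum>n<N. \<epsilon> n *\<^sub>C S n t))\<^sup>2 \<partial>rademacher"
    let ?D = "\<integral>\<epsilon>. (norm (\<Sum>n<N. \<epsilon> n *\<^sub>C x n))\<^sup>2 \<partial>rademacher"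
    have D: "(L2_norm space_time (\<lambda>s. \<Sum>n<N. \<epsilon> n *\<^sub>C unit_process (x n) s))\<^sup>2 = (norm (\<Sum>n<N. \<epsilon> n *\<^sub>C x n))\<^sup>2" for \<epsilon> :: "nat \<Rightarrow> complex"
    proof -
      have "(\<lambda>s. \<Sum>n<N. \<epsilon> n *\<^sub>C unit_process (x n) s) = unit_process (\<Sum>n<N. \<epsilon> n *\<^sub>C x n)"
        by (simp add: unit_process_def fun_eq_iff scaleR_sum_right bounded_bilinear.scaleR_right[OF bounded_bilinear_scaleC])
      moreover have "ennreal ((L2_norm space_time (unit_process y))\<^sup>2) = ennreal ((norm y)\<^sup>2)" for y :: 'x
        using nn_integral_norm_sq_L2[OF unit_process_L2] nn_integral_unit_process[of y] by metis
      ultimately show ?thesis by simp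
    qed
    have "\<forall>n<N. stochastic_convolution M F W (h_kernel (\<delta> n)) \<in> {stochastic_convolution M F W (h_kernel \<delta>) | \<delta>. 0 < \<delta>} \<and>
        unit_process (x n) \<in> (L2_progressive M F :: ('w \<times> real \<Rightarrow> 'x) set)"
    proof (intro allI impI conjI)
      fix n
      have "0 < \<delta> n" by (simp add: \<delta>_def)
      then show "stochastic_convolution M F W (h_kernel (\<delta> n)) \<in> {stochastic_convolution M F W (h_kernel \<delta>) | \<delta>. 0 < \<delta>}" by blast
    qed (rule unit_process_L2_progressive)
    from C[OF N this] have "sqrt ?A \<le> C * sqrt ?D" unfolding D S_def[symmetric] .
    moreover have A0: "0 \<le> ?A" by simp
    ultimately have "(sqrt ?A)\<^sup>2 \<le> (C * sqrt ?D)\<^sup>2" by (intro power_mono) auto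
    then have AD: "?A \<le> C\<^sup>2 * ?D" using A0 by (simp add: power_mult_distrib)
    let ?I = "\<lambda>n. {\<delta> n / 2<..<\<delta> n}"
    have disj: "m = n" if "t \<in> ?I m" "t \<in> ?I n" for t m n
    proof -
      have "\<not> m < n" if "t \<in> ?I m" "t \<in> ?I n" for m n
      proof
        assume "m < n"
        then have "(2::real) ^ Suc m \<le> 2 ^ n" by (intro power_increasing) auto
        then have "\<delta> m \<le> \<delta> n / 2" by (simp add: \<delta>_def)
        then show False using that by auto
      qed
      then show ?thesis using that by (metis linorder_neqE_nat)
    qed
    \<comment> \<open>At each time at most one indicator is nonzero, so the whole sum is one term of
      the Rademacher sum.\<close>
    have pt: "(\<Sum>n<N. indicator (?I n) (snd z) * ennreal ((norm (S n z))\<^sup>2)) \<le>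
        ennreal 2 * ennreal (\<integral>\<epsilon>. (norm (\<Sum>n<N. \<epsilon> n *\<^sub>C S n z))\<^sup>2 \<partial>rademacher)" for z
    proof (cases "\<exists>k<N. snd z \<in> ?I k")
      case True
      then obtain k where k: "k < N" "snd z \<in> ?I k" by blast
      have "(\<Sum>n<N. indicator (?I n) (snd z) * ennreal ((norm (S n z))\<^sup>2)) = (\<Sum>n\<in>{k}. indicator (?I n) (snd z) * ennreal ((norm (S n z))\<^sup>2))"
        using k disj by (intro sum.mono_neutral_right) (auto simp: indicator_def)
      also have "\<dots> = ennreal ((norm (S k z))\<^sup>2)" using k by simp
      also have "\<dots> \<le> ennreal (2 * (\<integral>\<epsilon>. (norm (\<Sum>n<N. \<epsilon> n *\<^sub>C S n z))\<^sup>2 \<partial>rademacher))"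
        using rademacher_norm_sum_lower[OF k(1), of "\<lambda>n. S n z"] by (intro ennreal_leI) simp
      also have "\<dots> = ennreal 2 * ennreal (\<integral>\<epsilon>. (norm (\<Sum>n<N. \<epsilon> n *\<^sub>C S n z))\<^sup>2 \<partial>rademacher)"
        by (rule ennreal_mult) simp_all
      finally show ?thesis .
    next
      case False
      then have "(\<Sum>n<N. indicator (?I n) (snd z) * ennreal ((norm (S n z))\<^sup>2)) = 0"
        by (intro sum.neutral ballI) (auto simp: indicator_def)
      then show ?thesis by (simp only: zero_le)
    qed
    have m: "(\<lambda>z. indicator (?I n) (snd z) * ennreal ((norm (S n z))\<^sup>2)) \<in> borel_measurable space_time" for n
    proof -
      have "?I n \<in> sets lborel_pos" using \<delta>[of n] by (auto simp: sets_lborel_pos)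
      then have "(indicator (?I n) :: real \<Rightarrow> ennreal) \<in> borel_measurable lborel_pos" by simp
      note [measurable] = measurable_compose[OF measurable_snd this] 
      have "strongly_measurable space_time (S n)" using SL2 by (simp add: L2_space_iff)
      note [measurable] = borel_measurable_norm_strongly_measurable[OF this]
      show ?thesis by measurable
    qed
    have "ennreal (\<Sum>n<N. (norm (x n))\<^sup>2 / 2) = (\<Sum>n<N. ennreal ((norm (x n))\<^sup>2 / 2))" by simp
    also have "\<dots> \<le> (\<Sum>n<N. \<integral>\<^sup>+z. indicator (?I n) (snd z) * ennreal ((norm (S n z))\<^sup>2) \<partial>space_time)"
      by (intro sum_mono convolution_unit_process_lower \<delta> S)
    also have "\<dots> = (\<integral>\<^sup>+z. (\<Sum>n<N. indicator (?I n) (snd z) * ennreal ((norm (S n z))\<^sup>2)) \<partial>space_time)"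
      by (rule nn_integral_sum[symmetric]) (rule m)
    also have "\<dots> \<le> (\<integral>\<^sup>+z. ennreal 2 * ennreal (\<integral>\<epsilon>. (norm (\<Sum>n<N. \<epsilon> n *\<^sub>C S n z))\<^sup>2 \<partial>rademacher) \<partial>space_time)"
      by (intro nn_integral_mono pt)
    also have "\<dots> = ennreal 2 * (\<integral>\<^sup>+z. ennreal (\<integral>\<epsilon>. (norm (\<Sum>n<N. \<epsilon> n *\<^sub>C S n z))\<^sup>2 \<partial>rademacher) \<partial>space_time)"
      using SL2 by (intro nn_integral_cmult borel_measurable_rademacher_norm_sum[OF sf]) auto
    also have "\<dots> = ennreal 2 * ennreal ?A"
      using rademacher_L2_norm_Fubini[OF sf, of N S] SL2 by simp
    also have "\<dots> = ennreal (2 * ?A)" by (rule ennreal_mult[symmetric]) simp_all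
    finally have "(\<Sum>n<N. (norm (x n))\<^sup>2 / 2) \<le> 2 * ?A" by (subst (asm) ennreal_le_iff) auto
    then have "(\<Sum>n<N. (norm (x n))\<^sup>2) \<le> 4 * ?A" by (simp flip: sum_divide_distrib)
    also have "\<dots> \<le> 4 * (C\<^sup>2 * ?D)" using AD by simp
    finally show ?thesis by simp
  qed
  show ?thesis
  \<comment> \<open>The summand 1 keeps the constant positive and finite if \<open>C\<close> is
    0.\<close>
  proof (intro exI[of _ "1 / (4 * C\<^sup>2 + 1)"] conjI allI)
    show "0 < 1 / (4 * C\<^sup>2 + 1)" by (simp add: add_nonneg_pos)
    fix N and x :: "nat \<Rightarrow> 'x"
    let ?D = "\<integral>\<epsilon>. (norm (\<Sum>n<N. \<epsilon> n *\<^sub>C x n))\<^sup>2 \<partial>rademacher"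
    have D: "0 \<le> ?D" by simp
    have "(\<Sum>n<N. (norm (x n))\<^sup>2) \<le> (4 * C\<^sup>2 + 1) * ?D"
    proof (cases "N = 0")
      case False
      then have "(\<Sum>n<N. (norm (x n))\<^sup>2) \<le> 4 * C\<^sup>2 * ?D" by (intro main) simp
      also have "\<dots> \<le> (4 * C\<^sup>2 + 1) * ?D" using D by (intro mult_right_mono) auto
      finally show ?thesis .
    qed simp
    moreover have "0 < 4 * C\<^sup>2 + 1" by (simp add: add_nonneg_pos)
    ultimately show "1 / (4 * C\<^sup>2 + 1) * (\<Sum>n<N. (norm (x n))\<^sup>2) \<le> ?D"
      by (simp add: pos_divide_le_eq mult.commute)
  qed
qed

end

section \<open>Density of adapted step processes\<close>

text \<open>The average over the preceding block of the grid of mesh \<open>1 / n\<close>. It uses only the past, so it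
  maps progressive sets to adapted step processes.\<close>

definition block_average :: "nat \<Rightarrow> real set \<Rightarrow> real \<Rightarrow> real" where
  "block_average n J s = real n * measure lborel
     (J \<inter> {(of_int \<lceil>real n * s\<rceil> - 2) / real n<..(of_int \<lceil>real n * s\<rceil> - 1) / real n})"

lemma ennreal_tendsto_0_mono:
  fixes f g :: "nat \<Rightarrow> ennreal"
  assumes "\<And>n. f n \<le> g n" "g \<longlonglongrightarrow> 0"
  shows "f \<longlonglongrightarrow> 0"
proof (rule tendsto_sandwich)
  show "\<forall>\<^sub>F n in sequentially. 0 \<le> f n" by simp
  show "\<forall>\<^sub>F n in sequentially. f n \<le> g n" using assms(1) by (intro always_eventually allI)
  show "(\<lambda>_. 0 :: ennreal) \<longlonglongrightarrow> 0" by (rule tendsto_const)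
qed (rule assms(2))

lemma emeasure_lborel_Ioc_finite: "emeasure lborel {a<..b::real} < \<infinity>"
  by (cases "a \<le> b") auto

lemma block_average_bounds:
  assumes n: "0 < n"
  shows "0 \<le> block_average n J s" "block_average n J s \<le> 1"
proof -
  let ?k = "of_int \<lceil>real n * s\<rceil> :: real"
  let ?I = "{(?k - 2) / real n<..(?k - 1) / real n}"
  show "0 \<le> block_average n J s" by (simp add: block_average_def)
  have le: "(?k - 2) / real n \<le> (?k - 1) / real n" using n by (intro divide_right_mono) auto
  have "measure lborel (J \<inter> ?I) \<le> measure lborel ?I"
  proof (cases "J \<inter> ?I \<in> sets lborel")
    case True
    then show ?thesis by (intro measure_mono_fmeasurable) (use emeasure_lborel_Ioc_finite in \<open>auto simp: fmeasurable_def\<close>)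
  next
    case False
    \<comment> \<open>A nonmeasurable set has \<open>measure\<close> 0 by convention.\<close>
    then show ?thesis by (simp add: measure_notin_sets)
  qed
  also have "measure lborel ?I = 1 / real n" using le n by (simp add: diff_divide_distrib[symmetric])
  finally have "real n * measure lborel (J \<inter> ?I) \<le> real n * (1 / real n)" by (intro mult_left_mono) auto
  then show "block_average n J s \<le> 1" using n by (simp add: block_average_def)
qed

lemma borel_measurable_block_average [measurable]: "block_average n J \<in> borel_measurable borel"
proof -
  have "(\<lambda>s. \<lceil>real n * s\<rceil>) \<in> borel \<rightarrow>\<^sub>M count_space UNIV" by measurable
  then have "(\<lambda>s. (\<lambda>k. real n * measure lborel (J \<inter> {(of_int k - 2) / real n<..(of_int k - 1) / real n})) \<lceil>real n * s\<rceil>) \<in> borel_measurable borel"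
    by (rule measurable_compose) simp
  then show ?thesis by (simp add: block_average_def[abs_def])
qed

lemma block_average_empty: "block_average n {} s = 0"
  by (simp add: block_average_def)

lemma block_average_UNION_sums:
  assumes "range J \<subseteq> sets borel" "disjoint_family J"
  shows "(\<lambda>i::nat. block_average n (J i) s) sums block_average n (\<Union>i. J i) s"
proof -
  let ?I = "{(of_int \<lceil>real n * s\<rceil> - 2) / real n<..(of_int \<lceil>real n * s\<rceil> - 1) / real n}"
  have "(\<lambda>i. measure lborel (J i \<inter> ?I)) sums measure lborel (\<Union>i. J i \<inter> ?I)"
  proof (rule measure_UNION)
    show "range (\<lambda>i. J i \<inter> ?I) \<subseteq> sets lborel" using assms(1) by auto
    show "disjoint_family (\<lambda>i. J i \<inter> ?I)" using assms(2) by (auto simp: disjoint_family_on_def)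
    have "emeasure lborel (\<Union>i. J i \<inter> ?I) \<le> emeasure lborel ?I" by (intro emeasure_mono) auto
    also have "\<dots> < \<infinity>" by (rule emeasure_lborel_Ioc_finite)
    finally show "emeasure lborel (\<Union>i. J i \<inter> ?I) \<noteq> \<infinity>" by (rule less_imp_neq)
  qed
  moreover have "(\<Union>i. J i \<inter> ?I) = (\<Union>i. J i) \<inter> ?I" by auto
  ultimately show ?thesis unfolding block_average_def by (simp add: sums_mult)
qed

lemma block_average_diff:
  assumes "A \<in> sets borel" "B \<in> sets borel" "B \<subseteq> A"
  shows "block_average n (A - B) s = block_average n A s - block_average n B s"
proof -
  let ?I = "{(of_int \<lceil>real n * s\<rceil> - 2) / real n<..(of_int \<lceil>real n * s\<rceil> - 1) / real n}"
  have "emeasure lborel (A \<inter> ?I) \<le> emeasure lborel ?I" using assms by (intro emeasure_mono) auto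
  also have "\<dots> < \<infinity>" by (rule emeasure_lborel_Ioc_finite)
  finally have "emeasure lborel (A \<inter> ?I) \<noteq> \<infinity>" by (rule less_imp_neq)
  then have "measure lborel (A \<inter> ?I - B \<inter> ?I) = measure lborel (A \<inter> ?I) - measure lborel (B \<inter> ?I)"
    using assms by (intro measure_Diff) auto
  moreover have "A \<inter> ?I - B \<inter> ?I = (A - B) \<inter> ?I" by auto
  ultimately show ?thesis unfolding block_average_def by (simp add: right_diff_distrib)
qed

text \<open>On (j/n, (j + 1)/n] the ceiling of n s is j + 1, so the average is taken over ((j -
  1)/n, j/n]. For j = 0 that block lies to the left of 0.\<close>

lemma block_average_sum:
  assumes n: "0 < n" and s: "0 < s" "s \<le> real T"
  shows "block_average n J s = (\<Sum>j<n * T. indicator {real j / real n<..real (Suc j) / real n} s *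
    (real n * measure lborel (J \<inter> {(real j - 1) / real n<..real j / real n})))"
proof -
  define k where "k = nat (\<lceil>real n * s\<rceil> - 1)"
  have pos: "0 < real n * s" using n s by simp
  then have "1 \<le> \<lceil>real n * s\<rceil>" by linarith
  then have k: "of_int \<lceil>real n * s\<rceil> = real k + 1" by (simp add: k_def)
  have "real n * s \<le> real n * real T" using s by (intro mult_left_mono) auto
  then have "\<lceil>real n * s\<rceil> \<le> int (n * T)" by (simp add: ceiling_le_iff)
  moreover have "int k + 1 = \<lceil>real n * s\<rceil>" using \<open>1 \<le> \<lceil>real n * s\<rceil>\<close> by (simp add: k_def)
  ultimately have kT: "k < n * T" by linarith
  have ind: "indicator {real j / real n<..real (Suc j) / real n} s = (if j = k then 1 else 0 :: real)" for j
  proof -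
    have "s \<in> {real j / real n<..real (Suc j) / real n} \<longleftrightarrow> real j < real n * s \<and> real n * s \<le> real j + 1"
      using n by (simp add: field_simps)
    also have "\<dots> \<longleftrightarrow> \<lceil>real n * s\<rceil> = int j + 1" by (simp add: ceiling_eq_iff)
    also have "\<dots> \<longleftrightarrow> j = k" using k by linarith
    finally show ?thesis by (simp add: indicator_def)
  qed
  have "(\<Sum>j<n * T. indicator {real j / real n<..real (Suc j) / real n} s *
    (real n * measure lborel (J \<inter> {(real j - 1) / real n<..real j / real n}))) =
    real n * measure lborel (J \<inter> {(real k - 1) / real n<..real k / real n})"
    unfolding ind using kT by (simp add: if_distrib[where f = "\<lambda>x. x * _"] sum.delta cong: if_cong)
  also have "\<dots> = block_average n J s" unfolding block_average_def k by simp
  finally show ?thesis by simp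
qed

text \<open>Each block hands its mass on to the next one, so averaging does not increase the total
  mass.\<close>

lemma nn_integral_block_average_le:
  assumes n: "0 < n" and J: "J \<in> sets borel" "J \<subseteq> {0<..real T}"
  shows "(\<integral>\<^sup>+s. ennreal (block_average n J s) * indicator {0<..real T} s \<partial>lborel) \<le> emeasure lborel J"
proof -
  let ?B = "\<lambda>j. J \<inter> {(real j - 1) / real n<..real j / real n}"
  have Jfin: "emeasure lborel J < \<infinity>"
    using emeasure_mono[OF J(2), of lborel] by (auto intro: le_less_trans)
  have "(\<integral>\<^sup>+s. ennreal (block_average n J s) * indicator {0<..real T} s \<partial>lborel) \<le>
    (\<integral>\<^sup>+s. (\<Sum>j<n * T. ennreal (real n * measure lborel (?B j)) * indicator {real j / real n<..real (Suc j) / real n} s) \<partial>lborel)"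
  proof (rule nn_integral_mono)
    fix s
    show "ennreal (block_average n J s) * indicator {0<..real T} s \<le>
      (\<Sum>j<n * T. ennreal (real n * measure lborel (?B j)) * indicator {real j / real n<..real (Suc j) / real n} s)"
    proof (cases "s \<in> {0<..real T}")
      case True
      then have "ennreal (block_average n J s) = ennreal (\<Sum>j<n * T. indicator {real j / real n<..real (Suc j) / real n} s * (real n * measure lborel (?B j)))"
        using block_average_sum[OF n, of s T J] by simp
      also have "\<dots> = (\<Sum>j<n * T. ennreal (indicator {real j / real n<..real (Suc j) / real n} s * (real n * measure lborel (?B j))))"
        by (rule sum_ennreal[symmetric]) simp
      also have "\<dots> = (\<Sum>j<n * T. ennreal (real n * measure lborel (?B j)) * indicator {real j / real n<..real (Suc j) / real n} s)"
        by (intro sum.cong) (auto simp: indicator_def)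
      finally show ?thesis using True by simp
    qed simp
  qed
  also have "\<dots> = (\<Sum>j<n * T. ennreal (real n * measure lborel (?B j)) * emeasure lborel {real j / real n<..real (Suc j) / real n})"
    by (subst nn_integral_sum) (auto simp: nn_integral_cmult_indicator)
  also have "\<dots> = (\<Sum>j<n * T. emeasure lborel (?B j))"
  proof (intro sum.cong refl)
    fix j
    have "real j / real n \<le> real (Suc j) / real n" using n by (intro divide_right_mono) auto
    then have "emeasure lborel {real j / real n<..real (Suc j) / real n} = ennreal (1 / real n)"
      using n by (simp add: diff_divide_distrib[symmetric])
    moreover have "emeasure lborel (?B j) = ennreal (measure lborel (?B j))"
      using Jfin J by (intro emeasure_eq_ennreal_measure) (auto simp: top_unique dest: emeasure_mono[of "?B j" J lborel, rotated] intro!: less_imp_neq le_less_trans[OF emeasure_mono[of "?B j" J lborel]])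
    ultimately show "ennreal (real n * measure lborel (?B j)) * emeasure lborel {real j / real n<..real (Suc j) / real n} = emeasure lborel (?B j)"
      using n by (simp flip: ennreal_mult)
  qed
  also have "\<dots> = emeasure lborel (\<Union>j<n * T. ?B j)"
  proof (rule sum_emeasure)
    show "disjoint_family_on ?B {..<n * T}"
      unfolding disjoint_family_on_def
    proof (intro ballI impI)
      fix i j :: nat assume "i \<noteq> j"
      have *: "?B i \<inter> ?B j = {}" if "i < j" for i j :: nat
      proof -
        have "real i / real n \<le> (real j - 1) / real n" using that by (intro divide_right_mono) auto
        then show ?thesis by auto
      qed
      show "?B i \<inter> ?B j = {}"
      proof (cases "i < j")
        case True
        then show ?thesis by (rule *)
      next
        case False
        then have "j < i" using \<open>i \<noteq> j\<close> by simp
        from *[OF this] show ?thesis by (subst Int_commute)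
      qed
    qed
  qed (use J in auto)
  also have "\<dots> \<le> emeasure lborel J" using J by (intro emeasure_mono) auto
  finally show ?thesis .
qed

definition block_error :: "nat \<Rightarrow> real \<Rightarrow> real set \<Rightarrow> ennreal" where
  "block_error n T J = (\<integral>\<^sup>+s. ennreal \<bar>indicator J s - block_average n J s\<bar> * indicator {0<..T} s \<partial>lborel)"

text \<open>The bound is uniform in \<open>n\<close> and additive over disjoint sets, which makes it
  a dominating function for countable unions.\<close>

lemma block_error_le:
  assumes n: "0 < n" and J: "J \<in> sets borel" "J \<subseteq> {0<..real T}"
  shows "block_error n T J \<le> 2 * emeasure lborel J"
proof -
  have "block_error n T J \<le> (\<integral>\<^sup>+s. indicator J s + ennreal (block_average n J s) * indicator {0<..real T} s \<partial>lborel)"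
    unfolding block_error_def
  proof (rule nn_integral_mono)
    fix s
    have "\<bar>indicator J s - block_average n J s\<bar> \<le> indicator J s + block_average n J s"
      using block_average_bounds[OF n, of J s] by (auto simp: indicator_def)
    then have "ennreal \<bar>indicator J s - block_average n J s\<bar> \<le> indicator J s + ennreal (block_average n J s)"
      using block_average_bounds[OF n, of J s] by (auto simp: indicator_def ennreal_leI simp flip: ennreal_plus ennreal_1)
    then show "ennreal \<bar>indicator J s - block_average n J s\<bar> * indicator {0<..real T} s
        \<le> indicator J s + ennreal (block_average n J s) * indicator {0<..real T} s"
      by (cases "s \<in> {0<..real T}") auto
  qed
  also have "\<dots> = emeasure lborel J + (\<integral>\<^sup>+s. ennreal (block_average n J s) * indicator {0<..real T} s \<partial>lborel)"
    using J by (subst nn_integral_add) auto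
  also have "\<dots> \<le> emeasure lborel J + emeasure lborel J"
    by (intro add_left_mono nn_integral_block_average_le n J)
  finally show ?thesis by (simp add: mult_2)
qed

lemma block_error_atMost_tendsto: "(\<lambda>n. block_error (Suc n) (real T) ({..a} \<inter> {0<..real T})) \<longlonglongrightarrow> 0"
proof -
  let ?J = "{..a} \<inter> {0<..real T}"
  have "(\<lambda>n. \<integral>\<^sup>+s. ennreal \<bar>indicator ?J s - block_average (Suc n) ?J s\<bar> * indicator {0<..real T} s \<partial>lborel) \<longlonglongrightarrow> (\<integral>\<^sup>+s. 0 \<partial>(lborel :: real measure))"
  proof (rule nn_integral_dominated_convergence[where w = "indicator {0<..real T}"])
    show "AE s in lborel. ennreal \<bar>indicator ?J s - block_average (Suc n) ?J s\<bar> * indicator {0<..real T} s \<le> indicator {0<..real T} s" for n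
    proof (rule AE_I2)
      fix s
      have "\<bar>indicator ?J s - block_average (Suc n) ?J s\<bar> \<le> 1"
        using block_average_bounds[of "Suc n" ?J s] by (auto simp: indicator_def)
      then show "ennreal \<bar>indicator ?J s - block_average (Suc n) ?J s\<bar> * indicator {0<..real T} s \<le> indicator {0<..real T} s"
        by (auto simp: indicator_def ennreal_le_1)
    qed
    have "AE s in lborel. s \<noteq> a" by (rule AE_lborel_singleton)
    then show "AE s in lborel. (\<lambda>n. ennreal \<bar>indicator ?J s - block_average (Suc n) ?J s\<bar> * indicator {0<..real T} s) \<longlonglongrightarrow> 0"
    proof eventually_elim
      case (elim s)
      show ?case
      proof (cases "s \<in> {0<..real T}")
        case True
        have "\<forall>\<^sub>F n in sequentially. block_average (Suc n) ?J s = indicator ?J s"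
        proof -
          \<comment> \<open>The block used at \<open>s\<close> lies to the left of \<open>s\<close>
            within distance 2/m, where m is the number of blocks per unit. Once 2/m < e it meets
            neither 0 nor \<open>a\<close>, so the average equals the indicator exactly.\<close>
          define e where "e = min s \<bar>s - a\<bar>"
          have e: "0 < e" using True elim by (simp add: e_def)
          then obtain N :: nat where N: "2 / e < real N" using reals_Archimedean2 by blast
          have "block_average (Suc n) ?J s = indicator ?J s" if "N \<le> n" for n
          proof -
            let ?m = "real (Suc n)" and ?k = "of_int \<lceil>real (Suc n) * s\<rceil> :: real"
            have m: "0 < ?m" "2 / e < ?m" using N that by auto
            have k: "?m * s \<le> ?k" "?k < ?m * s + 1" by linarith+
            have lo: "s - 2 / ?m \<le> (?k - 2) / ?m" using k m by (simp add: field_simps del: of_nat_Suc)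
            have hi: "(?k - 1) / ?m < s" using k m by (simp add: field_simps del: of_nat_Suc)
            have "2 / ?m < e" using m e by (simp add: field_simps del: of_nat_Suc)
            then have lo': "s - e < (?k - 2) / ?m" using lo by linarith
            show ?thesis
            proof (cases "s < a")
              case sa: True
              have "?J \<inter> {(?k - 2) / ?m<..(?k - 1) / ?m} = {(?k - 2) / ?m<..(?k - 1) / ?m}"
                using lo' hi sa True by (auto simp: e_def)
              moreover have "(?k - 2) / ?m \<le> (?k - 1) / ?m" using m by (intro divide_right_mono) auto
              then have "measure lborel {(?k - 2) / ?m<..(?k - 1) / ?m} = 1 / ?m"
                by (simp add: diff_divide_distrib[symmetric] del: of_nat_Suc)
              ultimately have "block_average (Suc n) ?J s = 1" using m by (simp add: block_average_def del: of_nat_Suc)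
              then show ?thesis using sa True by simp
            next
              case False
              then have as: "a < s" using elim by simp
              then have "?J \<inter> {(?k - 2) / ?m<..(?k - 1) / ?m} = {}"
                using lo' by (auto simp: e_def)
              then have "block_average (Suc n) ?J s = 0" by (simp add: block_average_def del: of_nat_Suc)
              then show ?thesis using as by simp
            qed
          qed
          then show ?thesis unfolding eventually_sequentially by blast
        qed
        then have "\<forall>\<^sub>F n in sequentially. ennreal \<bar>indicator ?J s - block_average (Suc n) ?J s\<bar> * indicator {0<..real T} s = 0"
          by eventually_elim simp
        then show ?thesis by (rule tendsto_eventually)
      qed simp
    qed
    show "(\<integral>\<^sup>+s. indicator {0<..real T} s \<partial>lborel) < \<infinity>" by simp
  qed (auto)
  then show ?thesis by (simp add: block_error_def)
qed

text \<open>Induction over the Borel sets from half-lines, in place of a differentiation theorem.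
  Complements follow from additivity of the average, and disjoint unions from dominated convergence
  of a series.\<close>

lemma block_error_tendsto:
  assumes "J \<in> sets borel"
  shows "(\<lambda>n. block_error (Suc n) (real T) (J \<inter> {0<..real T})) \<longlonglongrightarrow> 0"
proof -
  let ?Q = "\<lambda>J. (\<lambda>n. block_error (Suc n) (real T) (J \<inter> {0<..real T})) \<longlonglongrightarrow> 0"
  let ?F = "{0<..real T}"
  have borel: "sets borel = sigma_sets UNIV (range (\<lambda>a::real. {..a}))" by (subst borel_eq_atMost) simp
  show ?thesis using assms unfolding borel
  proof (rule sigma_sets_induct_disjoint[rotated 2])
    show "Int_stable (range (\<lambda>a::real. {..a}))" by (auto simp: Int_stable_def)
    show "range (\<lambda>a::real. {..a}) \<subseteq> Pow UNIV" by simp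
    show "?Q A" if "A \<in> range (\<lambda>a::real. {..a})" for A using that block_error_atMost_tendsto by auto
    show "?Q {}" by (simp add: block_error_def block_average_empty)
  next
    fix A assume A: "A \<in> sigma_sets UNIV (range (\<lambda>a::real. {..a}))" and IH: "?Q A"
    then have Ab: "A \<in> sets borel" unfolding borel by simp
    have full: "?Q {..real T}" by (rule block_error_atMost_tendsto)
    have le: "block_error (Suc n) (real T) ((UNIV - A) \<inter> ?F) \<le>
        block_error (Suc n) (real T) ({..real T} \<inter> ?F) + block_error (Suc n) (real T) (A \<inter> ?F)" for n
    proof -
      have "block_error (Suc n) (real T) ((UNIV - A) \<inter> ?F) \<le>
        (\<integral>\<^sup>+s. ennreal \<bar>indicator ({..real T} \<inter> ?F) s - block_average (Suc n) ({..real T} \<inter> ?F) s\<bar> * indicator ?F s +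
          ennreal \<bar>indicator (A \<inter> ?F) s - block_average (Suc n) (A \<inter> ?F) s\<bar> * indicator ?F s \<partial>lborel)"
        unfolding block_error_def
      proof (rule nn_integral_mono)
        fix s
        have eq: "(UNIV - A) \<inter> ?F = ({..real T} \<inter> ?F) - A \<inter> ?F" by auto
        have "block_average (Suc n) ((UNIV - A) \<inter> ?F) s = block_average (Suc n) ({..real T} \<inter> ?F) s - block_average (Suc n) (A \<inter> ?F) s"
          unfolding eq by (rule block_average_diff) (use Ab in auto)
        moreover have "indicator ((UNIV - A) \<inter> ?F) s = (indicator ({..real T} \<inter> ?F) s - indicator (A \<inter> ?F) s :: real)"
          by (auto simp: indicator_def)
        ultimately have "\<bar>indicator ((UNIV - A) \<inter> ?F) s - block_average (Suc n) ((UNIV - A) \<inter> ?F) s\<bar> \<le>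
          \<bar>indicator ({..real T} \<inter> ?F) s - block_average (Suc n) ({..real T} \<inter> ?F) s\<bar> + \<bar>indicator (A \<inter> ?F) s - block_average (Suc n) (A \<inter> ?F) s\<bar>"
          by linarith
        then have "ennreal \<bar>indicator ((UNIV - A) \<inter> ?F) s - block_average (Suc n) ((UNIV - A) \<inter> ?F) s\<bar> \<le>
          ennreal (\<bar>indicator ({..real T} \<inter> ?F) s - block_average (Suc n) ({..real T} \<inter> ?F) s\<bar> + \<bar>indicator (A \<inter> ?F) s - block_average (Suc n) (A \<inter> ?F) s\<bar>)"
          by (rule ennreal_leI)
        also have "\<dots> = ennreal \<bar>indicator ({..real T} \<inter> ?F) s - block_average (Suc n) ({..real T} \<inter> ?F) s\<bar> + ennreal \<bar>indicator (A \<inter> ?F) s - block_average (Suc n) (A \<inter> ?F) s\<bar>"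
          by (rule ennreal_plus) simp_all
        finally have "ennreal \<bar>indicator ((UNIV - A) \<inter> ?F) s - block_average (Suc n) ((UNIV - A) \<inter> ?F) s\<bar> \<le>
          ennreal \<bar>indicator ({..real T} \<inter> ?F) s - block_average (Suc n) ({..real T} \<inter> ?F) s\<bar> + ennreal \<bar>indicator (A \<inter> ?F) s - block_average (Suc n) (A \<inter> ?F) s\<bar>" .
        then show "ennreal \<bar>indicator ((UNIV - A) \<inter> ?F) s - block_average (Suc n) ((UNIV - A) \<inter> ?F) s\<bar> * indicator ?F s \<le>
          ennreal \<bar>indicator ({..real T} \<inter> ?F) s - block_average (Suc n) ({..real T} \<inter> ?F) s\<bar> * indicator ?F s +
          ennreal \<bar>indicator (A \<inter> ?F) s - block_average (Suc n) (A \<inter> ?F) s\<bar> * indicator ?F s"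
          by (cases "s \<in> ?F") simp_all
      qed
      also have "\<dots> = block_error (Suc n) (real T) ({..real T} \<inter> ?F) + block_error (Suc n) (real T) (A \<inter> ?F)"
        unfolding block_error_def using Ab by (subst nn_integral_add) auto
      finally show ?thesis .
    qed
    have "(\<lambda>n. block_error (Suc n) (real T) ({..real T} \<inter> ?F) + block_error (Suc n) (real T) (A \<inter> ?F)) \<longlonglongrightarrow> 0 + 0"
      by (rule tendsto_add[OF full IH])
    then show "?Q (UNIV - A)" unfolding add_0_left by (rule ennreal_tendsto_0_mono[OF le])
  next
    fix A :: "nat \<Rightarrow> real set"
    assume dA: "disjoint_family A" and rA: "range A \<subseteq> sigma_sets UNIV (range (\<lambda>a::real. {..a}))" and IH: "\<And>i. ?Q (A i)"
    have Ab: "A i \<in> sets borel" for i using rA unfolding borel by auto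
    define J where "J i = A i \<inter> ?F" for i
    have Jb: "J i \<in> sets borel" "J i \<subseteq> ?F" for i using Ab by (auto simp: J_def)
    have dJ: "disjoint_family J" using dA by (auto simp: J_def disjoint_family_on_def)
    have UJ: "(\<Union>i. A i) \<inter> ?F = (\<Union>i. J i)" by (auto simp: J_def)
    have le: "block_error (Suc n) (real T) (\<Union>i. J i) \<le> (\<Sum>i. block_error (Suc n) (real T) (J i))" for n
    proof -
      have "block_error (Suc n) (real T) (\<Union>i. J i) \<le>
        (\<integral>\<^sup>+s. (\<Sum>i. ennreal \<bar>indicator (J i) s - block_average (Suc n) (J i) s\<bar> * indicator ?F s) \<partial>lborel)"
        unfolding block_error_def
      proof (rule nn_integral_mono)
        fix s
        have i: "(\<lambda>i. indicator (J i) s :: real) sums indicator (\<Union>i. J i) s"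
          using dJ by (intro indicator_sums) (auto simp: disjoint_family_on_def)
        have b: "(\<lambda>i. block_average (Suc n) (J i) s) sums block_average (Suc n) (\<Union>i. J i) s"
          using Jb dJ by (intro block_average_UNION_sums) auto
        have d: "(\<lambda>i. indicator (J i) s - block_average (Suc n) (J i) s) sums (indicator (\<Union>i. J i) s - block_average (Suc n) (\<Union>i. J i) s)"
          by (rule sums_diff[OF i b])
        have abs: "summable (\<lambda>i. \<bar>indicator (J i) s - block_average (Suc n) (J i) s\<bar>)"
        proof (rule summable_comparison_test')
          show "summable (\<lambda>i. indicator (J i) s + block_average (Suc n) (J i) s)"
            using i b by (intro summable_add) (auto simp: sums_iff)
          show "norm \<bar>indicator (J i) s - block_average (Suc n) (J i) s\<bar> \<le> indicator (J i) s + block_average (Suc n) (J i) s" if "0 \<le> i" for i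
            using block_average_bounds[of "Suc n" "J i" s] by (auto simp: indicator_def)
        qed
        have "\<bar>indicator (\<Union>i. J i) s - block_average (Suc n) (\<Union>i. J i) s\<bar> \<le> (\<Sum>i. \<bar>indicator (J i) s - block_average (Suc n) (J i) s\<bar>)"
          using summable_rabs[OF abs] d by (simp add: sums_iff)
        then have "ennreal \<bar>indicator (\<Union>i. J i) s - block_average (Suc n) (\<Union>i. J i) s\<bar> \<le> (\<Sum>i. ennreal \<bar>indicator (J i) s - block_average (Suc n) (J i) s\<bar>)"
          using abs by (subst suminf_ennreal2) (auto intro: ennreal_leI)
        then show "ennreal \<bar>indicator (\<Union>i. J i) s - block_average (Suc n) (\<Union>i. J i) s\<bar> * indicator ?F s \<le>
          (\<Sum>i. ennreal \<bar>indicator (J i) s - block_average (Suc n) (J i) s\<bar> * indicator ?F s)"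
          by (cases "s \<in> ?F") simp_all
      qed
      also have "\<dots> = (\<Sum>i. block_error (Suc n) (real T) (J i))"
        unfolding block_error_def using Jb by (subst nn_integral_suminf) auto
      finally show ?thesis .
    qed
    \<comment> \<open>The series is treated as an integral over counting measure. The bounds are
      summable because the sets \<open>J i\<close> are disjoint subsets of (0, T].\<close>
    have "(\<lambda>n. \<integral>\<^sup>+i. block_error (Suc n) (real T) (J i) \<partial>count_space UNIV) \<longlonglongrightarrow> (\<integral>\<^sup>+i. 0 \<partial>count_space (UNIV :: nat set))"
    proof (rule nn_integral_dominated_convergence[where w = "\<lambda>i. 2 * emeasure lborel (J i)"])
      show "AE i in count_space UNIV. block_error (Suc n) (real T) (J i) \<le> 2 * emeasure lborel (J i)" for n
        using Jb by (intro AE_I2 block_error_le) auto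
      have "(\<Sum>i. emeasure lborel (J i)) = emeasure lborel (\<Union>i. J i)" using Jb dJ by (intro suminf_emeasure) auto
      also have "\<dots> \<le> emeasure lborel ?F" using Jb by (intro emeasure_mono) auto
      also have "\<dots> < \<infinity>" by simp
      finally show "(\<integral>\<^sup>+i. 2 * emeasure lborel (J i) \<partial>count_space UNIV) < \<infinity>"
        by (simp add: nn_integral_count_space_nat ennreal_suminf_cmult ennreal_mult_less_top)
      show "AE i in count_space UNIV. (\<lambda>n. block_error (Suc n) (real T) (J i)) \<longlonglongrightarrow> 0"
        using IH by (intro AE_I2) (simp add: J_def)
    qed auto
    then have "(\<lambda>n. \<Sum>i. block_error (Suc n) (real T) (J i)) \<longlonglongrightarrow> 0" by (simp add: nn_integral_count_space_nat)
    then have "(\<lambda>n. block_error (Suc n) (real T) (\<Union>i. J i)) \<longlonglongrightarrow> 0"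
      by (rule ennreal_tendsto_0_mono[OF le])
    then show "?Q (\<Union>i. A i)" unfolding UJ .
  qed
qed

context brownian
begin

section \<open>The progressive sigma-algebra and the discretisation of its sets\<close>

abbreviation past :: "real \<Rightarrow> ('w \<times> real) measure" where
  "past t \<equiv> F t \<Otimes>\<^sub>M restrict_space borel {0<..t}"

lemma space_past: "0 \<le> t \<Longrightarrow> space (past t) = space M \<times> {0<..t}"
  by (simp add: space_pair_measure space_F space_restrict_space)

text \<open>The progressive sigma-algebra. In \<open>progressive\<close> the approximating simple
  functions may depend on the horizon \<open>t\<close>; functions that are simple for this
  sigma-algebra serve all horizons at once.\<close>

definition progressive_sets :: "('w \<times> real) set set" where
  "progressive_sets = {A. A \<subseteq> space M \<times> {0<..} \<and> (\<forall>t>0. A \<inter> space M \<times> {0<..t} \<in> sets (past t))}"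

definition progressive_measure :: "('w \<times> real) measure" where
  "progressive_measure = sigma (space M \<times> {0<..}) progressive_sets"

lemma sigma_algebra_progressive_sets: "sigma_algebra (space M \<times> {0<..}) progressive_sets"
proof (rule sigma_algebra_iff2[THEN iffD2], intro conjI ballI allI impI)
  show "progressive_sets \<subseteq> Pow (space M \<times> {0<..})" by (auto simp: progressive_sets_def)
  show "{} \<in> progressive_sets" by (simp add: progressive_sets_def)
  fix A assume A: "A \<in> progressive_sets"
  have "(space M \<times> {0<..} - A) \<inter> space M \<times> {0<..t} \<in> sets (past t)" if "0 < t" for t
  proof -
    have "(space M \<times> {0<..} - A) \<inter> space M \<times> {0<..t} = space (past t) - A \<inter> space M \<times> {0<..t}"
      using that by (auto simp: space_past)
    then show ?thesis using A that by (auto simp: progressive_sets_def)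
  qed
  then show "space M \<times> {0<..} - A \<in> progressive_sets" by (auto simp: progressive_sets_def)
next
  fix A :: "nat \<Rightarrow> ('w \<times> real) set" assume A: "range A \<subseteq> progressive_sets"
  have "(\<Union>i. A i) \<inter> space M \<times> {0<..t} \<in> sets (past t)" if "0 < t" for t
  proof -
    have "(\<Union>i. A i) \<inter> space M \<times> {0<..t} = (\<Union>i. A i \<inter> space M \<times> {0<..t})" by auto
    also have "\<dots> \<in> sets (past t)" using A that by (intro sets.countable_UN) (auto simp: progressive_sets_def)
    finally show ?thesis .
  qed
  then show "(\<Union>i. A i) \<in> progressive_sets" using A by (auto simp: progressive_sets_def)
qed

lemma sets_progressive_measure: "sets progressive_measure = progressive_sets"
  and space_progressive_measure: "space progressive_measure = space M \<times> {0<..}"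
proof -
  interpret sigma_algebra "space M \<times> {0<..}" progressive_sets by (rule sigma_algebra_progressive_sets)
  show "sets progressive_measure = progressive_sets" "space progressive_measure = space M \<times> {0<..}"
    using space_closed by (simp_all add: progressive_measure_def sigma_sets_eq)
qed

lemma past_subset_space_time:
  assumes t: "0 < t" and A: "A \<in> sets (past t)"
  shows "A \<in> sets space_time"
proof -
  let ?R = "space M \<times> {0<..t}"
  have R: "?R \<in> sets space_time" by (rule rectangle_sets) auto
  have f: "fst \<in> restrict_space space_time ?R \<rightarrow>\<^sub>M F t"
  proof (rule measurableI)
    show "fst x \<in> space (F t)" if "x \<in> space (restrict_space space_time ?R)" for x
      using that t by (auto simp: space_restrict_space space_F)
    fix B assume "B \<in> sets (F t)"
    then have "B \<in> sets M" using sets_F[of t] t by auto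
    then have "B \<times> {0<..t} \<in> sets space_time" by (intro rectangle_sets) auto
    moreover have "fst -` B \<inter> space (restrict_space space_time ?R) = B \<times> {0<..t}"
      using sets.sets_into_space[OF \<open>B \<in> sets M\<close>] by (auto simp: space_restrict_space space_pair_measure)
    ultimately show "fst -` B \<inter> space (restrict_space space_time ?R) \<in> sets (restrict_space space_time ?R)"
      using R sets.sets_into_space[OF \<open>B \<in> sets M\<close>] by (auto simp: sets_restrict_space_iff)
  qed
  have s: "snd \<in> restrict_space space_time ?R \<rightarrow>\<^sub>M restrict_space borel {0<..t}"
  proof (rule measurable_restrict_space2)
    show "snd \<in> space (restrict_space space_time ?R) \<rightarrow> {0<..t}" by (auto simp: space_restrict_space)
    have "(\<lambda>x. x) \<in> lborel_pos \<rightarrow>\<^sub>M borel" unfolding lborel_pos_def by (rule measurable_restrict_space1) simp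
    then have "snd \<in> space_time \<rightarrow>\<^sub>M borel" using measurable_compose[OF measurable_snd] by blast
    then show "snd \<in> restrict_space space_time ?R \<rightarrow>\<^sub>M borel" by (rule measurable_restrict_space1)
  qed
  have "(\<lambda>z. (fst z, snd z)) \<in> restrict_space space_time ?R \<rightarrow>\<^sub>M past t" by (rule measurable_Pair[OF f s])
  then have "(\<lambda>z. z) \<in> restrict_space space_time ?R \<rightarrow>\<^sub>M past t" by simp
  from measurable_sets[OF this A] have "A \<inter> space (restrict_space space_time ?R) \<in> sets (restrict_space space_time ?R)" by simp
  moreover have "A \<inter> space (restrict_space space_time ?R) = A"
  proof -
    have "A \<subseteq> space (past t)" by (rule sets.sets_into_space[OF A])
    also have "\<dots> = space M \<times> {0<..t}" using t by (intro space_past) simp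
    finally show ?thesis by (auto simp: space_restrict_space space_pair_measure)
  qed
  ultimately show ?thesis using R by (simp add: sets_restrict_space_iff)
qed

lemma progressive_sets_space_time:
  assumes "A \<in> progressive_sets"
  shows "A \<in> sets space_time"
proof -
  have "A = (\<Union>n. A \<inter> space M \<times> {0<..real (Suc n)})"
  proof (intro set_eqI iffI)
    fix z assume z: "z \<in> A"
    obtain \<omega> s where zs: "z = (\<omega>, s)" by (cases z)
    have "\<omega> \<in> space M" "0 < s" using assms z by (auto simp: progressive_sets_def zs)
    moreover obtain n where "s < real n" using reals_Archimedean2 by blast
    ultimately show "z \<in> (\<Union>n. A \<inter> space M \<times> {0<..real (Suc n)})" using z by (auto simp: zs intro!: exI[of _ n])
  qed auto
  also have "\<dots> \<in> sets space_time"
  proof (intro sets.countable_UN subsetI)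
    have "A \<inter> space M \<times> {0<..real (Suc n)} \<in> sets space_time" for n
      using assms by (intro past_subset_space_time[of "real (Suc n)"]) (auto simp: progressive_sets_def)
    then show "x \<in> sets space_time" if "x \<in> range (\<lambda>n. A \<inter> space M \<times> {0<..real (Suc n)})" for x
      using that by auto
  qed
  finally show ?thesis .
qed

text \<open>The block ends at j/n, while the coefficient will be used on the following interval
  (j/n, (j + 1)/n]; this delay makes it adapted.\<close>

definition block_coefficient :: "nat \<Rightarrow> ('w \<times> real) set \<Rightarrow> nat \<Rightarrow> 'w \<Rightarrow> real" where
  "block_coefficient n A j \<omega> = real n * measure lborel (Pair \<omega> -` A \<inter> {(real j - 1) / real n<..real j / real n})"

lemma block_coefficient_bounds:
  assumes n: "0 < n"
  shows "0 \<le> block_coefficient n A j \<omega>" "block_coefficient n A j \<omega> \<le> 1"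
proof -
  have k: "real j / real n * real n = real j" using n by simp
  have "block_coefficient n A j \<omega> = block_average n (Pair \<omega> -` A) (real (Suc j) / real n)"
    unfolding block_coefficient_def block_average_def using n by simp
  then show "0 \<le> block_coefficient n A j \<omega>" "block_coefficient n A j \<omega> \<le> 1"
    using block_average_bounds[OF n] by simp_all
qed

text \<open>The part of \<open>A\<close> over the block belongs to the product sigma-algebra up to
  time j/n, so the measure of its sections is measurable for that time.\<close>

lemma block_coefficient_measurable:
  assumes n: "0 < n" and A: "A \<in> progressive_sets"
  shows "block_coefficient n A j \<in> borel_measurable (F (real j / real n))"
proof (cases "j = 0")
  case True
  \<comment> \<open>Progressive sets contain positive times only, so the block before time 0
    contributes nothing.\<close>
  have "Pair \<omega> -` A \<inter> {(real j - 1) / real n<..real j / real n} = {}" for \<omega>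
    using A by (auto simp: True progressive_sets_def)
  then have "block_coefficient n A j = (\<lambda>_. 0)" by (simp add: block_coefficient_def fun_eq_iff)
  then show ?thesis by simp
next
  case False
  let ?t = "real j / real n" and ?I = "{(real j - 1) / real n<..real j / real n}"
  have t: "0 < ?t" using n False by simp
  have lo: "0 \<le> (real j - 1) / real n" using False by simp
  let ?R = "restrict_space lborel {0<..?t}"
  have sets_R: "sets ?R = sets (restrict_space borel {0<..?t})" by (intro sets_restrict_space_cong) simp
  let ?Q = "A \<inter> space M \<times> ?I"
  have "A \<inter> space M \<times> {0<..?t} \<in> sets (past ?t)" using A t by (auto simp: progressive_sets_def)
  moreover have "space M \<times> ?I \<in> sets (past ?t)"
  proof (rule pair_measureI)
    show "space M \<in> sets (F ?t)" using space_F[of ?t] sets.top[of "F ?t"] t by simp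
    show "?I \<in> sets (restrict_space borel {0<..?t})" using lo by (auto simp: sets_restrict_space_iff)
  qed
  ultimately have "A \<inter> space M \<times> {0<..?t} \<inter> space M \<times> ?I \<in> sets (past ?t)" by (rule sets.Int)
  moreover have "A \<inter> space M \<times> {0<..?t} \<inter> space M \<times> ?I = ?Q" using lo by auto
  ultimately have "?Q \<in> sets (past ?t)" by simp
  then have Q: "?Q \<in> sets (F ?t \<Otimes>\<^sub>M ?R)" using sets_pair_measure_cong[OF refl sets_R, of "F ?t"] by simp
  have "sigma_finite_measure ?R"
    by (rule sigma_finite_measure_restrict_space) (auto simp: sigma_finite_lborel)
  then interpret R: sigma_finite_measure ?R .
  have m: "(\<lambda>\<omega>. emeasure ?R (Pair \<omega> -` ?Q)) \<in> borel_measurable (F ?t)" by (rule R.measurable_emeasure_Pair[OF Q])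
  have "block_coefficient n A j \<omega> = real n * enn2real (emeasure ?R (Pair \<omega> -` ?Q))" if \<omega>: "\<omega> \<in> space (F ?t)" for \<omega>
  proof -
    have "\<omega> \<in> space M" using \<omega> space_F[of ?t] t by simp
    then have eq: "Pair \<omega> -` ?Q = Pair \<omega> -` A \<inter> ?I" by auto
    have "Pair \<omega> -` ?Q \<subseteq> {0<..?t}" using lo by auto
    then have "emeasure ?R (Pair \<omega> -` ?Q) = emeasure lborel (Pair \<omega> -` ?Q)"
      by (intro emeasure_restrict_space) auto
    then show ?thesis unfolding block_coefficient_def measure_def eq by simp
  qed
  moreover have "(\<lambda>\<omega>. real n * enn2real (emeasure ?R (Pair \<omega> -` ?Q))) \<in> borel_measurable (F ?t)"
    using m by measurable
  ultimately show ?thesis by (subst measurable_cong) simp_all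
qed

text \<open>Adapted step processes require coefficients with finitely many values. Rounding down to
  multiples of 1/n achieves this at the cost of an error of at most 1/n.\<close>

definition rounded_coefficient :: "nat \<Rightarrow> ('w \<times> real) set \<Rightarrow> nat \<Rightarrow> 'w \<Rightarrow> real" where
  "rounded_coefficient n A j \<omega> = of_int \<lfloor>real n * block_coefficient n A j \<omega>\<rfloor> / real n"

lemma rounded_coefficient_bounds:
  assumes n: "0 < n"
  shows "0 \<le> rounded_coefficient n A j \<omega>" "rounded_coefficient n A j \<omega> \<le> 1"
    "\<bar>block_coefficient n A j \<omega> - rounded_coefficient n A j \<omega>\<bar> \<le> 1 / real n"
proof -
  let ?c = "block_coefficient n A j \<omega>"
  note b = block_coefficient_bounds[OF n, of A j \<omega>]
  have nc: "0 \<le> real n * ?c" "real n * ?c \<le> real n" using b n by (auto simp: mult_left_le)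
  have fl: "of_int \<lfloor>real n * ?c\<rfloor> \<le> real n * ?c" "real n * ?c - 1 \<le> of_int \<lfloor>real n * ?c\<rfloor>" by linarith+
  have fl0: "0 \<le> (of_int \<lfloor>real n * ?c\<rfloor> :: real)" using nc by simp
  show "0 \<le> rounded_coefficient n A j \<omega>" unfolding rounded_coefficient_def using fl0 by simp
  have "of_int \<lfloor>real n * ?c\<rfloor> \<le> real n" using fl nc by linarith
  then show "rounded_coefficient n A j \<omega> \<le> 1" unfolding rounded_coefficient_def using n by simp
  have "?c - rounded_coefficient n A j \<omega> = (real n * ?c - of_int \<lfloor>real n * ?c\<rfloor>) / real n"
    unfolding rounded_coefficient_def using n by (simp add: diff_divide_distrib)
  moreover have "\<bar>d / real n\<bar> \<le> 1 / real n" if "0 \<le> d" "d \<le> 1" for d :: real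
    using that n by (simp add: divide_right_mono)
  moreover have "0 \<le> real n * ?c - of_int \<lfloor>real n * ?c\<rfloor>" "real n * ?c - of_int \<lfloor>real n * ?c\<rfloor> \<le> 1"
    using fl by linarith+
  ultimately show "\<bar>?c - rounded_coefficient n A j \<omega>\<bar> \<le> 1 / real n" by metis
qed

lemma rounded_coefficient_simple:
  assumes n: "0 < n" and A: "A \<in> progressive_sets"
  shows "simple_function (F (real j / real n)) (rounded_coefficient n A j)"
proof -
  let ?f = "\<lambda>\<omega>. \<lfloor>real n * block_coefficient n A j \<omega>\<rfloor>"
  have [measurable]: "block_coefficient n A j \<in> borel_measurable (F (real j / real n))"
    by (rule block_coefficient_measurable[OF assms])
  have m: "?f \<in> F (real j / real n) \<rightarrow>\<^sub>M count_space UNIV" by measurable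
  have "simple_function (F (real j / real n)) ?f"
    unfolding simple_function_def
  proof (intro conjI ballI)
    have "?f \<omega> \<in> {0..int n}" for \<omega>
    proof -
      have "0 \<le> real n * block_coefficient n A j \<omega>" "real n * block_coefficient n A j \<omega> \<le> real n"
        using block_coefficient_bounds[OF n, of A j \<omega>] n by (auto simp: mult_left_le)
      then have "0 \<le> ?f \<omega>" "?f \<omega> \<le> \<lfloor>real n\<rfloor>" unfolding zero_le_floor by (blast intro: floor_mono)+
      then show ?thesis unfolding floor_of_nat by simp
    qed
    then show "finite (?f ` space (F (real j / real n)))" 
      by (rule finite_subset[OF image_subsetI finite_atLeastAtMost_int])
    show "?f -` {x} \<inter> space (F (real j / real n)) \<in> sets (F (real j / real n))" for x
      using m by (rule measurable_sets) simp
  qed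
  from simple_function_compose1[OF this, of "\<lambda>k. of_int k / real n"] show ?thesis
    by (simp add: rounded_coefficient_def[abs_def])
qed

definition block_process :: "nat \<Rightarrow> nat \<Rightarrow> ('w \<times> real) set \<Rightarrow> 'w \<times> real \<Rightarrow> real" where
  "block_process n T A z = (\<Sum>j<n * T. indicator {real j / real n<..real (Suc j) / real n} (snd z) * rounded_coefficient n A j (fst z))"

lemma block_process_error:
  assumes n: "0 < n" and A: "A \<in> progressive_sets" and s: "s \<in> {0<..real T}"
  shows "\<bar>indicator A (\<omega>, s) - block_process n T A (\<omega>, s)\<bar> \<le>
      \<bar>indicator (Pair \<omega> -` A \<inter> {0<..real T}) s - block_average n (Pair \<omega> -` A \<inter> {0<..real T}) s\<bar> + 1 / real n"
    and "0 \<le> block_process n T A (\<omega>, s)" "block_process n T A (\<omega>, s) \<le> 1"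
proof -
  let ?J = "Pair \<omega> -` A \<inter> {0<..real T}"
  let ?ind = "\<lambda>j. indicator {real j / real n<..real (Suc j) / real n} s :: real"
  \<comment> \<open>Cutting the section off at \<open>T\<close> changes nothing, because every block
    that is used ends before \<open>T\<close>.\<close>
  have coef: "real n * measure lborel (?J \<inter> {(real j - 1) / real n<..real j / real n}) = block_coefficient n A j \<omega>"
    if "j < n * T" for j
  proof -
    have "real j \<le> real n * real T" using that by (metis less_imp_le of_nat_le_iff of_nat_mult)
    then have "real j / real n \<le> real T" using n by (simp add: divide_le_eq mult.commute)
    then have "?J \<inter> {(real j - 1) / real n<..real j / real n} = Pair \<omega> -` A \<inter> {(real j - 1) / real n<..real j / real n}"
      using A by (auto simp: progressive_sets_def)
    then show ?thesis by (simp add: block_coefficient_def)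
  qed
  have avg: "block_average n ?J s = (\<Sum>j<n * T. ?ind j * block_coefficient n A j \<omega>)"
    using block_average_sum[OF n, of s T ?J] s coef by simp
  have one: "(\<Sum>j<n * T. ?ind j) = 1"
  proof -
    have "block_average n (UNIV :: real set) s = (\<Sum>j<n * T. ?ind j * (real n * measure lborel {(real j - 1) / real n<..real j / real n}))"
      using block_average_sum[OF n, of s T UNIV] s by simp
    moreover have "real n * measure lborel {(real j - 1) / real n<..real j / real n} = 1" for j
    proof -
      have "(real j - 1) / real n \<le> real j / real n" using n by (intro divide_right_mono) auto
      then show ?thesis using n by (simp add: diff_divide_distrib)
    qed
    moreover have "block_average n (UNIV :: real set) s = 1"
    proof -
      have "(of_int \<lceil>real n * s\<rceil> - 2) / real n \<le> (of_int \<lceil>real n * s\<rceil> - 1) / real n" using n by (intro divide_right_mono) auto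
      then show ?thesis unfolding block_average_def using n by (simp add: diff_divide_distrib[symmetric])
    qed
    ultimately show ?thesis by simp
  qed
  have "\<bar>block_average n ?J s - block_process n T A (\<omega>, s)\<bar> = \<bar>\<Sum>j<n * T. ?ind j * (block_coefficient n A j \<omega> - rounded_coefficient n A j \<omega>)\<bar>"
    unfolding avg block_process_def by (simp add: right_diff_distrib sum_subtractf)
  also have "\<dots> \<le> (\<Sum>j<n * T. ?ind j * (1 / real n))"
  proof (rule order_trans[OF sum_abs sum_mono])
    fix j
    have "?ind j * \<bar>block_coefficient n A j \<omega> - rounded_coefficient n A j \<omega>\<bar> \<le> ?ind j * (1 / real n)"
      by (intro mult_left_mono rounded_coefficient_bounds(3)[OF n]) simp
    then show "\<bar>?ind j * (block_coefficient n A j \<omega> - rounded_coefficient n A j \<omega>)\<bar> \<le> ?ind j * (1 / real n)"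
      by (simp add: abs_mult)
  qed
  also have "\<dots> = 1 / real n" unfolding sum_distrib_right[symmetric] one by simp
  finally have "\<bar>block_average n ?J s - block_process n T A (\<omega>, s)\<bar> \<le> 1 / real n" .
  moreover have "indicator A (\<omega>, s) = (indicator ?J s :: real)" using s by (simp add: indicator_def)
  ultimately show "\<bar>indicator A (\<omega>, s) - block_process n T A (\<omega>, s)\<bar> \<le> \<bar>indicator ?J s - block_average n ?J s\<bar> + 1 / real n"
    by linarith
  show "0 \<le> block_process n T A (\<omega>, s)"
    unfolding block_process_def using rounded_coefficient_bounds(1)[OF n] by (intro sum_nonneg) auto
  have "block_process n T A (\<omega>, s) \<le> (\<Sum>j<n * T. ?ind j * 1)"
    unfolding block_process_def snd_conv fst_conv
    by (intro sum_mono mult_left_mono rounded_coefficient_bounds(2)[OF n]) simp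
  then show "block_process n T A (\<omega>, s) \<le> 1" using one by simp
qed

lemma borel_measurable_block_process:
  assumes n: "0 < n" and A: "A \<in> progressive_sets"
  shows "block_process n T A \<in> borel_measurable space_time"
proof -
  have "(\<lambda>z. \<Sum>j<n * T. indicator {real j / real n<..real (Suc j) / real n} (snd z) * rounded_coefficient n A j (fst z)) \<in> borel_measurable space_time"
  proof (intro borel_measurable_sum borel_measurable_times)
    fix j
    have "(indicator {real j / real n<..real (Suc j) / real n} :: real \<Rightarrow> real) \<in> borel_measurable lborel_pos"
      unfolding lborel_pos_def by (rule measurable_restrict_space1) simp
    then show "(\<lambda>z. indicator {real j / real n<..real (Suc j) / real n} (snd z) :: real) \<in> borel_measurable space_time"
      by (rule measurable_compose[OF measurable_snd])
    have "rounded_coefficient n A j \<in> borel_measurable M"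
      using borel_measurable_simple_function[OF rounded_coefficient_simple[OF assms]] by (intro measurable_F_M[of "real j / real n"]) auto
    then show "(\<lambda>z. rounded_coefficient n A j (fst z)) \<in> borel_measurable space_time"
      by (rule measurable_compose[OF measurable_fst])
  qed
  then show ?thesis by (simp add: block_process_def[abs_def])
qed

text \<open>Both functions have values in [0, 1], so the squared difference is at most the absolute
  one. The convergence of \<open>block_error\<close> for each section therefore suffices, followed
  by dominated convergence in \<open>\<omega>\<close>.\<close>

lemma block_process_tendsto:
  assumes A: "A \<in> progressive_sets"
  shows "(\<lambda>n. \<integral>\<^sup>+z. ennreal ((indicator (A \<inter> space M \<times> {0<..real T}) z - block_process (Suc n) T A z)\<^sup>2) \<partial>space_time) \<longlonglongrightarrow> 0"
proof -
  let ?u = "\<lambda>n z. ennreal ((indicator (A \<inter> space M \<times> {0<..real T}) z - block_process (Suc n) T A z)\<^sup>2)"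
  let ?J = "\<lambda>\<omega>. Pair \<omega> -` A \<inter> {0<..real T}"
  have AT: "A \<in> sets space_time" by (rule progressive_sets_space_time[OF A])
  have AT': "A \<inter> space M \<times> {0<..real T} \<in> sets space_time" using AT rectangle_sets[of "space M" 0 "real T"] by auto
  have m: "?u n \<in> borel_measurable space_time" for n
    using AT' borel_measurable_block_process[OF _ A, of "Suc n" T] by measurable
  have Jb: "Pair \<omega> -` A \<in> sets borel" for \<omega>
    using sets_Pair1[OF AT, of \<omega>] by (simp add: sets_lborel_pos)
  define g where "g n \<omega> = (\<integral>\<^sup>+s. ?u n (\<omega>, s) \<partial>lborel_pos)" for n \<omega>
  have gm: "g n \<in> borel_measurable M" for n
    unfolding g_def by (rule lp.borel_measurable_nn_integral) (simp add: split_beta' m)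
  have g_le: "g n \<omega> \<le> block_error (Suc n) (real T) (?J \<omega>) + ennreal (real T / real (Suc n))" if \<omega>: "\<omega> \<in> space M" for n \<omega>
  proof -
    have "g n \<omega> \<le> (\<integral>\<^sup>+s. ennreal \<bar>indicator (?J \<omega>) s - block_average (Suc n) (?J \<omega>) s\<bar> * indicator {0<..real T} s
        + ennreal (1 / real (Suc n)) * indicator {0<..real T} s \<partial>lborel_pos)"
      unfolding g_def
    proof (rule nn_integral_mono)
      fix s assume "s \<in> space lborel_pos"
      then have s0: "0 < s" by simp
      show "?u n (\<omega>, s) \<le> ennreal \<bar>indicator (?J \<omega>) s - block_average (Suc n) (?J \<omega>) s\<bar> * indicator {0<..real T} s
        + ennreal (1 / real (Suc n)) * indicator {0<..real T} s"
      proof (cases "s \<le> real T")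
        case True
        then have s: "s \<in> {0<..real T}" using s0 by simp
        let ?d = "indicator A (\<omega>, s) - block_process (Suc n) T A (\<omega>, s)"
        have "?u n (\<omega>, s) = ennreal (?d\<^sup>2)" using s \<omega> by (simp add: indicator_def)
        also have "\<dots> \<le> ennreal \<bar>?d\<bar>"
        proof (rule ennreal_leI)
          have "\<bar>?d\<bar> \<le> 1" using block_process_error(2,3)[OF _ A s, of "Suc n" \<omega>] by (auto simp: indicator_def)
          then have "\<bar>?d\<bar> * \<bar>?d\<bar> \<le> \<bar>?d\<bar> * 1" by (intro mult_left_mono) auto
          then show "?d\<^sup>2 \<le> \<bar>?d\<bar>" by (simp add: power2_eq_square)
        qed
        also have "\<dots> \<le> ennreal (\<bar>indicator (?J \<omega>) s - block_average (Suc n) (?J \<omega>) s\<bar> + 1 / real (Suc n))"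
          by (rule ennreal_leI[OF block_process_error(1)[OF _ A s]]) simp
        also have "\<dots> = ennreal \<bar>indicator (?J \<omega>) s - block_average (Suc n) (?J \<omega>) s\<bar> + ennreal (1 / real (Suc n))"
          by (rule ennreal_plus) simp_all
        finally show ?thesis using s by simp
      next
        case False
        have "indicator {real j / real (Suc n)<..real (Suc j) / real (Suc n)} s = (0::real)" if "j < Suc n * T" for j
        proof -
          have "real (Suc j) \<le> real (Suc n) * real T" using that by (metis Suc_leI of_nat_le_iff of_nat_mult)
          then have "real (Suc j) / real (Suc n) \<le> real T" by (simp add: divide_le_eq mult.commute del: of_nat_Suc)
          then show ?thesis using False by simp
        qed
        then have "block_process (Suc n) T A (\<omega>, s) = 0" unfolding block_process_def by (intro sum.neutral) simp
        then show ?thesis using False by simp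
      qed
    qed
    also have "\<dots> = (\<integral>\<^sup>+s. ennreal \<bar>indicator (?J \<omega>) s - block_average (Suc n) (?J \<omega>) s\<bar> * indicator {0<..real T} s
        + ennreal (1 / real (Suc n)) * indicator {0<..real T} s \<partial>lborel)"
      unfolding lborel_pos_def by (subst nn_integral_restrict_space) (auto intro!: nn_integral_cong simp: indicator_def)
    also have "\<dots> = block_error (Suc n) (real T) (?J \<omega>) + ennreal (1 / real (Suc n)) * emeasure lborel {0<..real T}"
      unfolding block_error_def using Jb[of \<omega>]
      by (subst nn_integral_add) (auto simp: nn_integral_cmult_indicator)
    also have "ennreal (1 / real (Suc n)) * emeasure lborel {0<..real T} = ennreal (real T / real (Suc n))"
      by (simp flip: ennreal_mult)
    finally show ?thesis .
  qed
  have "(\<lambda>n. \<integral>\<^sup>+\<omega>. g n \<omega> \<partial>M) \<longlonglongrightarrow> (\<integral>\<^sup>+\<omega>. 0 \<partial>M)"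
  \<comment> \<open>The bound consists of 2 T from \<open>block_error_le\<close> and T from the
    rounding.\<close>
  proof (rule nn_integral_dominated_convergence[where w = "\<lambda>_. ennreal (3 * real T)"])
    show "AE \<omega> in M. g n \<omega> \<le> ennreal (3 * real T)" for n
    proof (rule AE_I2)
      fix \<omega> assume \<omega>: "\<omega> \<in> space M"
      have "block_error (Suc n) (real T) (?J \<omega>) \<le> 2 * emeasure lborel (?J \<omega>)" using Jb by (intro block_error_le) auto
      also have "\<dots> \<le> 2 * emeasure lborel {0<..real T}" by (intro mult_left_mono emeasure_mono) auto
      also have "\<dots> = ennreal (2 * real T)" by (simp add: ennreal_mult)
      finally have "block_error (Suc n) (real T) (?J \<omega>) \<le> ennreal (2 * real T)" .
      moreover have "ennreal (real T / real (Suc n)) \<le> ennreal (real T)"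
        using mult_left_mono[of 1 "real (Suc n)" "real T"]
        by (intro ennreal_leI) (simp add: divide_le_eq del: of_nat_Suc)
      ultimately have "g n \<omega> \<le> ennreal (2 * real T) + ennreal (real T)"
        using g_le[OF \<omega>, of n] by (meson add_mono order_trans)
      also have "\<dots> = ennreal (3 * real T)" by (subst ennreal_plus[symmetric]) auto
      finally show "g n \<omega> \<le> ennreal (3 * real T)" .
    qed
    show "AE \<omega> in M. (\<lambda>n. g n \<omega>) \<longlonglongrightarrow> 0"
    proof (rule AE_I2)
      fix \<omega> assume \<omega>: "\<omega> \<in> space M"
      have "(\<lambda>n. ennreal (real T / real (Suc n))) \<longlonglongrightarrow> ennreal 0"
        by (intro tendsto_ennrealI) (rule LIMSEQ_Suc[OF lim_const_over_n])
      from tendsto_add[OF block_error_tendsto[OF Jb, of T \<omega>] this]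
      have "(\<lambda>n. block_error (Suc n) (real T) (?J \<omega>) + ennreal (real T / real (Suc n))) \<longlonglongrightarrow> 0" by simp
      then show "(\<lambda>n. g n \<omega>) \<longlonglongrightarrow> 0" by (rule ennreal_tendsto_0_mono[OF g_le[OF \<omega>]])
    qed
    show "(\<integral>\<^sup>+\<omega>. ennreal (3 * real T) \<partial>M) < \<infinity>" by (simp add: emeasure_space_1 ennreal_mult_less_top)
  qed (auto intro: gm)
  moreover have "(\<integral>\<^sup>+\<omega>. g n \<omega> \<partial>M) = (\<integral>\<^sup>+z. ?u n z \<partial>space_time)" for n
    unfolding g_def by (rule lp.nn_integral_fst[OF m])
  ultimately show ?thesis by simp
qed

end

lemma norm_sum_scaleR_sq_le:
  fixes x :: "'i \<Rightarrow> real" and v :: "'i \<Rightarrow> 'x::real_normed_vector"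
  shows "(norm (\<Sum>i\<in>I. x i *\<^sub>R v i))\<^sup>2 \<le> real (card I) * (\<Sum>i\<in>I. (x i)\<^sup>2 * (norm (v i))\<^sup>2)"
proof -
  have "(norm (\<Sum>i\<in>I. x i *\<^sub>R v i))\<^sup>2 \<le> (\<Sum>i\<in>I. \<bar>x i\<bar> * norm (v i))\<^sup>2"
    using norm_sum[of "\<lambda>i. x i *\<^sub>R v i" I] by (intro power_mono) simp_all
  also have "\<dots> \<le> (\<Sum>i\<in>I. (\<bar>x i\<bar> * norm (v i))\<^sup>2) * (\<Sum>i\<in>I. 1\<^sup>2)"
    using Cauchy_Schwarz_ineq_sum[of "\<lambda>i. \<bar>x i\<bar> * norm (v i)" "\<lambda>_. 1" I] by simp
  finally show ?thesis by (simp add: power_mult_distrib mult.commute)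
qed

context brownian
begin

section \<open>Approximation by adapted step processes in mean square\<close>

definition step_approximable :: "('w \<times> real \<Rightarrow> 'x::real_normed_vector) \<Rightarrow> bool" where
  "step_approximable G \<longleftrightarrow> (\<forall>e>0. \<exists>m \<tau> \<xi>. adapted_step F m \<tau> \<xi> \<and>
     (\<integral>\<^sup>+z. ennreal ((norm (G z - step_process m \<tau> \<xi> z))\<^sup>2) \<partial>space_time) \<le> e)"

lemma strongly_measurable_step_process:
  assumes st: "adapted_step F m \<tau> \<xi>"
  shows "strongly_measurable space_time (step_process m \<tau> \<xi>)"
proof -
  obtain L where L: "admissible L" "\<And>\<omega> s. \<omega> \<in> space M \<Longrightarrow> elementary_process L (\<omega>, s) = step_process m \<tau> \<xi> (\<omega>, s)"
    "\<And>V g \<omega>. \<omega> \<in> space M \<Longrightarrow> elementary_integral V (map_time g L) \<omega> = step_integral V m (\<lambda>j. g (\<tau> j)) \<xi> \<omega>"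
    using adapted_step_elementary[OF st] by blast
  have "strongly_measurable space_time (elementary_process L)" by (rule strongly_measurable_elementary_process[OF L(1)])
  then show ?thesis
    by (rule strongly_measurable_cong[THEN iffD1, rotated]) (auto simp: space_pair_measure L(2))
qed

lemma step_approximable_limit:
  fixes G :: "'w \<times> real \<Rightarrow> 'x::real_normed_vector"
  assumes G: "strongly_measurable space_time G" and g: "\<And>i::nat. strongly_measurable space_time (g i)"
    and ap: "\<And>i. step_approximable (g i)"
    and lim: "(\<lambda>i. \<integral>\<^sup>+z. ennreal ((norm (G z - g i z))\<^sup>2) \<partial>space_time) \<longlonglongrightarrow> 0"
  shows "step_approximable G"
  unfolding step_approximable_def
proof (intro allI impI)
  fix e :: ennreal assume e: "0 < e"
  show "\<exists>m \<tau> \<xi>. adapted_step F m \<tau> \<xi> \<and>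
     (\<integral>\<^sup>+z. ennreal ((norm (G z - step_process m \<tau> \<xi> z))\<^sup>2) \<partial>space_time) \<le> e"
  proof -
    \<comment> \<open>Splitting the square of a sum doubles both parts, so each may cost
      e/4.\<close>
    have e4: "0 < e / 4" using e by (simp add: ennreal_zero_less_divide)
    have "\<forall>\<^sub>F i in sequentially. (\<integral>\<^sup>+z. ennreal ((norm (G z - g i z))\<^sup>2) \<partial>space_time) < e / 4"
      by (rule order_tendstoD(2)[OF lim e4])
    then obtain i where i: "(\<integral>\<^sup>+z. ennreal ((norm (G z - g i z))\<^sup>2) \<partial>space_time) < e / 4"
      using eventually_happens'[OF trivial_limit_sequentially] by blast
    obtain m \<tau> \<xi> where st: "adapted_step F m \<tau> \<xi>"
      and le: "(\<integral>\<^sup>+z. ennreal ((norm (g i z - step_process m \<tau> \<xi> z))\<^sup>2) \<partial>space_time) \<le> e / 4"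
      using ap[of i] e4 unfolding step_approximable_def by blast
    have "(\<integral>\<^sup>+z. ennreal ((norm (G z - step_process m \<tau> \<xi> z))\<^sup>2) \<partial>space_time) =
      (\<integral>\<^sup>+z. ennreal ((norm ((G z - g i z) + (g i z - step_process m \<tau> \<xi> z)))\<^sup>2) \<partial>space_time)" by simp
    also have "\<dots> \<le> 2 * (\<integral>\<^sup>+z. ennreal ((norm (G z - g i z))\<^sup>2) \<partial>space_time) +
       2 * (\<integral>\<^sup>+z. ennreal ((norm (g i z - step_process m \<tau> \<xi> z))\<^sup>2) \<partial>space_time)"
      by (intro nn_integral_norm_sq_add_le strongly_measurable_diff G g strongly_measurable_step_process[OF st])
    also have "\<dots> \<le> 2 * (e / 4) + 2 * (e / 4)"
      using i le by (intro add_mono mult_left_mono) auto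
    also have "\<dots> = 4 * (e / 4)" unfolding distrib_right[symmetric] by simp
    also have "\<dots> = e * 4 / 4" by (simp add: ennreal_times_divide mult.commute)
    also have "\<dots> = e" by (rule mult_divide_eq_ennreal) auto
    finally show ?thesis using st by blast
  qed
qed

text \<open>The level sets of \<open>s\<close> are progressive. Each is replaced by its block
  process on one common grid, so that the weighted sum is again a step process with adapted simple
  coefficients.\<close>

lemma step_approximable_simple:
  fixes s :: "'w \<times> real \<Rightarrow> 'x::real_normed_vector"
  assumes s: "simple_function progressive_measure s"
  shows "step_approximable (\<lambda>z. indicator {0<..real T} (snd z) *\<^sub>R s z)"
proof -
  let ?R = "space M \<times> {0<..real T}"
  define V where "V = s ` (space M \<times> {0<..})"
  define A where "A v = s -` {v} \<inter> space M \<times> {0<..}" for v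
  have V: "finite V" using simple_functionD(1)[OF s] by (simp add: V_def space_progressive_measure)
  have A: "A v \<in> progressive_sets" for v
    using simple_functionD(2)[OF s, of "{v}"] by (simp add: A_def space_progressive_measure sets_progressive_measure)
  have AT: "A v \<inter> ?R \<in> sets space_time" for v
    using progressive_sets_space_time[OF A] rectangle_sets[of "space M" 0 "real T"] by auto
  let ?\<tau> = "\<lambda>n j. real j / real (Suc n)"
  let ?\<xi> = "\<lambda>n j \<omega>. \<Sum>v\<in>V. rounded_coefficient (Suc n) (A v) j \<omega> *\<^sub>R v"
  have st: "adapted_step F (Suc n * T) (?\<tau> n) (?\<xi> n)" for n
    unfolding adapted_step_def
  proof (intro conjI allI impI)
    show "?\<tau> n j \<le> ?\<tau> n (Suc j)" for j by (intro divide_right_mono) auto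
    show "simple_function (F (?\<tau> n j)) (?\<xi> n j)" for j
    proof (intro simple_function_sum)
      fix v
      show "simple_function (F (?\<tau> n j)) (\<lambda>\<omega>. rounded_coefficient (Suc n) (A v) j \<omega> *\<^sub>R v)"
        using simple_function_compose1[OF rounded_coefficient_simple[OF _ A], of "Suc n" j "\<lambda>x. x *\<^sub>R v" v] by simp
    qed
  qed simp
  have proc: "step_process (Suc n * T) (?\<tau> n) (?\<xi> n) z = (\<Sum>v\<in>V. block_process (Suc n) T (A v) z *\<^sub>R v)" for n z
  proof -
    obtain \<omega> t where z: "z = (\<omega>, t)" by (cases z)
    have "step_process (Suc n * T) (?\<tau> n) (?\<xi> n) z =
      (\<Sum>j<Suc n * T. \<Sum>v\<in>V. (indicator {?\<tau> n j<..?\<tau> n (Suc j)} t * rounded_coefficient (Suc n) (A v) j \<omega>) *\<^sub>R v)"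
      unfolding step_process_def z case_prod_conv scaleR_sum_right scaleR_scaleR ..
    also have "\<dots> = (\<Sum>v\<in>V. block_process (Suc n) T (A v) z *\<^sub>R v)"
      unfolding block_process_def z snd_conv fst_conv scaleR_sum_left by (rule sum.swap)
    finally show ?thesis .
  qed
  have s_eq: "indicator {0<..real T} (snd z) *\<^sub>R s z = (\<Sum>v\<in>V. indicator (A v \<inter> ?R) z *\<^sub>R v)" if z: "z \<in> space space_time" for z
  proof -
    have z': "z \<in> space M \<times> {0<..}" using z by (simp add: space_pair_measure)
    then have "s z \<in> V" by (auto simp: V_def)
    have "(\<Sum>v\<in>V. indicator (A v \<inter> ?R) z *\<^sub>R v) = (\<Sum>v\<in>V. if v = s z then indicator {0<..real T} (snd z) *\<^sub>R s z else 0)"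
      using z' by (intro sum.cong) (auto simp: A_def indicator_def)
    then show ?thesis using V \<open>s z \<in> V\<close> by simp
  qed
  let ?d = "\<lambda>n v z. indicator (A v \<inter> ?R) z - block_process (Suc n) T (A v) z"
  have m: "(\<lambda>z. ennreal ((?d n v z)\<^sup>2)) \<in> borel_measurable space_time" for n v
  proof -
    have "?d n v \<in> borel_measurable space_time"
      by (intro borel_measurable_diff borel_measurable_indicator AT borel_measurable_block_process[OF _ A]) simp
    moreover have "(\<lambda>x::real. ennreal (x\<^sup>2)) \<in> borel_measurable borel" by measurable
    ultimately show ?thesis by (rule measurable_compose)
  qed
  have le: "(\<integral>\<^sup>+z. ennreal ((norm (indicator {0<..real T} (snd z) *\<^sub>R s z - step_process (Suc n * T) (?\<tau> n) (?\<xi> n) z))\<^sup>2) \<partial>space_time) \<le>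
      (\<Sum>v\<in>V. ennreal (real (card V) * (norm v)\<^sup>2) * (\<integral>\<^sup>+z. ennreal ((?d n v z)\<^sup>2) \<partial>space_time))" for n
  proof -
    have "(\<integral>\<^sup>+z. ennreal ((norm (indicator {0<..real T} (snd z) *\<^sub>R s z - step_process (Suc n * T) (?\<tau> n) (?\<xi> n) z))\<^sup>2) \<partial>space_time) \<le>
      (\<integral>\<^sup>+z. (\<Sum>v\<in>V. ennreal (real (card V) * (norm v)\<^sup>2) * ennreal ((?d n v z)\<^sup>2)) \<partial>space_time)"
    proof (rule nn_integral_mono)
      fix z assume z: "z \<in> space space_time"
      have "(norm (indicator {0<..real T} (snd z) *\<^sub>R s z - step_process (Suc n * T) (?\<tau> n) (?\<xi> n) z))\<^sup>2 = (norm (\<Sum>v\<in>V. ?d n v z *\<^sub>R v))\<^sup>2"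
        unfolding proc s_eq[OF z] scaleR_diff_left sum_subtractf ..
      also have "\<dots> \<le> real (card V) * (\<Sum>v\<in>V. (?d n v z)\<^sup>2 * (norm v)\<^sup>2)" by (rule norm_sum_scaleR_sq_le)
      also have "\<dots> = (\<Sum>v\<in>V. (real (card V) * (norm v)\<^sup>2) * (?d n v z)\<^sup>2)"
        unfolding sum_distrib_left by (intro sum.cong) (simp_all add: mult_ac)
      finally have "ennreal ((norm (indicator {0<..real T} (snd z) *\<^sub>R s z - step_process (Suc n * T) (?\<tau> n) (?\<xi> n) z))\<^sup>2) \<le>
        ennreal (\<Sum>v\<in>V. (real (card V) * (norm v)\<^sup>2) * (?d n v z)\<^sup>2)" by (rule ennreal_leI)
      also have "\<dots> = (\<Sum>v\<in>V. ennreal ((real (card V) * (norm v)\<^sup>2) * (?d n v z)\<^sup>2))"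
        by (rule sum_ennreal[symmetric]) simp
      also have "\<dots> = (\<Sum>v\<in>V. ennreal (real (card V) * (norm v)\<^sup>2) * ennreal ((?d n v z)\<^sup>2))"
        by (intro sum.cong refl ennreal_mult) simp_all
      finally show "ennreal ((norm (indicator {0<..real T} (snd z) *\<^sub>R s z - step_process (Suc n * T) (?\<tau> n) (?\<xi> n) z))\<^sup>2) \<le>
        (\<Sum>v\<in>V. ennreal (real (card V) * (norm v)\<^sup>2) * ennreal ((?d n v z)\<^sup>2))" .
    qed
    also have "\<dots> = (\<Sum>v\<in>V. \<integral>\<^sup>+z. ennreal (real (card V) * (norm v)\<^sup>2) * ennreal ((?d n v z)\<^sup>2) \<partial>space_time)"
      by (intro nn_integral_sum borel_measurable_times_ennreal borel_measurable_const m)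
    also have "\<dots> = (\<Sum>v\<in>V. ennreal (real (card V) * (norm v)\<^sup>2) * (\<integral>\<^sup>+z. ennreal ((?d n v z)\<^sup>2) \<partial>space_time))"
      by (intro sum.cong refl nn_integral_cmult m)
    finally show ?thesis .
  qed
  have "(\<lambda>n. \<Sum>v\<in>V. ennreal (real (card V) * (norm v)\<^sup>2) * (\<integral>\<^sup>+z. ennreal ((?d n v z)\<^sup>2) \<partial>space_time)) \<longlonglongrightarrow>
      (\<Sum>v\<in>V. ennreal (real (card V) * (norm v)\<^sup>2) * 0)"
  proof (rule tendsto_sum)
    fix v
    show "(\<lambda>n. ennreal (real (card V) * (norm v)\<^sup>2) * (\<integral>\<^sup>+z. ennreal ((?d n v z)\<^sup>2) \<partial>space_time)) \<longlonglongrightarrow> ennreal (real (card V) * (norm v)\<^sup>2) * 0"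
      by (rule ennreal_tendsto_cmult[OF _ block_process_tendsto[OF A]]) simp
  qed
  then have "(\<lambda>n. \<Sum>v\<in>V. ennreal (real (card V) * (norm v)\<^sup>2) * (\<integral>\<^sup>+z. ennreal ((?d n v z)\<^sup>2) \<partial>space_time)) \<longlonglongrightarrow> 0" by simp
  from ennreal_tendsto_0_mono[OF le this]
  have lim: "(\<lambda>n. \<integral>\<^sup>+z. ennreal ((norm (indicator {0<..real T} (snd z) *\<^sub>R s z - step_process (Suc n * T) (?\<tau> n) (?\<xi> n) z))\<^sup>2) \<partial>space_time) \<longlonglongrightarrow> 0" .
  show ?thesis
    unfolding step_approximable_def
  proof (intro allI impI)
    fix e :: ennreal assume "0 < e"
    from eventually_happens'[OF trivial_limit_sequentially order_tendstoD(2)[OF lim this]]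
    obtain n where "(\<integral>\<^sup>+z. ennreal ((norm (indicator {0<..real T} (snd z) *\<^sub>R s z - step_process (Suc n * T) (?\<tau> n) (?\<xi> n) z))\<^sup>2) \<partial>space_time) < e"
      by blast
    from conjI[OF st less_imp_le[OF this]]
    show "\<exists>m \<tau> \<xi>. adapted_step F m \<tau> \<xi> \<and> (\<integral>\<^sup>+z. ennreal ((norm (indicator {0<..real T} (snd z) *\<^sub>R s z - step_process m \<tau> \<xi> z))\<^sup>2) \<partial>space_time) \<le> e"
      by (intro exI)
  qed
qed

lemma borel_measurable_progressive_measure:
  fixes f :: "'w \<times> real \<Rightarrow> real"
  assumes "\<And>t. 0 < t \<Longrightarrow> f \<in> borel_measurable (past t)"
  shows "f \<in> borel_measurable progressive_measure"
proof (rule measurableI)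
  fix B :: "real set" assume B: "B \<in> sets borel"
  let ?A = "f -` B \<inter> space M \<times> {0<..}"
  have "?A \<inter> space M \<times> {0<..t} \<in> sets (past t)" if t: "0 < t" for t
  proof -
    have "f -` B \<inter> space (past t) \<in> sets (past t)" using assms[OF t] B by (rule measurable_sets)
    also have "space (past t) = space M \<times> {0<..t}" using t by (intro space_past) simp
    also have "f -` B \<inter> space M \<times> {0<..t} = ?A \<inter> space M \<times> {0<..t}" by auto
    finally show ?thesis .
  qed
  then have "?A \<in> progressive_sets" unfolding progressive_sets_def by blast
  then show "f -` B \<inter> space progressive_measure \<in> sets progressive_measure"
    unfolding sets_progressive_measure space_progressive_measure .
qed simp

text \<open>Separability of the range comes from strong measurability on space-time, and
  measurability of the distances for the progressive sigma-algebra from progressivity. Nearest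
  points then give simple progressive functions with an error dominated by
  \<open>norm (G z)\<close>, and cutting them at time \<open>i\<close> makes them
  approximable.\<close>

lemma step_approximable_L2_progressive:
  assumes G: "G \<in> L2_progressive M F"
  shows "step_approximable G"
proof -
  have GL: "G \<in> L2_space space_time" and pr: "progressive F G" using G by (auto simp: L2_progressive_def)
  have sm: "strongly_measurable space_time G" and fin: "(\<integral>\<^sup>+z. ennreal ((norm (G z))\<^sup>2) \<partial>space_time) < \<infinity>"
    using GL by (simp_all add: L2_space_iff)
  obtain D where D: "countable D" "\<And>z. z \<in> space space_time \<Longrightarrow> G z \<in> closure D"
    using strongly_measurable_separable[OF sm] by blast
  have D': "G z \<in> closure D" if "z \<in> space progressive_measure" for z
    using D(2)[of z] that by (simp add: space_progressive_measure space_pair_measure)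
  have "(\<lambda>z. norm (G z - x)) \<in> borel_measurable progressive_measure" for x
  proof (rule borel_measurable_progressive_measure)
    show "(\<lambda>z. norm (G z - x)) \<in> borel_measurable (past t)" if "0 < t" for t
      using pr that by (intro borel_measurable_norm_diff_strongly_measurable) (simp add: progressive_def)
  qed
  from nearest_point_approximation[OF D(1) D' this]
  obtain s where s: "\<And>i::nat. simple_function progressive_measure (s i)" "\<And>z. z \<in> space progressive_measure \<Longrightarrow> (\<lambda>i. s i z) \<longlonglongrightarrow> G z"
    "\<And>i z. norm (G z - s i z) \<le> norm (G z)" by blast
  let ?g = "\<lambda>i z. indicator {0<..real i} (snd z) *\<^sub>R s i z"
  have gm: "strongly_measurable space_time (?g i)" for i
  proof (rule strongly_measurable_scaleR)
    have "(indicator {0<..real i} :: real \<Rightarrow> real) \<in> borel_measurable lborel_pos"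
      unfolding lborel_pos_def by (rule measurable_restrict_space1) simp
    then show "(\<lambda>z. indicator {0<..real i} (snd z) :: real) \<in> borel_measurable space_time"
      by (rule measurable_compose[OF measurable_snd])
    have "strongly_measurable progressive_measure (s i)" by (rule strongly_measurable_simple_function[OF s(1)])
    then show "strongly_measurable space_time (s i)"
      by (rule strongly_measurable_mono)
         (auto simp: sets_progressive_measure space_progressive_measure space_pair_measure progressive_sets_space_time)
  qed
  have lim: "(\<lambda>i. \<integral>\<^sup>+z. ennreal ((norm (G z - ?g i z))\<^sup>2) \<partial>space_time) \<longlonglongrightarrow> (\<integral>\<^sup>+z. 0 \<partial>space_time)"
  proof (rule nn_integral_dominated_convergence[where w = "\<lambda>z. ennreal ((norm (G z))\<^sup>2)"])
    show "(\<lambda>z. ennreal ((norm (G z - ?g i z))\<^sup>2)) \<in> borel_measurable space_time" for i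
      using borel_measurable_norm_strongly_measurable[OF strongly_measurable_diff[OF sm gm[of i]]] by measurable
    show "(\<lambda>z. ennreal ((norm (G z))\<^sup>2)) \<in> borel_measurable space_time"
      using borel_measurable_norm_strongly_measurable[OF sm] by measurable
    show "AE z in space_time. ennreal ((norm (G z - ?g i z))\<^sup>2) \<le> ennreal ((norm (G z))\<^sup>2)" for i
      by (intro AE_I2 ennreal_leI power_mono) (auto simp: indicator_def s(3))
    show "AE z in space_time. (\<lambda>i. ennreal ((norm (G z - ?g i z))\<^sup>2)) \<longlonglongrightarrow> 0"
    proof (rule AE_I2)
      fix z assume "z \<in> space space_time"
      then have z: "z \<in> space progressive_measure" "0 < snd z"
        by (auto simp: space_progressive_measure space_pair_measure)
      obtain N :: nat where N: "snd z \<le> real N" using real_arch_simple by blast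
      have ev: "\<forall>\<^sub>F i in sequentially. s i z = ?g i z"
        unfolding eventually_sequentially
      proof (intro exI allI impI)
        fix i assume "N \<le> i"
        then have "snd z \<le> real i" using N by (meson of_nat_le_iff order_trans)
        then show "s i z = ?g i z" using z by simp
      qed
      have "(\<lambda>i. ?g i z) \<longlonglongrightarrow> G z" by (rule Lim_transform_eventually[OF s(2)[OF z(1)] ev])
      then have "(\<lambda>i. ennreal ((norm (G z - ?g i z))\<^sup>2)) \<longlonglongrightarrow> ennreal ((norm (G z - G z))\<^sup>2)"
        by (intro tendsto_ennrealI tendsto_power tendsto_norm tendsto_diff tendsto_const)
      then show "(\<lambda>i. ennreal ((norm (G z - ?g i z))\<^sup>2)) \<longlonglongrightarrow> 0" by simp
    qed
  qed (use fin in simp_all)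
  show ?thesis
    by (rule step_approximable_limit[OF sm gm step_approximable_simple[OF s(1)]]) (use lim in simp)
qed

end

section \<open>Condition $(S_2)$ in Hilbert spaces\<close>

text \<open>The square of a sum is at most twice the sum of the squares, so every telescoping step
  doubles the constant; the weights 2^k absorb this. The completeness argument can then work with
  squared norms throughout.\<close>

lemma norm_diff_sq_le_weighted_sum:
  fixes x :: "nat \<Rightarrow> 'x::real_normed_vector"
  assumes "i \<le> n"
  shows "(norm (x n - x i))\<^sup>2 \<le> 2 * (1/2) ^ i * (\<Sum>k=i..<n. 2 ^ k * (norm (x (Suc k) - x k))\<^sup>2)"
  using assms
proof (induction i rule: inc_induct)
  case base
  then show ?case by simp
next
  case (step i)
  have "(norm (x n - x i))\<^sup>2 = (norm ((x (Suc i) - x i) + (x n - x (Suc i))))\<^sup>2" by simp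
  also have "\<dots> \<le> 2 * (norm (x (Suc i) - x i))\<^sup>2 + 2 * (norm (x n - x (Suc i)))\<^sup>2" by (rule norm_sq_add_le)
  also have "\<dots> \<le> 2 * (norm (x (Suc i) - x i))\<^sup>2 + 2 * (2 * (1/2) ^ Suc i * (\<Sum>k=Suc i..<n. 2 ^ k * (norm (x (Suc k) - x k))\<^sup>2))"
    by (intro add_left_mono mult_left_mono step.IH) simp
  also have "\<dots> = 2 * (1/2) ^ i * (2 ^ i * (norm (x (Suc i) - x i))\<^sup>2 + (\<Sum>k=Suc i..<n. 2 ^ k * (norm (x (Suc k) - x k))\<^sup>2))"
    by (simp add: algebra_simps power_one_over)
  also have "\<dots> = 2 * (1/2) ^ i * (\<Sum>k=i..<n. 2 ^ k * (norm (x (Suc k) - x k))\<^sup>2)"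
    using step.hyps by (simp add: sum.atLeast_Suc_lessThan)
  finally show ?case .
qed

text \<open>The weights 2^k against increments of order 4^(-k) leave a geometric series. Hence
  \<open>h\<close> is integrable, and where it is finite it bounds the distance to every later term
  with rate 2^(-i).\<close>

lemma L2_Cauchy_limit:
  fixes S :: "nat \<Rightarrow> 'a \<Rightarrow> 'x::banach"
  assumes sm: "\<And>i. strongly_measurable N (S i)" and C: "0 \<le> C"
    and bound: "\<And>k. (\<integral>\<^sup>+a. ennreal ((norm (S (Suc k) a - S k a))\<^sup>2) \<partial>N) \<le> ennreal (C * (1/4) ^ k)"
  obtains T where "strongly_measurable N T"
    "\<And>i. (\<integral>\<^sup>+a. ennreal ((norm (T a - S i a))\<^sup>2) \<partial>N) \<le> ennreal (4 * C * (1/2) ^ i)"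
proof -
  have md: "(\<lambda>a. ennreal (2 ^ k * (norm (S (Suc k) a - S k a))\<^sup>2)) \<in> borel_measurable N" for k
    using borel_measurable_norm_strongly_measurable[OF strongly_measurable_diff[OF sm[of "Suc k"] sm[of k]]] by measurable
  have md': "(\<lambda>a. ennreal ((norm (S (Suc k) a - S k a))\<^sup>2)) \<in> borel_measurable N" for k
    using borel_measurable_norm_strongly_measurable[OF strongly_measurable_diff[OF sm[of "Suc k"] sm[of k]]] by measurable
  define h where "h a = (\<Sum>k. ennreal (2 ^ k * (norm (S (Suc k) a - S k a))\<^sup>2))" for a
  have hm [measurable]: "h \<in> borel_measurable N" unfolding h_def using md by (intro borel_measurable_suminf_order)
  have "(\<integral>\<^sup>+a. h a \<partial>N) = (\<Sum>k. \<integral>\<^sup>+a. ennreal (2 ^ k * (norm (S (Suc k) a - S k a))\<^sup>2) \<partial>N)"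
    unfolding h_def by (rule nn_integral_suminf[OF md])
  also have "\<dots> \<le> (\<Sum>k. ennreal (C * (1/2) ^ k))"
  proof (intro suminf_le allI)
    fix k
    have "(\<integral>\<^sup>+a. ennreal (2 ^ k * (norm (S (Suc k) a - S k a))\<^sup>2) \<partial>N) = (\<integral>\<^sup>+a. ennreal (2 ^ k) * ennreal ((norm (S (Suc k) a - S k a))\<^sup>2) \<partial>N)"
      by (intro nn_integral_cong ennreal_mult) simp_all
    also have "\<dots> = ennreal (2 ^ k) * (\<integral>\<^sup>+a. ennreal ((norm (S (Suc k) a - S k a))\<^sup>2) \<partial>N)"
      by (rule nn_integral_cmult[OF md'])
    also have "\<dots> \<le> ennreal (2 ^ k) * ennreal (C * (1/4) ^ k)" by (intro mult_left_mono bound) simp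
    also have "\<dots> = ennreal (2 ^ k * (C * (1/4) ^ k))" using C by (intro ennreal_mult[symmetric]) simp_all
    also have "2 ^ k * (C * (1/4) ^ k) = C * (1/2) ^ k"
      by (simp add: power_one_over flip: power_mult_distrib) (simp add: field_simps flip: power_mult_distrib)
    finally show "(\<integral>\<^sup>+a. ennreal (2 ^ k * (norm (S (Suc k) a - S k a))\<^sup>2) \<partial>N) \<le> ennreal (C * (1/2) ^ k)" .
  qed simp_all
  also have "\<dots> = ennreal (2 * C)"
  proof -
    have "(\<lambda>k. (1/2::real) ^ k) sums (1 / (1 - 1/2))" by (rule geometric_sums) simp
    from sums_mult[OF this, of C] have "(\<lambda>k. C * (1/2) ^ k) sums (2 * C)" by (simp add: mult.commute)
    then show ?thesis using C by (subst suminf_ennreal2) (auto simp: sums_iff)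
  qed
  finally have hint: "(\<integral>\<^sup>+a. h a \<partial>N) \<le> ennreal (2 * C)" .
  then have "(\<integral>\<^sup>+a. h a \<partial>N) < \<infinity>" by (rule le_less_trans) simp
  then have hfin: "AE a in N. h a \<noteq> \<infinity>" by (intro nn_integral_PInf_AE hm less_imp_neq)
  have diff: "(norm (S n a - S i a))\<^sup>2 \<le> 2 * (1/2) ^ i * enn2real (h a)" if "h a < \<infinity>" "i \<le> n" for a i n
  proof -
    have "ennreal (\<Sum>k=i..<n. 2 ^ k * (norm (S (Suc k) a - S k a))\<^sup>2) = (\<Sum>k=i..<n. ennreal (2 ^ k * (norm (S (Suc k) a - S k a))\<^sup>2))"
      by (rule sum_ennreal[symmetric]) simp
    also have "\<dots> \<le> h a" unfolding h_def by (rule sum_le_suminf) auto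
    finally have "(\<Sum>k=i..<n. 2 ^ k * (norm (S (Suc k) a - S k a))\<^sup>2) \<le> enn2real (h a)"
      using that(1) by (cases "h a") (simp_all add: ennreal_le_iff sum_nonneg)
    then have "2 * (1/2) ^ i * (\<Sum>k=i..<n. 2 ^ k * (norm (S (Suc k) a - S k a))\<^sup>2) \<le> 2 * (1/2) ^ i * enn2real (h a)"
      by (intro mult_left_mono) simp_all
    with norm_diff_sq_le_weighted_sum[OF that(2), of "\<lambda>i. S i a"] show ?thesis by linarith
  qed
  have conv: "convergent (\<lambda>i. S i a)" if h: "h a < \<infinity>" for a
  proof (rule Cauchy_convergent, rule CauchyI)
    fix e :: real assume e: "0 < e"
    have "(\<lambda>i. 2 * (1/2) ^ i * enn2real (h a)) \<longlonglongrightarrow> 2 * 0 * enn2real (h a)"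
      by (intro tendsto_intros LIMSEQ_power_zero) simp
    then have "(\<lambda>i. 2 * (1/2) ^ i * enn2real (h a)) \<longlonglongrightarrow> 0" by simp
    from order_tendstoD(2)[OF this, of "(e/2)\<^sup>2"] e obtain i where i: "2 * (1/2) ^ i * enn2real (h a) < (e/2)\<^sup>2"
      using eventually_happens'[OF trivial_limit_sequentially] by fastforce
    have *: "norm (S n a - S i a) < e / 2" if "i \<le> n" for n
      by (rule power_less_imp_less_base[of _ 2]) (use diff[OF h that] i e in auto)
    show "\<exists>M. \<forall>m\<ge>M. \<forall>n\<ge>M. norm (S m a - S n a) < e"
    proof (intro exI allI impI)
      fix m n assume "i \<le> m" "i \<le> n"
      have "norm (S m a - S n a) = norm ((S m a - S i a) - (S n a - S i a))" by simp
      also have "\<dots> \<le> norm (S m a - S i a) + norm (S n a - S i a)" by (rule norm_triangle_ineq4)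
      also have "\<dots> < e" using *[OF \<open>i \<le> m\<close>] *[OF \<open>i \<le> n\<close>] by simp
      finally show "norm (S m a - S n a) < e" .
    qed
  qed
  \<comment> \<open>The value 0 on the null set where \<open>h\<close> is infinite keeps
    \<open>T\<close> an everywhere limit of strongly measurable functions.\<close>
  define T where "T a = (if h a < \<infinity> then lim (\<lambda>i. S i a) else 0)" for a
  have lim: "(\<lambda>i. S i a) \<longlonglongrightarrow> T a" if "h a < \<infinity>" for a
    using conv[OF that] that by (simp add: T_def convergent_LIMSEQ_iff)
  have "strongly_measurable N T"
  proof (rule strongly_measurable_LIMSEQ)
    show "strongly_measurable N (\<lambda>a. (if h a < \<infinity> then 1 else 0) *\<^sub>R S i a)" for i
      by (intro strongly_measurable_scaleR sm) measurable
    show "(\<lambda>i. (if h a < \<infinity> then 1 else 0) *\<^sub>R S i a) \<longlonglongrightarrow> T a" for a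
      using lim[of a] by (cases "h a < \<infinity>") (auto simp: T_def)
  qed
  moreover have "(\<integral>\<^sup>+a. ennreal ((norm (T a - S i a))\<^sup>2) \<partial>N) \<le> ennreal (4 * C * (1/2) ^ i)" for i
  proof -
    have "(\<integral>\<^sup>+a. ennreal ((norm (T a - S i a))\<^sup>2) \<partial>N) \<le> (\<integral>\<^sup>+a. ennreal (2 * (1/2) ^ i) * h a \<partial>N)"
    proof (rule nn_integral_mono_AE)
      show "AE a in N. ennreal ((norm (T a - S i a))\<^sup>2) \<le> ennreal (2 * (1/2) ^ i) * h a"
        using hfin
      proof eventually_elim
        case (elim a)
        then have h: "h a < \<infinity>" by (simp add: less_top)
        have "(norm (T a - S i a))\<^sup>2 \<le> 2 * (1/2) ^ i * enn2real (h a)"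
        proof (rule LIMSEQ_le_const2)
          show "(\<lambda>n. (norm (S n a - S i a))\<^sup>2) \<longlonglongrightarrow> (norm (T a - S i a))\<^sup>2"
            by (intro tendsto_power tendsto_norm tendsto_diff lim h tendsto_const)
          show "\<exists>N. \<forall>n\<ge>N. (norm (S n a - S i a))\<^sup>2 \<le> 2 * (1/2) ^ i * enn2real (h a)" using diff[OF h] by blast
        qed
        then have "ennreal ((norm (T a - S i a))\<^sup>2) \<le> ennreal (2 * (1/2) ^ i * enn2real (h a))" by (rule ennreal_leI)
        also have "\<dots> = ennreal (2 * (1/2) ^ i) * ennreal (enn2real (h a))" by (rule ennreal_mult) simp_all
        also have "ennreal (enn2real (h a)) = h a" using h by simp
        finally show ?case .
      qed
    qed
    also have "\<dots> = ennreal (2 * (1/2) ^ i) * (\<integral>\<^sup>+a. h a \<partial>N)" by (rule nn_integral_cmult[OF hm])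
    also have "\<dots> \<le> ennreal (2 * (1/2) ^ i) * ennreal (2 * C)" by (intro mult_left_mono hint) simp
    also have "\<dots> = ennreal (2 * (1/2) ^ i * (2 * C))" using C by (intro ennreal_mult[symmetric]) simp_all
    also have "2 * (1/2) ^ i * (2 * C) = 4 * C * (1/2) ^ i" by simp
    finally show ?thesis .
  qed
  ultimately show thesis by (rule that)
qed

context brownian
begin

text \<open>The bounds are summable, so at almost every time the section integrals form a convergent
  series. The whole sequence tends to 0, not only a subsequence.\<close>

lemma AE_section_tendsto_0:
  assumes u: "\<And>i::nat. u i \<in> borel_measurable space_time"
    and bound: "\<And>i. (\<integral>\<^sup>+z. u i z \<partial>space_time) \<le> ennreal (C * (1/2) ^ i)" and C: "0 \<le> C"
  shows "AE t in lborel_pos. (\<lambda>i. \<integral>\<^sup>+\<omega>. u i (\<omega>, t) \<partial>M) \<longlonglongrightarrow> 0"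
proof -
  let ?U = "\<lambda>i t. \<integral>\<^sup>+\<omega>. u i (\<omega>, t) \<partial>M"
  have m: "?U i \<in> borel_measurable lborel_pos" for i by (rule borel_measurable_nn_integral_section[OF u])
  have "(\<integral>\<^sup>+t. (\<Sum>i. ?U i t) \<partial>lborel_pos) = (\<Sum>i. \<integral>\<^sup>+t. ?U i t \<partial>lborel_pos)" by (rule nn_integral_suminf[OF m])
  also have "\<dots> \<le> (\<Sum>i. ennreal (C * (1/2) ^ i))"
    using bound by (intro suminf_le) (simp_all add: nn_integral_space_time[OF u, symmetric])
  also have "\<dots> = ennreal (\<Sum>i. C * (1/2) ^ i)"
    using C by (intro suminf_ennreal2 summable_mult summable_geometric) simp_all
  also have "\<dots> < \<infinity>" by simp
  finally have "(\<integral>\<^sup>+t. (\<Sum>i. ?U i t) \<partial>lborel_pos) < \<infinity>" .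
  then have "AE t in lborel_pos. (\<Sum>i. ?U i t) \<noteq> \<infinity>"
    using m by (intro nn_integral_PInf_AE less_imp_neq borel_measurable_suminf_order)
  then show ?thesis
  proof eventually_elim
    case (elim t)
    then have fin: "(\<Sum>i. ?U i t) \<noteq> top" by simp
    have ne: "?U i t \<noteq> top" for i using ennreal_suminf_lessD[of "\<lambda>i. ?U i t" top i] fin by (simp add: less_top)
    have "summable (\<lambda>i. enn2real (?U i t))"
      by (rule summable_suminf_not_top) (use ne fin in \<open>simp_all add: less_top\<close>)
    then have "(\<lambda>i. ennreal (enn2real (?U i t))) \<longlonglongrightarrow> ennreal 0" by (intro tendsto_ennrealI summable_LIMSEQ_zero)
    then show "(\<lambda>i. ?U i t) \<longlonglongrightarrow> 0" using ne by (simp add: less_top)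
  qed
qed

lemma convolution_version_diff:
  "convolution_version V \<delta> (L @ uminus_elementary L') z = convolution_version V \<delta> L z - convolution_version V \<delta> L' z"
  by (simp add: convolution_version_def map_time_append map_time_uminus elementary_append elementary_uminus scaleR_diff_right)

text \<open>The convolutions of the approximating step processes converge in mean square over
  space-time. The geometric rate makes them converge at almost every time too, which is what
  identifies the limit as a convolution.\<close>

lemma convolution_exists:
  fixes B :: "'x::complex_banach \<Rightarrow> 'x \<Rightarrow> real" and G :: "'w \<times> real \<Rightarrow> 'x"
  assumes B: "bounded_bilinear B" and c: "0 < c" and low: "\<And>x. c * (norm x)\<^sup>2 \<le> B x x"
    and up: "\<And>x. B x x \<le> K * (norm x)\<^sup>2" and K: "0 \<le> K"
    and \<delta>: "0 < \<delta>" and G: "G \<in> L2_progressive M F"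
  shows "\<exists>S. is_convolution \<delta> G S"
proof -
  have GL: "G \<in> L2_space space_time" using G by (simp add: L2_progressive_def)
  then have Gsm: "strongly_measurable space_time G" by (simp add: L2_space_iff)
  obtain V where V: "\<And>t. 0 \<le> t \<Longrightarrow> V t \<in> borel_measurable M" "\<And>\<omega>. continuous_on {0..} (\<lambda>t. V t \<omega>)"
    "AE \<omega> in M. \<forall>t. V t \<omega> = W t \<omega>" using continuous_version by blast
  have pos: "0 < ennreal ((1/4) ^ i)" for i :: nat by simp
  \<comment> \<open>With the rate 4^(-i) the increments of the approximations decay as
    \<open>L2_Cauchy_limit\<close> requires.\<close>
  have "\<exists>m \<tau> \<xi>. adapted_step F m \<tau> \<xi> \<and>
     (\<integral>\<^sup>+z. ennreal ((norm (G z - step_process m \<tau> \<xi> z))\<^sup>2) \<partial>space_time) \<le> ennreal ((1/4) ^ i)" for i :: nat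
  proof -
    from step_approximable_L2_progressive[OF G] have "\<forall>e>0. \<exists>m \<tau> \<xi>. adapted_step F m \<tau> \<xi> \<and>
     (\<integral>\<^sup>+z. ennreal ((norm (G z - step_process m \<tau> \<xi> z))\<^sup>2) \<partial>space_time) \<le> e"
      unfolding step_approximable_def .
    from this[THEN spec, THEN mp, OF pos] show ?thesis .
  qed
  then have "\<forall>i. \<exists>p. adapted_step F (fst p) (fst (snd p)) (snd (snd p)) \<and>
     (\<integral>\<^sup>+z. ennreal ((norm (G z - step_process (fst p) (fst (snd p)) (snd (snd p)) z))\<^sup>2) \<partial>space_time) \<le> ennreal ((1/4) ^ i)"
    unfolding split_paired_Ex fst_conv snd_conv ..
  from choice[OF this] obtain p where p: "\<forall>i. adapted_step F (fst (p i)) (fst (snd (p i))) (snd (snd (p i))) \<and>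
     (\<integral>\<^sup>+z. ennreal ((norm (G z - step_process (fst (p i)) (fst (snd (p i))) (snd (snd (p i))) z))\<^sup>2) \<partial>space_time) \<le> ennreal ((1/4) ^ i)" ..
  define m where "m i = fst (p i)" for i
  define \<tau> where "\<tau> i = fst (snd (p i))" for i
  define \<xi> where "\<xi> i = snd (snd (p i))" for i
  have st: "adapted_step F (m i) (\<tau> i) (\<xi> i)"
    and le: "(\<integral>\<^sup>+z. ennreal ((norm (G z - step_process (m i) (\<tau> i) (\<xi> i) z))\<^sup>2) \<partial>space_time) \<le> ennreal ((1/4) ^ i)" for i
    using p[THEN spec, of i] unfolding m_def \<tau>_def \<xi>_def by (rule conjunct1, rule conjunct2)
  have "\<exists>L. admissible L \<and> (\<forall>\<omega> s. \<omega> \<in> space M \<longrightarrow> elementary_process L (\<omega>, s) = step_process (m i) (\<tau> i) (\<xi> i) (\<omega>, s)) \<and>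
      (\<forall>V g \<omega>. \<omega> \<in> space M \<longrightarrow> elementary_integral V (map_time g L) \<omega> = step_integral V (m i) (\<lambda>j. g (\<tau> i j)) (\<xi> i) \<omega>)" for i
  proof -
    obtain L where "admissible L" "\<And>\<omega> s. \<omega> \<in> space M \<Longrightarrow> elementary_process L (\<omega>, s) = step_process (m i) (\<tau> i) (\<xi> i) (\<omega>, s)"
      "\<And>V g \<omega>. \<omega> \<in> space M \<Longrightarrow> elementary_integral V (map_time g L) \<omega> = step_integral V (m i) (\<lambda>j. g (\<tau> i j)) (\<xi> i) \<omega>"
      using adapted_step_elementary[OF st[of i]] by blast
    then show ?thesis by blast
  qed
  then have "\<forall>i. \<exists>L. admissible L \<and> (\<forall>\<omega> s. \<omega> \<in> space M \<longrightarrow> elementary_process L (\<omega>, s) = step_process (m i) (\<tau> i) (\<xi> i) (\<omega>, s)) \<and>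
      (\<forall>V g \<omega>. \<omega> \<in> space M \<longrightarrow> elementary_integral V (map_time g L) \<omega> = step_integral V (m i) (\<lambda>j. g (\<tau> i j)) (\<xi> i) \<omega>)" ..
  from choice[OF this] obtain L where L: "\<And>i. admissible (L i)"
    "\<And>i \<omega> s. \<omega> \<in> space M \<Longrightarrow> elementary_process (L i) (\<omega>, s) = step_process (m i) (\<tau> i) (\<xi> i) (\<omega>, s)"
    "\<And>i V g \<omega>. \<omega> \<in> space M \<Longrightarrow> elementary_integral V (map_time g (L i)) \<omega> = step_integral V (m i) (\<lambda>j. g (\<tau> i j)) (\<xi> i) \<omega>"
    by blast
  have psm: "strongly_measurable space_time (elementary_process (L i))" for i
    by (rule strongly_measurable_elementary_process[OF L(1)])
  have le': "(\<integral>\<^sup>+z. ennreal ((norm (G z - elementary_process (L i) z))\<^sup>2) \<partial>space_time) \<le> ennreal ((1/4) ^ i)" for i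
  proof -
    have "(\<integral>\<^sup>+z. ennreal ((norm (G z - elementary_process (L i) z))\<^sup>2) \<partial>space_time) =
      (\<integral>\<^sup>+z. ennreal ((norm (G z - step_process (m i) (\<tau> i) (\<xi> i) z))\<^sup>2) \<partial>space_time)"
      by (rule nn_integral_cong) (auto simp: space_pair_measure L(2))
    with le show ?thesis by simp
  qed
  let ?S = "\<lambda>i. convolution_version V \<delta> (L i)"
  have Ssm: "strongly_measurable space_time (?S i)" for i
    by (rule strongly_measurable_convolution_version[OF V(1,2) L(1)])
  \<comment> \<open>The difference of two approximating convolutions is the convolution of a
    concatenated list. The factor 4 is a convenient bound for 2 + 2/4.\<close>
  have bound: "(\<integral>\<^sup>+z. ennreal ((norm (?S (Suc k) z - ?S k z))\<^sup>2) \<partial>space_time) \<le> ennreal (4 * K / c * (1/4) ^ k)" for k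
  proof -
    let ?L = "L (Suc k) @ uminus_elementary (L k)"
    have adm: "admissible ?L" using L(1) by (simp add: admissible_append admissible_uminus)
    have "(\<integral>\<^sup>+z. ennreal ((norm (elementary_process ?L z))\<^sup>2) \<partial>space_time) =
      (\<integral>\<^sup>+z. ennreal ((norm ((G z - elementary_process (L k) z) + (elementary_process (L (Suc k)) z - G z)))\<^sup>2) \<partial>space_time)"
      by (simp add: elementary_append elementary_uminus)
    also have "\<dots> \<le> 2 * (\<integral>\<^sup>+z. ennreal ((norm (G z - elementary_process (L k) z))\<^sup>2) \<partial>space_time) +
       2 * (\<integral>\<^sup>+z. ennreal ((norm (elementary_process (L (Suc k)) z - G z))\<^sup>2) \<partial>space_time)"
      by (intro nn_integral_norm_sq_add_le strongly_measurable_diff Gsm psm)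
    also have "\<dots> \<le> 2 * ennreal ((1/4) ^ k) + 2 * ennreal ((1/4) ^ Suc k)"
      using le'[of k] le'[of "Suc k"] by (intro add_mono mult_left_mono) (simp_all add: norm_minus_commute)
    also have "\<dots> = ennreal (2 * (1/4) ^ k + 2 * (1/4) ^ Suc k)"
      by (simp add: ennreal_mult del: power_Suc)
    also have "\<dots> \<le> ennreal (4 * (1/4) ^ k)" by (intro ennreal_leI) simp
    finally have p: "(\<integral>\<^sup>+z. ennreal ((norm (elementary_process ?L z))\<^sup>2) \<partial>space_time) \<le> ennreal (4 * (1/4) ^ k)" .
    have "(\<integral>\<^sup>+z. ennreal ((norm (?S (Suc k) z - ?S k z))\<^sup>2) \<partial>space_time) =
        (\<integral>\<^sup>+z. ennreal ((norm (convolution_version V \<delta> ?L z))\<^sup>2) \<partial>space_time)"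
      by (simp only: convolution_version_diff)
    also have "\<dots> \<le> ennreal (K / c) * (\<integral>\<^sup>+z. ennreal ((norm (elementary_process ?L z))\<^sup>2) \<partial>space_time)"
      by (rule nn_integral_convolution_version_le[OF B c low up adm \<delta> V])
    also have "\<dots> \<le> ennreal (K / c) * ennreal (4 * (1/4) ^ k)" by (intro mult_left_mono p) simp
    also have "\<dots> = ennreal (K / c * (4 * (1/4) ^ k))" using K c by (intro ennreal_mult[symmetric]) simp_all
    finally show ?thesis by (simp add: mult_ac)
  qed
  have C: "0 \<le> 4 * K / c" using K c by simp
  from L2_Cauchy_limit[OF Ssm C bound]
  obtain T where T: "strongly_measurable space_time T"
    "\<And>i. (\<integral>\<^sup>+z. ennreal ((norm (T z - ?S i z))\<^sup>2) \<partial>space_time) \<le> ennreal (4 * (4 * K / c) * (1/2) ^ i)" by blast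
  have S0: "?S 0 \<in> L2_space space_time"
  proof -
    have "(\<integral>\<^sup>+z. ennreal ((norm (elementary_process (L 0) z))\<^sup>2) \<partial>space_time) =
      (\<integral>\<^sup>+z. ennreal ((norm (G z + (elementary_process (L 0) z - G z)))\<^sup>2) \<partial>space_time)" by simp
    also have "\<dots> \<le> 2 * (\<integral>\<^sup>+z. ennreal ((norm (G z))\<^sup>2) \<partial>space_time) +
       2 * (\<integral>\<^sup>+z. ennreal ((norm (elementary_process (L 0) z - G z))\<^sup>2) \<partial>space_time)"
      by (intro nn_integral_norm_sq_add_le strongly_measurable_diff Gsm psm)
    also have "\<dots> < \<infinity>"
      using GL le_less_trans[OF le'[of 0]] by (simp add: L2_space_iff norm_minus_commute ennreal_mult_less_top)
    finally have "ennreal (K / c) * (\<integral>\<^sup>+z. ennreal ((norm (elementary_process (L 0) z))\<^sup>2) \<partial>space_time) < \<infinity>"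
      by (simp add: ennreal_mult_less_top)
    with nn_integral_convolution_version_le[OF B c low up L(1) \<delta> V, of 0] Ssm[of 0] show ?thesis
      by (simp add: L2_space_iff le_less_trans)
  qed
  have TL: "T \<in> L2_space space_time"
  proof -
    have "(\<lambda>z. T z - ?S 0 z) \<in> L2_space space_time"
      unfolding L2_space_iff
      by (intro conjI strongly_measurable_diff T(1) Ssm le_less_trans[OF T(2)]) simp
    from L2_space_add[OF this S0] show ?thesis by simp
  qed
  have "(\<lambda>i. ennreal ((1/4) ^ i)) \<longlonglongrightarrow> ennreal 0" by (intro tendsto_ennrealI LIMSEQ_power_zero) simp
  then have "(\<lambda>i. ennreal ((1/4) ^ i)) \<longlonglongrightarrow> 0" by simp
  from ennreal_tendsto_0_mono[OF le this]
  have lim: "(\<lambda>i. \<integral>\<^sup>+z. ennreal ((norm (G z - step_process (m i) (\<tau> i) (\<xi> i) z))\<^sup>2) \<partial>space_time) \<longlonglongrightarrow> 0" .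
  have um: "(\<lambda>z. ennreal ((norm (T z - ?S i z))\<^sup>2)) \<in> borel_measurable space_time" for i
    using borel_measurable_norm_strongly_measurable[OF strongly_measurable_diff[OF T(1) Ssm[of i]]] by measurable
  have limS: "AE t in lborel_pos. (\<lambda>i. \<integral>\<^sup>+\<omega>. ennreal ((norm (T (\<omega>, t) - ?S i (\<omega>, t)))\<^sup>2) \<partial>M) \<longlonglongrightarrow> 0"
    by (rule AE_section_tendsto_0[OF um T(2)]) (use C in simp)
  have "is_convolution \<delta> G T"
    by (rule is_convolution_if_limit[OF \<delta> G TL st lim L(3) V(3) limS])
  then show ?thesis by blast
qed

end

text \<open>Type 2 and cotype 2 at once. The mean of the form over Rademacher sums is a diagonal
  sum, and the norm is invariant under \<open>\<i>\<close>, so the bounds of the form carry over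
  term by term.\<close>

lemma rademacher_norm_sum_equiv:
  fixes B :: "'x::complex_normed_vector \<Rightarrow> 'x \<Rightarrow> real" and y :: "nat \<Rightarrow> 'x"
  assumes B: "bounded_bilinear B" and c: "0 < c" and low: "\<And>x. c * (norm x)\<^sup>2 \<le> B x x"
    and up: "\<And>x. B x x \<le> K * (norm x)\<^sup>2" and K: "0 \<le> K"
  shows "(\<integral>\<epsilon>. (norm (\<Sum>i<n. \<epsilon> i *\<^sub>C y i))\<^sup>2 \<partial>rademacher) \<le> K / c * (\<Sum>i<n. (norm (y i))\<^sup>2)"
    and "(\<Sum>i<n. (norm (y i))\<^sup>2) \<le> K / c * (\<integral>\<epsilon>. (norm (\<Sum>i<n. \<epsilon> i *\<^sub>C y i))\<^sup>2 \<partial>rademacher)"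
proof -
  let ?s = "\<lambda>\<epsilon>. \<Sum>i<n. \<epsilon> i *\<^sub>C y i"
  let ?N = "\<integral>\<epsilon>. (norm (?s \<epsilon>))\<^sup>2 \<partial>rademacher" and ?B = "\<integral>\<epsilon>. B (?s \<epsilon>) (?s \<epsilon>) \<partial>rademacher"
  note intB = integral_rademacher_bilinear[OF B, where y = y and n = n]
  note intN = integrable_rademacher_norm_sum[where x = y and n = n]
  have "(\<integral>\<epsilon>. c * (norm (?s \<epsilon>))\<^sup>2 \<partial>rademacher) \<le> ?B" using intB(2) intN low by (intro integral_mono) simp_all
  then have 1: "c * ?N \<le> ?B" by simp
  have "?B \<le> (\<integral>\<epsilon>. K * (norm (?s \<epsilon>))\<^sup>2 \<partial>rademacher)" using intB(2) intN up by (intro integral_mono) simp_all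
  then have 2: "?B \<le> K * ?N" by simp
  have i: "norm (\<i> *\<^sub>C x) = norm x" for x :: 'x by (simp add: norm_scaleC)
  have "?B \<le> (\<Sum>i<n. K * (norm (y i))\<^sup>2)"
    unfolding intB(1)
  proof (rule sum_mono)
    fix j show "(B (y j) (y j) + B (\<i> *\<^sub>C y j) (\<i> *\<^sub>C y j)) / 2 \<le> K * (norm (y j))\<^sup>2"
      using up[of "y j"] up[of "\<i> *\<^sub>C y j"] unfolding i by (simp add: field_simps)
  qed
  then have 3: "?B \<le> K * (\<Sum>i<n. (norm (y i))\<^sup>2)" by (simp add: sum_distrib_left)
  have "(\<Sum>i<n. c * (norm (y i))\<^sup>2) \<le> ?B"
    unfolding intB(1)
  proof (rule sum_mono)
    fix j show "c * (norm (y j))\<^sup>2 \<le> (B (y j) (y j) + B (\<i> *\<^sub>C y j) (\<i> *\<^sub>C y j)) / 2"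
      using low[of "y j"] low[of "\<i> *\<^sub>C y j"] unfolding i by (simp add: field_simps)
  qed
  then have 4: "c * (\<Sum>i<n. (norm (y i))\<^sup>2) \<le> ?B" by (simp add: sum_distrib_left)
  show "?N \<le> K / c * (\<Sum>i<n. (norm (y i))\<^sup>2)" using order_trans[OF 1 3] c by (simp add: field_simps)
  show "(\<Sum>i<n. (norm (y i))\<^sup>2) \<le> K / c * ?N" using order_trans[OF 4 2] c by (simp add: field_simps)
qed

context brownian
begin

text \<open>The bound has to hold for an arbitrary representative, because the choice operator may
  return any. The Ito isometry is applied at almost every \<open>t\<close>, and integration over
  \<open>t\<close> removes the dependence on \<open>\<delta>\<close>.\<close>

lemma nn_integral_convolution_le:
  fixes B :: "'x::complex_normed_vector \<Rightarrow> 'x \<Rightarrow> real" and G :: "'w \<times> real \<Rightarrow> 'x"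
  assumes B: "bounded_bilinear B" and c: "0 < c" and low: "\<And>x. c * (norm x)\<^sup>2 \<le> B x x"
    and up: "\<And>x. B x x \<le> K * (norm x)\<^sup>2" and K: "0 \<le> K" and \<delta>: "0 < \<delta>"
    and S: "is_convolution \<delta> G S" and G: "G \<in> L2_progressive M F"
  shows "(\<integral>\<^sup>+z. ennreal ((norm (S z))\<^sup>2) \<partial>space_time) \<le> ennreal (K / c) * (\<integral>\<^sup>+z. ennreal ((norm (G z))\<^sup>2) \<partial>space_time)"
proof -
  have "S \<in> L2_space space_time" using S by (simp add: is_convolution_def)
  then have Sm: "(\<lambda>z. ennreal ((norm (S z))\<^sup>2)) \<in> borel_measurable space_time"
    using borel_measurable_norm_strongly_measurable[of space_time S] by (simp add: L2_space_def)
  have "G \<in> L2_space space_time" using G by (simp add: L2_progressive_def)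
  then have Gm: "(\<lambda>z. ennreal ((norm (G z))\<^sup>2)) \<in> borel_measurable space_time"
    using borel_measurable_norm_strongly_measurable[of space_time G] by (simp add: L2_space_def)
  let ?I = "\<lambda>t. \<integral>\<^sup>+z. indicator {max 0 (t - \<delta>)<..t} (snd z) * ennreal ((norm (G z))\<^sup>2) \<partial>space_time"
  have Im: "?I \<in> borel_measurable lborel_pos" by (rule borel_measurable_nn_integral_window[OF Gm])
  have "AE t in lborel_pos. stochastic_integral_is M F W (window \<delta> t G) (\<lambda>\<omega>. S (\<omega>, t))"
    using S by (simp add: is_convolution_def)
  then have "AE t in lborel_pos. (\<integral>\<^sup>+\<omega>. ennreal ((norm (S (\<omega>, t)))\<^sup>2) \<partial>M) \<le> ennreal (K / c * (1 / \<delta>)) * ?I t"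
  proof eventually_elim
    case (elim t)
    let ?Y = "\<lambda>\<omega>. S (\<omega>, t)" and ?w = "window \<delta> t G"
    have Y: "?Y \<in> L2_space M" and w: "?w \<in> L2_space space_time"
      using elim by (auto simp: stochastic_integral_is_def L2_progressive_def)
    have "(\<integral>\<omega>. c * (norm (?Y \<omega>))\<^sup>2 \<partial>M) \<le> (\<integral>\<omega>. B (?Y \<omega>) (?Y \<omega>) \<partial>M)"
      using Y integrable_bilinear_L2[OF B Y] low by (intro integral_mono) (simp_all add: L2_space_def)
    also have "\<dots> = (\<integral>z. B (?w z) (?w z) \<partial>space_time)" by (rule ito_stochastic_integral[OF B elim])
    also have "\<dots> \<le> (\<integral>z. K * (norm (?w z))\<^sup>2 \<partial>space_time)"
      using w integrable_bilinear_L2[OF B w] up by (intro integral_mono) (simp_all add: L2_space_def)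
    finally have "c * (\<integral>\<omega>. (norm (?Y \<omega>))\<^sup>2 \<partial>M) \<le> K * (\<integral>z. (norm (?w z))\<^sup>2 \<partial>space_time)" by simp
    then have le: "(\<integral>\<omega>. (norm (?Y \<omega>))\<^sup>2 \<partial>M) \<le> K / c * (\<integral>z. (norm (?w z))\<^sup>2 \<partial>space_time)"
      using c by (simp add: field_simps)
    have "(\<integral>\<^sup>+\<omega>. ennreal ((norm (?Y \<omega>))\<^sup>2) \<partial>M) \<le> ennreal (K / c) * (\<integral>\<^sup>+z. ennreal ((norm (?w z))\<^sup>2) \<partial>space_time)"
      unfolding nn_integral_norm_sq_L2[OF Y] nn_integral_norm_sq_L2[OF w] L2_norm_sq
      using ennreal_leI[OF le] K c by (subst ennreal_mult[symmetric]) simp_all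
    also have "\<dots> \<le> ennreal (K / c) * (\<integral>\<^sup>+z. ennreal (1 / \<delta>) * (indicator {max 0 (t - \<delta>)<..t} (snd z) * ennreal ((norm (G z))\<^sup>2)) \<partial>space_time)"
    proof (intro mult_left_mono nn_integral_mono)
      fix z
      have "(norm (?w z))\<^sup>2 = 1 / \<delta> * ((indicator {max 0 (t - \<delta>)<..<t} (snd z))\<^sup>2 * (norm (G z))\<^sup>2)"
        unfolding window_eq[OF \<delta>] norm_scaleR power_mult_distrib power2_abs powr_half_sq[OF \<delta>] by simp
      also have "\<dots> \<le> 1 / \<delta> * (indicator {max 0 (t - \<delta>)<..t} (snd z) * (norm (G z))\<^sup>2)"
        using \<delta> by (intro mult_left_mono) (auto simp: indicator_def)
      finally have "ennreal ((norm (?w z))\<^sup>2) \<le> ennreal (1 / \<delta> * (indicator {max 0 (t - \<delta>)<..t} (snd z) * (norm (G z))\<^sup>2))"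
        by (rule ennreal_leI)
      also have "\<dots> = ennreal (1 / \<delta>) * (indicator {max 0 (t - \<delta>)<..t} (snd z) * ennreal ((norm (G z))\<^sup>2))"
        using \<delta> by (subst ennreal_mult) (auto simp: indicator_def)
      finally show "ennreal ((norm (?w z))\<^sup>2) \<le> ennreal (1 / \<delta>) * (indicator {max 0 (t - \<delta>)<..t} (snd z) * ennreal ((norm (G z))\<^sup>2))" .
    qed simp
    also have "(\<integral>\<^sup>+z. ennreal (1 / \<delta>) * (indicator {max 0 (t - \<delta>)<..t} (snd z) * ennreal ((norm (G z))\<^sup>2)) \<partial>space_time) = ennreal (1 / \<delta>) * ?I t"
    proof (rule nn_integral_cmult)
      have "(\<lambda>s. indicator {max 0 (t - \<delta>)<..t} s :: ennreal) \<in> borel_measurable lborel_pos"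
        unfolding lborel_pos_def by (rule measurable_restrict_space1) simp
      from measurable_compose[OF measurable_snd this] Gm
      show "(\<lambda>z. indicator {max 0 (t - \<delta>)<..t} (snd z) * ennreal ((norm (G z))\<^sup>2)) \<in> borel_measurable space_time"
        by (rule borel_measurable_times_ennreal)
    qed
    also have "ennreal (K / c) * (ennreal (1 / \<delta>) * ?I t) = ennreal (K / c * (1 / \<delta>)) * ?I t"
      using K c \<delta> by (subst ennreal_mult) (simp_all add: mult.assoc)
    finally show ?case .
  qed
  then have "(\<integral>\<^sup>+t. \<integral>\<^sup>+\<omega>. ennreal ((norm (S (\<omega>, t)))\<^sup>2) \<partial>M \<partial>lborel_pos) \<le> (\<integral>\<^sup>+t. ennreal (K / c * (1 / \<delta>)) * ?I t \<partial>lborel_pos)"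
    by (rule nn_integral_mono_AE)
  also have "\<dots> = ennreal (K / c * (1 / \<delta>)) * (ennreal \<delta> * (\<integral>\<^sup>+z. ennreal ((norm (G z))\<^sup>2) \<partial>space_time))"
    unfolding nn_integral_cmult[OF Im] nn_integral_window[OF \<delta> Gm] ..
  also have "\<dots> = ennreal (K / c * (1 / \<delta>) * \<delta>) * (\<integral>\<^sup>+z. ennreal ((norm (G z))\<^sup>2) \<partial>space_time)"
    using K c \<delta> unfolding mult.assoc[symmetric] by (subst ennreal_mult[symmetric]) simp_all
  also have "K / c * (1 / \<delta>) * \<delta> = K / c" using \<delta> by simp
  finally show ?thesis unfolding nn_integral_space_time[OF Sm] .
qed

lemma condition_S2_if_isomorphic_to_hilbert_space:
  assumes "isomorphic_to_hilbert_space TYPE('x::complex_banach)"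
  shows "condition_S2 M F W TYPE('x)"
proof -
  obtain B :: "'x \<Rightarrow> 'x \<Rightarrow> real" and c where B: "bounded_bilinear B" and "\<And>x y. B x y = B y x"
    and c: "0 < c" and low: "\<And>x. c * (norm x)\<^sup>2 \<le> B x x"
    using bilinear_if_isomorphic_to_hilbert_space[OF assms] by blast
  interpret B: bounded_bilinear B by (rule B)
  obtain K where K: "0 < K" "\<And>x y. norm (B x y) \<le> norm x * norm y * K" using B.pos_bounded by blast
  have up: "B x x \<le> K * (norm x)\<^sup>2" for x using K(2)[of x x] by (simp add: power2_eq_square mult_ac)
  have K0: "0 \<le> K" using K(1) by simp
  have sf: "sigma_finite_measure space_time" by (rule sigma_finite_pair_measure) unfold_locales
  let ?K = "K / c"
  have Kc: "0 \<le> ?K" using K0 c by simp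
  have m: "(\<lambda>z. ennreal ((norm (f z))\<^sup>2)) \<in> borel_measurable space_time" if "f \<in> L2_space space_time" for f :: "'w \<times> real \<Rightarrow> 'x"
    using borel_measurable_norm_strongly_measurable[of space_time f] that by (simp add: L2_space_def)
  have upper: "ennreal (\<integral>\<epsilon>. (L2_norm space_time (\<lambda>z. \<Sum>i<n. \<epsilon> i *\<^sub>C f i z))\<^sup>2 \<partial>rademacher) \<le>
      ennreal ?K * (\<Sum>i<n. \<integral>\<^sup>+z. ennreal ((norm (f i z))\<^sup>2) \<partial>space_time)"
    if f: "\<And>i. i < n \<Longrightarrow> f i \<in> L2_space space_time" for n and f :: "nat \<Rightarrow> 'w \<times> real \<Rightarrow> 'x"
  proof -
    have fubini: "ennreal (\<integral>\<epsilon>. (L2_norm space_time (\<lambda>z. \<Sum>i<n. \<epsilon> i *\<^sub>C f i z))\<^sup>2 \<partial>rademacher) =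
        (\<integral>\<^sup>+z. ennreal (\<integral>\<epsilon>. (norm (\<Sum>i<n. \<epsilon> i *\<^sub>C f i z))\<^sup>2 \<partial>rademacher) \<partial>space_time)"
      by (rule rademacher_L2_norm_Fubini[OF sf f])
    have "(\<integral>\<^sup>+z. ennreal (\<integral>\<epsilon>. (norm (\<Sum>i<n. \<epsilon> i *\<^sub>C f i z))\<^sup>2 \<partial>rademacher) \<partial>space_time) \<le>
      (\<integral>\<^sup>+z. ennreal ?K * (\<Sum>i<n. ennreal ((norm (f i z))\<^sup>2)) \<partial>space_time)"
    proof (rule nn_integral_mono)
      fix z
      have "ennreal (\<integral>\<epsilon>. (norm (\<Sum>i<n. \<epsilon> i *\<^sub>C f i z))\<^sup>2 \<partial>rademacher) \<le> ennreal (?K * (\<Sum>i<n. (norm (f i z))\<^sup>2))"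
        by (rule ennreal_leI[OF rademacher_norm_sum_equiv(1)[OF B c low up K0]])
      also have "\<dots> = ennreal ?K * ennreal (\<Sum>i<n. (norm (f i z))\<^sup>2)" by (intro ennreal_mult Kc sum_nonneg) simp
      also have "ennreal (\<Sum>i<n. (norm (f i z))\<^sup>2) = (\<Sum>i<n. ennreal ((norm (f i z))\<^sup>2))" by (rule sum_ennreal[symmetric]) simp
      finally show "ennreal (\<integral>\<epsilon>. (norm (\<Sum>i<n. \<epsilon> i *\<^sub>C f i z))\<^sup>2 \<partial>rademacher) \<le> ennreal ?K * (\<Sum>i<n. ennreal ((norm (f i z))\<^sup>2))" .
    qed
    also have "\<dots> = ennreal ?K * (\<integral>\<^sup>+z. (\<Sum>i<n. ennreal ((norm (f i z))\<^sup>2)) \<partial>space_time)"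
      by (rule nn_integral_cmult, rule borel_measurable_sum, rule m, rule f) simp
    also have "(\<integral>\<^sup>+z. (\<Sum>i<n. ennreal ((norm (f i z))\<^sup>2)) \<partial>space_time) = (\<Sum>i<n. \<integral>\<^sup>+z. ennreal ((norm (f i z))\<^sup>2) \<partial>space_time)"
      by (rule nn_integral_sum, rule m, rule f) simp
    finally show ?thesis unfolding fubini .
  qed
  have lower: "(\<Sum>i<n. \<integral>\<^sup>+z. ennreal ((norm (f i z))\<^sup>2) \<partial>space_time) \<le>
      ennreal ?K * ennreal (\<integral>\<epsilon>. (L2_norm space_time (\<lambda>z. \<Sum>i<n. \<epsilon> i *\<^sub>C f i z))\<^sup>2 \<partial>rademacher)"
    if f: "\<And>i. i < n \<Longrightarrow> f i \<in> L2_space space_time" for n and f :: "nat \<Rightarrow> 'w \<times> real \<Rightarrow> 'x"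
  proof -
    have fubini: "ennreal (\<integral>\<epsilon>. (L2_norm space_time (\<lambda>z. \<Sum>i<n. \<epsilon> i *\<^sub>C f i z))\<^sup>2 \<partial>rademacher) =
        (\<integral>\<^sup>+z. ennreal (\<integral>\<epsilon>. (norm (\<Sum>i<n. \<epsilon> i *\<^sub>C f i z))\<^sup>2 \<partial>rademacher) \<partial>space_time)"
      by (rule rademacher_L2_norm_Fubini[OF sf f])
    have "(\<Sum>i<n. \<integral>\<^sup>+z. ennreal ((norm (f i z))\<^sup>2) \<partial>space_time) = (\<integral>\<^sup>+z. (\<Sum>i<n. ennreal ((norm (f i z))\<^sup>2)) \<partial>space_time)"
      by (rule nn_integral_sum[symmetric], rule m, rule f) simp
    also have "\<dots> \<le> (\<integral>\<^sup>+z. ennreal ?K * ennreal (\<integral>\<epsilon>. (norm (\<Sum>i<n. \<epsilon> i *\<^sub>C f i z))\<^sup>2 \<partial>rademacher) \<partial>space_time)"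
    proof (rule nn_integral_mono)
      fix z
      have "(\<Sum>i<n. ennreal ((norm (f i z))\<^sup>2)) = ennreal (\<Sum>i<n. (norm (f i z))\<^sup>2)" by (rule sum_ennreal) simp
      also have "\<dots> \<le> ennreal (?K * (\<integral>\<epsilon>. (norm (\<Sum>i<n. \<epsilon> i *\<^sub>C f i z))\<^sup>2 \<partial>rademacher))"
        by (rule ennreal_leI[OF rademacher_norm_sum_equiv(2)[OF B c low up K0]])
      also have "\<dots> = ennreal ?K * ennreal (\<integral>\<epsilon>. (norm (\<Sum>i<n. \<epsilon> i *\<^sub>C f i z))\<^sup>2 \<partial>rademacher)" by (intro ennreal_mult Kc) simp
      finally show "(\<Sum>i<n. ennreal ((norm (f i z))\<^sup>2)) \<le> ennreal ?K * ennreal (\<integral>\<epsilon>. (norm (\<Sum>i<n. \<epsilon> i *\<^sub>C f i z))\<^sup>2 \<partial>rademacher)" .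
    qed
    also have "\<dots> = ennreal ?K * (\<integral>\<^sup>+z. ennreal (\<integral>\<epsilon>. (norm (\<Sum>i<n. \<epsilon> i *\<^sub>C f i z))\<^sup>2 \<partial>rademacher) \<partial>space_time)"
      by (rule nn_integral_cmult, rule borel_measurable_rademacher_norm_sum[OF sf f])
    finally show ?thesis unfolding fubini .
  qed
  show ?thesis
    unfolding condition_S2_def R_bounded_def
  \<comment> \<open>One factor \<open>?K\<close> comes from the upper Rademacher estimate, one from
    the operators and one from the lower Rademacher estimate.\<close>
  proof (intro exI[of _ "sqrt (?K ^ 3)"] allI impI)
    fix N :: nat and T :: "nat \<Rightarrow> ('w \<times> real \<Rightarrow> 'x) \<Rightarrow> 'w \<times> real \<Rightarrow> 'x" and G :: "nat \<Rightarrow> 'w \<times> real \<Rightarrow> 'x"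
    assume TG: "\<forall>n<N. T n \<in> {stochastic_convolution M F W (h_kernel \<delta>) |\<delta>. 0 < \<delta>} \<and> G n \<in> L2_progressive M F"
    have GL: "G n \<in> L2_space space_time" if "n < N" for n using TG that by (auto simp: L2_progressive_def)
    have T: "T n (G n) \<in> L2_space space_time"
      "(\<integral>\<^sup>+z. ennreal ((norm (T n (G n) z))\<^sup>2) \<partial>space_time) \<le> ennreal ?K * (\<integral>\<^sup>+z. ennreal ((norm (G n z))\<^sup>2) \<partial>space_time)"
      if n: "n < N" for n
    proof -
      obtain \<delta> where \<delta>: "0 < \<delta>" "T n = stochastic_convolution M F W (h_kernel \<delta>)" and Gn: "G n \<in> L2_progressive M F"
        using TG n by blast
      obtain S where "is_convolution \<delta> (G n) S" using convolution_exists[OF B c low up K0 \<delta>(1) Gn] by blast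
      then have *: "is_convolution \<delta> (G n) (T n (G n))" unfolding \<delta>(2) by (rule is_convolution_stochastic_convolution)
      then show "T n (G n) \<in> L2_space space_time" by (simp add: is_convolution_def)
      show "(\<integral>\<^sup>+z. ennreal ((norm (T n (G n) z))\<^sup>2) \<partial>space_time) \<le> ennreal ?K * (\<integral>\<^sup>+z. ennreal ((norm (G n z))\<^sup>2) \<partial>space_time)"
        by (rule nn_integral_convolution_le[OF B c low up K0 \<delta>(1) * Gn])
    qed
    let ?A = "\<integral>\<epsilon>. (L2_norm space_time (\<lambda>z. \<Sum>n<N. \<epsilon> n *\<^sub>C T n (G n) z))\<^sup>2 \<partial>rademacher"
    let ?D = "\<integral>\<epsilon>. (L2_norm space_time (\<lambda>z. \<Sum>n<N. \<epsilon> n *\<^sub>C G n z))\<^sup>2 \<partial>rademacher"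
    have D: "0 \<le> ?D" by simp
    have "ennreal ?A \<le> ennreal ?K * (\<Sum>n<N. \<integral>\<^sup>+z. ennreal ((norm (T n (G n) z))\<^sup>2) \<partial>space_time)"
      by (rule upper) (rule T(1))
    also have "\<dots> \<le> ennreal ?K * (\<Sum>n<N. ennreal ?K * (\<integral>\<^sup>+z. ennreal ((norm (G n z))\<^sup>2) \<partial>space_time))"
      using T(2) by (intro mult_left_mono sum_mono) simp_all
    also have "\<dots> = ennreal ?K * (ennreal ?K * (\<Sum>n<N. \<integral>\<^sup>+z. ennreal ((norm (G n z))\<^sup>2) \<partial>space_time))"
      by (simp only: sum_distrib_left)
    also have "\<dots> \<le> ennreal ?K * (ennreal ?K * (ennreal ?K * ennreal ?D))"
      by (intro mult_left_mono lower GL) simp_all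
    also have "\<dots> = ennreal (?K ^ 3 * ?D)"
    proof -
      have "ennreal k * (ennreal k * (ennreal k * ennreal d)) = ennreal (k ^ 3 * d)" if "0 \<le> k" "0 \<le> d" for k d
        using that by (simp add: power3_eq_cube mult.assoc flip: ennreal_mult)
      from this[OF Kc D] show ?thesis .
    qed
    finally have "?A \<le> ?K ^ 3 * ?D" using Kc D by (subst (asm) ennreal_le_iff) simp_all
    then have "sqrt ?A \<le> sqrt (?K ^ 3 * ?D)" by (rule real_sqrt_le_mono)
    then show "sqrt ?A \<le> sqrt (?K ^ 3) * sqrt ?D" by (simp add: real_sqrt_mult)
  qed
qed

end

theorem theorem4p9:
  fixes M :: "'w measure" and F :: "real \<Rightarrow> 'w measure" and W :: "real \<Rightarrow> 'w \<Rightarrow> real"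
  assumes "brownian_motion M F W"
    and "UMD TYPE('x::complex_banach)"
    and "type_2 TYPE('x)"
  shows "condition_S2 M F W TYPE('x) \<longleftrightarrow> isomorphic_to_hilbert_space TYPE('x)"
proof
  interpret brownian M F W by unfold_locales (rule assms(1))
  show "condition_S2 M F W TYPE('x)" if "isomorphic_to_hilbert_space TYPE('x)"
    using that by (rule condition_S2_if_isomorphic_to_hilbert_space)
  assume "condition_S2 M F W TYPE('x)"
  from cotype_if_condition_S2[OF this] obtain c where c: "0 < c"
    and cotype: "\<And>N (x :: nat \<Rightarrow> 'x). c * (\<Sum>n<N. (norm (x n))\<^sup>2) \<le> (\<integral>\<epsilon>. (norm (\<Sum>n<N. \<epsilon> n *\<^sub>C x n))\<^sup>2 \<partial>rademacher)"
    by blast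
  obtain \<tau> where \<tau>: "\<And>N (x :: nat \<Rightarrow> 'x). sqrt (\<integral>\<epsilon>. (norm (\<Sum>n<N. \<epsilon> n *\<^sub>C x n))\<^sup>2 \<partial>rademacher)
      \<le> \<tau> * sqrt (\<Sum>n<N. (norm (x n))\<^sup>2)"
    using assms(3) unfolding type_2_def by blast
  have type: "(\<integral>\<epsilon>. (norm (\<Sum>n<N. \<epsilon> n *\<^sub>C x n))\<^sup>2 \<partial>rademacher) \<le> \<tau>\<^sup>2 * (\<Sum>n<N. (norm (x n))\<^sup>2)"
    for N and x :: "nat \<Rightarrow> 'x"
  proof -
    have "(sqrt (\<integral>\<epsilon>. (norm (\<Sum>n<N. \<epsilon> n *\<^sub>C x n))\<^sup>2 \<partial>rademacher))\<^sup>2 \<le> (\<tau> * sqrt (\<Sum>n<N. (norm (x n))\<^sup>2))\<^sup>2"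
      by (intro power_mono \<tau>) simp
    then show ?thesis by (simp add: power_mult_distrib sum_nonneg)
  qed
  show "isomorphic_to_hilbert_space TYPE('x)"
    by (rule isomorphic_to_hilbert_space_if_type_cotype[OF type cotype c]) simp
qed

end
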